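(* (Bochner type identity) Let $\mathcal{R}\subset\mathbb{R}^N\setminus\{0\}$ be a reduced root system, $a>0$, and $k$ a non-negative multiplicity function with $a+2\langle k\rangle+N-2>0$. If $f\in(L^1\cap L^2)(\mathbb{R}^N,\vartheta_{k,a}(x)dx)$ is of the form $f(x)=p(x)\psi(\|x\|)$ for some $p\in\mathcal{H}_k^m(\mathbb{R}^N)$ and a one-variable function $\psi$ on $\mathbb{R}_+$, then $$\mathcal{F}_{k,a}(f)(\xi)=a^{-\left(\frac{2m+2\langle k\rangle+N-2}{a}\right)}\,e^{-i\frac\pi am}\,p(\xi)\,\mathbf{H}_{a,\frac{2m+2\langle k\rangle+N-2}{a}}(\psi)(\|\xi\|).$$ In particular, if $f$ is radial, then $\mathcal{F}_{k,a}(f)$ is also radial.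
   Context: Let $N\ge1$, $\langle\cdot,\cdot\rangle$ the standard inner product on $\mathbb{R}^N$, $\|x\|=\langle x,x\rangle^{1/2}$, $r_\alpha(x)=x-2\frac{\langle\alpha,x\rangle}{\|\alpha\|^2}\alpha$. A (reduced) root system is a finite set $\mathcal{R}\subset\mathbb{R}^N\setminus\{0\}$ with $r_\alpha(\mathcal{R})=\mathcal{R}$ and $\mathcal{R}\cap\mathbb{R}\alpha=\{\pm\alpha\}$ for all $\alpha\in\mathcal{R}$. $\mathfrak{C}$ is the finite Coxeter group generated by $\{r_\alpha\}$, $\mathcal{R}^+$ a positive subsystem. A multiplicity function is a $\mathfrak{C}$-invariant function $k=(k_\alpha)$ on $\mathcal{R}$; non-negative means all $k_\alpha\ge0$; $\langle k\rangle=\sum_{\alpha\in\mathcal{R}^+}k_\alpha$. Dunkl operators: $T_\xi(k)f(x)=\partial_\xi f(x)+\sum_{\alpha\in\mathcal{R}^+}k_\alpha\langle\alpha,\xi\rangle\frac{f(x)-f(r_\alpha x)}{\langle\alpha,x\rangle}$; Dunkl Laplacian $\Delta_k=\sum_{j=1}^NT_{\xi_j}(k)^2$ for an orthonormal basis $(\xi_j)$. $\vartheta_{k,a}(x)=\|x\|^{a-2}\prod_{\alpha\in\mathcal{R}}|\langle\alpha,x\rangle|^{k_\alpha}$. $\mathcal{H}_k^m(\mathbb{R}^N)$ is the space of homogeneous polynomials $p$ of degree $m$ with $\Delta_kp=0$. Let $\lambda_{k,a,m}=\frac{2m+2\langle k\rangle+N-2}{a}$ and $L_\ell^{(\lambda)}$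 the Laguerre polynomials. The operator $\|x\|^{2-a}\Delta_k-\|x\|^a$ is essentially self-adjoint on $L^2(\mathbb{R}^N,\vartheta_{k,a}(x)dx)$ with domain the span of the functions $p(x)L_\ell^{(\lambda_{k,a,m})}(\frac2a\|x\|^a)e^{-\|x\|^a/a}$ ($\ell,m\in\mathbb{N}$, $p\in\mathcal{H}_k^m(\mathbb{R}^N)$), and $\mathcal{F}_{k,a}=e^{i\frac\pi2\left(\frac{2\langle k\rangle+N+a-2}{a}\right)}\exp\big(\frac{\pi i}{2a}(\|x\|^{2-a}\Delta_k-\|x\|^a)\big)$ by functional calculus of its closure. The classical one-variable Hankel transform is $$\mathbf{H}_{a,\nu}(\psi)(s)=\int_0^\infty\psi(r)\,\widetilde J_\nu\Big(\frac2a(rs)^{\frac a2}\Big)r^{a(\nu+1)-1}dr,$$ where $\widetilde J_\nu(w)=(\frac w2)^{-\nu}J_\nu(w)=\sum_{\ell\ge0}\frac{(-1)^\ell w^{2\ell}}{2^{2\ell}\ell!\,\Gamma(\nu+\ell+1)}$. As for all integral kernels of unitary operators here, where the integral does not converge absolutely it is understood by continuous extension (in the $L^2$ sense) from the dense subspace of functions for which it does. *)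

theory Defs
  imports "HOL-Analysis.Analysis"
begin

section \<open>Root systems\<close>

definition root_reflection :: "real^'n \<Rightarrow> real^'n \<Rightarrow> real^'n" where
  "root_reflection \<alpha> x = x - (2 * (\<alpha> \<bullet> x) / (norm \<alpha>)\<^sup>2) *\<^sub>R \<alpha>"

definition reduced_root_system :: "(real^'n) set \<Rightarrow> bool" where
  "reduced_root_system R \<longleftrightarrow>
     finite R \<and> 0 \<notin> R \<and>
     (\<forall>\<alpha>\<in>R. root_reflection \<alpha> ` R = R \<and> R \<inter> range (\<lambda>t. t *\<^sub>R \<alpha>) = {\<alpha>, - \<alpha>})"

text \<open>The reflections are involutions, so the monoid they generate is the generated group.\<close>

inductive_set coxeter_group :: "(real^'n) set \<Rightarrow> (real^'n \<Rightarrow> real^'n) set" for R where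
  coxeter_id: "id \<in> coxeter_group R"
| coxeter_refl: "\<alpha> \<in> R \<Longrightarrow> w \<in> coxeter_group R \<Longrightarrow> root_reflection \<alpha> \<circ> w \<in> coxeter_group R"

definition positive_subsystem :: "(real^'n) set \<Rightarrow> (real^'n) set \<Rightarrow> bool" where
  "positive_subsystem R P \<longleftrightarrow>
     (\<exists>v. (\<forall>\<alpha>\<in>R. v \<bullet> \<alpha> \<noteq> 0) \<and> P = {\<alpha>\<in>R. v \<bullet> \<alpha> > 0})"

definition multiplicity_function :: "(real^'n) set \<Rightarrow> (real^'n \<Rightarrow> real) \<Rightarrow> bool" where
  "multiplicity_function R k \<longleftrightarrow> (\<forall>w\<in>coxeter_group R. \<forall>\<alpha>\<in>R. k (w \<alpha>) = k \<alpha>)"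

definition mult_sum :: "(real^'n) set \<Rightarrow> (real^'n \<Rightarrow> real) \<Rightarrow> real" where
  "mult_sum P k = (\<Sum>\<alpha>\<in>P. k \<alpha>)"

section \<open>Dunkl operators\<close>

definition dir_deriv :: "real^'n \<Rightarrow> (real^'n \<Rightarrow> complex) \<Rightarrow> real^'n \<Rightarrow> complex" where
  "dir_deriv \<xi> f x = vector_derivative (\<lambda>t. f (x + t *\<^sub>R \<xi>)) (at 0)"

text \<open>
  On the hyperplane orthogonal to \<open>\<alpha>\<close> the quotient \<open>(f(x) - f(r\<^sub>\<alpha> x)) / \<langle>\<alpha>, x\<rangle>\<close> has a
  removable singularity; the value used there is its limit for continuously differentiable
  \<open>f\<close>. (Division by zero in HOL would give the wrong value 0.)
\<close>

definition root_quotient :: "real^'n \<Rightarrow> (real^'n \<Rightarrow> complex) \<Rightarrow> real^'n \<Rightarrow> complex" where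
  "root_quotient \<alpha> f x =
     (if \<alpha> \<bullet> x = 0 then of_real (2 / (norm \<alpha>)\<^sup>2) * dir_deriv \<alpha> f x
      else (f x - f (root_reflection \<alpha> x)) / of_real (\<alpha> \<bullet> x))"

definition dunkl_op ::
    "(real^'n) set \<Rightarrow> (real^'n \<Rightarrow> real) \<Rightarrow> real^'n \<Rightarrow> (real^'n \<Rightarrow> complex) \<Rightarrow> real^'n \<Rightarrow> complex" where
  "dunkl_op P k \<xi> f x =
     dir_deriv \<xi> f x + (\<Sum>\<alpha>\<in>P. of_real (k \<alpha> * (\<alpha> \<bullet> \<xi>)) * root_quotient \<alpha> f x)"

definition dunkl_laplacian ::
    "(real^'n) set \<Rightarrow> (real^'n \<Rightarrow> real) \<Rightarrow> (real^'n \<Rightarrow> complex) \<Rightarrow> real^'n \<Rightarrow> complex" where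
  "dunkl_laplacian P k f x = (\<Sum>b\<in>Basis. dunkl_op P k b (dunkl_op P k b f) x)"

definition dunkl_harmonics ::
    "(real^'n) set \<Rightarrow> (real^'n \<Rightarrow> real) \<Rightarrow> nat \<Rightarrow> (real^'n \<Rightarrow> complex) set" where
  "dunkl_harmonics P k m =
     {p. polynomial_function p \<and> (\<forall>t x. p (t *\<^sub>R x) = of_real (t ^ m) * p x) \<and>
         (\<forall>x. dunkl_laplacian P k p x = 0)}"

text \<open>
  \<open>0 powr 0 = 0\<close> in HOL, so this density differs from the usual one on root hyperplanes with
  \<open>k \<alpha> = 0\<close> and, if \<open>a = 2\<close>, at the origin: on a Lebesgue null set.
\<close>

definition dunkl_weight :: "(real^'n) set \<Rightarrow> (real^'n \<Rightarrow> real) \<Rightarrow> real \<Rightarrow> real^'n \<Rightarrow> real" where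
  "dunkl_weight R k a x = norm x powr (a - 2) * (\<Prod>\<alpha>\<in>R. \<bar>\<alpha> \<bullet> x\<bar> powr k \<alpha>)"

definition dunkl_measure :: "(real^'n) set \<Rightarrow> (real^'n \<Rightarrow> real) \<Rightarrow> real \<Rightarrow> (real^'n) measure" where
  "dunkl_measure R k a = density lborel (\<lambda>x. ennreal (dunkl_weight R k a x))"

section \<open>Operators on \<open>L\<^sup>2\<close> spaces\<close>

text \<open>
  Elements of \<open>L\<^sup>2(M)\<close> are represented by functions, equality being equality almost everywhere.
  Unbounded operators are represented by their graphs, saturated with respect to it.
\<close>

definition L2_space :: "'a measure \<Rightarrow> ('a \<Rightarrow> complex) set" where
  "L2_space M = {f \<in> borel_measurable M. integrable M (\<lambda>x. (cmod (f x))\<^sup>2)}"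

definition L2_inner :: "'a measure \<Rightarrow> ('a \<Rightarrow> complex) \<Rightarrow> ('a \<Rightarrow> complex) \<Rightarrow> complex" where
  "L2_inner M f g = (LINT x|M. f x * cnj (g x))"

definition L2_tendsto ::
    "'a measure \<Rightarrow> (nat \<Rightarrow> 'a \<Rightarrow> complex) \<Rightarrow> ('a \<Rightarrow> complex) \<Rightarrow> bool" where
  "L2_tendsto M F f \<longleftrightarrow>
     (\<forall>n. F n \<in> L2_space M) \<and> f \<in> L2_space M \<and>
     (\<lambda>n. sqrt (LINT x|M. (cmod (F n x - f x))\<^sup>2)) \<longlonglongrightarrow> 0"

type_synonym 'a op_graph = "(('a \<Rightarrow> complex) \<times> ('a \<Rightarrow> complex)) set"

definition op_closure :: "'a measure \<Rightarrow> 'a op_graph \<Rightarrow> 'a op_graph" where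
  "op_closure M A =
     {(f, g). \<exists>F G. (\<forall>n. (F n, G n) \<in> A) \<and> L2_tendsto M F f \<and> L2_tendsto M G g}"

text \<open>Linearity (almost everywhere) is a consequence of the preservation of inner products.\<close>

definition L2_unitary ::
    "'a measure \<Rightarrow> 'b measure \<Rightarrow> (('a \<Rightarrow> complex) \<Rightarrow> ('b \<Rightarrow> complex)) \<Rightarrow> bool" where
  "L2_unitary M N W \<longleftrightarrow>
     (\<forall>f\<in>L2_space M. W f \<in> L2_space N) \<and>
     (\<forall>f\<in>L2_space M. \<forall>g\<in>L2_space M. L2_inner N (W f) (W g) = L2_inner M f g) \<and>
     (\<forall>h\<in>L2_space N. \<exists>f\<in>L2_space M. AE z in N. W f z = h z)"

text \<open>
  The spectral theorem in multiplication form: a self-adjoint operator \<open>A\<close> on a separable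
  Hilbert space is unitarily equivalent to multiplication by the variable \<open>t\<close> on a direct sum
  of spaces \<open>L\<^sup>2(\<real>, \<mu>\<^sub>n)\<close>, that is, on \<open>L\<^sup>2(\<nu>)\<close> for a measure \<open>\<nu>\<close> on \<open>\<nat> \<times> \<real>\<close>; then \<open>\<phi>(A)\<close> is
  multiplication by \<open>\<phi>(t)\<close>, on its maximal domain. The operator \<open>\<phi>(A)\<close> does not depend on the
  chosen \<open>\<nu>\<close> and \<open>W\<close>.
\<close>

definition spectral_representation ::
    "'a measure \<Rightarrow> 'a op_graph \<Rightarrow> (nat \<times> real) measure
      \<Rightarrow> (('a \<Rightarrow> complex) \<Rightarrow> (nat \<times> real \<Rightarrow> complex)) \<Rightarrow> bool" where
  "spectral_representation M A \<nu> W \<longleftrightarrow>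
     sets \<nu> = sets (count_space UNIV \<Otimes>\<^sub>M borel) \<and>
     L2_unitary M \<nu> W \<and>
     A = {(f, g). f \<in> L2_space M \<and> g \<in> L2_space M \<and>
                  (AE z in \<nu>. W g z = of_real (snd z) * W f z)}"

definition functional_calculus ::
    "'a measure \<Rightarrow> 'a op_graph \<Rightarrow> (real \<Rightarrow> complex) \<Rightarrow> ('a \<Rightarrow> complex) \<Rightarrow> ('a \<Rightarrow> complex)" where
  "functional_calculus M A \<phi> f =
     (SOME g. g \<in> L2_space M \<and>
        (\<exists>\<nu> W. spectral_representation M A \<nu> W \<and>
               (AE z in \<nu>. W g z = \<phi> (snd z) * W f z)))"

section \<open>The \<open>(k,a)\<close>-generalized Fourier transform\<close>

definition lambda_kam ::
    "(real^'n) set \<Rightarrow> (real^'n \<Rightarrow> real) \<Rightarrow> real \<Rightarrow> nat \<Rightarrow> real" where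
  "lambda_kam P k a m = (2 * real m + 2 * mult_sum P k + real CARD('n) - 2) / a"

definition laguerre :: "nat \<Rightarrow> real \<Rightarrow> real \<Rightarrow> real" where
  "laguerre l \<mu> t = (\<Sum>j\<le>l. (-1) ^ j * ((\<mu> + real l) gchoose (l - j)) * t ^ j / fact j)"

definition laguerre_basis_fun ::
    "(real^'n) set \<Rightarrow> (real^'n \<Rightarrow> real) \<Rightarrow> real \<Rightarrow> nat \<Rightarrow> nat \<Rightarrow> (real^'n \<Rightarrow> complex)
      \<Rightarrow> real^'n \<Rightarrow> complex" where
  "laguerre_basis_fun P k a l m p x =
     p x * of_real (laguerre l (lambda_kam P k a m) (2 / a * norm x powr a)
                    * exp (- (norm x powr a) / a))"

definition laguerre_span ::
    "(real^'n) set \<Rightarrow> (real^'n \<Rightarrow> real) \<Rightarrow> real \<Rightarrow> (real^'n \<Rightarrow> complex) set" where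
  "laguerre_span P k a =
     {\<lambda>x. \<Sum>u\<in>S. c u * u x | S c. finite S \<and>
        S \<subseteq> {laguerre_basis_fun P k a l m p | l m p. p \<in> dunkl_harmonics P k m}}"

definition laguerre_operator ::
    "(real^'n) set \<Rightarrow> (real^'n) set \<Rightarrow> (real^'n \<Rightarrow> real) \<Rightarrow> real \<Rightarrow> (real^'n) op_graph" where
  "laguerre_operator R P k a =
     {(f, g). f \<in> L2_space (dunkl_measure R k a) \<and> g \<in> L2_space (dunkl_measure R k a) \<and>
        (\<exists>u\<in>laguerre_span P k a.
           (AE x in dunkl_measure R k a. f x = u x) \<and>
           (AE x in dunkl_measure R k a.
              g x = of_real (norm x powr (2 - a)) * dunkl_laplacian P k u x
                    - of_real (norm x powr a) * u x))}"

definition ka_fourier ::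
    "(real^'n) set \<Rightarrow> (real^'n) set \<Rightarrow> (real^'n \<Rightarrow> real) \<Rightarrow> real
      \<Rightarrow> (real^'n \<Rightarrow> complex) \<Rightarrow> real^'n \<Rightarrow> complex" where
  "ka_fourier R P k a f \<xi> =
     exp (\<i> * of_real (pi / 2 * ((2 * mult_sum P k + real CARD('n) + a - 2) / a))) *
     functional_calculus (dunkl_measure R k a)
       (op_closure (dunkl_measure R k a) (laguerre_operator R P k a))
       (\<lambda>t. exp (of_real (pi / (2 * a)) * \<i> * of_real t)) f \<xi>"

section \<open>The Hankel transform\<close>

definition bessel_tilde :: "real \<Rightarrow> real \<Rightarrow> real" where
  "bessel_tilde \<nu> w =
     (\<Sum>l. (-1) ^ l * w ^ (2 * l) / (2 ^ (2 * l) * fact l * Gamma (\<nu> + real l + 1)))"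

definition hankel_integrand ::
    "real \<Rightarrow> real \<Rightarrow> (real \<Rightarrow> complex) \<Rightarrow> real \<Rightarrow> real \<Rightarrow> complex" where
  "hankel_integrand a \<nu> \<psi> s r =
     \<psi> r * of_real (bessel_tilde \<nu> (2 / a * (r * s) powr (a / 2)) * r powr (a * (\<nu> + 1) - 1))"

definition hankel_converges :: "real \<Rightarrow> real \<Rightarrow> (real \<Rightarrow> complex) \<Rightarrow> bool" where
  "hankel_converges a \<nu> \<psi> \<longleftrightarrow>
     (\<forall>s>0. set_integrable lborel {0<..} (hankel_integrand a \<nu> \<psi> s))"

definition hankel_integral :: "real \<Rightarrow> real \<Rightarrow> (real \<Rightarrow> complex) \<Rightarrow> real \<Rightarrow> complex" where
  "hankel_integral a \<nu> \<psi> s = (LINT r:{0<..}|lborel. hankel_integrand a \<nu> \<psi> s r)"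

definition hankel_measure :: "real \<Rightarrow> real \<Rightarrow> real measure" where
  "hankel_measure a \<nu> =
     density (restrict_space lborel {0<..}) (\<lambda>r. ennreal (r powr (a * (\<nu> + 1) - 1)))"

text \<open>
  Where the integral does not converge absolutely, the transform is the continuous extension in
  \<open>L\<^sup>2(r\<^bsup>a(\<nu>+1)-1\<^esup> dr)\<close>, hence determined only up to a null set.
\<close>

definition hankel_transform :: "real \<Rightarrow> real \<Rightarrow> (real \<Rightarrow> complex) \<Rightarrow> real \<Rightarrow> complex" where
  "hankel_transform a \<nu> \<psi> =
     (if hankel_converges a \<nu> \<psi> then hankel_integral a \<nu> \<psi>
      else (SOME g. \<exists>\<Psi>. (\<forall>n. hankel_converges a \<nu> (\<Psi> n)) \<and>
        L2_tendsto (hankel_measure a \<nu>) \<Psi> \<psi> \<and>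
        L2_tendsto (hankel_measure a \<nu>) (\<lambda>n. hankel_integral a \<nu> (\<Psi> n)) g))"

end

theory Submission
  imports Defs
begin

text \<open>
 The transform is the unitary \<open>\<phi>(A)\<close>, \<open>\<phi>(t) = e\<^bsup>\<pi> i t / (2a)\<^esup>\<close>, of an operator \<open>A\<close> that is diagonal in the
 functions \<open>p(x) L\<^sub>l(2\<tau>) e\<^bsup>-\<tau>\<^esup>\<close> with \<open>\<tau> = \<parallel>x\<parallel>\<^sup>a / a\<close>, \<open>p\<close> a \<open>k\<close>-harmonic polynomial of degree \<open>m\<close> and \<open>L\<^sub>l\<close>
 of index \<open>\<lambda>\<^sub>m = (2m + 2\<langle>k\<rangle> + N - 2) / a\<close>; the eigenvalue is \<open>- a (2l + \<lambda>\<^sub>m + 1)\<close> (\<open>basis_fun_eigen\<close>).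
 With the constant in front, the transform multiplies such a function by \<open>(-1)\<^sup>l e\<^bsup>-i\<pi>m/a\<^esup>\<close>.
 On the other side, the one-variable Hankel transform of index \<open>\<lambda>\<^sub>m\<close> multiplies
 \<open>L\<^sub>l(2\<tau>) e\<^bsup>-\<tau>\<^esup>\<close> by \<open>(-1)\<^sup>l a\<^bsup>\<lambda>\<^esup>\<close>, \<open>\<lambda> = \<lambda>\<^sub>m\<close> (\<open>bessel_laguerre\<close>). Both sides of the identity are thus the same operator
 on the closed span of the functions \<open>p(x) L\<^sub>l(2\<tau>) e\<^bsup>-\<tau>\<^esup>\<close> with \<open>p\<close> fixed, and every square integrable
 \<open>p(x) \<psi>(\<parallel>x\<parallel>)\<close> belongs to it, because \<open>\<psi>\<close> expands in Laguerre functions.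

 Four things make this precise. (1) \<^emph>\<open>Functional calculus.\<close> The closure of a symmetric operator with a
 total system of eigenfunctions is the maximal multiplication operator in the coefficients, and
 in any spectral representation an eigenfunction lives on the fibre of its eigenvalue; so \<open>\<phi>(A)\<close>
 multiplies eigenfunctions by \<open>\<phi>\<close> of their eigenvalues (\<open>functional_calculus_eigen\<close>).
 (2) \<^emph>\<open>Orthogonality.\<close> Harmonics of different degrees are orthogonal for the Gaussian weight, since the
 Dunkl operators are antisymmetric up to multiplication by a coordinate (\<open>gint_dunkl_op\<close>,
 \<open>harmonics_orthogonal_gauss\<close>). Polar coordinates, available in the form that integrals of a
 homogeneous function times a radial one factorise (\<open>integral_polar\<close>), carry this over to all
 radial weights and make \<open>g \<mapsto> p(x) g(\<parallel>x\<parallel>)\<close> a multiple of an isometry from a weighted half-line.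
 (3) \<^emph>\<open>Totality.\<close> Densities of exponential decay are determined by their moments
 (\<open>moments_determine\<close>). So a function orthogonal to all eigenfunctions is orthogonal, on each ball,
 to all \<open>\<parallel>x\<parallel>\<^bsup>2j\<^esup> h(x)\<close> with \<open>h\<close> harmonic; these span the polynomials (\<open>harmonic_decomposition\<close>), which
 are dense (\<open>eigenfunctions_total\<close>). (4) \<^emph>\<open>The two clauses in the definition of the Hankel transform.\<close>
 Where the integral converges for a square integrable function it agrees almost everywhere with
 the unitary extension from the Laguerre functions, and the extension by continuity is unique
 (\<open>hankel_transform_eq_flip\<close>).
\<close>

section \<open>The Hilbert space of square integrable functions\<close>

lemma borel_measurable_cnj [measurable (raw)]:
 "f \<in> borel_measurable M ==> (%x. cnj (f x)) \<in> borel_measurable M"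
 by (rule borel_measurable_continuous_on[of cnj]) (auto intro: continuous_intros)

lemma cnj_mult_self: "z * cnj z = of_real ((cmod z)\<^sup>2)" "cnj z * z = of_real ((cmod z)\<^sup>2)"
 by (simp_all only: complex_norm_square mult.commute)

lemmas integrable_dominated = Bochner_Integration.integrable_bound

lemma L2_spaceI: "f \<in> borel_measurable M ==> integrable M (%x. (cmod (f x))\<^sup>2) ==> f \<in> L2_space M"
 by (simp add: L2_space_def)

lemma L2_measurable [measurable_dest]: "f \<in> L2_space M ==> f \<in> borel_measurable M"
 by (simp add: L2_space_def)

lemma L2_integrable: "f \<in> L2_space M ==> integrable M (%x. (cmod (f x))\<^sup>2)"
 by (simp add: L2_space_def)

lemma L2_mult_integrable:
 assumes f: "f \<in> L2_space M" and g: "g \<in> L2_space M"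
 shows "integrable M (%x. f x * g x)"
proof (rule integrable_dominated)
 show "integrable M (%x. (cmod (f x))\<^sup>2 + (cmod (g x))\<^sup>2)"
  using f g by (simp add: L2_integrable)
 have *: "\<bar>a * b\<bar> \<le> a\<^sup>2 + b\<^sup>2" for a b :: real
 proof -
  have "2 * \<bar>a * b\<bar> \<le> a\<^sup>2 + b\<^sup>2" using sum_squares_bound[of "\<bar>a\<bar>" "\<bar>b\<bar>"] by (simp add: abs_mult)
  then show ?thesis by linarith
 qed
 show "AE x in M. norm (f x * g x) \<le> norm ((cmod (f x))\<^sup>2 + (cmod (g x))\<^sup>2)"
  using *[of "cmod (f _)" "cmod (g _)"] by (auto simp: norm_mult)
 show "(%x. f x * g x) \<in> borel_measurable M"
  using f g by measurable
qed

lemma L2_cnj: "f \<in> L2_space M ==> (%x. cnj (f x)) \<in> L2_space M"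
 by (auto intro!: L2_spaceI dest: L2_integrable)

lemma L2_scale: "f \<in> L2_space M ==> (%x. c * f x) \<in> L2_space M"
 by (auto intro!: L2_spaceI simp: norm_mult power_mult_distrib dest: L2_integrable)

lemma L2_zero: "(%x. 0) \<in> L2_space M"
 by (auto intro!: L2_spaceI)

lemma L2_add:
 assumes f: "f \<in> L2_space M" and g: "g \<in> L2_space M"
 shows "(%x. f x + g x) \<in> L2_space M"
proof (rule L2_spaceI)
 show "integrable M (%x. (cmod (f x + g x))\<^sup>2)"
 proof (rule integrable_dominated)
  show "integrable M (%x. 2 * (cmod (f x))\<^sup>2 + 2 * (cmod (g x))\<^sup>2)"
   using f g by (simp add: L2_integrable)
  have "(cmod (a + b))\<^sup>2 \<le> 2 * (cmod a)\<^sup>2 + 2 * (cmod b)\<^sup>2" for a b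
  proof -
   have "(cmod (a + b))\<^sup>2 \<le> (cmod a + cmod b)\<^sup>2"
    by (simp add: power_mono norm_triangle_ineq)
   also have "\<dots> \<le> 2 * (cmod a)\<^sup>2 + 2 * (cmod b)\<^sup>2"
    using sum_squares_bound[of "cmod a" "cmod b"] by (simp add: power2_sum)
   finally show ?thesis .
  qed
  then show "AE x in M. norm ((cmod (f x + g x))\<^sup>2) \<le> norm (2 * (cmod (f x))\<^sup>2 + 2 * (cmod (g x))\<^sup>2)"
   by simp
  show "(%x. (cmod (f x + g x))\<^sup>2) \<in> borel_measurable M"
   using f g by measurable
 qed
qed (use f g in measurable)

lemma L2_diff: "f \<in> L2_space M ==> g \<in> L2_space M ==> (%x. f x - g x) \<in> L2_space M"
 using L2_add[of f M "%x. (-1) * g x"] L2_scale[of g M "-1"] by simp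

lemma L2_sum: "(\<And>i. i \<in> I ==> f i \<in> L2_space M) ==> (%x. \<Sum>i\<in>I. f i x) \<in> L2_space M"
 by (induction I rule: infinite_finite_induct) (auto intro: L2_add L2_zero)

lemma L2_bounded_mult:
 assumes f: "f \<in> L2_space M" and g: "g \<in> borel_measurable M" and "\<And>x. cmod (g x) \<le> B"
 shows "(%x. g x * f x) \<in> L2_space M"
proof (rule L2_spaceI)
 show "integrable M (%x. (cmod (g x * f x))\<^sup>2)"
 proof (rule integrable_dominated)
  show "integrable M (%x. B\<^sup>2 * (cmod (f x))\<^sup>2)"
   using f by (simp add: L2_integrable)
  show "AE x in M. norm ((cmod (g x * f x))\<^sup>2) \<le> norm (B\<^sup>2 * (cmod (f x))\<^sup>2)"
   using assms(3) by (auto simp: norm_mult power_mult_distrib intro!: mult_right_mono power_mono)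
 qed (use f g in measurable)
qed (use f g in measurable)

definition L2_sq :: "'a measure => ('a => complex) => real" where
 "L2_sq M f = (LINT x|M. (cmod (f x))\<^sup>2)"

lemma L2_sq_nonneg [simp]: "0 \<le> L2_sq M f"
 by (simp add: L2_sq_def)

lemma L2_inner_self: "L2_inner M f f = of_real (L2_sq M f)"
 unfolding L2_inner_def L2_sq_def cnj_mult_self by (rule integral_complex_of_real)

lemma L2_inner_cnj: "L2_inner M g f = cnj (L2_inner M f g)"
proof -
 have "cnj (L2_inner M f g) = (LINT x|M. cnj (f x * cnj (g x)))"
  unfolding L2_inner_def by (rule Bochner_Integration.integral_cnj[symmetric])
 then show ?thesis by (simp add: L2_inner_def mult.commute)
qed

lemma L2_inner_integrable:
 "f \<in> L2_space M ==> g \<in> L2_space M ==> integrable M (%x. f x * cnj (g x))"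
 by (intro L2_mult_integrable L2_cnj)

lemma L2_inner_add_left:
 assumes "f \<in> L2_space M" "g \<in> L2_space M" "h \<in> L2_space M"
 shows "L2_inner M (%x. f x + g x) h = L2_inner M f h + L2_inner M g h"
 using assms unfolding L2_inner_def by (simp add: distrib_right L2_inner_integrable)

lemma L2_inner_diff_left:
 assumes "f \<in> L2_space M" "g \<in> L2_space M" "h \<in> L2_space M"
 shows "L2_inner M (%x. f x - g x) h = L2_inner M f h - L2_inner M g h"
 using assms unfolding L2_inner_def by (simp add: left_diff_distrib L2_inner_integrable)

lemma L2_inner_scale_left: "L2_inner M (%x. c * f x) g = c * L2_inner M f g"
 unfolding L2_inner_def by (simp add: mult.assoc)

lemma L2_inner_scale_right: "L2_inner M f (%x. c * g x) = cnj c * L2_inner M f g"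
 unfolding L2_inner_def by (simp add: mult.left_commute)

lemma L2_inner_sum_left:
 assumes "\<And>i. i \<in> I ==> f i \<in> L2_space M" "h \<in> L2_space M"
 shows "L2_inner M (%x. \<Sum>i\<in>I. f i x) h = (\<Sum>i\<in>I. L2_inner M (f i) h)"
 using assms unfolding L2_inner_def by (simp add: sum_distrib_right L2_inner_integrable)

lemma L2_inner_sum_right:
 assumes "\<And>i. i \<in> I ==> f i \<in> L2_space M" "h \<in> L2_space M"
 shows "L2_inner M h (%x. \<Sum>i\<in>I. f i x) = (\<Sum>i\<in>I. L2_inner M h (f i))"
 using assms unfolding L2_inner_def by (simp add: sum_distrib_left L2_inner_integrable)

lemma L2_inner_diff_right:
 assumes "f \<in> L2_space M" "g \<in> L2_space M" "h \<in> L2_space M"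
 shows "L2_inner M h (%x. f x - g x) = L2_inner M h f - L2_inner M h g"
 using assms unfolding L2_inner_def by (simp add: right_diff_distrib L2_inner_integrable)

lemma L2_inner_add_right:
 assumes "f \<in> L2_space M" "g \<in> L2_space M" "h \<in> L2_space M"
 shows "L2_inner M h (%x. f x + g x) = L2_inner M h f + L2_inner M h g"
 using assms unfolding L2_inner_def by (simp add: distrib_left L2_inner_integrable)

lemma L2_inner_cong_AE:
 assumes "AE x in M. f x = f' x" "AE x in M. g x = g' x"
  "f \<in> borel_measurable M" "f' \<in> borel_measurable M" "g \<in> borel_measurable M" "g' \<in> borel_measurable M"
 shows "L2_inner M f g = L2_inner M f' g'"
 unfolding L2_inner_def by (rule integral_cong_AE) (use assms in \<open>auto intro!: borel_measurable_times borel_measurable_cnj\<close>)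

lemma L2_cong_AE:
 assumes "f \<in> L2_space M" "AE x in M. f x = g x" "g \<in> borel_measurable M"
 shows "g \<in> L2_space M"
proof (rule L2_spaceI)
 show "integrable M (%x. (cmod (g x))\<^sup>2)"
  by (rule integrable_cong_AE_imp[OF L2_integrable[OF assms(1)]]) (use assms in auto)
qed (use assms in auto)

lemma L2_sq_eq_0:
 assumes "f \<in> L2_space M"
 shows "L2_sq M f = 0 \<longleftrightarrow> (AE x in M. f x = 0)"
 unfolding L2_sq_def using assms
 by (subst integral_nonneg_eq_0_iff_AE) (auto dest: L2_integrable)

lemma L2_sq_diff:
 assumes f: "f \<in> L2_space M" and g: "g \<in> L2_space M"
 shows "L2_sq M (%x. f x - c * g x) = L2_sq M f - 2 * Re (cnj c * L2_inner M f g) + (cmod c)\<^sup>2 * L2_sq M g"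
proof -
 have cg: "(%x. c * g x) \<in> L2_space M" using g by (rule L2_scale)
 have "L2_inner M (%x. f x - c * g x) (%x. f x - c * g x)
  = L2_inner M f f - L2_inner M f (%x. c * g x) - (L2_inner M (%x. c * g x) f - L2_inner M (%x. c * g x) (%x. c * g x))"
  using f cg by (simp add: L2_inner_diff_left L2_inner_diff_right L2_diff)
 also have "\<dots> = of_real (L2_sq M f) - (cnj c * L2_inner M f g + cnj (cnj c * L2_inner M f g)) + (c * cnj c) * of_real (L2_sq M g)"
  using L2_inner_cnj[of M g f]
  by (simp add: L2_inner_scale_left L2_inner_scale_right L2_inner_self algebra_simps)
 finally have *: "complex_of_real (L2_sq M (%x. f x - c * g x)) = of_real (L2_sq M f) - (cnj c * L2_inner M f g + cnj (cnj c * L2_inner M f g)) + (c * cnj c) * of_real (L2_sq M g)"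
  by (simp add: L2_inner_self)
 show ?thesis
  using arg_cong[OF *, of Re] by (simp add: cnj_mult_self complex_add_cnj)
qed

lemma L2_Cauchy_Schwarz:
 assumes f: "f \<in> L2_space M" and g: "g \<in> L2_space M"
 shows "(cmod (L2_inner M f g))\<^sup>2 \<le> L2_sq M f * L2_sq M g"
proof (cases "L2_sq M g = 0")
 case True
 then have "AE x in M. g x = 0" using g by (simp add: L2_sq_eq_0)
 then have "L2_inner M f g = L2_inner M f (%x. 0)"
  by (intro L2_inner_cong_AE) (use f g in auto)
 then show ?thesis by (simp add: L2_inner_def)
next
 case False
 define n where "n = L2_sq M g"
 have n: "n > 0" using False L2_sq_nonneg[of M g] unfolding n_def by linarith
 define c where "c = L2_inner M f g / of_real n"
 have "0 \<le> L2_sq M (%x. f x - c * g x)" by simp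
 also have "\<dots> = L2_sq M f - 2 * Re (cnj c * L2_inner M f g) + (cmod c)\<^sup>2 * n"
  unfolding n_def using f g by (rule L2_sq_diff)
 also have "cnj c * L2_inner M f g = of_real ((cmod (L2_inner M f g))\<^sup>2 / n)"
  unfolding c_def using n
  by (simp add: cnj_mult_self)
 also have "(cmod c)\<^sup>2 * n = (cmod (L2_inner M f g))\<^sup>2 / n"
  unfolding c_def using n by (simp add: norm_divide power_divide power2_eq_square)
 finally show ?thesis using n unfolding n_def[symmetric] by (simp add: field_simps)
qed

lemma L2_inner_le:
 assumes "f \<in> L2_space M" "g \<in> L2_space M"
 shows "cmod (L2_inner M f g) \<le> sqrt (L2_sq M f) * sqrt (L2_sq M g)"
 using L2_Cauchy_Schwarz[OF assms] by (simp add: real_le_rsqrt real_sqrt_mult[symmetric])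

lemma L2_tendsto_iff:
 "L2_tendsto M F f \<longleftrightarrow> (\<forall>n. F n \<in> L2_space M) \<and> f \<in> L2_space M \<and> (%n. L2_sq M (%x. F n x - f x)) \<longlonglongrightarrow> 0"
proof -
 have "(%n. sqrt (s n)) \<longlonglongrightarrow> 0 \<longleftrightarrow> s \<longlonglongrightarrow> 0" if "\<And>n. 0 \<le> s n" for s :: "nat => real"
 proof
  assume "(%n. sqrt (s n)) \<longlonglongrightarrow> 0"
  from tendsto_power[OF this, of 2] show "s \<longlonglongrightarrow> 0" using that by simp
 next
  assume "s \<longlonglongrightarrow> 0"
  from tendsto_real_sqrt[OF this] show "(%n. sqrt (s n)) \<longlonglongrightarrow> 0" by simp
 qed
 from this[of "%n. L2_sq M (%x. F n x - f x)"]
 show ?thesis unfolding L2_tendsto_def L2_sq_def[symmetric] by auto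
qed

lemma L2_tendsto_inner:
 assumes "L2_tendsto M F f" and g: "g \<in> L2_space M"
 shows "(%n. L2_inner M (F n) g) \<longlonglongrightarrow> L2_inner M f g"
proof -
 have F: "\<And>n. F n \<in> L2_space M" and f: "f \<in> L2_space M"
  and lim: "(%n. sqrt (L2_sq M (%x. F n x - f x))) \<longlonglongrightarrow> 0"
  using assms(1) by (auto simp: L2_tendsto_def L2_sq_def)
 have "(%n. L2_inner M (F n) g - L2_inner M f g) \<longlonglongrightarrow> 0"
 proof (rule Lim_null_comparison)
  show "\<forall>\<^sub>F n in sequentially. norm (L2_inner M (F n) g - L2_inner M f g)
    \<le> sqrt (L2_sq M (%x. F n x - f x)) * sqrt (L2_sq M g)"
   using L2_inner_le[OF L2_diff[OF F f] g] by (simp add: L2_inner_diff_left F f g)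
  show "(%n. sqrt (L2_sq M (%x. F n x - f x)) * sqrt (L2_sq M g)) \<longlonglongrightarrow> 0"
   using tendsto_mult_right[OF lim, of "sqrt (L2_sq M g)"] by simp
 qed
 then show ?thesis by (simp add: LIM_zero_iff)
qed

subsection \<open>Orthonormal sequences\<close>

text \<open>
 Zero vectors are admitted, so that the Gram--Schmidt process need not discard the vectors that
 depend linearly on earlier ones.
\<close>

definition L2_orthonormal :: "'a measure => (nat => 'a => complex) => bool" where
 "L2_orthonormal M e \<longleftrightarrow> (\<forall>j. e j \<in> L2_space M) \<and>
   (\<forall>i j. i \<noteq> j \<longrightarrow> L2_inner M (e i) (e j) = 0) \<and> (\<forall>j. L2_sq M (e j) = 0 \<or> L2_sq M (e j) = 1)"

lemma orthonormal_inner_sum: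
 assumes e: "L2_orthonormal M e" and "finite S" and "i \<in> S"
 shows "L2_inner M (%x. \<Sum>j\<in>S. c j * e j x) (e i) = c i * of_real (L2_sq M (e i))"
proof -
 have [simp]: "e j \<in> L2_space M" for j using e by (auto simp: L2_orthonormal_def)
 have "L2_inner M (%x. \<Sum>j\<in>S. c j * e j x) (e i) = (\<Sum>j\<in>S. c j * L2_inner M (e j) (e i))"
  by (subst L2_inner_sum_left) (auto simp: L2_scale L2_inner_scale_left)
 also have "\<dots> = (\<Sum>j\<in>S. if j = i then c i * of_real (L2_sq M (e i)) else 0)"
  using e by (intro sum.cong) (auto simp: L2_orthonormal_def L2_inner_self)
 finally show ?thesis using assms by simp
qed

lemma orthonormal_sq_sum:
 assumes e: "L2_orthonormal M e" and "finite S"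
 shows "L2_sq M (%x. \<Sum>j\<in>S. c j * e j x) = (\<Sum>j\<in>S. (cmod (c j))\<^sup>2 * L2_sq M (e j))"
proof -
 have [simp]: "e j \<in> L2_space M" for j using e by (auto simp: L2_orthonormal_def)
 have "L2_inner M (%x. \<Sum>j\<in>S. c j * e j x) (%x. \<Sum>j\<in>S. c j * e j x)
  = (\<Sum>i\<in>S. cnj (c i) * L2_inner M (%x. \<Sum>j\<in>S. c j * e j x) (e i))"
  by (subst L2_inner_sum_right) (auto simp: L2_scale L2_sum L2_inner_scale_right)
 also have "\<dots> = of_real (\<Sum>i\<in>S. (cmod (c i))\<^sup>2 * L2_sq M (e i))"
  using assms by (auto simp: orthonormal_inner_sum cnj_mult_self mult.assoc[symmetric] intro!: sum.cong)
 finally show ?thesis unfolding L2_inner_self of_real_eq_iff .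
qed

lemma orthonormal_sq_sum_le:
 assumes e: "L2_orthonormal M e" and "finite S"
 shows "L2_sq M (%x. \<Sum>j\<in>S. c j * e j x) \<le> (\<Sum>j\<in>S. (cmod (c j))\<^sup>2)"
 unfolding orthonormal_sq_sum[OF assms]
proof (rule sum_mono)
 fix j
 have "L2_sq M (e j) \<le> 1" using e unfolding L2_orthonormal_def by (metis zero_le_one order_refl)
 then show "(cmod (c j))\<^sup>2 * L2_sq M (e j) \<le> (cmod (c j))\<^sup>2"
  by (simp add: mult_left_le)
qed

lemma Bessel_inequality:
 assumes e: "L2_orthonormal M e" and f: "f \<in> L2_space M"
 shows "(\<Sum>j<n. (cmod (L2_inner M f (e j)))\<^sup>2) \<le> L2_sq M f"
proof -
 have [simp]: "e j \<in> L2_space M" for j using e by (auto simp: L2_orthonormal_def)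
 define c where "c j = L2_inner M f (e j)" for j
 define s where "s = (%x. \<Sum>j<n. c j * e j x)"
 have s: "s \<in> L2_space M" unfolding s_def by (intro L2_sum L2_scale) simp
 have cz: "c j * of_real (L2_sq M (e j)) = c j" for j
 proof -
  have "c j = 0" if "L2_sq M (e j) = 0"
   using L2_inner_le[OF f, of "e j"] that by (simp add: c_def)
  then show ?thesis using e by (auto simp: L2_orthonormal_def)
 qed
 have "L2_inner M f s = (\<Sum>j<n. cnj (c j) * c j)"
  unfolding s_def by (subst L2_inner_sum_right) (auto simp: f L2_scale L2_inner_scale_right c_def)
 also have "\<dots> = of_real (\<Sum>j<n. (cmod (c j))\<^sup>2)"
  by (simp add: cnj_mult_self)
 finally have fs: "L2_inner M f s = of_real (\<Sum>j<n. (cmod (c j))\<^sup>2)" .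
 have "L2_sq M s \<le> (\<Sum>j<n. (cmod (c j))\<^sup>2)"
  unfolding s_def by (rule orthonormal_sq_sum_le[OF e]) simp
 moreover have "0 \<le> L2_sq M (%x. f x - 1 * s x)" by simp
 ultimately show ?thesis
  unfolding L2_sq_diff[OF f s] fs c_def by simp
qed

lemma Bessel_summable:
 assumes e: "L2_orthonormal M e" and f: "f \<in> L2_space M"
 shows "summable (%j. (cmod (L2_inner M f (e j)))\<^sup>2)"
 by (rule summableI_nonneg_bounded[of _ "L2_sq M f"]) (auto intro: Bessel_inequality[OF e f])

lemma nn_integral_L2_sq:
 assumes "f \<in> L2_space M"
 shows "(\<integral>\<^sup>+ x. ennreal ((cmod (f x))\<^sup>2) \<partial>M) = ennreal (L2_sq M f)"
 unfolding L2_sq_def by (rule nn_integral_eq_integral) (use assms in \<open>auto dest: L2_integrable\<close>)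

text \<open>
 The weighted sum \<open>\<Sum>\<^sub>k 2\<^sup>k \<parallel>S\<^sub>k\<^sub>+\<^sub>1 - S\<^sub>k\<parallel>\<^sup>2\<close> is finite, so almost everywhere the increments are
 dominated by a geometric sequence.
\<close>

lemma L2_AE_fast_Cauchy:
 assumes S: "\<And>k. S k \<in> L2_space M"
  and fast: "\<And>k. L2_sq M (%x. S (Suc k) x - S k x) \<le> (1 / 4) ^ k"
 shows "AE x in M. convergent (%k. S k x)"
proof -
 define d where "d k x = S (Suc k) x - S k x" for k x
 have d: "d k \<in> L2_space M" for k unfolding d_def using S by (intro L2_diff)
 have [measurable]: "d k \<in> borel_measurable M" for k using d by (rule L2_measurable)
 have "(\<integral>\<^sup>+ x. (\<Sum>k. ennreal (2 ^ k * (cmod (d k x))\<^sup>2)) \<partial>M)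
   = (\<Sum>k. \<integral>\<^sup>+ x. ennreal (2 ^ k * (cmod (d k x))\<^sup>2) \<partial>M)"
  by (rule nn_integral_suminf) measurable
 also have "\<dots> = (\<Sum>k. ennreal (2 ^ k * L2_sq M (d k)))"
  by (simp add: ennreal_mult nn_integral_cmult nn_integral_L2_sq d)
 also have "\<dots> \<le> (\<Sum>k. ennreal ((1 / 2) ^ k))"
 proof (rule suminf_le)
  fix k :: nat
  have "2 ^ k * L2_sq M (d k) \<le> 2 ^ k * (1 / 4) ^ k"
   using fast[of k] unfolding d_def by simp
  also have "(2::real) ^ k * (1 / 4) ^ k = (1 / 2) ^ k"
   by (simp add: power_mult_distrib[symmetric])
  finally show "ennreal (2 ^ k * L2_sq M (d k)) \<le> ennreal ((1 / 2) ^ k)"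
   by (simp add: ennreal_leI)
 qed auto
 also have "\<dots> < \<infinity>"
  by (subst suminf_ennreal_eq[OF _ geometric_sums]) auto
 finally have "(\<integral>\<^sup>+ x. (\<Sum>k. ennreal (2 ^ k * (cmod (d k x))\<^sup>2)) \<partial>M) \<noteq> \<infinity>" by simp
 then have "AE x in M. (\<Sum>k. ennreal (2 ^ k * (cmod (d k x))\<^sup>2)) \<noteq> \<infinity>"
  by (intro nn_integral_PInf_AE) measurable
 then show ?thesis
 proof (rule AE_mp, intro AE_I2 impI)
  fix x assume fin: "(\<Sum>k. ennreal (2 ^ k * (cmod (d k x))\<^sup>2)) \<noteq> \<infinity>"
  have "summable (%k. 2 ^ k * (cmod (d k x))\<^sup>2)"
   using fin by (intro summable_suminf_not_top) auto
  then have "(%k. 2 ^ k * (cmod (d k x))\<^sup>2) \<longlonglongrightarrow> 0" by (rule summable_LIMSEQ_zero)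
  then have "Bseq (%k. 2 ^ k * (cmod (d k x))\<^sup>2)" by (intro convergent_imp_Bseq convergentI)
  then obtain B where B: "B > 0" "\<And>k. norm (2 ^ k * (cmod (d k x))\<^sup>2) \<le> B" by (auto simp: Bseq_def)
  have bound: "cmod (d k x) \<le> sqrt B * (sqrt (1 / 2)) ^ k" for k
  proof (rule power2_le_imp_le)
   have "(cmod (d k x))\<^sup>2 \<le> B * (1 / 2) ^ k"
    using B(2)[of k] by (simp add: power_divide field_simps)
   also have "\<dots> = (sqrt B * (sqrt (1 / 2)) ^ k)\<^sup>2"
   proof -
    have "((sqrt (1 / 2)) ^ k)\<^sup>2 = ((sqrt (1 / 2))\<^sup>2 :: real) ^ k"
     by (simp only: power_mult[symmetric] mult.commute)
    then show ?thesis using B(1) by (simp add: power_mult_distrib)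
   qed
   finally show "(cmod (d k x))\<^sup>2 \<le> (sqrt B * (sqrt (1 / 2)) ^ k)\<^sup>2" .
  qed (use B in auto)
  have "summable (%k. d k x)"
  proof (rule summable_comparison_test')
   show "summable (%k. sqrt B * (sqrt (1 / 2)) ^ k)"
    by (intro summable_mult summable_geometric) (simp add: real_sqrt_divide)
  qed (use bound in auto)
  then have "convergent (%n. S 0 x + (\<Sum>k<n. d k x))"
   by (intro convergent_add convergent_const) (simp add: summable_iff_convergent)
  moreover have "S 0 x + (\<Sum>k<n. d k x) = S n x" for n
   unfolding d_def using sum_lessThan_telescope[of "%k. S k x" n] by simp
  ultimately show "convergent (%k. S k x)" by simp
 qed
qed

text \<open>
 The limit is found along a subsequence that converges so fast that it converges almost
 everywhere; Fatou's lemma then controls the distance to the whole sequence.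
\<close>

theorem Riesz_Fischer:
 assumes e: "L2_orthonormal M e" and c: "summable (%j. (cmod (c j))\<^sup>2)"
 shows "\<exists>f. L2_tendsto M (%n x. \<Sum>j<n. c j * e j x) f"
proof -
 define S where "S n = (%x. \<Sum>j<n. c j * e j x)" for n
 have [simp]: "e j \<in> L2_space M" for j using e by (auto simp: L2_orthonormal_def)
 have S: "S n \<in> L2_space M" for n unfolding S_def by (intro L2_sum L2_scale) simp
 define R where "R m = (\<Sum>j. (cmod (c (j + m)))\<^sup>2)" for m
 have R: "R \<longlonglongrightarrow> 0"
  unfolding R_def by (rule suminf_exist_split2[OF c])
 have dist: "L2_sq M (%x. S n x - S m x) \<le> R m" if "m \<le> n" for m n
 proof -
  have "(%x. S n x - S m x) = (%x. \<Sum>j\<in>{m..<n}. c j * e j x)"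
   unfolding S_def using that by (simp add: sum_diff_nat_ivl flip: atLeast0LessThan)
  then have "L2_sq M (%x. S n x - S m x) \<le> (\<Sum>j\<in>{m..<n}. (cmod (c j))\<^sup>2)"
   using orthonormal_sq_sum_le[OF e, of "{m..<n}" c] by simp
  also have "\<dots> = (\<Sum>j<n - m. (cmod (c (j + m)))\<^sup>2)"
   by (rule sum.reindex_bij_witness[of _ "%j. j + m" "%j. j - m"]) auto
  also have "\<dots> \<le> R m"
   unfolding R_def using c by (intro sum_le_suminf) (auto simp: summable_iff_shift[of "%j. (cmod (c j))\<^sup>2"])
  finally show ?thesis .
 qed
 have "\<exists>n0. \<forall>n\<ge>n0. R n \<le> (1 / 4) ^ k" for k
  using order_tendstoD(2)[OF R, of "(1 / 4) ^ k"] by (auto simp: eventually_sequentially intro: less_imp_le)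
 then obtain n0 where n0: "\<And>k n. n0 k \<le> n ==> R n \<le> (1 / 4) ^ k" by metis
 define N where "N k = k + (\<Sum>i\<le>k. n0 i)" for k
 have N_ge: "n0 k \<le> N k" "k \<le> N k" for k
  unfolding N_def by (auto intro!: trans_le_add2 member_le_sum)
 have N_mono: "N k \<le> N (Suc k)" for k unfolding N_def by simp
 have conv: "AE x in M. convergent (%k. S (N k) x)"
 proof (rule L2_AE_fast_Cauchy)
  fix k show "L2_sq M (%x. S (N (Suc k)) x - S (N k) x) \<le> (1 / 4) ^ k"
   using dist[OF N_mono[of k]] n0[OF N_ge(1)[of k]] by linarith
 qed (rule S)
 define f where "f x = lim (%k. S (N k) x)" for x
 have [measurable]: "S n \<in> borel_measurable M" for n using S by (rule L2_measurable)
 have [measurable]: "f \<in> borel_measurable M"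
  unfolding f_def by (rule borel_measurable_lim_metric) measurable
 have Fatou: "(\<integral>\<^sup>+ x. ennreal ((cmod (S m x - f x))\<^sup>2) \<partial>M) \<le> ennreal (R m)" for m
 proof -
  have "(\<integral>\<^sup>+ x. ennreal ((cmod (S m x - f x))\<^sup>2) \<partial>M)
    = (\<integral>\<^sup>+ x. liminf (%k. ennreal ((cmod (S m x - S (N k) x))\<^sup>2)) \<partial>M)"
  proof (rule nn_integral_cong_AE, rule AE_mp[OF conv], intro AE_I2 impI)
   fix x assume "convergent (%k. S (N k) x)"
   then have "(%k. S (N k) x) \<longlonglongrightarrow> f x" unfolding f_def by (simp add: convergent_LIMSEQ_iff)
   then have "(%k. ennreal ((cmod (S m x - S (N k) x))\<^sup>2)) \<longlonglongrightarrow> ennreal ((cmod (S m x - f x))\<^sup>2)"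
    by (intro tendsto_intros)
   from lim_imp_Liminf[OF _ this]
   show "ennreal ((cmod (S m x - f x))\<^sup>2) = liminf (%k. ennreal ((cmod (S m x - S (N k) x))\<^sup>2))"
    by simp
  qed
  also have "\<dots> \<le> liminf (%k. \<integral>\<^sup>+ x. ennreal ((cmod (S m x - S (N k) x))\<^sup>2) \<partial>M)"
   by (rule nn_integral_liminf) measurable
  also have "\<dots> \<le> liminf (%k::nat. ennreal (R m))"
  proof (rule Liminf_mono)
   have "(\<integral>\<^sup>+ x. ennreal ((cmod (S m x - S (N k) x))\<^sup>2) \<partial>M) \<le> ennreal (R m)" if "m \<le> k" for k
   proof -
    have "(\<integral>\<^sup>+ x. ennreal ((cmod (S m x - S (N k) x))\<^sup>2) \<partial>M) = ennreal (L2_sq M (%x. S (N k) x - S m x))"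
     by (subst nn_integral_L2_sq[symmetric]) (auto intro: L2_diff S simp: norm_minus_commute)
    also have "\<dots> \<le> ennreal (R m)"
     using dist[of m "N k"] that N_ge(2)[of k] by (intro ennreal_leI) simp
    finally show ?thesis .
   qed
   then show "\<forall>\<^sub>F k in sequentially. (\<integral>\<^sup>+ x. ennreal ((cmod (S m x - S (N k) x))\<^sup>2) \<partial>M) \<le> ennreal (R m)"
    by (auto simp: eventually_sequentially)
  qed
  finally show ?thesis by (simp add: Liminf_const)
 qed
 have R0: "0 \<le> R m" for m
  using dist[of m m] L2_sq_nonneg[of M "%x. S m x - S m x"] by linarith
 have diff: "(%x. S m x - f x) \<in> L2_space M" for m
 proof (rule L2_spaceI)
  show "integrable M (%x. (cmod (S m x - f x))\<^sup>2)"
  proof (rule integrableI_bounded)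
   show "(\<integral>\<^sup>+ x. ennreal (norm ((cmod (S m x - f x))\<^sup>2)) \<partial>M) < \<infinity>"
    using Fatou[of m] by (simp add: order_le_less_trans)
  qed measurable
 qed measurable
 have f: "f \<in> L2_space M"
  using L2_diff[OF S[of 0] diff[of 0]] by simp
 have "L2_sq M (%x. S m x - f x) \<le> R m" for m
  using Fatou[of m] R0[of m] by (simp add: nn_integral_L2_sq[OF diff])
 then have "(%m. L2_sq M (%x. S m x - f x)) \<longlonglongrightarrow> 0"
  by (intro tendsto_sandwich[OF _ _ tendsto_const R]) auto
 then have "L2_tendsto M S f"
  unfolding L2_tendsto_iff using S f by auto
 then show ?thesis unfolding S_def by blast
qed

lemma orthonormal_coefficient_degenerate:
 assumes e: "L2_orthonormal M e" and f: "f \<in> L2_space M"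
 shows "L2_inner M f (e j) * of_real (L2_sq M (e j)) = L2_inner M f (e j)"
proof -
 have "L2_inner M f (e j) = 0" if "L2_sq M (e j) = 0"
  using L2_inner_le[OF f, of "e j"] that e by (auto simp: L2_orthonormal_def)
 moreover have "L2_sq M (e j) = 0 \<or> L2_sq M (e j) = 1" using e by (simp add: L2_orthonormal_def)
 ultimately show ?thesis by auto
qed

lemma orthonormal_series_coefficient:
 assumes e: "L2_orthonormal M e" and lim: "L2_tendsto M (%n x. \<Sum>j<n. c j * e j x) f"
 shows "L2_inner M f (e i) = c i * of_real (L2_sq M (e i))"
proof (rule LIMSEQ_unique)
 show "(%n. L2_inner M (%x. \<Sum>j<n. c j * e j x) (e i)) \<longlonglongrightarrow> L2_inner M f (e i)"
  by (rule L2_tendsto_inner[OF lim]) (use e in \<open>simp add: L2_orthonormal_def\<close>)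
 have "\<forall>\<^sub>F n in sequentially. L2_inner M (%x. \<Sum>j<n. c j * e j x) (e i) = c i * of_real (L2_sq M (e i))"
  using eventually_gt_at_top[of i] by eventually_elim (simp add: orthonormal_inner_sum[OF e])
 then show "(%n. L2_inner M (%x. \<Sum>j<n. c j * e j x) (e i)) \<longlonglongrightarrow> c i * of_real (L2_sq M (e i))"
  by (rule tendsto_eventually)
qed

definition L2_total :: "'a measure => (nat => 'a => complex) => bool" where
 "L2_total M u \<longleftrightarrow> (\<forall>j. u j \<in> L2_space M) \<and>
   (\<forall>f\<in>L2_space M. (\<forall>j. L2_inner M f (u j) = 0) \<longrightarrow> (AE x in M. f x = 0))"

lemma L2_tendsto_cong_AE:
 assumes "L2_tendsto M F f" "AE x in M. f x = g x" "g \<in> borel_measurable M"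
 shows "L2_tendsto M F g"
proof -
 have F: "\<And>n. F n \<in> L2_space M" and f: "f \<in> L2_space M" using assms(1) by (auto simp: L2_tendsto_def)
 have g: "g \<in> L2_space M" by (rule L2_cong_AE[OF f assms(2,3)])
 have "L2_sq M (%x. F n x - f x) = L2_sq M (%x. F n x - g x)" for n
  unfolding L2_sq_def by (rule integral_cong_AE) (use F f g assms(2) in auto)
 then show ?thesis using assms(1) g by (simp add: L2_tendsto_iff)
qed

lemma orthonormal_expansion:
 assumes e: "L2_orthonormal M e" "L2_total M e" and f: "f \<in> L2_space M"
 shows "L2_tendsto M (%n x. \<Sum>j<n. L2_inner M f (e j) * e j x) f"
proof -
 have [simp]: "e j \<in> L2_space M" for j using e by (auto simp: L2_orthonormal_def)
 obtain g where g: "L2_tendsto M (%n x. \<Sum>j<n. L2_inner M f (e j) * e j x) g"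
  using Riesz_Fischer[OF e(1) Bessel_summable[OF e(1) f]] by blast
 then have gL: "g \<in> L2_space M" by (simp add: L2_tendsto_def)
 have "L2_inner M (%x. g x - f x) (e j) = 0" for j
  using orthonormal_series_coefficient[OF e(1) g, of j] orthonormal_coefficient_degenerate[OF e(1) f, of j]
  by (simp add: L2_inner_diff_left gL f)
 then have "AE x in M. g x - f x = 0"
  using e(2) L2_diff[OF gL f] by (auto simp: L2_total_def)
 then have "AE x in M. g x = f x" by simp
 then show ?thesis by (rule L2_tendsto_cong_AE[OF g]) (use f in auto)
qed

lemma Parseval:
 assumes e: "L2_orthonormal M e" "L2_total M e" and f: "f \<in> L2_space M" and g: "g \<in> L2_space M"
 shows "(%j. L2_inner M f (e j) * cnj (L2_inner M g (e j))) sums L2_inner M f g"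
proof -
 have [simp]: "e j \<in> L2_space M" for j using e by (auto simp: L2_orthonormal_def)
 have "L2_inner M (%x. \<Sum>j<n. L2_inner M f (e j) * e j x) g
   = (\<Sum>j<n. L2_inner M f (e j) * cnj (L2_inner M g (e j)))" for n
  using L2_inner_cnj[of M "e _" g]
  by (subst L2_inner_sum_left) (auto simp: g L2_scale L2_inner_scale_left)
 then show ?thesis
  using L2_tendsto_inner[OF orthonormal_expansion[OF e f] g] by (simp add: sums_def)
qed

subsection \<open>Systems of eigenspaces\<close>

text \<open>
 Gram--Schmidt within each value of \<open>c\<close> separately: the result stays in the eigenspace of the
 given eigenvalue, and vectors from different eigenspaces are orthogonal already.
\<close>

fun graded_gram_schmidt ::
  "'a measure => (nat => 'a => complex) => (nat => real) => nat => 'a => complex" where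
 "graded_gram_schmidt M u c j =
   (let g = (%x. u j x - (\<Sum>i\<in>{i. i < j \<and> c i = c j}.
         L2_inner M (u j) (graded_gram_schmidt M u c i) * graded_gram_schmidt M u c i x))
   in (%x. of_real (1 / sqrt (L2_sq M g)) * g x))"

declare graded_gram_schmidt.simps [simp del]

text \<open>
 The spaces \<open>E t\<close> need not be closed: in the application they consist of finite combinations. The
 sequence \<open>u\<close>, with eigenvalues \<open>c\<close>, witnesses that countably many of their elements are total.
\<close>

locale eigenspaces =
 fixes M :: "'a measure" and E :: "real => ('a => complex) set"
  and u :: "nat => 'a => complex" and c :: "nat => real"
 assumes E_L2: "\<And>t v. v \<in> E t ==> v \<in> L2_space M"
  and E_zero: "\<And>t. (%x. 0) \<in> E t"
  and E_add: "\<And>t v w. v \<in> E t ==> w \<in> E t ==> (%x. v x + w x) \<in> E t"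
  and E_scale: "\<And>t v b. v \<in> E t ==> (%x. b * v x) \<in> E t"
  and E_orthogonal: "\<And>s t v w. s \<noteq> t ==> v \<in> E s ==> w \<in> E t ==> L2_inner M v w = 0"
  and u_E: "\<And>j. u j \<in> E (c j)"
  and u_total: "L2_total M u"
begin

lemma E_sum: "(\<And>i. i \<in> I ==> v i \<in> E t) ==> (%x. \<Sum>i\<in>I. v i x) \<in> E t"
 by (induction I rule: infinite_finite_induct) (auto intro: E_zero E_add)

abbreviation gram_schmidt :: "nat => 'a => complex" where
 "gram_schmidt \<equiv> graded_gram_schmidt M u c"

definition residual :: "nat => 'a => complex" where
 "residual j x = u j x - (\<Sum>i\<in>{i. i < j \<and> c i = c j}. L2_inner M (u j) (gram_schmidt i) * gram_schmidt i x)"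

definition normalizer :: "nat => complex" where
 "normalizer j = of_real (1 / sqrt (L2_sq M (residual j)))"

lemma gram_schmidt_eq: "gram_schmidt j = (%x. normalizer j * residual j x)"
proof -
 have "residual j = (%x. u j x - (\<Sum>i\<in>{i. i < j \<and> c i = c j}. L2_inner M (u j) (gram_schmidt i) * gram_schmidt i x))"
  by (rule ext) (simp add: residual_def)
 then show ?thesis by (subst graded_gram_schmidt.simps) (simp add: Let_def normalizer_def)
qed

lemma gram_schmidt_E: "gram_schmidt j \<in> E (c j) \<and> residual j \<in> E (c j)"
proof (induction j rule: less_induct)
 case (less j)
 have "(%x. \<Sum>i\<in>{i. i < j \<and> c i = c j}. L2_inner M (u j) (gram_schmidt i) * gram_schmidt i x) \<in> E (c j)"
  using less by (intro E_sum E_scale) (metis (mono_tags, lifting) mem_Collect_eq)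
 from E_add[OF u_E[of j] E_scale[OF this, of "-1"]]
 have "residual j \<in> E (c j)" unfolding residual_def by simp
 then show ?case by (subst gram_schmidt_eq) (auto intro: E_scale)
qed

lemma gram_schmidt_L2 [simp]: "gram_schmidt j \<in> L2_space M"
 and residual_L2 [simp]: "residual j \<in> L2_space M"
 using gram_schmidt_E E_L2 by blast+

lemma u_L2 [simp]: "u j \<in> L2_space M"
 using u_E E_L2 by blast

lemma gram_schmidt_norm: "L2_sq M (gram_schmidt j) = 0 \<or> L2_sq M (gram_schmidt j) = 1"
proof -
 have "L2_inner M (gram_schmidt j) (gram_schmidt j) = normalizer j * (cnj (normalizer j) * L2_inner M (residual j) (residual j))"
  by (simp only: gram_schmidt_eq L2_inner_scale_left L2_inner_scale_right)
 then have "complex_of_real (L2_sq M (gram_schmidt j)) = of_real (1 / sqrt (L2_sq M (residual j)) * (1 / sqrt (L2_sq M (residual j))) * L2_sq M (residual j))"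
  unfolding L2_inner_self normalizer_def by (simp only: of_real_mult complex_cnj_complex_of_real mult.assoc)
 then have *: "L2_sq M (gram_schmidt j) = 1 / sqrt (L2_sq M (residual j)) * (1 / sqrt (L2_sq M (residual j))) * L2_sq M (residual j)"
  unfolding of_real_eq_iff .
 show ?thesis
  by (cases "L2_sq M (residual j) = 0") (auto simp: * field_simps)
qed

lemma gram_schmidt_orthogonal: "i < j ==> L2_inner M (gram_schmidt j) (gram_schmidt i) = 0"
proof (induction j arbitrary: i rule: less_induct)
 case (less j)
 show ?case
 proof (cases "c i = c j")
  case False
  then show ?thesis using gram_schmidt_E E_orthogonal by metis
 next
  case True
  have cross: "L2_inner M (gram_schmidt i') (gram_schmidt i) = 0" if "i' < j" "i' \<noteq> i" for i'
  proof (cases "i < i'")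
   case True then show ?thesis using less.IH[of i' i] that by simp
  next
   case False
   then have "L2_inner M (gram_schmidt i) (gram_schmidt i') = 0" using less.IH[of i i'] less.prems that by simp
   then show ?thesis by (subst L2_inner_cnj) simp
  qed
  have "L2_inner M (residual j) (gram_schmidt i)
    = L2_inner M (u j) (gram_schmidt i)
     - (\<Sum>i'\<in>{i. i < j \<and> c i = c j}. L2_inner M (u j) (gram_schmidt i') * L2_inner M (gram_schmidt i') (gram_schmidt i))"
   unfolding residual_def by (subst L2_inner_diff_left) (auto simp: L2_sum L2_scale L2_inner_sum_left L2_inner_scale_left)
  also have "(\<Sum>i'\<in>{i. i < j \<and> c i = c j}. L2_inner M (u j) (gram_schmidt i') * L2_inner M (gram_schmidt i') (gram_schmidt i))
    = (\<Sum>i'\<in>{i. i < j \<and> c i = c j}. if i' = i then L2_inner M (u j) (gram_schmidt i) * of_real (L2_sq M (gram_schmidt i)) else 0)"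
   by (intro sum.cong) (auto simp: cross L2_inner_self)
  also have "\<dots> = L2_inner M (u j) (gram_schmidt i) * of_real (L2_sq M (gram_schmidt i))"
   using less.prems True by simp
  also have "\<dots> = L2_inner M (u j) (gram_schmidt i)"
  proof (cases "L2_sq M (gram_schmidt i) = 0")
   case True
   then show ?thesis using L2_inner_le[of "u j" M "gram_schmidt i"] by simp
  next
   case False
   then show ?thesis using gram_schmidt_norm[of i] by simp
  qed
  finally have "L2_inner M (residual j) (gram_schmidt i) = 0" by simp
  then show ?thesis by (subst gram_schmidt_eq) (simp add: L2_inner_scale_left)
 qed
qed

lemma gram_schmidt_orthonormal: "L2_orthonormal M gram_schmidt"
proof -
 have "L2_inner M (gram_schmidt i) (gram_schmidt j) = 0" if "i \<noteq> j" for i j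
 proof (cases "j < i")
  case True then show ?thesis by (rule gram_schmidt_orthogonal)
 next
  case False
  then show ?thesis using that gram_schmidt_orthogonal[of i j] by (subst L2_inner_cnj) simp
 qed
 then show ?thesis using gram_schmidt_norm by (auto simp: L2_orthonormal_def)
qed

lemma gram_schmidt_total: "L2_total M gram_schmidt"
 unfolding L2_total_def
proof (intro conjI ballI impI allI)
 fix f assume f: "f \<in> L2_space M" and orth: "\<forall>j. L2_inner M f (gram_schmidt j) = 0"
 have "L2_inner M f (u j) = 0" for j
 proof -
  have "L2_inner M f (residual j) = 0"
  proof (cases "L2_sq M (residual j) = 0")
   case True
   then show ?thesis using L2_inner_le[OF f, of "residual j"] by simp
  next
   case False
   have "0 = L2_inner M f (gram_schmidt j)" using orth by simp
   also have "\<dots> = cnj (normalizer j) * L2_inner M f (residual j)"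
    by (subst gram_schmidt_eq) (simp add: L2_inner_scale_right)
   finally show ?thesis using False by (simp add: normalizer_def)
  qed
  moreover have "L2_inner M f (residual j) = L2_inner M f (u j)"
   unfolding residual_def using orth
   by (subst L2_inner_diff_right) (auto simp: f L2_sum L2_scale L2_inner_sum_right L2_inner_scale_right)
  ultimately show ?thesis by simp
 qed
 then show "AE x in M. f x = 0" using u_total f by (auto simp: L2_total_def)
qed simp

lemma inner_gram_schmidt_eigen:
 assumes "v \<in> E t"
 shows "of_real (c j) * L2_inner M v (gram_schmidt j) = of_real t * L2_inner M v (gram_schmidt j)"
 using E_orthogonal[OF _ assms] gram_schmidt_E[of j] by (metis mult_zero_right)

lemma inner_gram_schmidt_multiplier:
 assumes "v \<in> E t"
 shows "\<phi> (c j) * cnj (L2_inner M v (gram_schmidt j)) = \<phi> t * cnj (L2_inner M v (gram_schmidt j))"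
 using E_orthogonal[OF _ assms] gram_schmidt_E[of j] by (metis complex_cnj_zero mult_zero_right)

text \<open>
 The series \<open>\<Sum>\<^sub>j \<phi>(c\<^sub>j) \<langle>f, e\<^sub>j\<rangle> e\<^sub>j\<close> over the orthonormalised eigenfunctions converges by the theorem of
 Riesz and Fischer, because \<open>\<phi>\<close> is bounded.
\<close>

lemma multiplier_exists:
 assumes f: "f \<in> L2_space M" and \<phi>: "\<And>t. cmod (\<phi> t) \<le> 1"
 shows "\<exists>g\<in>L2_space M. \<forall>t. \<forall>v\<in>E t. L2_inner M g v = \<phi> t * L2_inner M f v"
proof -
 define a where "a j = L2_inner M f (gram_schmidt j)" for j
 have sm: "summable (%j. (cmod (a j))\<^sup>2)"
  unfolding a_def by (rule Bessel_summable[OF gram_schmidt_orthonormal f])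
 have "summable (%j. (cmod (\<phi> (c j) * a j))\<^sup>2)"
 proof (rule summable_comparison_test'[OF sm])
  fix j
  have "(cmod (\<phi> (c j)))\<^sup>2 \<le> 1" using \<phi>[of "c j"] by (simp add: power_le_one)
  then show "norm ((cmod (\<phi> (c j) * a j))\<^sup>2) \<le> (cmod (a j))\<^sup>2"
   by (simp add: norm_mult power_mult_distrib mult_left_le_one_le)
 qed
 then obtain g where g: "L2_tendsto M (%n x. \<Sum>j<n. \<phi> (c j) * a j * gram_schmidt j x) g"
  using Riesz_Fischer[OF gram_schmidt_orthonormal, of "%j. \<phi> (c j) * a j"] by blast
 then have gL: "g \<in> L2_space M" by (simp add: L2_tendsto_def)
 have co: "L2_inner M g (gram_schmidt j) = \<phi> (c j) * a j" for j
  using orthonormal_series_coefficient[OF gram_schmidt_orthonormal g, of j]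
   orthonormal_coefficient_degenerate[OF gram_schmidt_orthonormal f, of j]
  by (simp add: a_def mult.assoc)
 show ?thesis
 proof (intro bexI[of _ g] allI ballI gL)
  fix t v assume v: "v \<in> E t"
  have "(%j. L2_inner M g (gram_schmidt j) * cnj (L2_inner M v (gram_schmidt j))) sums L2_inner M g v"
   by (rule Parseval[OF gram_schmidt_orthonormal gram_schmidt_total gL E_L2[OF v]])
  moreover have "L2_inner M g (gram_schmidt j) * cnj (L2_inner M v (gram_schmidt j))
    = \<phi> t * (L2_inner M f (gram_schmidt j) * cnj (L2_inner M v (gram_schmidt j)))" for j
   using inner_gram_schmidt_multiplier[OF v, of \<phi> j] unfolding co a_def by (simp add: mult_ac)
  moreover have "(%j. \<phi> t * (L2_inner M f (gram_schmidt j) * cnj (L2_inner M v (gram_schmidt j)))) sums (\<phi> t * L2_inner M f v)"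
   by (intro sums_mult Parseval gram_schmidt_orthonormal gram_schmidt_total f E_L2[OF v])
  ultimately show "L2_inner M g v = \<phi> t * L2_inner M f v" by (simp add: sums_unique2)
 qed
qed

lemma multiplier_symmetric:
 assumes f: "f \<in> L2_space M" and g: "g \<in> L2_space M" and f': "f' \<in> L2_space M" and g': "g' \<in> L2_space M"
  and ff': "\<And>t v. v \<in> E t ==> L2_inner M f' v = of_real (\<phi> t) * L2_inner M f v"
  and gg': "\<And>t v. v \<in> E t ==> L2_inner M g' v = of_real (\<phi> t) * L2_inner M g v"
 shows "L2_inner M f' g = L2_inner M f g'"
proof -
 note P = Parseval[OF gram_schmidt_orthonormal gram_schmidt_total]
 have "L2_inner M f' (gram_schmidt j) * cnj (L2_inner M g (gram_schmidt j))
   = L2_inner M f (gram_schmidt j) * cnj (L2_inner M g' (gram_schmidt j))" for j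
  using ff'[of "gram_schmidt j" "c j"] gg'[of "gram_schmidt j" "c j"] gram_schmidt_E[of j] by simp
 then show ?thesis
  using sums_unique2[OF P[OF f' g]] P[OF f g'] by simp
qed

end

subsection \<open>Functional calculus of operators with a total system of eigenvectors\<close>

text \<open>
 \<open>A_eigen\<close> is symmetry against eigenfunctions; \<open>A_sum\<close> says that finite sums of eigenfunctions belong
 to the domain, with the expected images.
\<close>

locale diagonal_operator = eigenspaces +
 fixes A :: "'a op_graph"
 assumes A_L2: "\<And>f g. (f, g) \<in> A ==> f \<in> L2_space M \<and> g \<in> L2_space M"
  and A_eigen: "\<And>f g t v. (f, g) \<in> A ==> v \<in> E t ==> L2_inner M g v = of_real t * L2_inner M f v"
  and A_sum: "\<And>n v. (\<And>j. v j \<in> E (c j)) ==> (%x. \<Sum>j<n. v j x, %x. \<Sum>j<n. of_real (c j) * v j x) \<in> A"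
begin

text \<open>
 The closure is the maximal multiplication operator in the coefficients, which expresses essential
 self-adjointness: one inclusion is the continuity of the inner product, and the partial sums of
 the expansions give the other.
\<close>

lemma closure_iff:
 "(f, g) \<in> op_closure M A \<longleftrightarrow> f \<in> L2_space M \<and> g \<in> L2_space M \<and>
   (\<forall>j. L2_inner M g (gram_schmidt j) = of_real (c j) * L2_inner M f (gram_schmidt j))"
proof safe
 assume "(f, g) \<in> op_closure M A"
 then obtain F G where FG: "\<And>n. (F n, G n) \<in> A" "L2_tendsto M F f" "L2_tendsto M G g"
  by (auto simp: op_closure_def)
 then show "f \<in> L2_space M" "g \<in> L2_space M" by (auto simp: L2_tendsto_def)
 fix j
 have "(%n. L2_inner M (G n) (gram_schmidt j)) \<longlonglongrightarrow> L2_inner M g (gram_schmidt j)"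
  by (rule L2_tendsto_inner[OF FG(3)]) simp
 moreover have "(%n. of_real (c j) * L2_inner M (F n) (gram_schmidt j)) \<longlonglongrightarrow> of_real (c j) * L2_inner M f (gram_schmidt j)"
  by (intro tendsto_intros L2_tendsto_inner[OF FG(2)]) simp
 moreover have "L2_inner M (G n) (gram_schmidt j) = of_real (c j) * L2_inner M (F n) (gram_schmidt j)" for n
  using A_eigen[OF FG(1)] gram_schmidt_E by blast
 ultimately show "L2_inner M g (gram_schmidt j) = of_real (c j) * L2_inner M f (gram_schmidt j)"
  by (simp add: LIMSEQ_unique)
next
 assume f: "f \<in> L2_space M" and g: "g \<in> L2_space M"
  and eq: "\<forall>j. L2_inner M g (gram_schmidt j) = of_real (c j) * L2_inner M f (gram_schmidt j)"
 note ex = orthonormal_expansion[OF gram_schmidt_orthonormal gram_schmidt_total]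
 have "(%x. \<Sum>j<n. L2_inner M f (gram_schmidt j) * gram_schmidt j x,
     %x. \<Sum>j<n. L2_inner M g (gram_schmidt j) * gram_schmidt j x) \<in> A" for n
  using A_sum[of "%j x. L2_inner M f (gram_schmidt j) * gram_schmidt j x" n] gram_schmidt_E
  by (simp add: E_scale eq mult.assoc)
 then show "(f, g) \<in> op_closure M A"
  unfolding op_closure_def mem_Collect_eq prod.case
  by (intro exI[of _ "%n x. \<Sum>j<n. L2_inner M f (gram_schmidt j) * gram_schmidt j x"]
    exI[of _ "%n x. \<Sum>j<n. L2_inner M g (gram_schmidt j) * gram_schmidt j x"]) (simp add: ex f g)
qed

text \<open>
 The indices at which the Gram--Schmidt process did not produce a zero vector. Counting measure on
 them, with the eigenvalue as second coordinate, is a spectral measure.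
\<close>

definition support :: "nat set" where
 "support = {j. L2_sq M (gram_schmidt j) = 1}"

definition spectral_measure :: "(nat \<times> real) measure" where
 "spectral_measure = distr (count_space support) (count_space UNIV \<Otimes>\<^sub>M borel) (%j. (j, c j))"

definition coefficients :: "('a => complex) => nat \<times> real => complex" where
 "coefficients f z = L2_inner M f (gram_schmidt (fst z))"

lemma coefficient_0: "f \<in> L2_space M ==> j \<notin> support ==> L2_inner M f (gram_schmidt j) = 0"
 using orthonormal_coefficient_degenerate[OF gram_schmidt_orthonormal, of f j] gram_schmidt_norm[of j]
 by (auto simp: support_def)

lemma sets_spectral_measure [measurable_cong]:
 "sets spectral_measure = sets (count_space UNIV \<Otimes>\<^sub>M borel)"
 by (simp add: spectral_measure_def)

lemma integrable_spectral_measure: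
 fixes F :: "nat \<times> real => 'b::{banach, second_countable_topology}"
 assumes [measurable]: "F \<in> borel_measurable (count_space UNIV \<Otimes>\<^sub>M borel)"
 shows "integrable spectral_measure F \<longleftrightarrow> summable (%j. norm (indicator support j *\<^sub>R F (j, c j)))"
proof -
 have "integrable spectral_measure F \<longleftrightarrow> integrable (count_space support) (%j. F (j, c j))"
  unfolding spectral_measure_def by (subst integrable_distr_eq) (auto simp: space_pair_measure)
 also have "count_space support = restrict_space (count_space UNIV) support"
  by (simp add: restrict_count_space)
 finally show ?thesis
  by (subst (asm) integrable_restrict_space) (auto simp: integrable_count_space_nat_iff)
qed

lemma integral_spectral_measure:
 fixes F :: "nat \<times> real => 'b::{banach, second_countable_topology}"
 assumes [measurable]: "F \<in> borel_measurable (count_space UNIV \<Otimes>\<^sub>M borel)"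
  and int: "integrable spectral_measure F"
 shows "(%j. indicator support j *\<^sub>R F (j, c j)) sums (LINT z|spectral_measure. F z)"
proof -
 have "(LINT z|spectral_measure. F z) = (LINT j|count_space support. F (j, c j))"
  unfolding spectral_measure_def by (subst integral_distr) (auto simp: space_pair_measure)
 also have "count_space support = restrict_space (count_space UNIV) support"
  by (simp add: restrict_count_space)
 also have "(LINT j|restrict_space (count_space UNIV) support. F (j, c j)) = (LINT j|count_space UNIV. indicator support j *\<^sub>R F (j, c j))"
  by (subst integral_restrict_space) auto
 finally have "(LINT z|spectral_measure. F z) = (LINT j|count_space UNIV. indicator support j *\<^sub>R F (j, c j))" .
 moreover have "integrable (count_space UNIV) (%j. indicator support j *\<^sub>R F (j, c j))"
  using int by (simp add: integrable_spectral_measure integrable_count_space_nat_iff)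
 ultimately show ?thesis by (simp add: sums_integral_count_space_nat)
qed

lemma AE_spectral_measure_eq:
 fixes F G :: "nat \<times> real => complex"
 assumes [measurable]: "F \<in> borel_measurable (count_space UNIV \<Otimes>\<^sub>M borel)" "G \<in> borel_measurable (count_space UNIV \<Otimes>\<^sub>M borel)"
 shows "(AE z in spectral_measure. F z = G z) \<longleftrightarrow> (\<forall>j\<in>support. F (j, c j) = G (j, c j))"
proof -
 have "{z \<in> space (count_space UNIV \<Otimes>\<^sub>M borel). F z = G z} \<in> sets (count_space UNIV \<Otimes>\<^sub>M borel)"
  by measurable
 then show ?thesis
  unfolding spectral_measure_def
  by (subst AE_distr_iff) (auto simp: space_pair_measure AE_count_space)
qed

lemma coefficients_measurable [measurable]:
 "coefficients f \<in> borel_measurable (count_space UNIV \<Otimes>\<^sub>M borel)"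
 unfolding coefficients_def[abs_def]
 by (rule measurable_compose[OF measurable_fst]) auto

lemma coefficients_unitary: "L2_unitary M spectral_measure coefficients"
 unfolding L2_unitary_def
proof (intro conjI ballI)
 show W: "coefficients f \<in> L2_space spectral_measure" if "f \<in> L2_space M" for f
 proof (rule L2_spaceI)
  show "integrable spectral_measure (%z. (cmod (coefficients f z))\<^sup>2)"
  proof (subst integrable_spectral_measure)
   have "norm (indicator support j *\<^sub>R (cmod (coefficients f (j, c j)))\<^sup>2) = (cmod (L2_inner M f (gram_schmidt j)))\<^sup>2" for j
    using coefficient_0[OF that, of j] by (auto simp: coefficients_def indicator_def)
   then show "summable (%j. norm (indicator support j *\<^sub>R (cmod (coefficients f (j, c j)))\<^sup>2))"
    using Bessel_summable[OF gram_schmidt_orthonormal that] by simp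
  qed measurable
 qed measurable
 fix f g assume f: "f \<in> L2_space M" and g: "g \<in> L2_space M"
 have "(%j. indicator support j *\<^sub>R (coefficients f (j, c j) * cnj (coefficients g (j, c j)))) sums
   L2_inner spectral_measure (coefficients f) (coefficients g)"
  unfolding L2_inner_def by (intro integral_spectral_measure L2_inner_integrable W f g) measurable
 moreover have "indicator support j *\<^sub>R (coefficients f (j, c j) * cnj (coefficients g (j, c j)))
   = L2_inner M f (gram_schmidt j) * cnj (L2_inner M g (gram_schmidt j))" for j
  using coefficient_0[OF f, of j] by (auto simp: coefficients_def indicator_def)
 ultimately show "L2_inner spectral_measure (coefficients f) (coefficients g) = L2_inner M f g"
  using Parseval[OF gram_schmidt_orthonormal gram_schmidt_total f g] by (simp add: sums_unique2)
next
 fix h assume h: "h \<in> L2_space spectral_measure"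
 have [measurable]: "h \<in> borel_measurable (count_space UNIV \<Otimes>\<^sub>M borel)"
  using L2_measurable[OF h] by (simp add: measurable_cong_sets[OF sets_spectral_measure refl])
 define b where "b j = (if j \<in> support then h (j, c j) else 0)" for j
 have "summable (%j. norm (indicator support j *\<^sub>R (cmod (h (j, c j)))\<^sup>2))"
  using L2_integrable[OF h] by (subst (asm) integrable_spectral_measure) auto
 also have "(%j. norm (indicator support j *\<^sub>R (cmod (h (j, c j)))\<^sup>2)) = (%j. (cmod (b j))\<^sup>2)"
  by (auto simp: b_def)
 finally obtain f where f: "L2_tendsto M (%n x. \<Sum>j<n. b j * gram_schmidt j x) f"
  using Riesz_Fischer[OF gram_schmidt_orthonormal, of b] by blast
 then have fL: "f \<in> L2_space M" by (simp add: L2_tendsto_def)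
 have "coefficients f (j, c j) = h (j, c j)" if "j \<in> support" for j
  using orthonormal_series_coefficient[OF gram_schmidt_orthonormal f, of j] that
  by (simp add: coefficients_def b_def support_def)
 then have "AE z in spectral_measure. coefficients f z = h z"
  by (subst AE_spectral_measure_eq) auto
 then show "\<exists>f\<in>L2_space M. AE z in spectral_measure. coefficients f z = h z"
  using fL by blast
qed

lemma spectral_representation_exists:
 "spectral_representation M (op_closure M A) spectral_measure coefficients"
proof -
 have "(AE z in spectral_measure. coefficients g z = of_real (snd z) * coefficients f z)
   \<longleftrightarrow> (\<forall>j. L2_inner M g (gram_schmidt j) = of_real (c j) * L2_inner M f (gram_schmidt j))"
  if "f \<in> L2_space M" "g \<in> L2_space M" for f g
  using coefficient_0[OF that(1)] coefficient_0[OF that(2)]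
  by (subst AE_spectral_measure_eq) (auto simp: coefficients_def)
 then show ?thesis
  unfolding spectral_representation_def
  using coefficients_unitary closure_iff by (auto simp: sets_spectral_measure)
qed

text \<open>
 Since \<open>W v\<close> is annihilated by \<open>snd z - t\<close>, it lives where \<open>snd z = t\<close>, and there \<open>\<phi> (snd z)\<close> is the
 constant \<open>\<phi> t\<close>. This holds in every spectral representation, so the choice of one is immaterial.
\<close>

lemma spectral_representation_eigen:
 assumes rep: "spectral_representation M (op_closure M A) \<nu> W"
  and f: "f \<in> L2_space M" and g: "g \<in> L2_space M"
  and Wg: "AE z in \<nu>. W g z = \<phi> (snd z) * W f z" and v: "v \<in> E t"
 shows "L2_inner M g v = \<phi> t * L2_inner M f v"
proof -
 have vL: "v \<in> L2_space M" and tvL: "(%x. of_real t * v x) \<in> L2_space M" using E_L2[OF v] by (auto intro: L2_scale)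
 have uni: "L2_unitary M \<nu> W" and gr: "op_closure M A = {(f, g). f \<in> L2_space M \<and> g \<in> L2_space M \<and>
         (AE z in \<nu>. W g z = of_real (snd z) * W f z)}"
  using rep by (auto simp: spectral_representation_def)
 have W: "\<And>f. f \<in> L2_space M ==> W f \<in> L2_space \<nu>"
  and Wi: "\<And>f g. f \<in> L2_space M ==> g \<in> L2_space M ==> L2_inner \<nu> (W f) (W g) = L2_inner M f g"
  using uni by (auto simp: L2_unitary_def)
 have "(v, %x. of_real t * v x) \<in> op_closure M A"
  unfolding closure_iff using vL tvL inner_gram_schmidt_eigen[OF v] by (auto simp only: L2_inner_scale_left)
 then have 1: "AE z in \<nu>. W (%x. of_real t * v x) z = of_real (snd z) * W v z" by (simp add: gr)
 have "complex_of_real (L2_sq \<nu> (%z. W (%x. of_real t * v x) z - of_real t * W v z)) = 0"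
  by (simp add: L2_inner_self[symmetric] L2_inner_diff_left L2_inner_diff_right L2_diff L2_scale
    W vL tvL L2_inner_scale_left L2_inner_scale_right Wi)
 then have 2: "AE z in \<nu>. W (%x. of_real t * v x) z = of_real t * W v z"
  by (simp add: L2_sq_eq_0 L2_diff L2_scale W vL tvL)
 have 3: "AE z in \<nu>. W g z * cnj (W v z) = \<phi> t * (W f z * cnj (W v z))"
  using 1 2 Wg by eventually_elim auto
 have "L2_inner M g v = L2_inner \<nu> (W g) (W v)" by (simp add: Wi g vL)
 also have "\<dots> = (LINT z|\<nu>. \<phi> t * (W f z * cnj (W v z)))"
  unfolding L2_inner_def
  by (rule integral_cong_AE) (use 3 W[OF f] W[OF g] W[OF vL] in measurable)
 also have "\<dots> = \<phi> t * L2_inner \<nu> (W f) (W v)" by (simp add: L2_inner_def)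
 finally show ?thesis by (simp add: Wi f vL)
qed

theorem functional_calculus_eigen:
 assumes f: "f \<in> L2_space M" and [measurable]: "\<phi> \<in> borel_measurable borel" and \<phi>: "\<And>t. cmod (\<phi> t) \<le> 1"
 defines "g \<equiv> functional_calculus M (op_closure M A) \<phi> f"
 shows "g \<in> L2_space M" and "v \<in> E t ==> L2_inner M g v = \<phi> t * L2_inner M f v"
proof -
 let ?\<nu> = spectral_measure and ?W = coefficients
 have "(%z. \<phi> (snd z)) \<in> borel_measurable (count_space UNIV \<Otimes>\<^sub>M borel)" by measurable
 then have "(%z. \<phi> (snd z)) \<in> borel_measurable ?\<nu>"
  by (simp add: measurable_cong_sets[OF sets_spectral_measure refl])
 then have "(%z. \<phi> (snd z) * ?W f z) \<in> L2_space ?\<nu>"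
  using coefficients_unitary f \<phi> by (intro L2_bounded_mult[where B = 1]) (auto simp: L2_unitary_def)
 then obtain g0 where "g0 \<in> L2_space M" "AE z in ?\<nu>. ?W g0 z = \<phi> (snd z) * ?W f z"
  using coefficients_unitary by (auto simp: L2_unitary_def)
 then have "\<exists>g. g \<in> L2_space M \<and> (\<exists>\<nu> W. spectral_representation M (op_closure M A) \<nu> W \<and>
        (AE z in \<nu>. W g z = \<phi> (snd z) * W f z))"
  using spectral_representation_exists by blast
 from someI_ex[OF this] have "g \<in> L2_space M \<and> (\<exists>\<nu> W. spectral_representation M (op_closure M A) \<nu> W \<and>
        (AE z in \<nu>. W g z = \<phi> (snd z) * W f z))"
  unfolding g_def functional_calculus_def .
 then show "g \<in> L2_space M" "v \<in> E t ==> L2_inner M g v = \<phi> t * L2_inner M f v"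
  using spectral_representation_eigen[OF _ f] by blast+
qed

end

section \<open>Moments\<close>

lemma measure_eqI_atMost:
 fixes M N :: "real measure"
 assumes sets: "sets M = sets borel" "sets N = sets borel"
  and eq: "\<And>T. emeasure M {..T} = emeasure N {..T}" and fin: "\<And>T. emeasure M {..T} \<noteq> \<infinity>"
 shows "M = N"
proof (rule measure_eqI_generator_eq[where E = "range atMost" and \<Omega> = UNIV and A = "%n. {..real n}"])
 show "Int_stable (range (atMost :: real => _))"
  by (auto simp: Int_stable_def)
 show "sets M = sigma_sets UNIV (range atMost)" "sets N = sigma_sets UNIV (range atMost)"
  using sets by (simp_all add: borel_eq_atMost)
 show "(\<Union>n. {..real n}) = UNIV" by (auto simp: real_arch_simple)
qed (use eq fin in auto)

lemma power_le_exp: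
 fixes t :: real assumes "0 \<le> t" shows "t ^ n \<le> fact n * exp t"
proof -
 have "(\<Sum>i\<in>{n}. t ^ i /\<^sub>R fact i) \<le> (\<Sum>i. t ^ i /\<^sub>R fact i)"
  by (rule sum_le_suminf[OF summable_exp_generic]) (use assms in auto)
 then show ?thesis by (simp add: exp_def field_simps)
qed

lemma power_exp_bound:
 fixes c t :: real assumes "0 < c" "0 \<le> t" shows "t ^ n * exp (c * t) \<le> fact n / c ^ n * exp (2 * c * t)"
proof -
 have "(c * t) ^ n \<le> fact n * exp (c * t)" using assms by (intro power_le_exp) auto
 then have "t ^ n \<le> fact n / c ^ n * exp (c * t)" using assms by (simp add: power_mult_distrib field_simps)
 then have "t ^ n * exp (c * t) \<le> fact n / c ^ n * exp (c * t) * exp (c * t)" by (rule mult_right_mono) simp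
 then show ?thesis by (simp add: exp_add[symmetric] mult.assoc)
qed

text \<open>
 Exponential integrability lets the Laplace transform of \<open>G\<close> be expanded in a power series
 with a radius of convergence that does not depend on the centre. So vanishing of the moments
 spreads from \<open>0\<close> along the half-line in steps of fixed length \<open>\<delta> / 2\<close>.
\<close>

lemma moments_zero_Laplace:
 fixes G :: "'a => complex" and \<tau> :: "'a => real"
 assumes [measurable]: "G \<in> borel_measurable M" "\<tau> \<in> borel_measurable M"
  and \<tau>: "\<And>x. 0 \<le> \<tau> x" and c: "0 < c"
  and int: "integrable M (%x. exp (2 * c * \<tau> x) * cmod (G x))"
  and mom: "\<And>n. (LINT x|M. of_real (\<tau> x ^ n) * G x) = 0"
 shows "(LINT x|M. of_real (\<tau> x ^ n * exp (- (real k * c * \<tau> x))) * G x) = 0"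
proof (induction k arbitrary: n)
 case 0 then show ?case using mom by simp
next
 case (Suc k)
 have dom: "integrable M (%x. \<tau> x ^ n * exp (c * \<tau> x) * cmod (G x))" for n
 proof (rule integrable_dominated)
  show "integrable M (%x. fact n / c ^ n * (exp (2 * c * \<tau> x) * cmod (G x)))" using int by simp
  show "AE x in M. norm (\<tau> x ^ n * exp (c * \<tau> x) * cmod (G x)) \<le> norm (fact n / c ^ n * (exp (2 * c * \<tau> x) * cmod (G x)))"
  proof (rule AE_I2)
   fix x
   have "\<tau> x ^ n * exp (c * \<tau> x) * cmod (G x) \<le> fact n / c ^ n * exp (2 * c * \<tau> x) * cmod (G x)"
    using power_exp_bound[OF c \<tau>] by (intro mult_right_mono) auto
   then show "norm (\<tau> x ^ n * exp (c * \<tau> x) * cmod (G x)) \<le> norm (fact n / c ^ n * (exp (2 * c * \<tau> x) * cmod (G x)))"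
    using c \<tau>[of x] by (simp add: abs_mult mult.assoc)
  qed
 qed measurable
 have exp_le: "exp (- (real k * c * \<tau> x)) \<le> 1" for x using c \<tau>[of x] by simp
 have exp_le1: "exp (- (real k * c * \<tau> x)) \<le> exp (c * \<tau> x)" for x
  using c \<tau>[of x] by (simp add: field_simps) (meson add_nonneg_nonneg mult_nonneg_nonneg of_nat_0_le_iff less_imp_le order_trans neg_le_0_iff_le)
 have intk: "integrable M (%x. of_real (\<tau> x ^ n * exp (- (real k * c * \<tau> x))) * G x)" for n
 proof (rule integrable_dominated[OF dom[of n]])
  show "AE x in M. norm (of_real (\<tau> x ^ n * exp (- (real k * c * \<tau> x))) * G x) \<le> norm (\<tau> x ^ n * exp (c * \<tau> x) * cmod (G x))"
   using exp_le1 \<tau> by (intro AE_I2) (auto simp: norm_mult norm_power abs_mult simp del: of_real_mult intro!: mult_right_mono mult_left_mono)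
 qed measurable
 define S where "S N x = of_real (\<Sum>i<N. (- (c * \<tau> x)) ^ i /\<^sub>R fact i) * (of_real (\<tau> x ^ n * exp (- (real k * c * \<tau> x))) * G x)" for N x
 have S_eq: "S N = (%x. \<Sum>i<N. of_real ((- c) ^ i / fact i) * (of_real (\<tau> x ^ (n + i) * exp (- (real k * c * \<tau> x))) * G x))" for N
 proof (rule ext)
  fix x
  have "(- (c * \<tau> x)) ^ i /\<^sub>R fact i * (\<tau> x ^ n * e) = (- c) ^ i / fact i * (\<tau> x ^ (n + i) * e)" for i e
   by (simp add: power_add divide_inverse mult_ac flip: power_mult_distrib)
  then show "S N x = (\<Sum>i<N. of_real ((- c) ^ i / fact i) * (of_real (\<tau> x ^ (n + i) * exp (- (real k * c * \<tau> x))) * G x))"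
   unfolding S_def of_real_sum sum_distrib_right mult.assoc[symmetric] of_real_mult[symmetric] by (simp only: mult.assoc)
 qed
 have "(LINT x|M. S N x) = (\<Sum>i<N. of_real ((- c) ^ i / fact i) * (LINT x|M. of_real (\<tau> x ^ (n + i) * exp (- (real k * c * \<tau> x))) * G x))" for N
  unfolding S_eq using intk by (subst Bochner_Integration.integral_sum) (auto simp del: of_real_mult)
 then have S0: "(LINT x|M. S N x) = 0" for N using Suc.IH by simp
 have "(%N. LINT x|M. S N x) \<longlonglongrightarrow> (LINT x|M. of_real (exp (- (c * \<tau> x))) * (of_real (\<tau> x ^ n * exp (- (real k * c * \<tau> x))) * G x))"
 proof (rule integral_dominated_convergence[where w = "%x. \<tau> x ^ n * exp (c * \<tau> x) * cmod (G x)"])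
  show "AE x in M. (%N. S N x) \<longlonglongrightarrow> of_real (exp (- (c * \<tau> x))) * (of_real (\<tau> x ^ n * exp (- (real k * c * \<tau> x))) * G x)"
   unfolding S_def using exp_converges[of "- (c * \<tau> _)"] by (intro AE_I2 tendsto_mult_right tendsto_of_real) (simp add: sums_def)
  fix N
  show "AE x in M. norm (S N x) \<le> \<tau> x ^ n * exp (c * \<tau> x) * cmod (G x)"
  proof (rule AE_I2)
   fix x
   have "\<bar>\<Sum>i<N. (- (c * \<tau> x)) ^ i /\<^sub>R fact i\<bar> \<le> (\<Sum>i<N. (c * \<tau> x) ^ i /\<^sub>R fact i)"
    using c \<tau>[of x] by (intro order_trans[OF sum_abs] sum_mono) (simp add: power_abs abs_mult)
   also have "\<dots> \<le> exp (c * \<tau> x)"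
    unfolding exp_def using c \<tau>[of x] by (intro sum_le_suminf summable_exp_generic) auto
   finally have 1: "\<bar>\<Sum>i<N. (- (c * \<tau> x)) ^ i /\<^sub>R fact i\<bar> \<le> exp (c * \<tau> x)" .
   have "norm (S N x) = \<bar>\<Sum>i<N. (- (c * \<tau> x)) ^ i /\<^sub>R fact i\<bar> * (\<tau> x ^ n * exp (- (real k * c * \<tau> x)) * cmod (G x))"
    unfolding S_def norm_mult norm_of_real using \<tau>[of x] by (simp add: abs_mult)
   also have "\<dots> \<le> exp (c * \<tau> x) * (\<tau> x ^ n * 1 * cmod (G x))"
    using 1 exp_le[of x] \<tau>[of x] by (intro mult_mono) auto
   finally show "norm (S N x) \<le> \<tau> x ^ n * exp (c * \<tau> x) * cmod (G x)" by (simp add: mult_ac)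
  qed
 qed (use dom in \<open>auto simp: S_def\<close>)
 then have "(LINT x|M. of_real (exp (- (c * \<tau> x))) * (of_real (\<tau> x ^ n * exp (- (real k * c * \<tau> x))) * G x)) = 0"
  by (simp only: S0 LIMSEQ_const_iff)
 moreover have "exp (- (c * t)) * (t ^ n * exp (- (real k * c * t))) = t ^ n * exp (- (real (Suc k) * c * t))" for t
  by (simp add: algebra_simps flip: exp_add)
 ultimately show ?case by (simp only: mult.assoc[symmetric] of_real_mult[symmetric])
qed

text \<open>
 Polynomials are dense in the continuous functions on a compact set, indicators of closed sets
 are limits of continuous functions, and closed sets generate the Borel sets.
\<close>

theorem polynomials_determine_image:
 fixes F :: "'a => complex" and y :: "'a => 'b::euclidean_space" and g :: "'b => complex"
 assumes F: "integrable M F" and [measurable]: "y \<in> borel_measurable M"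
  and K: "compact K" "\<And>x. F x \<noteq> 0 ==> y x \<in> K"
  and zero: "\<And>q. real_polynomial_function q ==> (LINT x|M. of_real (q (y x)) * F x) = 0"
  and [measurable]: "g \<in> borel_measurable borel" and g: "\<And>t. cmod (g t) \<le> B"
 shows "(LINT x|M. g (y x) * F x) = 0"
proof -
 have [measurable]: "F \<in> borel_measurable M" using F by auto
 have int: "integrable M (%x. h (y x) * F x)"
  if [measurable]: "h \<in> borel_measurable borel" and h: "\<And>t. t \<in> K ==> cmod (h t) \<le> C" for h C
 proof (rule integrable_dominated)
  show "integrable M (%x. C * cmod (F x))" using F by simp
  have "cmod (h (y x)) * cmod (F x) \<le> \<bar>C\<bar> * cmod (F x)" for x
   using h[of "y x"] K(2)[of x] by (cases "F x = 0") (auto intro!: mult_right_mono)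
  then show "AE x in M. norm (h (y x) * F x) \<le> norm (C * cmod (F x))" by (simp add: norm_mult abs_mult)
 qed measurable
 have intc: "integrable M (%x. of_real (h (y x)) * F x)" if h: "continuous_on UNIV h" for h :: "'b => real"
 proof -
  have "bounded (h ` K)" using K h by (intro compact_imp_bounded compact_continuous_image) (auto intro: continuous_on_subset)
  then obtain C where "\<And>t. t \<in> K ==> \<bar>h t\<bar> \<le> C" by (auto simp: bounded_iff)
  moreover have "h \<in> borel_measurable borel" using h by (rule borel_measurable_continuous_onI)
  ultimately show ?thesis using int[of "%t. of_real (h t)" C] by simp
 qed
 let ?I = "LINT x|M. cmod (F x)"
 have I: "0 \<le> ?I" by simp
 have cont: "(LINT x|M. of_real (h (y x)) * F x) = 0" if h: "continuous_on UNIV h" for h :: "'b => real"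
 proof -
  have le: "cmod (LINT x|M. of_real (h (y x)) * F x) \<le> e * ?I" if e: "0 < e" for e
  proof -
   obtain q where q: "real_polynomial_function q" "\<And>t. t \<in> K ==> \<bar>h t - q t\<bar> < e"
    using Stone_Weierstrass_real_polynomial_function[OF K(1) _ e, of h] continuous_on_subset[OF h] by blast
   have qc: "continuous_on UNIV q"
    using q(1) by (simp add: continuous_on_polymonial_function real_polynomial_function_eq)
   let ?d = "%x. of_real (h (y x)) * F x - of_real (q (y x)) * F x"
   have "(LINT x|M. of_real (h (y x)) * F x) = (LINT x|M. ?d x)"
    by (subst Bochner_Integration.integral_diff) (auto simp: zero[OF q(1)] intro!: intc h qc)
   also have "cmod \<dots> \<le> (LINT x|M. e * cmod (F x))"
   proof (rule order_trans[OF integral_norm_bound], rule integral_mono)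
    show "integrable M (%x. cmod (?d x))" by (intro integrable_norm Bochner_Integration.integrable_diff intc h qc)
    have "cmod (?d x) = \<bar>h (y x) - q (y x)\<bar> * cmod (F x)" for x
     unfolding left_diff_distrib[symmetric] of_real_diff[symmetric] norm_mult norm_of_real ..
    then show "cmod (?d x) \<le> e * cmod (F x)" for x
     using q(2)[of "y x"] K(2)[of x] by (cases "F x = 0") (auto intro!: mult_right_mono)
   qed (use F in simp)
   finally show ?thesis by simp
  qed
  have "cmod (LINT x|M. of_real (h (y x)) * F x) \<le> 0 + e" if "0 < e" for e
  proof -
   have "cmod (LINT x|M. of_real (h (y x)) * F x) \<le> e / (?I + 1) * ?I" using that I by (intro le divide_pos_pos add_nonneg_pos) auto
   also have "\<dots> \<le> e / (?I + 1) * (?I + 1)" using that I by (intro mult_left_mono) auto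
   also have "\<dots> = e" using add_nonneg_pos[OF I zero_less_one] by simp
   finally show ?thesis by simp
  qed
  then have "cmod (LINT x|M. of_real (h (y x)) * F x) \<le> 0" by (rule field_le_epsilon)
  then show ?thesis by simp
 qed
 let ?J = "%A x. of_real (indicator A (y x)) * F x"
 have Jint: "integrable M (?J A)" if [measurable]: "A \<in> sets borel" for A
  by (rule int[where h = "%t. of_real (indicator A t)" and C = 1]) (auto simp: indicator_def)
 have closed: "(LINT x|M. ?J C x) = 0" if C: "closed C" for C
 proof (cases "C = {}")
  case False
  have [measurable]: "C \<in> sets borel" using C by simp
  let ?h = "%n t. max 0 (1 - real n * infdist t C)"
  have hc: "continuous_on UNIV (?h n)" for n by (intro continuous_intros)
  then have [measurable]: "?h n \<in> borel_measurable borel" for n by (rule borel_measurable_continuous_onI)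
  have "(%n. LINT x|M. of_real (?h n (y x)) * F x) \<longlonglongrightarrow> (LINT x|M. ?J C x)"
  proof (rule integral_dominated_convergence[where w = "%x. cmod (F x)"])
   have "(%n. ?h n t) \<longlonglongrightarrow> indicator C t" for t
   proof (cases "t \<in> C")
    case False
    then have d: "0 < infdist t C" using C \<open>C \<noteq> {}\<close> infdist_pos_not_in_closed by blast
    obtain n0 where "1 / infdist t C < real n0" using reals_Archimedean2 by blast
    then have n0: "1 < real n0 * infdist t C" using d by (simp add: field_simps)
    have "?h n t = 0" if "n0 \<le> n" for n
    proof -
     have "real n0 * infdist t C \<le> real n * infdist t C" using that d by (intro mult_right_mono) auto
     then show ?thesis using n0 by simp
    qed
    then have "\<forall>\<^sub>F n in sequentially. ?h n t = 0" unfolding eventually_sequentially by blast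
    then show ?thesis using False by (simp add: tendsto_eventually)
   qed simp
   then show "AE x in M. (%n. of_real (?h n (y x)) * F x) \<longlonglongrightarrow> ?J C x"
    by (intro AE_I2 tendsto_mult_right tendsto_of_real)
   have "\<bar>?h n t\<bar> \<le> 1" for n t by (simp add: infdist_nonneg)
   then show "AE x in M. norm (of_real (?h n (y x)) * F x) \<le> cmod (F x)" for n
    by (intro AE_I2) (simp add: norm_mult mult_left_le_one_le)
  qed (use F in simp_all)
  then show ?thesis unfolding cont[OF hc] by (simp only: LIMSEQ_const_iff)
 qed simp
 have sets: "(LINT x|M. ?J A x) = 0" if "A \<in> sets borel" for A
 proof -
  have "Int_stable (Collect closed :: 'b set set)" by (auto simp: Int_stable_def)
  moreover have "Collect closed \<subseteq> Pow (UNIV :: 'b set)" by auto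
  moreover have "A \<in> sigma_sets UNIV (Collect closed)" using that by (simp add: borel_eq_closed)
  ultimately show ?thesis
  proof (induct rule: sigma_sets_induct_disjoint)
   case (compl A)
   then have A: "A \<in> sets borel" by (simp add: borel_eq_closed)
   have "?J (UNIV - A) x = F x - ?J A x" for x by (simp add: indicator_def)
   then show ?case using compl closed[of UNIV] F Jint[OF A] by simp
  next
   case (union A)
   then have A: "A i \<in> sets borel" for i by (auto simp: borel_eq_closed)
   let ?S = "%i. y -` A i \<inter> space M"
   have J: "(LINT x|M. ?J B x) = (LINT x:(y -` B \<inter> space M)|M. F x)" for B
    unfolding set_lebesgue_integral_def
    by (intro Bochner_Integration.integral_cong refl) (auto simp: indicator_def)
   have U: "y -` (\<Union>i. A i) \<inter> space M = (\<Union>i. ?S i)" by auto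
   have S: "?S i \<in> sets M" for i using A[of i] by measurable
   then have "(\<Union>i. ?S i) \<in> sets M" by (intro sets.countable_nat_UN) blast
   then have "set_integrable M (\<Union>i. ?S i) F"
    unfolding set_integrable_def by (rule integrable_mult_indicator[OF _ F])
   then have "(LINT x:(\<Union>i. ?S i)|M. F x) = (\<Sum>i. (LINT x:(?S i)|M. F x))"
    using S union(1) by (intro lebesgue_integral_countable_add) (auto simp: disjoint_family_on_def)
   then show ?case unfolding J U using union(3) by (simp add: J)
  qed (use closed in simp_all)
 qed
 obtain s where s: "\<And>i. simple_function borel (s i)" "\<And>t. (%i. s i t) \<longlonglongrightarrow> g t" "\<And>i t. cmod (s i t) \<le> 2 * cmod (g t)"
  using borel_measurable_implies_sequence_metric[of g borel 0] by (auto simp: dist_norm)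
 have sm [measurable]: "s i \<in> borel_measurable borel" for i using s(1) by (rule borel_measurable_simple_function)
 have "(%i. LINT x|M. s i (y x) * F x) \<longlonglongrightarrow> (LINT x|M. g (y x) * F x)"
 proof (rule integral_dominated_convergence[where w = "%x. 2 * B * cmod (F x)"])
  show "AE x in M. (%i. s i (y x) * F x) \<longlonglongrightarrow> g (y x) * F x" by (intro AE_I2 tendsto_mult_right s)
  have "cmod (s i t) \<le> 2 * B" for i t using s(3)[of i t] g[of t] by linarith
  then show "AE x in M. norm (s i (y x) * F x) \<le> 2 * B * cmod (F x)" for i
   by (intro AE_I2) (simp add: norm_mult mult_right_mono)
 qed (use F in simp_all)
 moreover have "(LINT x|M. s i (y x) * F x) = 0" for i
 proof -
  have fin: "finite (range (s i))" using s(1)[of i] by (simp add: simple_function_def)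
  have A: "s i -` {c} \<in> sets borel" for c using measurable_sets_borel[OF sm[of i], of "{c}"] by simp
  have "s i (y x) * F x = (\<Sum>c\<in>range (s i). c * ?J (s i -` {c}) x)" for x
  proof -
   have "(\<Sum>c\<in>range (s i). c * ?J (s i -` {c}) x) = (\<Sum>c\<in>range (s i). if c = s i (y x) then c * F x else 0)"
    by (intro sum.cong refl) (auto simp: indicator_def)
   then show ?thesis using fin by simp
  qed
  then have "(LINT x|M. s i (y x) * F x) = (\<Sum>c\<in>range (s i). LINT x|M. c * ?J (s i -` {c}) x)"
   using Jint[OF A] by (simp add: Bochner_Integration.integral_sum)
  then show ?thesis by (simp add: sets[OF A])
 qed
 ultimately show ?thesis by (simp add: LIMSEQ_const_iff)
qed

text \<open>
 The theorem on uniqueness of moments (for densities of exponential decay) that underlies the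
 completeness of the Laguerre functions.
\<close>

theorem moments_determine:
 fixes G :: "'a => complex" and \<tau> :: "'a => real"
 assumes [measurable]: "G \<in> borel_measurable M" "\<tau> \<in> borel_measurable M"
  and \<tau>: "\<And>x. 0 \<le> \<tau> x" and \<delta>: "0 < \<delta>"
  and int: "integrable M (%x. exp (\<delta> * \<tau> x) * cmod (G x))"
  and mom: "\<And>n. (LINT x|M. of_real (\<tau> x ^ n) * G x) = 0"
  and int_mom: "\<And>n. integrable M (%x. of_real (\<tau> x ^ n) * G x)"
  and [measurable]: "g \<in> borel_measurable borel" and g: "\<And>t. cmod (g t) \<le> B"
 shows "(LINT x|M. g (\<tau> x) * G x) = 0"
proof -
 define c where "c = \<delta> / 2"
 have c: "0 < c" and int': "integrable M (%x. exp (2 * c * \<tau> x) * cmod (G x))" using \<delta> int by (auto simp: c_def)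
 define y where "y x = exp (- (c * \<tau> x))" for x
 have [measurable]: "y \<in> borel_measurable M" unfolding y_def by measurable
 have y01: "y x \<in> {0..1}" for x unfolding y_def using c \<tau>[of x] by simp
 have G: "integrable M G" using int_mom[of 0] by simp
 have powers: "(LINT x|M. of_real (y x ^ i) * G x) = 0" for i
  using moments_zero_Laplace[OF _ _ \<tau> c int' mom, of 0 i] unfolding y_def by (simp add: exp_of_nat_mult[symmetric] mult.assoc)
 have int_pow: "integrable M (%x. of_real (y x ^ i) * G x)" for i
 proof (rule integrable_dominated[OF G])
  have "\<bar>y x\<bar> ^ i \<le> 1" for x using y01[of x] by (simp add: power_le_one)
  then show "AE x in M. norm (of_real (y x ^ i) * G x) \<le> norm (G x)"
   by (intro AE_I2) (simp add: norm_mult norm_power mult_left_le_one_le)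
 qed measurable
 have "(LINT x|M. g (- ln (y x) / c) * G x) = 0"
 proof (rule polynomials_determine_image[OF G _ compact_Icc[of 0 1] y01])
  fix q :: "real => real" assume "real_polynomial_function q"
  then obtain b n where q: "q = (%t. \<Sum>i\<le>n. b i * t ^ i)" by (auto simp: real_polynomial_function_iff_sum)
  have "of_real (q (y x)) * G x = (\<Sum>i\<le>n. of_real (b i) * (of_real (y x ^ i) * G x))" for x
   unfolding q of_real_sum sum_distrib_right by (simp add: mult.assoc)
  then have "(LINT x|M. of_real (q (y x)) * G x) = (\<Sum>i\<le>n. of_real (b i) * (LINT x|M. of_real (y x ^ i) * G x))"
   using int_pow by (simp add: Bochner_Integration.integral_sum del: of_real_power)
  then show "(LINT x|M. of_real (q (y x)) * G x) = 0" by (simp only: powers mult_zero_right sum.neutral_const)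
 qed (use g in auto)
 then show ?thesis using c by (simp add: y_def)
qed

section \<open>Polar coordinates for homogeneous weights\<close>

lemma cball_in_sets_borel [measurable]: "cball x r \<in> sets borel"
 by (rule borel_closed[OF closed_cball])

lemma nn_integral_powr_atMost:
 fixes c :: real assumes "0 < c" "0 \<le> K"
 shows "(\<integral>\<^sup>+r. ennreal (K * (c * r powr (c - 1))) * indicator {0<..} r * indicator {..T} r \<partial>lborel)
  = ennreal (K * max 0 T powr c)"
proof -
 have "((%r. K * (c * r powr (c - 1))) has_integral K * (c * (max 0 T powr ((c - 1) + 1) / ((c - 1) + 1)))) {0..max 0 T}"
  using assms by (intro has_integral_mult_right has_integral_powr_from_0) auto
 then have "(\<integral>\<^sup>+r. ennreal (K * (c * r powr (c - 1))) * indicator {0..max 0 T} r \<partial>lborel) = ennreal (K * max 0 T powr c)"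
  using assms by (subst nn_integral_has_integral_lebesgue') auto
 also have "(\<integral>\<^sup>+r. ennreal (K * (c * r powr (c - 1))) * indicator {0..max 0 T} r \<partial>lborel)
   = (\<integral>\<^sup>+r. ennreal (K * (c * r powr (c - 1))) * indicator {0<..} r * indicator {..T} r \<partial>lborel)"
  by (rule nn_integral_cong) (auto simp: indicator_def not_less max_def split: if_splits)
 finally show ?thesis .
qed

text \<open>A measure on the half-line that scales like a power is a power of the variable times \<open>dr\<close>.\<close>

lemma power_measure_eqI:
 fixes c :: real
 assumes "sets \<mu> = sets borel" "0 < c" "0 \<le> K"
  and em: "\<And>T. emeasure \<mu> {..T} = ennreal (K * max 0 T powr c)"
 shows "\<mu> = density lborel (%r. ennreal (K * (c * r powr (c - 1))) * indicator {0<..} r)"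
proof (rule measure_eqI_atMost)
 fix T
 show "emeasure \<mu> {..T} = emeasure (density lborel (%r. ennreal (K * (c * r powr (c - 1))) * indicator {0<..} r)) {..T}"
  unfolding em by (subst emeasure_density) (auto simp: nn_integral_powr_atMost assms)
qed (use assms em in auto)

lemma nn_integral_lborel_scale:
 fixes f :: "'a::euclidean_space => ennreal"
 assumes [measurable]: "f \<in> borel_measurable borel" and "0 < T"
 shows "(\<integral>\<^sup>+x. f x \<partial>lborel) = ennreal (T ^ DIM('a)) * (\<integral>\<^sup>+x. f (T *\<^sub>R x) \<partial>lborel)"
 using assms(2)
 by (subst lborel_affine[of T "0 :: 'a"])
  (auto simp: nn_integral_density nn_integral_distr nn_integral_cmult)

text \<open>
 By homogeneity the mass of a ball is a constant times a power of its radius.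
\<close>

lemma homogeneous_norm_distr:
 fixes V :: "'a::euclidean_space => real"
 assumes [measurable]: "V \<in> borel_measurable borel" and V0: "\<And>x. 0 \<le> V x" and e: "0 \<le> e"
  and hom: "\<And>t x. 0 < t ==> V (t *\<^sub>R x) = t powr e * V x"
  and B: "\<And>x. norm x \<le> 1 ==> V x \<le> B"
 shows "distr (density lborel (%x. ennreal (V x))) borel norm
  = density lborel (%r. ennreal ((LINT x:cball 0 1|lborel. V x) * ((e + real DIM('a)) * r powr (e + real DIM('a) - 1))) * indicator {0<..} r)"
proof (rule power_measure_eqI)
 let ?d = "e + real DIM('a)"
 show "0 < ?d" using e by (simp add: add_nonneg_pos)
 have Lint: "set_integrable lborel (cball 0 1) V"
 proof (rule set_integrable_bound[where f = "%x. B"])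
  show "set_integrable lborel (cball (0::'a) 1) (%x. B)"
   unfolding set_integrable_def using emeasure_bounded_finite[OF bounded_cball[of "0::'a" 1]]
    by (intro integrable_scaleR_left integrable_real_indicator) auto
  show "AE x in lborel. x \<in> cball 0 1 \<longrightarrow> norm (V x) \<le> norm B"
   using B V0 by (intro AE_I2 impI) (auto intro: order_trans[OF _ abs_ge_self])
 qed (simp add: set_borel_measurable_def)
 show "0 \<le> (LINT x:cball 0 1|lborel. V x)"
  unfolding set_lebesgue_integral_def using V0 by (intro integral_nonneg_AE) auto
 have ball: "(\<integral>\<^sup>+x. ennreal (V x) * indicator (cball 0 1) x \<partial>lborel) = ennreal (LINT x:cball 0 1|lborel. V x)"
 proof -
  have "(\<integral>\<^sup>+x. ennreal (V x) * indicator (cball 0 1) x \<partial>lborel) = (\<integral>\<^sup>+x. ennreal (indicator (cball 0 1) x *\<^sub>R V x) \<partial>lborel)"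
   by (rule nn_integral_cong) (auto simp: indicator_def)
  also have "\<dots> = ennreal (LINT x:cball 0 1|lborel. V x)"
   unfolding set_lebesgue_integral_def using Lint V0
   by (intro nn_integral_eq_integral) (auto simp: set_integrable_def)
  finally show ?thesis .
 qed
 fix T
 have "emeasure (distr (density lborel (%x. ennreal (V x))) borel norm) {..T}
   = (\<integral>\<^sup>+x. ennreal (V x) * indicator {x. norm x \<le> T} x \<partial>lborel)"
  by (subst emeasure_distr, measurable) (simp add: emeasure_density vimage_def)
 also have "\<dots> = ennreal ((LINT x:cball 0 1|lborel. V x) * max 0 T powr ?d)"
 proof (cases "0 < T")
  case True
  have "(\<integral>\<^sup>+x. ennreal (V x) * indicator {x. norm x \<le> T} x \<partial>lborel)
    = ennreal (T ^ DIM('a)) * (\<integral>\<^sup>+x. ennreal (V (T *\<^sub>R x)) * indicator {x. norm x \<le> T} (T *\<^sub>R x) \<partial>lborel)"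
   using True by (subst nn_integral_lborel_scale[of _ T]) auto
  also have "(\<integral>\<^sup>+x. ennreal (V (T *\<^sub>R x)) * indicator {x. norm x \<le> T} (T *\<^sub>R x) \<partial>lborel)
    = (\<integral>\<^sup>+x. ennreal (T powr e) * (ennreal (V x) * indicator (cball 0 1) x) \<partial>lborel)"
   using True V0 by (intro nn_integral_cong) (auto simp: hom indicator_def ennreal_mult)
  also have "\<dots> = ennreal (T powr e) * ennreal (LINT x:cball 0 1|lborel. V x)"
   by (subst nn_integral_cmult) (auto simp: ball)
  also have "ennreal (T ^ DIM('a)) * (ennreal (T powr e) * ennreal (LINT x:cball 0 1|lborel. V x))
    = ennreal ((LINT x:cball 0 1|lborel. V x) * T powr ?d)"
   using True \<open>0 \<le> (LINT x:cball 0 1|lborel. V x)\<close>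
   by (simp add: powr_add powr_realpow ennreal_mult[symmetric] mult_ac)
  finally show ?thesis using True by simp
 next
  case False
  have "(\<integral>\<^sup>+x. ennreal (V x) * indicator {x. norm x \<le> T} x \<partial>lborel) = (\<integral>\<^sup>+x. 0 \<partial>(lborel :: 'a measure))"
  proof (rule nn_integral_cong_AE)
   have "AE x in (lborel :: 'a measure). x \<noteq> 0" by (rule AE_lborel_singleton)
   then show "AE x in (lborel :: 'a measure). ennreal (V x) * indicator {x. norm x \<le> T} x = 0"
   proof eventually_elim
    case (elim x)
    then have "\<not> norm x \<le> T" using False by (metis norm_le_zero_iff not_less order_trans)
    then show ?case by simp
   qed
  qed
  then show ?thesis using False by simp
 qed
 finally show "emeasure (distr (density lborel (%x. ennreal (V x))) borel norm) {..T}
   = ennreal ((LINT x:cball 0 1|lborel. V x) * max 0 T powr ?d)" .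
qed simp

lemma nn_integral_polar:
 fixes V :: "'a::euclidean_space => real" and g :: "real => ennreal"
 assumes [measurable]: "V \<in> borel_measurable borel" and V0: "\<And>x. 0 \<le> V x" and e: "0 \<le> e"
  and hom: "\<And>t x. 0 < t ==> V (t *\<^sub>R x) = t powr e * V x"
  and B: "\<And>x. norm x \<le> 1 ==> V x \<le> B" and [measurable]: "g \<in> borel_measurable borel"
 shows "(\<integral>\<^sup>+x. g (norm x) * ennreal (V x) \<partial>lborel)
  = ennreal ((e + real DIM('a)) * (LINT x:cball 0 1|lborel. V x)) *
   (\<integral>\<^sup>+r. g r * ennreal (r powr (e + real DIM('a) - 1)) * indicator {0<..} r \<partial>lborel)"
proof -
 let ?d = "e + real DIM('a)" and ?C = "LINT x:cball 0 1|lborel. V x"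
 have C: "0 \<le> ?C" unfolding set_lebesgue_integral_def using V0 by (intro integral_nonneg_AE) auto
 note D = homogeneous_norm_distr[OF assms(1) V0 e hom B]
 have "(\<integral>\<^sup>+x. g (norm x) * ennreal (V x) \<partial>lborel) = (\<integral>\<^sup>+r. g r \<partial>distr (density lborel (%x. ennreal (V x))) borel norm)"
  by (simp add: nn_integral_distr nn_integral_density mult.commute)
 also have "\<dots> = (\<integral>\<^sup>+r. ennreal (?C * (?d * r powr (?d - 1))) * indicator {0<..} r * g r \<partial>lborel)"
  by (subst D) (auto simp: nn_integral_density)
 also have "\<dots> = (\<integral>\<^sup>+r. ennreal (?d * ?C) * (g r * ennreal (r powr (?d - 1)) * indicator {0<..} r) \<partial>lborel)"
  using C e by (intro nn_integral_cong) (simp add: ennreal_mult[symmetric] mult_ac)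
 finally show ?thesis by (simp add: nn_integral_cmult)
qed

lemma integral_polar_nonneg:
 fixes V :: "'a::euclidean_space => real" and g :: "real => complex"
 assumes [measurable]: "V \<in> borel_measurable borel" and V0: "\<And>x. 0 \<le> V x" and e: "0 \<le> e"
  and hom: "\<And>t x. 0 < t ==> V (t *\<^sub>R x) = t powr e * V x"
  and B: "\<And>x. norm x \<le> 1 ==> V x \<le> B" and [measurable]: "g \<in> borel_measurable borel"
 shows "(LINT x|lborel. g (norm x) * of_real (V x))
  = of_real ((e + real DIM('a)) * (LINT x:cball 0 1|lborel. V x)) *
   (LINT r:{0<..}|lborel. g r * of_real (r powr (e + real DIM('a) - 1)))"
proof -
 let ?d = "e + real DIM('a)" and ?C = "LINT x:cball 0 1|lborel. V x"
 have C: "0 \<le> ?C" unfolding set_lebesgue_integral_def using V0 by (intro integral_nonneg_AE) auto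
 have "(LINT x|lborel. g (norm x) * of_real (V x)) = (LINT x|density lborel (%x. ennreal (V x)). g (norm x))"
  by (subst integral_density) (auto simp: V0 scaleR_conv_of_real mult.commute)
 also have "\<dots> = (LINT r|distr (density lborel (%x. ennreal (V x))) borel norm. g r)"
  by (subst integral_distr) auto
 also have "\<dots> = (LINT r|density lborel (%r. ennreal (?C * (?d * r powr (?d - 1)) * indicator {0<..} r)). g r)"
  using e hom B by (subst homogeneous_norm_distr[OF assms(1) V0, of e B])
   (auto simp: indicator_def intro!: arg_cong[where f = "%N. integral\<^sup>L N g"] density_cong)
 also have "\<dots> = (LINT r|lborel. of_real (?d * ?C) * (indicator {0<..} r *\<^sub>R (g r * of_real (r powr (?d - 1)))))"
  using C e by (subst integral_density) (auto simp: scaleR_conv_of_real indicator_def mult_ac intro!: Bochner_Integration.integral_cong)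
 finally show ?thesis by (simp only: set_lebesgue_integral_def integral_mult_right_zero)
qed

text \<open>
 The real and imaginary parts of \<open>V\<close> are split by sign. If the radial factor is not integrable on the
 half-line, then \<open>V\<close> vanishes almost everywhere and both sides are \<open>0\<close>.
\<close>

theorem integral_polar:
 fixes V :: "'a::euclidean_space => complex" and g :: "real => complex"
 assumes [measurable]: "V \<in> borel_measurable borel" and e: "0 \<le> e"
  and hom: "\<And>t x. 0 < t ==> V (t *\<^sub>R x) = of_real (t powr e) * V x"
  and B: "\<And>x. norm x \<le> 1 ==> cmod (V x) \<le> B" and [measurable]: "g \<in> borel_measurable borel"
  and int: "integrable lborel (%x. g (norm x) * V x)"
 shows "(LINT x|lborel. g (norm x) * V x)
  = of_real (e + real DIM('a)) * (LINT x:cball 0 1|lborel. V x) *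
   (LINT r:{0<..}|lborel. g r * of_real (r powr (e + real DIM('a) - 1)))"
proof -
 define I where "I = (LINT r:{0<..}|lborel. g r * of_real (r powr (e + real DIM('a) - 1)))"
 define pos where "pos F x = max 0 (F (V x))" for F :: "complex => real" and x
 have part: "(LINT x|lborel. g (norm x) * of_real (pos F x)) = of_real ((e + real DIM('a)) * (LINT x:cball 0 1|lborel. pos F x)) * I
   \<and> integrable lborel (%x. g (norm x) * of_real (pos F x)) \<and> set_integrable lborel (cball 0 1) (pos F)"
  if [measurable]: "F \<in> borel_measurable borel" and F: "\<And>z. \<bar>F z\<bar> \<le> cmod z"
   and hF: "\<And>r z. 0 \<le> r ==> F (of_real r * z) = r * F z" for F
 proof (intro conjI)
  have [measurable]: "pos F \<in> borel_measurable borel" unfolding pos_def by measurable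
  have pF: "0 \<le> pos F x" "pos F x \<le> cmod (V x)" for x
   unfolding pos_def using F[of "V x"] by auto
  show "(LINT x|lborel. g (norm x) * of_real (pos F x)) = of_real ((e + real DIM('a)) * (LINT x:cball 0 1|lborel. pos F x)) * I"
   unfolding I_def
  proof (rule integral_polar_nonneg[OF _ _ e])
   fix t :: real and x :: 'a assume "0 < t"
   then show "pos F (t *\<^sub>R x) = t powr e * pos F x"
    unfolding pos_def by (simp add: hom hF max_mult_distrib_left)
  next
   fix x :: 'a assume "norm x \<le> 1"
   then show "pos F x \<le> B" using B pF(2)[of x] by (meson order_trans)
  qed (use pF in auto)
  show "integrable lborel (%x. g (norm x) * of_real (pos F x))"
  proof (rule integrable_dominated[OF int])
   show "AE x in lborel. norm (g (norm x) * of_real (pos F x)) \<le> norm (g (norm x) * V x)"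
    using pF by (intro AE_I2) (auto simp: norm_mult intro!: mult_left_mono)
  qed measurable
  show "set_integrable lborel (cball 0 1) (pos F)"
  proof (rule set_integrable_bound[where f = "%x. B"])
   show "set_integrable lborel (cball (0::'a) 1) (%x. B)"
    unfolding set_integrable_def using emeasure_bounded_finite[OF bounded_cball[of "0::'a" 1]]
    by (intro integrable_scaleR_left integrable_real_indicator) auto
   show "AE x in lborel. x \<in> cball 0 1 \<longrightarrow> norm (pos F x) \<le> norm B"
   proof (intro AE_I2 impI)
    fix x :: 'a assume "x \<in> cball 0 1"
    then show "norm (pos F x) \<le> norm B" using B[of x] pF[of x] by auto
   qed
  qed (use \<open>pos F \<in> borel_measurable borel\<close> in \<open>auto simp: set_borel_measurable_def\<close>)
 qed
 have m: "Re \<in> borel_measurable borel" "Im \<in> borel_measurable borel" "(%z. - Re z) \<in> borel_measurable borel" "(%z. - Im z) \<in> borel_measurable borel"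
  by measurable
 note p1 = part[OF m(1)] and p2 = part[OF m(2)] and p3 = part[OF m(3)] and p4 = part[OF m(4)]
 have p1: "(LINT x|lborel. g (norm x) * of_real (pos Re x)) = of_real ((e + real DIM('a)) * (LINT x:cball 0 1|lborel. pos Re x)) * I"
   "integrable lborel (%x. g (norm x) * of_real (pos Re x))" "set_integrable lborel (cball 0 1) (pos Re)"
  using part[OF m(1)] by (auto simp: abs_Re_le_cmod)
 have p2: "(LINT x|lborel. g (norm x) * of_real (pos Im x)) = of_real ((e + real DIM('a)) * (LINT x:cball 0 1|lborel. pos Im x)) * I"
   "integrable lborel (%x. g (norm x) * of_real (pos Im x))" "set_integrable lborel (cball 0 1) (pos Im)"
  using part[OF m(2)] by (auto simp: abs_Im_le_cmod)
 have p3: "(LINT x|lborel. g (norm x) * of_real (pos (%z. - Re z) x)) = of_real ((e + real DIM('a)) * (LINT x:cball 0 1|lborel. pos (%z. - Re z) x)) * I"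
   "integrable lborel (%x. g (norm x) * of_real (pos (%z. - Re z) x))" "set_integrable lborel (cball 0 1) (pos (%z. - Re z))"
  using part[OF m(3)] by (auto simp: abs_Re_le_cmod)
 have p4: "(LINT x|lborel. g (norm x) * of_real (pos (%z. - Im z) x)) = of_real ((e + real DIM('a)) * (LINT x:cball 0 1|lborel. pos (%z. - Im z) x)) * I"
   "integrable lborel (%x. g (norm x) * of_real (pos (%z. - Im z) x))" "set_integrable lborel (cball 0 1) (pos (%z. - Im z))"
  using part[OF m(4)] by (auto simp: abs_Im_le_cmod)
 have V: "V x = of_real (pos Re x) - of_real (pos (%z. - Re z) x) + \<i> * (of_real (pos Im x) - of_real (pos (%z. - Im z) x))" for x
  unfolding pos_def by (rule complex_eqI) (auto simp: max_def)
 have s: "(LINT x:cball 0 1|lborel. of_real (pos F x)) = complex_of_real (LINT x:cball 0 1|lborel. pos F x)" for F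
  unfolding set_lebesgue_integral_def by (simp add: scaleR_conv_of_real flip: of_real_mult)
 have si: "set_integrable lborel (cball 0 1) (%x. complex_of_real (pos F x))" if "set_integrable lborel (cball 0 1) (pos F)" for F
  using that unfolding set_integrable_def by (simp add: scaleR_conv_of_real flip: of_real_mult)
 have "(LINT x|lborel. g (norm x) * V x)
   = (LINT x|lborel. g (norm x) * of_real (pos Re x) - g (norm x) * of_real (pos (%z. - Re z) x)
     + \<i> * (g (norm x) * of_real (pos Im x) - g (norm x) * of_real (pos (%z. - Im z) x)))"
  by (subst V) (simp add: algebra_simps)
 also have "\<dots> = (LINT x|lborel. g (norm x) * of_real (pos Re x)) - (LINT x|lborel. g (norm x) * of_real (pos (%z. - Re z) x))
     + \<i> * ((LINT x|lborel. g (norm x) * of_real (pos Im x)) - (LINT x|lborel. g (norm x) * of_real (pos (%z. - Im z) x)))"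
  using p1(2) p2(2) p3(2) p4(2) by simp
 finally have L: "(LINT x|lborel. g (norm x) * V x) = \<dots>" .
 have "(LINT x:cball 0 1|lborel. V x) = (LINT x:cball 0 1|lborel. of_real (pos Re x) - of_real (pos (%z. - Re z) x)
     + \<i> * (of_real (pos Im x) - of_real (pos (%z. - Im z) x)))"
  by (subst V) simp
 also have "\<dots> = (LINT x:cball 0 1|lborel. of_real (pos Re x)) - (LINT x:cball 0 1|lborel. of_real (pos (%z. - Re z) x))
     + \<i> * ((LINT x:cball 0 1|lborel. of_real (pos Im x)) - (LINT x:cball 0 1|lborel. of_real (pos (%z. - Im z) x)))"
  using si[OF p1(3)] si[OF p2(3)] si[OF p3(3)] si[OF p4(3)]
  by (simp add: set_integral_diff set_integral_add set_integral_mult_right)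
 finally have R: "(LINT x:cball 0 1|lborel. V x) = \<dots>" .
 show ?thesis
  unfolding L R p1(1) p2(1) p3(1) p4(1) I_def[symmetric] s by (simp add: algebra_simps)
qed

section \<open>The measure of the Hankel transform\<close>

lemma space_hankel_measure [simp]: "space (hankel_measure a \<nu>) = {0<..}"
 by (simp add: hankel_measure_def space_restrict_space)

lemma sets_hankel_measure [measurable_cong]: "sets (hankel_measure a \<nu>) = sets (restrict_space borel {0<..})"
 by (simp add: hankel_measure_def) (rule sets_restrict_space_cong, simp)

lemma borel_measurable_hankel: "f \<in> borel_measurable borel ==> f \<in> borel_measurable (hankel_measure a \<nu>)"
 unfolding measurable_cong_sets[OF sets_hankel_measure refl] by (rule measurable_restrict_space1)

lemma borel_measurable_hankel_iff:
 fixes f :: "real => complex"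
 shows "f \<in> borel_measurable (hankel_measure a \<nu>) \<longleftrightarrow> (%r. indicator {0<..} r *\<^sub>R f r) \<in> borel_measurable borel"
 unfolding measurable_cong_sets[OF sets_hankel_measure refl]
 by (subst borel_measurable_restrict_space_iff) auto

lemma nn_integral_hankel:
 assumes [measurable]: "g \<in> borel_measurable borel"
 shows "(\<integral>\<^sup>+r. g r \<partial>hankel_measure a \<nu>) = (\<integral>\<^sup>+r. g r * ennreal (r powr (a * (\<nu> + 1) - 1)) * indicator {0<..} r \<partial>lborel)"
proof -
 have "(\<integral>\<^sup>+r. g r \<partial>hankel_measure a \<nu>) = (\<integral>\<^sup>+r. ennreal (r powr (a * (\<nu> + 1) - 1)) * g r \<partial>restrict_space lborel {0<..})"
  unfolding hankel_measure_def
  by (subst nn_integral_density) (auto intro!: measurable_restrict_space1)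
 also have "\<dots> = (\<integral>\<^sup>+r. ennreal (r powr (a * (\<nu> + 1) - 1)) * g r * indicator {0<..} r \<partial>lborel)"
  by (subst nn_integral_restrict_space) auto
 finally show ?thesis by (simp add: mult_ac)
qed

lemma integral_hankel:
 fixes f :: "real => complex"
 assumes "f \<in> borel_measurable (hankel_measure a \<nu>)"
 shows "(LINT r|hankel_measure a \<nu>. f r) = (LINT r:{0<..}|lborel. f r * of_real (r powr (a * (\<nu> + 1) - 1)))"
  and "integrable (hankel_measure a \<nu>) f \<longleftrightarrow> set_integrable lborel {0<..} (%r. f r * of_real (r powr (a * (\<nu> + 1) - 1)))"
proof -
 have m: "f \<in> borel_measurable (restrict_space lborel {0<..})"
  using assms by (simp add: hankel_measure_def)
 have m2: "(%r. r powr (a * (\<nu> + 1) - 1)) \<in> borel_measurable (restrict_space lborel {0<..})"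
  by (intro measurable_restrict_space1) simp
 show "(LINT r|hankel_measure a \<nu>. f r) = (LINT r:{0<..}|lborel. f r * of_real (r powr (a * (\<nu> + 1) - 1)))"
  unfolding hankel_measure_def
  by (subst integral_density[OF m m2]) (auto simp: integral_restrict_space set_lebesgue_integral_def scaleR_conv_of_real mult_ac)
 show "integrable (hankel_measure a \<nu>) f \<longleftrightarrow> set_integrable lborel {0<..} (%r. f r * of_real (r powr (a * (\<nu> + 1) - 1)))"
  unfolding hankel_measure_def
  by (subst integrable_density[OF m m2]) (auto simp: integrable_restrict_space set_integrable_def scaleR_conv_of_real mult_ac)
qed

text \<open>
 The substitution \<open>t = r\<^sup>a / a\<close>, in which the functions at hand become Laguerre functions.
\<close>

lemma distr_hankel_measure:
 assumes a: "0 < a" and \<nu>: "-1 < \<nu>"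
 shows "distr (hankel_measure a \<nu>) borel (%r. r powr a / a)
  = density lborel (%t. ennreal (a powr \<nu> / (\<nu> + 1) * ((\<nu> + 1) * t powr ((\<nu> + 1) - 1))) * indicator {0<..} t)"
proof (rule power_measure_eqI)
 fix T :: real
 have [measurable]: "(%r. r powr a / a) \<in> measurable (hankel_measure a \<nu>) borel"
  by (rule borel_measurable_hankel) measurable
 define U where "U = (a * max 0 T) powr (1 / a)"
 have *: "r powr a / a \<le> T \<longleftrightarrow> r \<le> U" if "0 < r" for r
 proof (cases "0 < T")
  case True
  have "r powr a / a \<le> T \<longleftrightarrow> r powr a \<le> a * T" using a by (simp add: field_simps)
  also have "\<dots> \<longleftrightarrow> (r powr a) powr (1 / a) \<le> (a * T) powr (1 / a)"
   using a True powr_mono2[of "1 / a" "r powr a" "a * T"] powr_less_mono2[of "1 / a" "a * T" "r powr a"]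
   by (cases "r powr a \<le> a * T") (simp_all add: not_le)
  finally show ?thesis using a that True unfolding U_def by (simp add: powr_powr)
 next
  case False
  moreover have "0 < r powr a / a" using a that by simp
  ultimately have "\<not> r powr a / a \<le> T" by linarith
  moreover have "U = 0" using False unfolding U_def by simp
  ultimately show ?thesis using that by simp
 qed
 have "emeasure (distr (hankel_measure a \<nu>) borel (%r. r powr a / a)) {..T}
   = emeasure (hankel_measure a \<nu>) ((%r. r powr a / a) -` {..T} \<inter> space (hankel_measure a \<nu>))"
  by (rule emeasure_distr) auto
 also have "(%r. r powr a / a) -` {..T} \<inter> space (hankel_measure a \<nu>) = {0<..} \<inter> {..U}"
  using * by auto
 also have "emeasure (hankel_measure a \<nu>) ({0<..} \<inter> {..U}) = (\<integral>\<^sup>+r. indicator ({0<..} \<inter> {..U}) r \<partial>hankel_measure a \<nu>)"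
  by (subst nn_integral_indicator) (auto simp: sets_hankel_measure sets_restrict_space)
 also have "\<dots> = (\<integral>\<^sup>+r. ennreal (1 / (a * (\<nu> + 1)) * (a * (\<nu> + 1) * r powr (a * (\<nu> + 1) - 1))) * indicator {0<..} r * indicator {..U} r \<partial>lborel)"
  using a \<nu> by (subst nn_integral_hankel) (auto simp: indicator_def intro!: nn_integral_cong)
 also have "\<dots> = ennreal (1 / (a * (\<nu> + 1)) * max 0 U powr (a * (\<nu> + 1)))"
  using a \<nu> by (intro nn_integral_powr_atMost) auto
 also have "max 0 U powr (a * (\<nu> + 1)) = a powr (\<nu> + 1) * max 0 T powr (\<nu> + 1)"
  using a by (simp add: U_def powr_powr powr_mult)
 also have "1 / (a * (\<nu> + 1)) * (a powr (\<nu> + 1) * X) = a powr \<nu> / (\<nu> + 1) * X" for X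
  using a \<nu> by (simp add: powr_add divide_simps)
 finally show "emeasure (distr (hankel_measure a \<nu>) borel (%r. r powr a / a)) {..T} = ennreal (a powr \<nu> / (\<nu> + 1) * max 0 T powr (\<nu> + 1))" .
qed (use \<nu> in auto)

lemma nn_integral_hankel_substitution:
 fixes g :: "real => ennreal"
 assumes a: "0 < a" and \<nu>: "-1 < \<nu>" and [measurable]: "g \<in> borel_measurable borel"
 shows "(\<integral>\<^sup>+r. g (r powr a / a) \<partial>hankel_measure a \<nu>) = ennreal (a powr \<nu>) * (\<integral>\<^sup>+t. g t * ennreal (t powr \<nu>) * indicator {0<..} t \<partial>lborel)"
proof -
 have m: "(%r. r powr a / a) \<in> measurable (hankel_measure a \<nu>) borel"
  by (rule borel_measurable_hankel) measurable
 have "(\<integral>\<^sup>+r. g (r powr a / a) \<partial>hankel_measure a \<nu>) = (\<integral>\<^sup>+t. g t \<partial>distr (hankel_measure a \<nu>) borel (%r. r powr a / a))"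
  by (rule nn_integral_distr[OF m, symmetric]) simp
 also have "\<dots> = (\<integral>\<^sup>+t. ennreal (a powr \<nu>) * (g t * ennreal (t powr \<nu>) * indicator {0<..} t) \<partial>lborel)"
  unfolding distr_hankel_measure[OF a \<nu>] using \<nu>
  by (subst nn_integral_density) (auto simp: ennreal_mult mult_ac)
 finally show ?thesis by (simp add: nn_integral_cmult)
qed

lemma integral_hankel_substitution:
 fixes g :: "real => complex"
 assumes a: "0 < a" and \<nu>: "-1 < \<nu>" and [measurable]: "g \<in> borel_measurable borel"
 shows "(LINT r|hankel_measure a \<nu>. g (r powr a / a)) = of_real (a powr \<nu>) * (LINT t:{0<..}|lborel. g t * of_real (t powr \<nu>))"
proof -
 have m: "(%r. r powr a / a) \<in> measurable (hankel_measure a \<nu>) borel"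
  by (rule borel_measurable_hankel) measurable
 have "(LINT r|hankel_measure a \<nu>. g (r powr a / a)) = (LINT t|distr (hankel_measure a \<nu>) borel (%r. r powr a / a). g t)"
  by (rule integral_distr[OF m, symmetric]) simp
 also have "\<dots> = (LINT t|density lborel (%t. ennreal (a powr \<nu> * t powr \<nu> * indicator {0<..} t)). g t)"
  unfolding distr_hankel_measure[OF a \<nu>] using \<nu>
  by (intro arg_cong[where f = "%N. integral\<^sup>L N g"] density_cong) (auto simp: indicator_def)
 also have "\<dots> = (LINT t|lborel. of_real (a powr \<nu>) * (indicator {0<..} t *\<^sub>R (g t * of_real (t powr \<nu>))))"
  by (subst integral_density) (auto simp: scaleR_conv_of_real indicator_def mult_ac intro!: Bochner_Integration.integral_cong)
 finally show ?thesis by (simp only: set_lebesgue_integral_def integral_mult_right_zero)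
qed

section \<open>Polynomials and Dunkl operators\<close>

lemmas real_polynomial_linear = real_polynomial_function.intros(1)
 and real_polynomial_const = real_polynomial_function.intros(2)
 and real_polynomial_add = real_polynomial_function.intros(3)
 and real_polynomial_mult = real_polynomial_function.intros(4)

lemma polynomial_function_complex_iff:
 fixes p :: "'a::euclidean_space => complex"
 shows "polynomial_function p \<longleftrightarrow>
  real_polynomial_function (%x. Re (p x)) \<and> real_polynomial_function (%x. Im (p x))"
 by (subst polynomial_function_iff_Basis_inner) (auto simp: Basis_complex_def inner_complex_def)

lemma polynomial_function_complex_mult:
 fixes p q :: "'a::euclidean_space => complex"
 shows "polynomial_function p ==> polynomial_function q ==> polynomial_function (%x. p x * q x)"
 unfolding polynomial_function_complex_iff
 by (auto intro!: real_polynomial_function_diff real_polynomial_add real_polynomial_mult)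

lemma polynomial_function_of_real:
 fixes f :: "'a::euclidean_space => real"
 shows "real_polynomial_function f ==> polynomial_function (%x. complex_of_real (f x))"
 unfolding polynomial_function_complex_iff by simp (rule real_polynomial_const)

lemma polynomial_function_cnj:
 fixes p :: "'a::euclidean_space => complex"
 shows "polynomial_function p ==> polynomial_function (%x. cnj (p x))"
 unfolding polynomial_function_complex_iff by (auto intro: real_polynomial_function_minus)

lemma real_polynomial_inner: "real_polynomial_function (%x::'a::euclidean_space. x \<bullet> v)" "real_polynomial_function (%x::'a::euclidean_space. v \<bullet> x)"
 by (auto intro!: real_polynomial_linear bounded_linear_inner_left bounded_linear_inner_right)

lemma real_polynomial_inner_self: "real_polynomial_function (%x::'a::euclidean_space. x \<bullet> x)"
proof -
 have "(%x::'a. x \<bullet> x) = (%x. \<Sum>b\<in>Basis. (x \<bullet> b) * (x \<bullet> b))"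
  by (rule ext) (rule euclidean_inner)
 then show ?thesis
  by (auto intro!: real_polynomial_function_sum real_polynomial_mult real_polynomial_inner)
qed

lemmas polynomial_intros = polynomial_function_complex_mult polynomial_function_of_real polynomial_function_cnj
 polynomial_function_sum polynomial_function_add polynomial_function_diff polynomial_function_const
 real_polynomial_mult real_polynomial_const real_polynomial_inner real_polynomial_inner_self real_polynomial_function_power

lemma real_polynomial_function_has_derivative:
 fixes f :: "'a::euclidean_space => real"
 assumes "real_polynomial_function f"
 shows "\<exists>D. (\<forall>x. (f has_derivative D x) (at x)) \<and> (\<forall>\<xi>. real_polynomial_function (%x. D x \<xi>))"
 using assms
proof induction
 case (linear f)
 then show ?case
  by (intro exI[of _ "%x. f"]) (auto intro: bounded_linear_imp_has_derivative real_polynomial_const)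
next
 case (const c)
 show ?case by (intro exI[of _ "%x \<xi>. 0"]) (auto intro: real_polynomial_const)
next
 case (add f g)
 then obtain D D' where "\<forall>x. (f has_derivative D x) (at x)" "\<forall>\<xi>. real_polynomial_function (%x. D x \<xi>)"
  "\<forall>x. (g has_derivative D' x) (at x)" "\<forall>\<xi>. real_polynomial_function (%x. D' x \<xi>)" by blast
 then show ?case
  by (intro exI[of _ "%x \<xi>. D x \<xi> + D' x \<xi>"]) (auto intro: has_derivative_add real_polynomial_add)
next
 case (mult f g)
 then obtain D D' where "\<forall>x. (f has_derivative D x) (at x)" "\<forall>\<xi>. real_polynomial_function (%x. D x \<xi>)"
  "\<forall>x. (g has_derivative D' x) (at x)" "\<forall>\<xi>. real_polynomial_function (%x. D' x \<xi>)" by blast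
 then show ?case using mult.hyps
  by (intro exI[of _ "%x \<xi>. f x * D' x \<xi> + D x \<xi> * g x"] conjI allI
    has_derivative_mult real_polynomial_add[OF real_polynomial_mult real_polynomial_mult]) auto
qed

abbreviation has_dir_deriv :: "(real^'n => complex) => real^'n => complex => real^'n => bool" where
 "has_dir_deriv f \<xi> d x \<equiv> ((%t. f (x + t *\<^sub>R \<xi>)) has_vector_derivative d) (at 0)"

lemma dir_deriv_eqI: "has_dir_deriv f \<xi> d x ==> dir_deriv \<xi> f x = d"
 unfolding dir_deriv_def by (rule vector_derivative_at)

lemma has_derivative_imp_dir_deriv:
 assumes "(f has_derivative D) (at x)"
 shows "has_dir_deriv f \<xi> (D \<xi>) x"
proof -
 have "((%t. x + t *\<^sub>R \<xi>) has_derivative (%t. t *\<^sub>R \<xi>)) (at 0)"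
  by (auto intro!: derivative_eq_intros)
 from has_derivative_compose[OF this, of f D] have "((%t. f (x + t *\<^sub>R \<xi>)) has_derivative (%t. D (t *\<^sub>R \<xi>))) (at 0)"
  using assms by simp
 then show ?thesis
  using linear_scale[OF has_derivative_linear[OF assms]] by (simp add: has_vector_derivative_def)
qed

lemma polynomial_has_derivative:
 fixes p :: "real^'n => complex"
 assumes "polynomial_function p"
 shows "(p has_derivative (%\<xi>. dir_deriv \<xi> p x)) (at x)" and "polynomial_function (dir_deriv \<xi> p)"
proof -
 have re: "real_polynomial_function (%x. Re (p x))" and im: "real_polynomial_function (%x. Im (p x))"
  using assms unfolding polynomial_function_complex_iff by auto
 obtain D where D: "\<And>x. ((%x. Re (p x)) has_derivative D x) (at x)" "\<And>\<xi>. real_polynomial_function (%x. D x \<xi>)"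
  using real_polynomial_function_has_derivative[OF re] by blast
 obtain D' where D': "\<And>x. ((%x. Im (p x)) has_derivative D' x) (at x)" "\<And>\<xi>. real_polynomial_function (%x. D' x \<xi>)"
  using real_polynomial_function_has_derivative[OF im] by blast
 define E where "E x \<xi> = Complex (D x \<xi>) (D' x \<xi>)" for x \<xi>
 have E: "(p has_derivative E x) (at x)" for x
 proof -
  have "((%x. of_real (Re (p x)) + \<i> * of_real (Im (p x))) has_derivative (%\<xi>. of_real (D x \<xi>) + \<i> * of_real (D' x \<xi>))) (at x)"
   by (intro has_derivative_add has_derivative_of_real has_derivative_mult_right D D')
  then show ?thesis unfolding E_def[abs_def] by (simp add: complex_eq[symmetric] Complex_eq)
 qed
 have eq: "dir_deriv \<xi> p x = E x \<xi>" for x \<xi>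
  by (rule dir_deriv_eqI[OF has_derivative_imp_dir_deriv[OF E]])
 show "(p has_derivative (%\<xi>. dir_deriv \<xi> p x)) (at x)"
  using E[of x] by (simp add: eq)
 have "dir_deriv \<xi> p = (%x. E x \<xi>)" by (rule ext) (rule eq)
 then show "polynomial_function (dir_deriv \<xi> p)"
  unfolding polynomial_function_complex_iff using D(2) D'(2) by (simp add: E_def)
qed

lemma polynomial_has_dir_deriv:
 "polynomial_function p ==> has_dir_deriv p \<xi> (dir_deriv \<xi> p x) x"
 using has_derivative_imp_dir_deriv[OF polynomial_has_derivative(1)] .

lemma continuous_on_polynomial: "polynomial_function (p :: real^'n => complex) ==> continuous_on S p"
 by (rule continuous_on_polymonial_function)

lemma root_reflection_linear: "linear (root_reflection \<alpha>)"
 unfolding root_reflection_def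
 by (rule linearI) (simp_all add: inner_add_right algebra_simps add_divide_distrib scaleR_add_left)

lemma root_reflection_involution:
 assumes "\<alpha> \<noteq> 0" shows "root_reflection \<alpha> (root_reflection \<alpha> x) = x"
proof -
 have "\<alpha> \<bullet> root_reflection \<alpha> x = - (\<alpha> \<bullet> x)"
  unfolding root_reflection_def using assms by (simp add: inner_diff_right power2_norm_eq_inner)
 then show ?thesis by (simp add: root_reflection_def[of \<alpha> "root_reflection \<alpha> x"]) (simp add: root_reflection_def)
qed

lemma inner_root_reflection:
 assumes "\<alpha> \<noteq> 0" shows "\<beta> \<bullet> root_reflection \<alpha> x = root_reflection \<alpha> \<beta> \<bullet> x"
 unfolding root_reflection_def using assms
 by (simp add: inner_diff_right inner_diff_left inner_commute)

lemma inner_root_reflection_self: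
 assumes "\<alpha> \<noteq> 0" shows "\<alpha> \<bullet> root_reflection \<alpha> x = - (\<alpha> \<bullet> x)"
 unfolding root_reflection_def using assms by (simp add: inner_diff_right power2_norm_eq_inner)

lemma root_reflection_inner_inner:
 assumes "\<alpha> \<noteq> 0" shows "root_reflection \<alpha> x \<bullet> root_reflection \<alpha> y = x \<bullet> y"
 using assms by (simp add: inner_root_reflection root_reflection_involution)

lemma norm_root_reflection: "\<alpha> \<noteq> 0 ==> norm (root_reflection \<alpha> x) = norm x"
 by (simp add: norm_eq_sqrt_inner root_reflection_inner_inner)

lemma polynomial_root_reflection: "polynomial_function (root_reflection (\<alpha> :: real^'n))"
 by (rule polynomial_function_bounded_linear) (simp add: linear_linear root_reflection_linear)

text \<open>
 The difference vanishes on the hyperplane orthogonal to \<open>\<alpha>\<close>; the quotient is constructed along with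
 the polynomial, a product being treated like a difference of products.
\<close>

lemma real_polynomial_root_quotient:
 fixes f :: "real^'n => real"
 assumes "real_polynomial_function f" and "\<alpha> \<noteq> 0"
 shows "\<exists>q. real_polynomial_function q \<and> (\<forall>x. f x - f (root_reflection \<alpha> x) = (\<alpha> \<bullet> x) * q x)"
 using assms(1)
proof induction
 case (linear f)
 have "f x - f (root_reflection \<alpha> x) = (\<alpha> \<bullet> x) * (2 / (norm \<alpha>)\<^sup>2 * f \<alpha>)" for x
  unfolding root_reflection_def
  by (simp add: linear_diff[OF bounded_linear.linear[OF linear]] linear_scale[OF bounded_linear.linear[OF linear]])
 then show ?case by (intro exI[of _ "%x. 2 / (norm \<alpha>)\<^sup>2 * f \<alpha>"]) (auto intro: real_polynomial_const)
next
 case (const c)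
 show ?case by (intro exI[of _ "%x. 0"]) (auto intro: real_polynomial_const)
next
 case (add f g)
 then obtain q q' where q: "real_polynomial_function q" "\<forall>x. f x - f (root_reflection \<alpha> x) = (\<alpha> \<bullet> x) * q x"
  "real_polynomial_function q'" "\<forall>x. g x - g (root_reflection \<alpha> x) = (\<alpha> \<bullet> x) * q' x" by blast
 then show ?case
  by (intro exI[of _ "%x. q x + q' x"]) (auto intro: real_polynomial_add simp: distrib_left simp flip: q(2,4)[rule_format])
next
 case (mult f g)
 then obtain q q' where q: "real_polynomial_function q" "\<And>x. f x - f (root_reflection \<alpha> x) = (\<alpha> \<bullet> x) * q x"
  "real_polynomial_function q'" "\<And>x. g x - g (root_reflection \<alpha> x) = (\<alpha> \<bullet> x) * q' x" by blast
 have fr: "real_polynomial_function (%x. f (root_reflection \<alpha> x))"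
  using real_polynomial_function_compose[OF polynomial_root_reflection mult.hyps(1)] by (simp add: o_def)
 have "f x * g x - f (root_reflection \<alpha> x) * g (root_reflection \<alpha> x)
   = (\<alpha> \<bullet> x) * (q x * g x + f (root_reflection \<alpha> x) * q' x)" for x
 proof -
  have "f x * g x - f (root_reflection \<alpha> x) * g (root_reflection \<alpha> x)
   = (f x - f (root_reflection \<alpha> x)) * g x + f (root_reflection \<alpha> x) * (g x - g (root_reflection \<alpha> x))"
   by (simp add: algebra_simps)
  then show ?thesis unfolding q(2,4) by (simp add: algebra_simps)
 qed
 then show ?case using q(1,3) mult.hyps fr
  by (intro exI[of _ "%x. q x * g x + f (root_reflection \<alpha> x) * q' x"])
   (auto intro!: real_polynomial_add real_polynomial_mult)
qed

lemma polynomial_root_quotient: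
 fixes p :: "real^'n => complex"
 assumes p: "polynomial_function p" and \<alpha>: "\<alpha> \<noteq> 0"
 shows "polynomial_function (root_quotient \<alpha> p)"
  and "p x - p (root_reflection \<alpha> x) = of_real (\<alpha> \<bullet> x) * root_quotient \<alpha> p x"
proof -
 have re: "real_polynomial_function (%x. Re (p x))" and im: "real_polynomial_function (%x. Im (p x))"
  using p unfolding polynomial_function_complex_iff by auto
 obtain q1 where q1: "real_polynomial_function q1" "\<And>x. Re (p x) - Re (p (root_reflection \<alpha> x)) = (\<alpha> \<bullet> x) * q1 x"
  using real_polynomial_root_quotient[OF re \<alpha>] by blast
 obtain q2 where q2: "real_polynomial_function q2" "\<And>x. Im (p x) - Im (p (root_reflection \<alpha> x)) = (\<alpha> \<bullet> x) * q2 x"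
  using real_polynomial_root_quotient[OF im \<alpha>] by blast
 define q where "q x = Complex (q1 x) (q2 x)" for x
 have q: "polynomial_function q" unfolding polynomial_function_complex_iff q_def using q1 q2 by simp
 have pq: "p x - p (root_reflection \<alpha> x) = of_real (\<alpha> \<bullet> x) * q x" for x
  by (rule complex_eqI) (simp_all add: q_def q1(2) q2(2))
 have "root_quotient \<alpha> p x = q x" for x
 proof (cases "\<alpha> \<bullet> x = 0")
  case False
  then show ?thesis by (simp add: root_quotient_def pq)
 next
  case True
  \<comment> \<open>Differentiate \<open>p(x + t\<alpha>) - p(x - t\<alpha>) = t \<parallel>\<alpha>\<parallel>\<^sup>2 q(x + t\<alpha>)\<close> at \<open>t = 0\<close>.\<close>
  have refl: "root_reflection \<alpha> (x + t *\<^sub>R \<alpha>) = x + t *\<^sub>R (- \<alpha>)" for t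
  proof -
   have "2 * (\<alpha> \<bullet> (x + t *\<^sub>R \<alpha>)) / (norm \<alpha>)\<^sup>2 = 2 * t"
    using True \<alpha> by (simp add: inner_add_right power2_norm_eq_inner)
   then show ?thesis
    unfolding root_reflection_def by (simp only: add_diff_eq[symmetric] scaleR_left_diff_distrib[symmetric]) simp
  qed
  have "((%t. p (x + t *\<^sub>R \<alpha>) - p (x + t *\<^sub>R (- \<alpha>))) has_vector_derivative
    dir_deriv \<alpha> p x - dir_deriv (- \<alpha>) p x) (at 0)"
   by (intro has_vector_derivative_diff polynomial_has_dir_deriv p)
  moreover have "dir_deriv (- \<alpha>) p x = - dir_deriv \<alpha> p x"
   using linear_neg[OF has_derivative_linear[OF polynomial_has_derivative(1)[OF p]]] .
  ultimately have 1: "((%t. p (x + t *\<^sub>R \<alpha>) - p (x + t *\<^sub>R (- \<alpha>))) has_vector_derivative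
    2 * dir_deriv \<alpha> p x) (at 0)" by simp
  have "((%t. of_real (t * (norm \<alpha>)\<^sup>2) * q (x + t *\<^sub>R \<alpha>)) has_vector_derivative
    (of_real (0 * (norm \<alpha>)\<^sup>2) * dir_deriv \<alpha> q x + of_real ((norm \<alpha>)\<^sup>2) * q (x + 0 *\<^sub>R \<alpha>))) (at 0)"
   by (intro has_vector_derivative_mult polynomial_has_dir_deriv q has_vector_derivative_of_real)
    (auto intro!: derivative_eq_intros simp: has_real_derivative_iff_has_vector_derivative[symmetric])
  moreover have "of_real (t * (norm \<alpha>)\<^sup>2) * q (x + t *\<^sub>R \<alpha>) = p (x + t *\<^sub>R \<alpha>) - p (x + t *\<^sub>R (- \<alpha>))" for t
   using pq[of "x + t *\<^sub>R \<alpha>"] True unfolding refl by (simp add: inner_add_right power2_norm_eq_inner)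
  ultimately have 2: "((%t. p (x + t *\<^sub>R \<alpha>) - p (x + t *\<^sub>R (- \<alpha>))) has_vector_derivative
    of_real ((norm \<alpha>)\<^sup>2) * q x) (at 0)" by simp
  have "2 * dir_deriv \<alpha> p x = of_real ((norm \<alpha>)\<^sup>2) * q x"
   by (rule vector_derivative_unique_at[OF 1 2])
  then show ?thesis using True \<alpha> by (simp add: root_quotient_def field_simps)
 qed
 then have eq: "root_quotient \<alpha> p = q" by (rule ext)
 show "polynomial_function (root_quotient \<alpha> p)" "p x - p (root_reflection \<alpha> x) = of_real (\<alpha> \<bullet> x) * root_quotient \<alpha> p x"
  unfolding eq using q pq by auto
qed

lemma coxeter_reflection: "\<alpha> \<in> R ==> root_reflection \<alpha> \<in> coxeter_group R"
 using coxeter_refl[OF _ coxeter_id, of \<alpha> R] by simp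

locale dunkl =
 fixes R P :: "(real^'n) set" and k :: "real^'n => real"
 assumes root_system: "reduced_root_system R" and positive: "positive_subsystem R P"
  and multiplicity: "multiplicity_function R k" and k_nonneg: "\<forall>\<alpha>\<in>R. 0 \<le> k \<alpha>"
begin

abbreviation mult_inner :: "real^'n => real^'n => complex" where
 "mult_inner \<xi> \<alpha> \<equiv> of_real (k \<alpha> * (\<alpha> \<bullet> \<xi>))"

lemma finite_R [simp]: "finite R"
 using root_system by (simp add: reduced_root_system_def)

lemma R_nonzero: "\<alpha> \<in> R ==> \<alpha> \<noteq> 0"
 using root_system by (auto simp: reduced_root_system_def)

lemma R_reflection: "\<alpha> \<in> R ==> root_reflection \<alpha> ` R = R"
 using root_system by (auto simp: reduced_root_system_def)

lemma R_reflection_mem: "\<alpha> \<in> R ==> \<beta> \<in> R ==> root_reflection \<alpha> \<beta> \<in> R"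
 using R_reflection by blast

lemma R_reflection_bij: "\<alpha> \<in> R ==> bij_betw (root_reflection \<alpha>) R R"
 unfolding bij_betw_def using R_reflection root_reflection_involution[OF R_nonzero]
 by (metis inj_on_def)

lemma P_subset: "P \<subseteq> R"
 using positive by (auto simp: positive_subsystem_def)

lemma P_R: "\<alpha> \<in> P ==> \<alpha> \<in> R"
 using P_subset by blast

lemma finite_P [simp]: "finite P"
 using P_subset finite_R by (rule finite_subset)

lemma P_nonzero: "\<alpha> \<in> P ==> \<alpha> \<noteq> 0"
 using R_nonzero P_subset by blast

lemma reflection_self: "\<alpha> \<noteq> 0 ==> root_reflection \<alpha> \<alpha> = - \<alpha>"
 by (simp add: root_reflection_def power2_norm_eq_inner) (simp add: scaleR_2)

lemma uminus_R: "\<alpha> \<in> R ==> - \<alpha> \<in> R"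
 using R_reflection_mem[of \<alpha> \<alpha>] by (simp add: reflection_self[OF R_nonzero])

lemma R_split: "R = P \<union> uminus ` P" "P \<inter> uminus ` P = {}"
proof -
 obtain v where v: "\<forall>\<alpha>\<in>R. v \<bullet> \<alpha> \<noteq> 0" "P = {\<alpha>\<in>R. v \<bullet> \<alpha> > 0}"
  using positive by (auto simp: positive_subsystem_def)
 show "P \<inter> uminus ` P = {}" using v by auto
 have "\<alpha> \<in> P \<union> uminus ` P" if "\<alpha> \<in> R" for \<alpha>
 proof (cases "v \<bullet> \<alpha> > 0")
  case False
  then have "- \<alpha> \<in> P" using v that uminus_R[OF that] by (auto simp: less_le)
  then show ?thesis by (metis UnI2 image_eqI minus_minus)
 qed (use v that in auto)
 then show "R = P \<union> uminus ` P" using P_subset uminus_R by auto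
qed

lemma k_reflection: "\<alpha> \<in> R ==> \<beta> \<in> R ==> k (root_reflection \<alpha> \<beta>) = k \<beta>"
 using multiplicity coxeter_reflection by (auto simp: multiplicity_function_def)

lemma k_uminus: "\<alpha> \<in> R ==> k (- \<alpha>) = k \<alpha>"
 using k_reflection[of \<alpha> \<alpha>] by (simp add: reflection_self[OF R_nonzero])

lemma sum_R_P:
 fixes f :: "real^'n => 'b::comm_monoid_add"
 shows "(\<Sum>\<alpha>\<in>R. f \<alpha>) = (\<Sum>\<alpha>\<in>P. f \<alpha> + f (- \<alpha>))"
proof -
 have "(\<Sum>\<alpha>\<in>R. f \<alpha>) = (\<Sum>\<alpha>\<in>P. f \<alpha>) + (\<Sum>\<alpha>\<in>uminus ` P. f \<alpha>)"
  using R_split(2) by (subst R_split(1), subst sum.union_disjoint) auto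
 also have "(\<Sum>\<alpha>\<in>uminus ` P. f \<alpha>) = (\<Sum>\<alpha>\<in>P. f (- \<alpha>))"
  by (subst sum.reindex) (auto simp: inj_on_def)
 finally show ?thesis by (simp add: sum.distrib)
qed

lemma mult_sum_nonneg: "0 \<le> mult_sum P k"
 unfolding mult_sum_def using k_nonneg P_R by (intro sum_nonneg) auto

definition regular :: "(real^'n) set" where
 "regular = {x. x \<noteq> 0 \<and> (\<forall>\<alpha>\<in>R. \<alpha> \<bullet> x \<noteq> 0)}"

lemma regular_P: "x \<in> regular ==> \<alpha> \<in> P ==> \<alpha> \<bullet> x \<noteq> 0"
 using P_R by (auto simp: regular_def)

lemma regular_eq: "regular = - ({0} \<union> (\<Union>\<alpha>\<in>R. {x. \<alpha> \<bullet> x = 0}))"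
 by (auto simp: regular_def)

lemma open_regular: "open regular"
 unfolding regular_eq by (intro open_Compl closed_Un closed_UN) (auto intro: closed_hyperplane)

lemma negligible_singular: "negligible (- regular)"
 unfolding regular_eq double_complement
 by (intro negligible_Un negligible_Union finite_imageI finite_R) (auto dest: R_nonzero intro: negligible_hyperplane)

lemma regular_reflection: "\<alpha> \<in> R ==> x \<in> regular ==> root_reflection \<alpha> x \<in> regular"
 unfolding regular_def using R_reflection_mem[of \<alpha>] norm_root_reflection[OF R_nonzero, of \<alpha> x]
 by (auto simp: inner_root_reflection[OF R_nonzero])

lemma AE_regular: "AE x in lborel. x \<in> regular"
proof -
 have "- regular \<in> null_sets lebesgue" using negligible_singular by (simp add: negligible_iff_null_sets)
 moreover have "- regular \<in> sets borel" using open_regular by (intro borel_closed) (simp add: closed_def)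
 ultimately have "- regular \<in> null_sets lborel"
  by (simp add: null_sets_def)
 then show ?thesis by (rule AE_I') auto
qed

text \<open>
 The regular points have a complement of measure zero and are therefore dense. Identities between
 Dunkl operators are thus checked where they are given by difference quotients.
\<close>

lemma eq_on_regular_imp_eq:
 fixes f g :: "real^'n => complex"
 assumes "continuous_on UNIV f" "continuous_on UNIV g" "\<And>x. x \<in> regular ==> f x = g x"
 shows "f x = g x"
proof (rule ccontr)
 let ?U = "{x. f x \<noteq> g x}"
 assume "f x \<noteq> g x"
 then have ne: "?U \<noteq> {}" by blast
 have "open ?U" using assms(1,2) by (simp add: open_Collect_neq)
 moreover have "negligible ?U" using negligible_singular by (rule negligible_subset) (use assms(3) in auto)
 ultimately show False using open_not_negligible ne by blast
qed

subsection \<open>Dunkl operators off the reflecting hyperplanes\<close>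

lemma dunkl_op_regular:
 assumes "x \<in> regular" "has_dir_deriv f \<xi> d x"
 shows "dunkl_op P k \<xi> f x = d + (\<Sum>\<alpha>\<in>P. mult_inner \<xi> \<alpha> * ((f x - f (root_reflection \<alpha> x)) / of_real (\<alpha> \<bullet> x)))"
 unfolding dunkl_op_def dir_deriv_eqI[OF assms(2)]
 using regular_P[OF assms(1)] by (intro arg_cong2[where f = "(+)"] refl sum.cong) (auto simp: root_quotient_def)

lemma dunkl_op_cong:
 assumes "x \<in> regular" "\<And>y. y \<in> regular ==> f y = g y"
 shows "dunkl_op P k \<xi> f x = dunkl_op P k \<xi> g x"
proof -
 have "\<forall>\<^sub>F t in nhds (0::real). x + t *\<^sub>R \<xi> \<in> regular"
 proof (rule eventually_nhds_in_open[THEN filterlim_iff[THEN iffD1, rule_format, rotated], of regular "x + 0 *\<^sub>R \<xi>"])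
  show "filterlim (%t. x + t *\<^sub>R \<xi>) (nhds (x + 0 *\<^sub>R \<xi>)) (nhds 0)"
   by (intro tendsto_intros) (simp add: filterlim_ident)
 qed (use assms open_regular in auto)
 then have "vector_derivative (%t. f (x + t *\<^sub>R \<xi>)) (at 0) = vector_derivative (%t. g (x + t *\<^sub>R \<xi>)) (at 0)"
  by (intro vector_derivative_cong_eq) (auto elim!: eventually_mono intro: assms(2))
 moreover have "root_quotient \<alpha> f x = root_quotient \<alpha> g x" if "\<alpha> \<in> P" for \<alpha>
  using regular_P[OF assms(1) that] assms(2)[OF assms(1)] assms(2)[OF regular_reflection[OF P_R[OF that] assms(1)]]
  by (simp add: root_quotient_def)
 ultimately show ?thesis by (simp add: dunkl_op_def dir_deriv_def)
qed

lemma polynomial_dunkl_op: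
 assumes p: "polynomial_function p" shows "polynomial_function (dunkl_op P k \<xi> p)"
proof -
 have "polynomial_function (%x. dir_deriv \<xi> p x + (\<Sum>\<alpha>\<in>P. mult_inner \<xi> \<alpha> * root_quotient \<alpha> p x))"
  using polynomial_has_derivative(2)[OF p] polynomial_root_quotient(1)[OF p P_nonzero]
  by (intro polynomial_intros) auto
 then show ?thesis by (simp add: dunkl_op_def[abs_def])
qed

lemma polynomial_dunkl_laplacian:
 assumes p: "polynomial_function p" shows "polynomial_function (dunkl_laplacian P k p)"
proof -
 have "polynomial_function (%x. \<Sum>b\<in>Basis. dunkl_op P k b (dunkl_op P k b p) x)"
  by (intro polynomial_function_sum polynomial_dunkl_op p) auto
 then show ?thesis by (simp add: dunkl_laplacian_def[abs_def])
qed

lemma dunkl_op_polynomial_regular: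
 assumes "polynomial_function p" "x \<in> regular"
 shows "dunkl_op P k \<xi> p x = dir_deriv \<xi> p x + (\<Sum>\<alpha>\<in>P. mult_inner \<xi> \<alpha> * ((p x - p (root_reflection \<alpha> x)) / of_real (\<alpha> \<bullet> x)))"
 by (rule dunkl_op_regular[OF assms(2) polynomial_has_dir_deriv[OF assms(1)]])

lemma dunkl_op_sum:
 assumes x: "x \<in> regular" and d: "\<And>i. i \<in> I ==> \<exists>d. has_dir_deriv (f i) \<xi> d x"
 shows "dunkl_op P k \<xi> (%x. \<Sum>i\<in>I. c i * f i x) x = (\<Sum>i\<in>I. c i * dunkl_op P k \<xi> (f i) x)"
proof -
 obtain d' where d': "\<And>i. i \<in> I ==> has_dir_deriv (f i) \<xi> (d' i) x" using d by metis
 have "has_dir_deriv (%x. \<Sum>i\<in>I. c i * f i x) \<xi> (\<Sum>i\<in>I. c i * d' i) x"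
  using d' by (intro has_vector_derivative_sum has_vector_derivative_mult_right)
 note D = dunkl_op_regular[OF x this]
 have "(\<Sum>i\<in>I. c i * dunkl_op P k \<xi> (f i) x)
   = (\<Sum>i\<in>I. c i * d' i + (\<Sum>\<alpha>\<in>P. c i * (mult_inner \<xi> \<alpha> * ((f i x - f i (root_reflection \<alpha> x)) / of_real (\<alpha> \<bullet> x)))))"
  by (intro sum.cong refl) (subst dunkl_op_regular[OF x d'], auto simp: distrib_left sum_distrib_left)
 also have "\<dots> = (\<Sum>i\<in>I. c i * d' i) + (\<Sum>\<alpha>\<in>P. \<Sum>i\<in>I. c i * (mult_inner \<xi> \<alpha> * ((f i x - f i (root_reflection \<alpha> x)) / of_real (\<alpha> \<bullet> x))))"
  unfolding sum.distrib by (subst (2) sum.swap) (rule refl)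
 also have "\<dots> = (\<Sum>i\<in>I. c i * d' i) + (\<Sum>\<alpha>\<in>P. mult_inner \<xi> \<alpha> * (((\<Sum>i\<in>I. c i * f i x) - (\<Sum>i\<in>I. c i * f i (root_reflection \<alpha> x))) / of_real (\<alpha> \<bullet> x)))"
  unfolding sum_subtractf[symmetric] sum_divide_distrib sum_distrib_left
  by (intro arg_cong2[where f = "(+)"] refl sum.cong) (simp add: right_diff_distrib diff_divide_distrib mult_ac)
 finally show ?thesis unfolding D by simp
qed

lemma dunkl_op_poly_sum:
 assumes "\<And>i. i \<in> I ==> polynomial_function (p i)" "finite I"
 shows "dunkl_op P k \<xi> (%x. \<Sum>i\<in>I. c i * p i x) x = (\<Sum>i\<in>I. c i * dunkl_op P k \<xi> (p i) x)"
proof (rule eq_on_regular_imp_eq)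
 show "continuous_on UNIV (dunkl_op P k \<xi> (%x. \<Sum>i\<in>I. c i * p i x))"
  using assms by (intro continuous_on_polynomial polynomial_dunkl_op polynomial_intros) auto
 show "continuous_on UNIV (%x. \<Sum>i\<in>I. c i * dunkl_op P k \<xi> (p i) x)"
  using assms by (intro continuous_on_polynomial polynomial_intros polynomial_dunkl_op) auto
 show "dunkl_op P k \<xi> (%x. \<Sum>i\<in>I. c i * p i x) x = (\<Sum>i\<in>I. c i * dunkl_op P k \<xi> (p i) x)" if "x \<in> regular" for x
  using that assms polynomial_has_dir_deriv by (intro dunkl_op_sum) blast+
qed

lemma dunkl_laplacian_poly_sum:
 assumes "\<And>i. i \<in> I ==> polynomial_function (p i)" "finite I"
 shows "dunkl_laplacian P k (%x. \<Sum>i\<in>I. c i * p i x) x = (\<Sum>i\<in>I. c i * dunkl_laplacian P k (p i) x)"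
proof -
 have "dunkl_op P k b (dunkl_op P k b (%x. \<Sum>i\<in>I. c i * p i x)) x = (\<Sum>i\<in>I. c i * dunkl_op P k b (dunkl_op P k b (p i)) x)" for b
 proof -
  have "dunkl_op P k b (%x. \<Sum>i\<in>I. c i * p i x) = (%x. \<Sum>i\<in>I. c i * dunkl_op P k b (p i) x)"
   by (rule ext) (rule dunkl_op_poly_sum[OF assms])
  then show ?thesis using assms by (simp add: dunkl_op_poly_sum polynomial_dunkl_op)
 qed
 then show ?thesis
  unfolding dunkl_laplacian_def sum_distrib_left by (subst sum.swap) simp
qed

lemma dunkl_laplacian_poly_diff:
 assumes "polynomial_function p" "polynomial_function q"
 shows "dunkl_laplacian P k (%x. p x - q x) x = dunkl_laplacian P k p x - dunkl_laplacian P k q x"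
 using dunkl_laplacian_poly_sum[of "UNIV :: bool set" "%b. if b then p else q" "%b. if b then 1 else -1" x] assms
 by (simp add: UNIV_bool algebra_simps)

text \<open>
 Euler's identity for the degree, and its analogue for the other order of composition; together
 they give the number \<open>2m + N + 2\<langle>k\<rangle>\<close> that fixes the spectrum.
\<close>

definition homogeneous :: "nat => (real^'n => complex) => bool" where
 "homogeneous m p \<longleftrightarrow> (\<forall>t x. p (t *\<^sub>R x) = of_real (t ^ m) * p x)"

lemma sum_Basis_inner: "(\<Sum>b\<in>Basis. (x \<bullet> b) * (y \<bullet> b)) = x \<bullet> (y :: real^'n)"
 by (rule euclidean_inner[symmetric])

lemma Euler_identity:
 assumes p: "polynomial_function p" and hom: "homogeneous m p"
 shows "(\<Sum>b\<in>Basis. of_real (x \<bullet> b) * dir_deriv b p x) = of_nat m * p x"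
proof -
 have lin: "linear (%\<xi>. dir_deriv \<xi> p x)"
  by (rule has_derivative_linear[OF polynomial_has_derivative(1)[OF p]])
 have "dir_deriv x p x = dir_deriv (\<Sum>b\<in>Basis. (x \<bullet> b) *\<^sub>R b) p x"
  by (simp add: euclidean_representation)
 also have "\<dots> = (\<Sum>b\<in>Basis. (x \<bullet> b) *\<^sub>R dir_deriv b p x)"
  by (simp add: linear_sum[OF lin] linear_scale[OF lin])
 finally have 1: "dir_deriv x p x = (\<Sum>b\<in>Basis. of_real (x \<bullet> b) * dir_deriv b p x)"
  by (simp add: scaleR_conv_of_real)
 have "p (x + t *\<^sub>R x) = of_real ((1 + t) ^ m) * p x" for t
  using hom[unfolded homogeneous_def, rule_format, of "1 + t" x] by (simp add: scaleR_add_left)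
 moreover have "((%t. of_real ((1 + t) ^ m) * p x) has_vector_derivative of_real (of_nat m) * p x) (at 0)"
  by (intro has_vector_derivative_mult_left has_vector_derivative_of_real)
   (auto intro!: derivative_eq_intros simp: has_real_derivative_iff_has_vector_derivative[symmetric])
 ultimately have "dir_deriv x p x = of_nat m * p x" by (intro dir_deriv_eqI) simp
 then show ?thesis using 1 by simp
qed

lemma dunkl_degree_left:
 assumes p: "polynomial_function p" and hom: "homogeneous m p" and x: "x \<in> regular"
 shows "(\<Sum>b\<in>Basis. of_real (x \<bullet> b) * dunkl_op P k b p x)
  = of_nat m * p x + (\<Sum>\<alpha>\<in>P. of_real (k \<alpha>) * (p x - p (root_reflection \<alpha> x)))"
proof -
 define Q where "Q \<alpha> = (p x - p (root_reflection \<alpha> x)) / of_real (\<alpha> \<bullet> x)" for \<alpha>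
 have "(\<Sum>b\<in>Basis. of_real (x \<bullet> b) * dunkl_op P k b p x)
   = (\<Sum>b\<in>Basis. of_real (x \<bullet> b) * dir_deriv b p x) + (\<Sum>b\<in>Basis. \<Sum>\<alpha>\<in>P. of_real (k \<alpha> * ((\<alpha> \<bullet> b) * (x \<bullet> b))) * Q \<alpha>)"
  unfolding dunkl_op_polynomial_regular[OF p x] Q_def[symmetric]
  by (simp add: distrib_left sum.distrib sum_distrib_left mult_ac)
 also have "(\<Sum>b\<in>Basis. \<Sum>\<alpha>\<in>P. of_real (k \<alpha> * ((\<alpha> \<bullet> b) * (x \<bullet> b))) * Q \<alpha>)
   = (\<Sum>\<alpha>\<in>P. of_real (k \<alpha> * (\<Sum>b\<in>Basis. (\<alpha> \<bullet> b) * (x \<bullet> b))) * Q \<alpha>)"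
  by (subst sum.swap) (simp add: sum_distrib_left sum_distrib_right)
 also have "\<dots> = (\<Sum>\<alpha>\<in>P. of_real (k \<alpha>) * (p x - p (root_reflection \<alpha> x)))"
  unfolding sum_Basis_inner Q_def using regular_P[OF x] by (intro sum.cong) auto
 finally show ?thesis unfolding Euler_identity[OF p hom] .
qed

lemma dunkl_degree_right:
 assumes p: "polynomial_function p" and hom: "homogeneous m p" and x: "x \<in> regular"
 shows "(\<Sum>b\<in>Basis. dunkl_op P k b (%y. of_real (y \<bullet> b) * p y) x)
  = (of_nat m + of_nat CARD('n)) * p x + (\<Sum>\<alpha>\<in>P. of_real (k \<alpha>) * (p x + p (root_reflection \<alpha> x)))"
proof -
 let ?r = root_reflection
 have 1: "dunkl_op P k b (%y. of_real (y \<bullet> b) * p y) x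
   = p x + of_real (x \<bullet> b) * dir_deriv b p x
    + (\<Sum>\<alpha>\<in>P. of_real (k \<alpha>) / of_real (\<alpha> \<bullet> x) * (of_real ((\<alpha> \<bullet> b) * (x \<bullet> b)) * p x - of_real ((\<alpha> \<bullet> b) * (?r \<alpha> x \<bullet> b)) * p (?r \<alpha> x)))"
  if b: "b \<in> Basis" for b
 proof -
  have "((%t. of_real ((x + t *\<^sub>R b) \<bullet> b) * p (x + t *\<^sub>R b)) has_vector_derivative
    of_real ((x + 0 *\<^sub>R b) \<bullet> b) * dir_deriv b p x + of_real 1 * p (x + 0 *\<^sub>R b)) (at 0)"
   by (intro has_vector_derivative_mult polynomial_has_dir_deriv p has_vector_derivative_of_real)
    (use b in \<open>auto intro!: derivative_eq_intros simp: has_real_derivative_iff_has_vector_derivative[symmetric] inner_add_left inner_Basis\<close>)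
  then have "has_dir_deriv (%y. of_real (y \<bullet> b) * p y) b (p x + of_real (x \<bullet> b) * dir_deriv b p x) x"
   by (simp add: add.commute)
  note D = dunkl_op_regular[OF x this]
  show ?thesis unfolding D
   by (intro arg_cong2[where f = "(+)"] refl sum.cong) (simp add: algebra_simps diff_divide_distrib)
 qed
 have "(\<Sum>b\<in>Basis. dunkl_op P k b (%y. of_real (y \<bullet> b) * p y) x)
   = of_nat CARD('n) * p x + of_nat m * p x
    + (\<Sum>b\<in>Basis. \<Sum>\<alpha>\<in>P. of_real (k \<alpha>) / of_real (\<alpha> \<bullet> x) * (of_real ((\<alpha> \<bullet> b) * (x \<bullet> b)) * p x - of_real ((\<alpha> \<bullet> b) * (?r \<alpha> x \<bullet> b)) * p (?r \<alpha> x)))"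
  by (simp add: 1 sum.distrib Euler_identity[OF p hom])
 also have "(\<Sum>b\<in>Basis. \<Sum>\<alpha>\<in>P. of_real (k \<alpha>) / of_real (\<alpha> \<bullet> x) * (of_real ((\<alpha> \<bullet> b) * (x \<bullet> b)) * p x - of_real ((\<alpha> \<bullet> b) * (?r \<alpha> x \<bullet> b)) * p (?r \<alpha> x)))
   = (\<Sum>\<alpha>\<in>P. of_real (k \<alpha>) / of_real (\<alpha> \<bullet> x) * (of_real (\<Sum>b\<in>Basis. (\<alpha> \<bullet> b) * (x \<bullet> b)) * p x - of_real (\<Sum>b\<in>Basis. (\<alpha> \<bullet> b) * (?r \<alpha> x \<bullet> b)) * p (?r \<alpha> x)))"
  by (subst sum.swap) (simp only: sum_distrib_left sum_distrib_right of_real_sum sum_subtractf[symmetric])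
 also have "\<dots> = (\<Sum>\<alpha>\<in>P. of_real (k \<alpha>) * (p x + p (?r \<alpha> x)))"
 proof (rule sum.cong[OF refl])
  fix \<alpha> assume \<alpha>: "\<alpha> \<in> P"
  show "of_real (k \<alpha>) / of_real (\<alpha> \<bullet> x) * (of_real (\<Sum>b\<in>Basis. (\<alpha> \<bullet> b) * (x \<bullet> b)) * p x - of_real (\<Sum>b\<in>Basis. (\<alpha> \<bullet> b) * (?r \<alpha> x \<bullet> b)) * p (?r \<alpha> x))
    = of_real (k \<alpha>) * (p x + p (?r \<alpha> x))"
   unfolding sum_Basis_inner inner_root_reflection_self[OF P_nonzero[OF \<alpha>]]
   using regular_P[OF x \<alpha>] by (simp add: field_simps)
 qed
 finally show ?thesis by (simp add: algebra_simps)
qed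

subsection \<open>The Dunkl Laplacian of a polynomial times a radial function\<close>

lemma has_dir_deriv_radial:
 fixes \<Phi> :: "real => real"
 assumes p: "polynomial_function p" and x: "x \<noteq> 0"
  and \<Phi>: "\<forall>s>0. (\<Phi> has_real_derivative \<Phi>' s) (at s)"
 shows "has_dir_deriv (%y. p y * of_real (\<Phi> (y \<bullet> y))) \<xi>
  (dir_deriv \<xi> p x * of_real (\<Phi> (x \<bullet> x)) + of_real (2 * (x \<bullet> \<xi>)) * p x * of_real (\<Phi>' (x \<bullet> x))) x"
proof -
 have "((%t. (x + t *\<^sub>R \<xi>) \<bullet> (x + t *\<^sub>R \<xi>)) has_real_derivative 2 * (x \<bullet> \<xi>)) (at 0)"
  unfolding inner_add_left inner_add_right
  by (auto intro!: derivative_eq_intros simp: inner_commute)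
 moreover have "(\<Phi> has_real_derivative \<Phi>' (x \<bullet> x)) (at ((x + 0 *\<^sub>R \<xi>) \<bullet> (x + 0 *\<^sub>R \<xi>)))"
  using \<Phi> x by simp
 ultimately have "((%t. \<Phi> ((x + t *\<^sub>R \<xi>) \<bullet> (x + t *\<^sub>R \<xi>))) has_real_derivative \<Phi>' (x \<bullet> x) * (2 * (x \<bullet> \<xi>))) (at 0)"
  using DERIV_chain2[where f = \<Phi> and g = "%t. (x + t *\<^sub>R \<xi>) \<bullet> (x + t *\<^sub>R \<xi>)" and x = 0] by blast
 then have "((%t. p (x + t *\<^sub>R \<xi>) * of_real (\<Phi> ((x + t *\<^sub>R \<xi>) \<bullet> (x + t *\<^sub>R \<xi>)))) has_vector_derivative
   p (x + 0 *\<^sub>R \<xi>) * of_real (\<Phi>' (x \<bullet> x) * (2 * (x \<bullet> \<xi>))) + dir_deriv \<xi> p x * of_real (\<Phi> ((x + 0 *\<^sub>R \<xi>) \<bullet> (x + 0 *\<^sub>R \<xi>)))) (at 0)"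
  by (intro has_vector_derivative_mult polynomial_has_dir_deriv p has_vector_derivative_of_real)
   (simp add: has_real_derivative_iff_has_vector_derivative)
 then show ?thesis by (simp add: add.commute mult_ac)
qed

lemma dunkl_op_radial:
 fixes \<Phi> :: "real => real"
 assumes p: "polynomial_function p" and x: "x \<in> regular"
  and \<Phi>: "\<forall>s>0. (\<Phi> has_real_derivative \<Phi>' s) (at s)"
 shows "dunkl_op P k \<xi> (%y. p y * of_real (\<Phi> (y \<bullet> y))) x
  = dunkl_op P k \<xi> p x * of_real (\<Phi> (x \<bullet> x)) + of_real (2 * (x \<bullet> \<xi>)) * p x * of_real (\<Phi>' (x \<bullet> x))"
proof -
 have x0: "x \<noteq> 0" using x by (simp add: regular_def)
 have inv: "root_reflection \<alpha> x \<bullet> root_reflection \<alpha> x = x \<bullet> x" if "\<alpha> \<in> P" for \<alpha>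
  using root_reflection_inner_inner[OF P_nonzero[OF that]] .
 have S: "(\<Sum>\<alpha>\<in>P. mult_inner \<xi> \<alpha> * ((p x * of_real (\<Phi> (x \<bullet> x))
    - p (root_reflection \<alpha> x) * of_real (\<Phi> (root_reflection \<alpha> x \<bullet> root_reflection \<alpha> x))) / of_real (\<alpha> \<bullet> x)))
   = (\<Sum>\<alpha>\<in>P. mult_inner \<xi> \<alpha> * ((p x - p (root_reflection \<alpha> x)) / of_real (\<alpha> \<bullet> x))) * of_real (\<Phi> (x \<bullet> x))"
  unfolding sum_distrib_right
  by (intro sum.cong refl) (simp add: inv left_diff_distrib right_diff_distrib diff_divide_distrib mult.assoc)
 show ?thesis
  unfolding dunkl_op_regular[OF x has_dir_deriv_radial[OF p x0 \<Phi>]] dunkl_op_polynomial_regular[OF p x] S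
  by (simp add: distrib_right)
qed

text \<open>
 The reflections fix radial functions, so only the derivative in \<open>T\<^sub>\<xi>\<close> acts on the radial factor. The
 mixed terms combine into the two degree identities.
\<close>

theorem dunkl_laplacian_radial:
 fixes \<Phi> :: "real => real"
 assumes p: "polynomial_function p" and hom: "homogeneous m p" and x: "x \<in> regular"
  and \<Phi>: "\<forall>s>0. (\<Phi> has_real_derivative \<Phi>' s) (at s)"
  and \<Phi>': "\<forall>s>0. (\<Phi>' has_real_derivative \<Phi>'' s) (at s)"
 shows "dunkl_laplacian P k (%y. p y * of_real (\<Phi> (y \<bullet> y))) x
  = dunkl_laplacian P k p x * of_real (\<Phi> (x \<bullet> x))
   + p x * of_real (2 * (2 * real m + real CARD('n) + 2 * mult_sum P k) * \<Phi>' (x \<bullet> x) + 4 * (x \<bullet> x) * \<Phi>'' (x \<bullet> x))"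
proof -
 have x0: "x \<noteq> 0" using x by (simp add: regular_def)
 define s where "s = x \<bullet> x"
 have second: "dunkl_op P k b (dunkl_op P k b (%y. p y * of_real (\<Phi> (y \<bullet> y)))) x
   = dunkl_op P k b (dunkl_op P k b p) x * of_real (\<Phi> s)
    + 2 * of_real (\<Phi>' s) * (of_real (x \<bullet> b) * dunkl_op P k b p x + dunkl_op P k b (%y. of_real (y \<bullet> b) * p y) x)
    + 4 * of_real (\<Phi>'' s) * p x * of_real ((x \<bullet> b) * (x \<bullet> b))" for b
 proof -
  define q where "q y = of_real (y \<bullet> b) * p y" for y
  have q: "polynomial_function q" unfolding q_def
   by (intro polynomial_intros p)
  define F where "F j y = (if j then dunkl_op P k b p y * of_real (\<Phi> (y \<bullet> y)) else q y * of_real (\<Phi>' (y \<bullet> y)))" for j y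
  have "dunkl_op P k b (dunkl_op P k b (%y. p y * of_real (\<Phi> (y \<bullet> y)))) x
    = dunkl_op P k b (%y. \<Sum>j\<in>UNIV. (if j then 1 else 2) * F j y) x"
   by (rule dunkl_op_cong[OF x]) (simp add: dunkl_op_radial[OF p _ \<Phi>] UNIV_bool F_def q_def)
  also have "\<dots> = (\<Sum>j\<in>UNIV. (if j then 1 else 2) * dunkl_op P k b (F j) x)"
  proof (rule dunkl_op_sum[OF x])
   fix j :: bool
   show "\<exists>d. has_dir_deriv (F j) b d x"
    using has_dir_deriv_radial[OF polynomial_dunkl_op[OF p] x0 \<Phi>] has_dir_deriv_radial[OF q x0 \<Phi>']
    unfolding F_def by (cases j) (simp_all, blast+)
  qed
  also have "\<dots> = dunkl_op P k b (%y. dunkl_op P k b p y * of_real (\<Phi> (y \<bullet> y))) x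
    + 2 * dunkl_op P k b (%y. q y * of_real (\<Phi>' (y \<bullet> y))) x"
   by (simp add: UNIV_bool F_def[abs_def])
  also have "\<dots> = dunkl_op P k b (dunkl_op P k b p) x * of_real (\<Phi> s) + of_real (2 * (x \<bullet> b)) * dunkl_op P k b p x * of_real (\<Phi>' s)
    + 2 * (dunkl_op P k b q x * of_real (\<Phi>' s) + of_real (2 * (x \<bullet> b)) * q x * of_real (\<Phi>'' s))"
   by (simp only: dunkl_op_radial[OF polynomial_dunkl_op[OF p] x \<Phi>] dunkl_op_radial[OF q x \<Phi>'] s_def)
  finally show ?thesis by (simp add: q_def[abs_def] algebra_simps)
 qed
 have "dunkl_laplacian P k (%y. p y * of_real (\<Phi> (y \<bullet> y))) x
   = dunkl_laplacian P k p x * of_real (\<Phi> s)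
    + 2 * of_real (\<Phi>' s) * ((\<Sum>b\<in>Basis. of_real (x \<bullet> b) * dunkl_op P k b p x) + (\<Sum>b\<in>Basis. dunkl_op P k b (%y. of_real (y \<bullet> b) * p y) x))
    + 4 * of_real (\<Phi>'' s) * p x * of_real (\<Sum>b\<in>Basis. (x \<bullet> b) * (x \<bullet> b))"
  unfolding dunkl_laplacian_def second
  by (simp only: sum.distrib sum_distrib_left[symmetric] sum_distrib_right[symmetric] of_real_sum[symmetric])
 also have "(\<Sum>b\<in>Basis. of_real (x \<bullet> b) * dunkl_op P k b p x) + (\<Sum>b\<in>Basis. dunkl_op P k b (%y. of_real (y \<bullet> b) * p y) x)
   = of_real (2 * real m + real CARD('n) + 2 * mult_sum P k) * p x"
  unfolding dunkl_degree_left[OF p hom x] dunkl_degree_right[OF p hom x]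
  by (simp add: mult_sum_def algebra_simps sum.distrib sum_subtractf sum_distrib_left sum_distrib_right)
 also have "(\<Sum>b\<in>Basis. (x \<bullet> b) * (x \<bullet> b)) = s" unfolding s_def by (rule sum_Basis_inner)
 finally show ?thesis by (simp add: s_def algebra_simps)
qed

end

subsection \<open>Decomposition of polynomials into harmonic ones\<close>

context dunkl begin

lemma dunkl_op_homogeneous:
 assumes p: "polynomial_function p" and t: "t \<noteq> 0" and hom: "\<And>x. p (t *\<^sub>R x) = z * p x"
 shows "of_real t * dunkl_op P k \<xi> p (t *\<^sub>R x) = z * dunkl_op P k \<xi> p x"
proof -
 have dd: "of_real t * dir_deriv \<xi> p (t *\<^sub>R x) = z * dir_deriv \<xi> p x" for \<xi>
 proof -
  have lin: "linear (%\<xi>. dir_deriv \<xi> p (t *\<^sub>R x))"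
   by (rule has_derivative_linear[OF polynomial_has_derivative(1)[OF p]])
  have "has_dir_deriv p (t *\<^sub>R \<xi>) (dir_deriv (t *\<^sub>R \<xi>) p (t *\<^sub>R x)) (t *\<^sub>R x)"
   by (rule polynomial_has_dir_deriv[OF p])
  also have "(%s. p (t *\<^sub>R x + s *\<^sub>R t *\<^sub>R \<xi>)) = (%s. z * p (x + s *\<^sub>R \<xi>))"
   using hom[of "x + _ *\<^sub>R \<xi>"] by (simp add: scaleR_add_right mult.commute)
  finally have "((%s. z * p (x + s *\<^sub>R \<xi>)) has_vector_derivative dir_deriv (t *\<^sub>R \<xi>) p (t *\<^sub>R x)) (at 0)" .
  moreover have "((%s. z * p (x + s *\<^sub>R \<xi>)) has_vector_derivative z * dir_deriv \<xi> p x) (at 0)"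
   by (intro has_vector_derivative_mult_right polynomial_has_dir_deriv p)
  ultimately show ?thesis
   using vector_derivative_unique_at linear_scale[OF lin] by (metis scaleR_conv_of_real)
 qed
 have "of_real t * root_quotient \<alpha> p (t *\<^sub>R x) = z * root_quotient \<alpha> p x" for \<alpha>
 proof (cases "\<alpha> \<bullet> x = 0")
  case True
  then show ?thesis using dd[of \<alpha>] by (simp add: root_quotient_def)
 next
  case False
  have "root_reflection \<alpha> (t *\<^sub>R x) = t *\<^sub>R root_reflection \<alpha> x"
   by (rule linear_scale[OF root_reflection_linear])
  then show ?thesis using False t by (simp add: root_quotient_def hom field_simps)
 qed
 then have "(\<Sum>\<alpha>\<in>P. mult_inner \<xi> \<alpha> * (of_real t * root_quotient \<alpha> p (t *\<^sub>R x)))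
   = (\<Sum>\<alpha>\<in>P. mult_inner \<xi> \<alpha> * (z * root_quotient \<alpha> p x))" by simp
 then show ?thesis using dd[of \<xi>]
  by (simp add: dunkl_op_def distrib_left sum_distrib_left mult_ac)
qed

lemma dunkl_laplacian_homogeneous:
 assumes p: "polynomial_function p" and t: "t \<noteq> 0" and hom: "homogeneous m p"
 shows "of_real (t\<^sup>2) * dunkl_laplacian P k p (t *\<^sub>R x) = of_real (t ^ m) * dunkl_laplacian P k p x"
proof -
 have "of_real (t\<^sup>2) * dunkl_op P k b (dunkl_op P k b p) (t *\<^sub>R x) = of_real (t ^ m) * dunkl_op P k b (dunkl_op P k b p) x" for b
 proof -
  have "dunkl_op P k b p (t *\<^sub>R x) = of_real (t ^ m) / of_real t * dunkl_op P k b p x" for x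
   using dunkl_op_homogeneous[OF p t, of "of_real (t ^ m)" b x] hom t by (simp add: homogeneous_def field_simps)
  from dunkl_op_homogeneous[OF polynomial_dunkl_op[OF p] t this, of b x]
  show ?thesis using t by (simp add: power2_eq_square field_simps)
 qed
 then show ?thesis unfolding dunkl_laplacian_def sum_distrib_left by simp
qed

lemma tendsto_scale_0:
 assumes "continuous_on UNIV (f :: real^'n => complex)"
 shows "((%t. f (t *\<^sub>R x)) \<longlongrightarrow> f 0) (at 0)"
proof -
 have "continuous_on UNIV (%t. f (t *\<^sub>R x))"
  by (intro continuous_on_compose2[OF assms] continuous_intros) auto
 then have "isCont (%t. f (t *\<^sub>R x)) 0" by (simp add: continuous_on_eq_continuous_at)
 then show ?thesis by (simp add: isCont_def)
qed

lemma dunkl_laplacian_low_degree: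
 assumes p: "polynomial_function p" and hom: "homogeneous m p" and "m < 2"
 shows "dunkl_laplacian P k p x = 0"
proof -
 let ?L = "dunkl_laplacian P k p"
 have L: "continuous_on UNIV ?L" by (intro continuous_on_polynomial polynomial_dunkl_laplacian p)
 have eq: "of_real (t ^ (2 - m)) * ?L (t *\<^sub>R x) = ?L x" if "t \<noteq> 0" for t
 proof -
  have "of_real (t ^ m) * (of_real (t ^ (2 - m)) * ?L (t *\<^sub>R x)) = of_real (t ^ m) * ?L x"
   using dunkl_laplacian_homogeneous[OF p that hom, of x] \<open>m < 2\<close>
   by (simp add: mult.assoc[symmetric] flip: of_real_mult power_add of_real_power)
  then show ?thesis using that by simp
 qed
 have "((%t. of_real (t ^ (2 - m)) * ?L (t *\<^sub>R x)) \<longlongrightarrow> of_real (0 ^ (2 - m)) * ?L 0) (at 0)"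
  by (intro tendsto_mult tendsto_scale_0[OF L] tendsto_of_real tendsto_power tendsto_ident_at)
 moreover have "\<forall>\<^sub>F t in at (0::real). of_real (t ^ (2 - m)) * ?L (t *\<^sub>R x) = ?L x"
  using eq by (auto simp: eventually_at_filter)
 ultimately have "((%t::real. ?L x) \<longlongrightarrow> of_real (0 ^ (2 - m)) * ?L 0) (at 0)"
  by (rule Lim_transform_eventually)
 then have "?L x = of_real (0 ^ (2 - m)) * ?L 0" by (simp add: tendsto_const_iff)
 then show ?thesis using \<open>m < 2\<close> by simp
qed

lemma homogeneous_dunkl_laplacian:
 assumes p: "polynomial_function p" and hom: "homogeneous (Suc (Suc m)) p"
 shows "homogeneous m (dunkl_laplacian P k p)"
 unfolding homogeneous_def
proof (intro allI)
 fix t :: real and x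
 let ?L = "dunkl_laplacian P k p"
 have L: "continuous_on UNIV ?L" by (intro continuous_on_polynomial polynomial_dunkl_laplacian p)
 have eq: "?L (t *\<^sub>R x) = of_real (t ^ m) * ?L x" if "t \<noteq> 0" for t
  using dunkl_laplacian_homogeneous[OF p that hom, of x] that by (simp add: power2_eq_square mult.assoc)
 show "?L (t *\<^sub>R x) = of_real (t ^ m) * ?L x"
 proof (cases "t = 0")
  case True
  have "((%t. of_real (t ^ m) * ?L x) \<longlongrightarrow> of_real (0 ^ m) * ?L x) (at (0::real))"
   by (intro tendsto_mult tendsto_const tendsto_of_real tendsto_power tendsto_ident_at)
  moreover have "((%t. of_real (t ^ m) * ?L x) \<longlongrightarrow> ?L 0) (at (0::real))"
   by (rule Lim_transform_eventually[OF tendsto_scale_0[OF L, of x]]) (use eq in \<open>auto simp: eventually_at_filter\<close>)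
  ultimately have "?L 0 = of_real (0 ^ m) * ?L x"
   by (intro tendsto_unique[of "at (0::real)"]) auto
  then show ?thesis using True by simp
 qed (rule eq)
qed

lemma dunkl_harmonics_iff:
 "p \<in> dunkl_harmonics P k m \<longleftrightarrow> polynomial_function p \<and> homogeneous m p \<and> (\<forall>x. dunkl_laplacian P k p x = 0)"
 by (simp add: dunkl_harmonics_def homogeneous_def)

lemma harmonics_zero: "(%x. 0) \<in> dunkl_harmonics P k m"
 using dunkl_laplacian_poly_sum[of "{}" "%_ _. 0" "%_. 0"]
 by (auto simp: dunkl_harmonics_iff homogeneous_def)

lemma harmonics_scale:
 assumes "p \<in> dunkl_harmonics P k m" shows "(%x. c * p x) \<in> dunkl_harmonics P k m"
 using assms dunkl_laplacian_poly_sum[of "{()}" "%_. p" "%_. c"]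
 by (auto simp: dunkl_harmonics_iff homogeneous_def intro: polynomial_function_complex_mult)

lemma harmonics_cnj:
 assumes "p \<in> dunkl_harmonics P k m" shows "(%x. cnj (p x)) \<in> dunkl_harmonics P k m"
proof -
 have T: "dunkl_op P k b (%x. cnj (q x)) x = cnj (dunkl_op P k b q x)" if q: "polynomial_function q" for q b x
 proof -
  have dd: "dir_deriv \<xi> (%x. cnj (q x)) x = cnj (dir_deriv \<xi> q x)" for \<xi>
  proof (rule dir_deriv_eqI)
   show "has_dir_deriv (%x. cnj (q x)) \<xi> (cnj (dir_deriv \<xi> q x)) x"
    using bounded_linear.has_vector_derivative[OF bounded_linear_cnj polynomial_has_dir_deriv[OF q]] .
  qed
  have "root_quotient \<alpha> (%x. cnj (q x)) x = cnj (root_quotient \<alpha> q x)" for \<alpha>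
   by (simp add: root_quotient_def dd)
  then show ?thesis by (simp add: dunkl_op_def dd)
 qed
 have p: "polynomial_function p" using assms by (simp add: dunkl_harmonics_iff)
 have "dunkl_op P k b (%x. cnj (p x)) = (%x. cnj (dunkl_op P k b p x))" for b
  by (rule ext) (rule T[OF p])
 then have "dunkl_laplacian P k (%x. cnj (p x)) x = cnj (dunkl_laplacian P k p x)" for x
  by (simp add: dunkl_laplacian_def T[OF polynomial_dunkl_op[OF p]])
 then show ?thesis using assms by (auto simp: dunkl_harmonics_iff homogeneous_def polynomial_function_cnj)
qed

lemma dunkl_laplacian_power_harmonic:
 assumes h: "h \<in> dunkl_harmonics P k m"
 shows "dunkl_laplacian P k (%x. of_real ((x \<bullet> x) ^ Suc j) * h x) x
  = of_real (2 * (real j + 1) * (2 * real m + real CARD('n) + 2 * mult_sum P k + 2 * real j)) * (of_real ((x \<bullet> x) ^ j) * h x)"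
proof (rule eq_on_regular_imp_eq)
 have hp: "polynomial_function h" and hh: "homogeneous m h" and h0: "\<And>x. dunkl_laplacian P k h x = 0"
  using h by (auto simp: dunkl_harmonics_iff)
 have pw: "polynomial_function (%x. of_real ((x \<bullet> x) ^ i) * h x)" for i
  by (intro polynomial_intros hp)
 show "continuous_on UNIV (dunkl_laplacian P k (%x. of_real ((x \<bullet> x) ^ Suc j) * h x))"
  by (intro continuous_on_polynomial polynomial_dunkl_laplacian pw)
 show "continuous_on UNIV (%x. of_real (2 * (real j + 1) * (2 * real m + real CARD('n) + 2 * mult_sum P k + 2 * real j)) * (of_real ((x \<bullet> x) ^ j) * h x))"
  by (intro continuous_on_mult continuous_on_const continuous_on_polynomial pw)
 fix x assume x: "x \<in> regular"
 define \<Phi>2 :: "real => real" where "\<Phi>2 s = (real j + 1) * (real j * s ^ (j - 1))" for s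
 have 1: "\<forall>s>0. ((%s. s ^ Suc j) has_real_derivative (real j + 1) * s ^ j) (at s)"
  using DERIV_pow[of "Suc j"] by (auto simp: add.commute)
 have 2: "\<forall>s>0. ((%s. (real j + 1) * s ^ j) has_real_derivative \<Phi>2 s) (at s)"
  unfolding \<Phi>2_def by (auto intro!: derivative_eq_intros)
 have 3: "4 * s * \<Phi>2 s = 4 * (real j + 1) * real j * s ^ j" for s
  unfolding \<Phi>2_def by (cases j) auto
 have "dunkl_laplacian P k (%x. of_real ((x \<bullet> x) ^ Suc j) * h x) x
   = h x * of_real (2 * (2 * real m + real CARD('n) + 2 * mult_sum P k) * ((real j + 1) * (x \<bullet> x) ^ j) + 4 * (x \<bullet> x) * \<Phi>2 (x \<bullet> x))"
  using dunkl_laplacian_radial[OF hp hh x 1 2] by (simp add: h0 mult.commute)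
 then show "dunkl_laplacian P k (%x. of_real ((x \<bullet> x) ^ Suc j) * h x) x
  = of_real (2 * (real j + 1) * (2 * real m + real CARD('n) + 2 * mult_sum P k + 2 * real j)) * (of_real ((x \<bullet> x) ^ j) * h x)"
  unfolding 3 by (simp add: algebra_simps)
qed

text \<open>
 By induction on the degree \<open>\<Delta>q\<close> has such a decomposition; each of its terms
 \<open>\<parallel>x\<parallel>\<^bsup>2j\<^esup> h\<^sub>j\<close> is the Laplacian of a positive multiple of \<open>\<parallel>x\<parallel>\<^bsup>2j+2\<^esup> h\<^sub>j\<close>, and subtracting
 those multiples from \<open>q\<close> leaves a harmonic polynomial.
\<close>

theorem harmonic_decomposition:
 assumes "polynomial_function q" "homogeneous n q"
 shows "\<exists>h. (\<forall>j. \<exists>m. h j \<in> dunkl_harmonics P k m) \<and> (\<forall>x. q x = (\<Sum>j\<le>n. of_real ((x \<bullet> x) ^ j) * h j x))"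
proof -
 have "\<exists>h. (\<forall>j. if 2 * j \<le> n then h j \<in> dunkl_harmonics P k (n - 2 * j) else h j = (%x. 0)) \<and>
   (\<forall>x. q x = (\<Sum>j\<le>n. of_real ((x \<bullet> x) ^ j) * h j x))"
  using assms
 proof (induction n arbitrary: q rule: less_induct)
  case (less n)
  note q = less.prems(1) and hom = less.prems(2)
  show ?case
  proof (cases "n < 2")
   case True
   then have "q \<in> dunkl_harmonics P k n"
    using q hom dunkl_laplacian_low_degree[OF q hom] by (auto simp: dunkl_harmonics_iff)
   moreover have "(\<Sum>j\<le>n. of_real ((x \<bullet> x) ^ j) * (if j = 0 then q else (%x. 0)) x) = q x" for x
    by (subst sum.mono_neutral_right[of _ "{0}"]) auto
   moreover have "j = 0" if "2 * j \<le> n" for j using that True by linarith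
   ultimately show ?thesis
    by (intro exI[of _ "%j. if j = 0 then q else (%x. 0)"]) force
  next
   case False
   define n' where "n' = n - 2"
   have n: "n = Suc (Suc n')" using False by (simp add: n'_def)
   obtain h' where h': "\<And>j. 2 * j \<le> n' ==> h' j \<in> dunkl_harmonics P k (n' - 2 * j)"
     "\<And>j. \<not> 2 * j \<le> n' ==> h' j = (%x. 0)"
    and L: "\<And>x. dunkl_laplacian P k q x = (\<Sum>j\<le>n'. of_real ((x \<bullet> x) ^ j) * h' j x)"
    using less.IH[of n' "dunkl_laplacian P k q"] polynomial_dunkl_laplacian[OF q] homogeneous_dunkl_laplacian[OF q hom[unfolded n]]
    by (auto simp: n split: if_splits)
   define c where "c j = 2 * (real j + 1) * (2 * real (n' - 2 * j) + real CARD('n) + 2 * mult_sum P k + 2 * real j)" for j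
   have c: "c j > 0" for j
    unfolding c_def using mult_sum_nonneg by (intro mult_pos_pos add_pos_nonneg add_nonneg_pos) auto
   define s where "s x = (\<Sum>j\<le>n'. of_real (1 / c j) * (of_real ((x \<bullet> x) ^ Suc j) * h' j x))" for x
   have h'h: "\<exists>m. h' j \<in> dunkl_harmonics P k m" for j
    by (cases "2 * j \<le> n'") (use h' harmonics_zero in auto)
   then have h'p: "polynomial_function (h' j)" for j using dunkl_harmonics_iff by blast
   have pw: "polynomial_function (%x. of_real ((x \<bullet> x) ^ i) * h' j x)" for i j
    by (intro polynomial_intros h'p)
   have sp: "polynomial_function s"
    unfolding s_def by (intro polynomial_intros pw) auto
   have "dunkl_laplacian P k s x = (\<Sum>j\<le>n'. of_real (1 / c j) * dunkl_laplacian P k (%x. of_real ((x \<bullet> x) ^ Suc j) * h' j x) x)" for x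
    unfolding s_def
   proof (rule dunkl_laplacian_poly_sum)
    show "polynomial_function (%x. of_real ((x \<bullet> x) ^ Suc j) * h' j x)" for j by (rule pw)
   qed simp
   also have "\<dots> x = dunkl_laplacian P k q x" for x
    unfolding L
   proof (rule sum.cong[OF refl])
    fix j
    have "dunkl_laplacian P k (%x. of_real ((x \<bullet> x) ^ Suc j) * h' j x) x = of_real (c j) * (of_real ((x \<bullet> x) ^ j) * h' j x)"
    proof (cases "2 * j \<le> n'")
     case True
     then show ?thesis unfolding c_def by (intro dunkl_laplacian_power_harmonic h')
    next
     case False
     then show ?thesis using harmonics_zero[of 0] by (simp add: h'(2) dunkl_harmonics_iff)
    qed
    then show "of_real (1 / c j) * dunkl_laplacian P k (%x. of_real ((x \<bullet> x) ^ Suc j) * h' j x) x = of_real ((x \<bullet> x) ^ j) * h' j x"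
     using c[of j] by simp
   qed
   finally have Ls: "dunkl_laplacian P k s x = dunkl_laplacian P k q x" for x .
   have hs: "homogeneous n s"
    unfolding homogeneous_def
   proof (intro allI)
    fix t :: real and x
    have E: "of_real (((t *\<^sub>R x) \<bullet> (t *\<^sub>R x)) ^ Suc j) * h' j (t *\<^sub>R x) = of_real (t ^ n) * (of_real ((x \<bullet> x) ^ Suc j) * h' j x)" for j
    proof (cases "2 * j \<le> n'")
     case True
     then have "h' j (t *\<^sub>R x) = of_real (t ^ (n' - 2 * j)) * h' j x"
      using h'(1) by (simp add: dunkl_harmonics_iff homogeneous_def)
     moreover have "((t *\<^sub>R x) \<bullet> (t *\<^sub>R x)) ^ Suc j * t ^ (n' - 2 * j) = t ^ n * (x \<bullet> x) ^ Suc j"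
     proof -
      have "((t *\<^sub>R x) \<bullet> (t *\<^sub>R x)) ^ Suc j = t ^ (2 * Suc j) * (x \<bullet> x) ^ Suc j"
       by (simp only: inner_scaleR_left inner_scaleR_right mult.assoc[symmetric] power_mult_distrib power_mult power2_eq_square)
      moreover have "t ^ (2 * Suc j) * t ^ (n' - 2 * j) = t ^ n"
       using True by (simp only: power_add[symmetric] n) simp
      ultimately show ?thesis by (simp only: mult_ac)
     qed
     ultimately show ?thesis by (metis (no_types, lifting) mult.assoc mult.commute of_real_mult)
    next
     case False
     then show ?thesis by (simp add: h'(2))
    qed
    show "s (t *\<^sub>R x) = of_real (t ^ n) * s x"
     unfolding s_def sum_distrib_left E by (simp only: mult_ac)
   qed
   define h0 where "h0 x = q x - s x" for x
   have h0: "h0 \<in> dunkl_harmonics P k n"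
    unfolding dunkl_harmonics_iff h0_def
    using hs hom by (auto simp: dunkl_laplacian_poly_diff q sp Ls homogeneous_def right_diff_distrib intro: q sp)
   define h where "h j = (case j of 0 => h0 | Suc i => if i \<le> n' then (%x. of_real (1 / c i) * h' i x) else (%x. 0))" for j
   show ?thesis
   proof (intro exI[of _ h] conjI allI)
    fix j
    show "if 2 * j \<le> n then h j \<in> dunkl_harmonics P k (n - 2 * j) else h j = (%x. 0)"
    proof (cases j)
     case 0 then show ?thesis using h0 by (simp add: h_def)
    next
     case (Suc i)
     have "n - 2 * j = n' - 2 * i" using Suc n by simp
     then show ?thesis
      using h'(1)[of i] h'(2)[of i] harmonics_scale[of "h' i" "n' - 2 * i" "1 / complex_of_real (c i)"] harmonics_zero
      by (cases "2 * i \<le> n'") (auto simp: h_def Suc n)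
    qed
   next
    fix x
    have "(\<Sum>j\<le>n. of_real ((x \<bullet> x) ^ j) * h j x) = h0 x + (\<Sum>i\<le>Suc n'. of_real ((x \<bullet> x) ^ Suc i) * h (Suc i) x)"
     unfolding n by (subst sum.atMost_Suc_shift) (simp add: h_def)
    also have "(\<Sum>i\<le>Suc n'. of_real ((x \<bullet> x) ^ Suc i) * h (Suc i) x) = s x"
     unfolding s_def by (simp add: h_def mult_ac)
    finally show "q x = (\<Sum>j\<le>n. of_real ((x \<bullet> x) ^ j) * h j x)" by (simp add: h0_def)
   qed
  qed
 qed
 then show ?thesis using harmonics_zero by metis
qed

end

subsection \<open>Monomials\<close>

definition monomial :: "(real^'n) list => real^'n => real" where
 "monomial bs x = prod_list (map (%b. x \<bullet> b) bs)"

inductive_set monomial_span :: "(real^'n => real) set" where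
 monomial: "bs \<in> lists Basis ==> monomial bs \<in> monomial_span"
| add: "f \<in> monomial_span ==> g \<in> monomial_span ==> (%x. f x + g x) \<in> monomial_span"
| scale: "f \<in> monomial_span ==> (%x. c * f x) \<in> monomial_span"

lemma monomial_span_mult:
 assumes "f \<in> monomial_span" "g \<in> monomial_span" shows "(%x. f x * g x) \<in> monomial_span"
 using assms(1)
proof induction
 case (monomial bs)
 note bs = monomial
 show ?case using assms(2)
 proof induction
  case (monomial cs)
  have "(%x. monomial bs x * monomial cs x) = monomial (bs @ cs)"
   by (auto simp: monomial_def)
  then show ?case using bs monomial by (auto intro!: monomial_span.monomial)
 next
  case (add f g) then show ?case by (simp add: distrib_left monomial_span.add)
 next
  case (scale f c)
  then have "(%x. c * (monomial bs x * f x)) \<in> monomial_span" by (intro monomial_span.scale)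
  then show ?case by (simp add: mult.left_commute)
 qed
next
 case (add f g) then show ?case by (simp add: distrib_right monomial_span.add)
next
 case (scale f c)
 then have "(%x. c * (f x * g x)) \<in> monomial_span" by (intro monomial_span.scale)
 then show ?case by (simp add: mult.assoc)
qed

lemma monomial_span_sum:
 "finite I ==> (\<And>i. i \<in> I ==> f i \<in> monomial_span) ==> (%x. \<Sum>i\<in>I. f i x) \<in> monomial_span"
proof (induction I rule: finite_induct)
 case empty
 then show ?case using monomial_span.scale[OF monomial_span.monomial[of "[]"], of 0] by simp
qed (auto intro: monomial_span.add)

lemma real_polynomial_in_monomial_span:
 fixes f :: "real^'n => real"
 assumes "real_polynomial_function f" shows "f \<in> monomial_span"
 using assms
proof induction
 case (linear f)
 have "f x = (\<Sum>b\<in>Basis. f b * monomial [b] x)" for x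
 proof -
  have "f x = f (\<Sum>b\<in>Basis. (x \<bullet> b) *\<^sub>R b)" by (simp add: euclidean_representation)
  also have "\<dots> = (\<Sum>b\<in>Basis. (x \<bullet> b) * f b)"
   by (simp only: linear_sum[OF bounded_linear.linear[OF linear]] linear_scale[OF bounded_linear.linear[OF linear]] real_scaleR_def)
  finally show ?thesis by (simp add: monomial_def mult.commute)
 qed
 then have eq: "f = (%x. \<Sum>b\<in>Basis. f b * monomial [b] x)" by blast
 have "(%x. \<Sum>b\<in>Basis. f b * monomial [b] x) \<in> monomial_span"
  by (intro monomial_span_sum monomial_span.scale monomial_span.monomial) auto
 then show ?case by (simp only: eq[symmetric])
next
 case (const c)
 have "(%x. c * monomial [] x) \<in> monomial_span" by (intro monomial_span.intros) auto
 then show ?case by (simp add: monomial_def)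
qed (auto intro: monomial_span.add monomial_span_mult)

lemma real_polynomial_monomial: "real_polynomial_function (monomial bs)"
proof (induction bs)
 case Nil
 then show ?case by (simp add: monomial_def[abs_def] real_polynomial_const)
next
 case (Cons b bs)
 have "monomial (b # bs) = (%x. (x \<bullet> b) * monomial bs x)" by (auto simp: monomial_def)
 then show ?case using Cons by (auto intro!: polynomial_intros)
qed

lemma monomial_scale: "monomial bs (t *\<^sub>R x) = t ^ length bs * monomial bs x"
 by (induction bs) (auto simp: monomial_def)

section \<open>Gaussian integrals\<close>

lemma nn_integral_Gamma:
 fixes \<nu> c :: real
 assumes \<nu>: "-1 < \<nu>" and c: "0 < c"
 shows "(\<integral>\<^sup>+t. ennreal (exp (- (c * t)) * t powr \<nu>) * indicator {0<..} t \<partial>lborel) = ennreal (Gamma (\<nu> + 1) / c powr (\<nu> + 1))"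
proof -
 have "((%t. t powr (\<nu> + 1 - 1) / exp t) has_integral Gamma (\<nu> + 1)) {0..}"
  by (rule Gamma_integral_real) (use \<nu> in simp)
 then have 1: "(\<integral>\<^sup>+t. ennreal (t powr \<nu> / exp t) * indicator {0..} t \<partial>lborel) = ennreal (Gamma (\<nu> + 1))"
  by (subst nn_integral_has_integral_lebesgue') auto
 have "(\<integral>\<^sup>+t. ennreal (exp (- (c * t)) * t powr \<nu>) * indicator {0<..} t \<partial>lborel)
   = ennreal ((1 / c) ^ DIM(real)) * (\<integral>\<^sup>+t. ennreal (exp (- (c * ((1 / c) *\<^sub>R t))) * ((1 / c) *\<^sub>R t) powr \<nu>) * indicator {0<..} ((1 / c) *\<^sub>R t) \<partial>lborel)"
  using c by (subst nn_integral_lborel_scale[of _ "1 / c"]) auto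
 also have "(\<integral>\<^sup>+t. ennreal (exp (- (c * ((1 / c) *\<^sub>R t))) * ((1 / c) *\<^sub>R t) powr \<nu>) * indicator {0<..} ((1 / c) *\<^sub>R t) \<partial>lborel)
   = (\<integral>\<^sup>+t. ennreal (1 / c powr \<nu>) * (ennreal (t powr \<nu> / exp t) * indicator {0..} t) \<partial>lborel)"
  using c by (intro nn_integral_cong) (auto simp: indicator_def powr_divide exp_minus field_simps zero_less_divide_iff simp flip: ennreal_mult)
 also have "\<dots> = ennreal (1 / c powr \<nu>) * ennreal (Gamma (\<nu> + 1))"
  by (subst nn_integral_cmult) (auto simp: 1)
 also have "ennreal ((1 / c) ^ DIM(real)) * (ennreal (1 / c powr \<nu>) * ennreal (Gamma (\<nu> + 1))) = ennreal (Gamma (\<nu> + 1) / c powr (\<nu> + 1))"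
  using c \<nu> Gamma_real_pos[of "\<nu> + 1"] by (simp add: powr_add field_simps flip: ennreal_mult)
 finally show ?thesis .
qed

lemma nn_integral_exp_hankel:
 assumes a: "0 < a" and \<nu>: "-1 < \<nu>" and c: "0 < c"
 shows "(\<integral>\<^sup>+r. ennreal (exp (- (c * (r powr a / a)))) \<partial>hankel_measure a \<nu>) < \<infinity>"
 using c by (subst nn_integral_hankel_substitution[OF a \<nu>, where g = "%t. ennreal (exp (- (c * t)))"])
  (auto simp: nn_integral_Gamma[OF \<nu> c] ennreal_mult'[symmetric] ennreal_mult_less_top)

lemma power_le_gaussian:
 fixes \<delta> r :: real
 assumes "0 < \<delta>" "0 \<le> r"
 shows "(1 + r) ^ n \<le> fact n * exp (1 + 1 / (2 * \<delta>)) * exp (\<delta> * r\<^sup>2 / 2)"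
proof -
 have "0 \<le> (\<delta> * r - 1)\<^sup>2" by simp
 then have "2 * \<delta> * r \<le> 1 + \<delta>\<^sup>2 * r\<^sup>2" by (simp add: power2_eq_square algebra_simps)
 then have "r \<le> (1 + \<delta>\<^sup>2 * r\<^sup>2) / (2 * \<delta>)" using assms by (simp add: field_simps)
 also have "\<dots> = 1 / (2 * \<delta>) + \<delta> * r\<^sup>2 / 2" using assms by (simp add: field_simps power2_eq_square)
 finally have "exp (1 + r) \<le> exp (1 + 1 / (2 * \<delta>)) * exp (\<delta> * r\<^sup>2 / 2)"
  unfolding exp_add[symmetric] by simp
 then show ?thesis
  using order_trans[OF power_le_exp[of "1 + r" n] mult_left_mono[of _ _ "fact n"]] assms by (simp add: mult.assoc)
qed

lemma integrable_gaussian_bound: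
 fixes f :: "'a::euclidean_space => 'b::{banach, second_countable_topology}"
 assumes [measurable]: "f \<in> borel_measurable borel" and \<delta>: "0 < \<delta>"
  and bound: "\<And>x. norm (f x) \<le> C * (1 + norm x) ^ n * exp (- (\<delta> * (norm x)\<^sup>2))"
 shows "integrable lborel f"
proof -
 define K where "K = C * (fact n * exp (1 + 1 / (2 * \<delta>)))"
 have "norm (f 0) \<le> C" using bound[of 0] by simp
 then have C: "0 \<le> C" using norm_ge_zero order_trans by blast
 have "norm (f x) \<le> K * exp (- (\<delta> / 2 * (norm x)\<^sup>2))" for x
 proof -
  have "norm (f x) \<le> C * (fact n * exp (1 + 1 / (2 * \<delta>)) * exp (\<delta> * (norm x)\<^sup>2 / 2)) * exp (- (\<delta> * (norm x)\<^sup>2))"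
   using power_le_gaussian[OF \<delta>, of "norm x" n] C by (intro order_trans[OF bound] mult_right_mono mult_left_mono) auto
  also have "\<dots> = K * (exp (\<delta> * (norm x)\<^sup>2 / 2) * exp (- (\<delta> * (norm x)\<^sup>2)))" by (simp add: K_def)
  finally show ?thesis by (simp add: exp_add[symmetric])
 qed
 note le = this
 have dom: "integrable lborel (%x::'a. K * exp (- (\<delta> / 2 * (norm x)\<^sup>2)))"
 proof (intro integrable_mult_right integrableI_bounded)
  define \<nu> where "\<nu> = real DIM('a) / 2 - 1"
  have \<nu>: "-1 < \<nu>" unfolding \<nu>_def by simp
  have "(\<integral>\<^sup>+x. ennreal (norm (exp (- (\<delta> / 2 * (norm (x::'a))\<^sup>2)))) \<partial>lborel)
    = (\<integral>\<^sup>+x. ennreal (exp (- (\<delta> / 2 * (norm (x::'a))\<^sup>2))) * ennreal 1 \<partial>lborel)" by simp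
  also have "\<dots> = ennreal (real DIM('a) * (LINT x:cball (0::'a) 1|lborel. 1)) *
    (\<integral>\<^sup>+r. ennreal (exp (- (\<delta> / 2 * r\<^sup>2))) * ennreal (r powr (real DIM('a) - 1)) * indicator {0<..} r \<partial>lborel)"
   using nn_integral_polar[of "%x::'a. 1" 0 1 "%r. ennreal (exp (- (\<delta> / 2 * r\<^sup>2)))"] by simp
  also have "(\<integral>\<^sup>+r. ennreal (exp (- (\<delta> / 2 * r\<^sup>2))) * ennreal (r powr (real DIM('a) - 1)) * indicator {0<..} r \<partial>lborel)
    = (\<integral>\<^sup>+r. ennreal (exp (- (\<delta> * (r powr 2 / 2)))) * ennreal (r powr (2 * (\<nu> + 1) - 1)) * indicator {0<..} r \<partial>lborel)"
   by (intro nn_integral_cong) (auto simp: \<nu>_def indicator_def powr_numeral)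
  also have "\<dots> = (\<integral>\<^sup>+r. ennreal (exp (- (\<delta> * (r powr 2 / 2)))) \<partial>hankel_measure 2 \<nu>)"
   by (rule nn_integral_hankel[symmetric]) measurable
  finally show "(\<integral>\<^sup>+x. ennreal (norm (exp (- (\<delta> / 2 * (norm (x::'a))\<^sup>2)))) \<partial>lborel) < \<infinity>"
   using nn_integral_exp_hankel[OF _ \<nu> \<delta>, of 2] by (simp add: ennreal_mult_less_top)
 qed measurable
 show ?thesis
  by (rule integrable_dominated[OF dom]) (use le in \<open>auto intro: order_trans[OF _ abs_ge_self]\<close>)
qed

lemma real_polynomial_growth:
 fixes f :: "'a::real_normed_vector => real"
 assumes "real_polynomial_function f"
 shows "\<exists>C n. 0 \<le> C \<and> (\<forall>x. \<bar>f x\<bar> \<le> C * (1 + norm x) ^ n)"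
 using assms
proof induction
 case (linear f)
 obtain K where K: "0 < K" "\<And>x. norm (f x) \<le> norm x * K" using bounded_linear.pos_bounded[OF linear] by blast
 have "\<bar>f x\<bar> \<le> K * (1 + norm x) ^ 1" for x using K(2)[of x] K(1) by (simp add: algebra_simps)
 then show ?case using K(1) by (intro exI[of _ K] exI[of _ "1::nat"]) auto
next
 case (const c)
 show ?case by (intro exI[of _ "\<bar>c\<bar>"] exI[of _ "0::nat"]) auto
next
 case (add f g)
 then obtain C n D m where C: "0 \<le> C" "\<And>x. \<bar>f x\<bar> \<le> C * (1 + norm x) ^ n" and D: "0 \<le> D" "\<And>x. \<bar>g x\<bar> \<le> D * (1 + norm x) ^ m" by blast
 have "\<bar>f x + g x\<bar> \<le> (C + D) * (1 + norm x) ^ (n + m)" for x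
 proof -
  have "C * (1 + norm x) ^ n \<le> C * (1 + norm x) ^ (n + m)" "D * (1 + norm x) ^ m \<le> D * (1 + norm x) ^ (n + m)"
   using C(1) D(1) by (auto intro!: mult_left_mono power_increasing)
  then show ?thesis using C(2)[of x] D(2)[of x] by (simp add: distrib_right)
 qed
 then show ?case using C(1) D(1) by (intro exI[of _ "C + D"] exI[of _ "n + m"]) auto
next
 case (mult f g)
 then obtain C n D m where C: "0 \<le> C" "\<And>x. \<bar>f x\<bar> \<le> C * (1 + norm x) ^ n" and D: "0 \<le> D" "\<And>x. \<bar>g x\<bar> \<le> D * (1 + norm x) ^ m" by blast
 have "\<bar>f x * g x\<bar> \<le> C * D * (1 + norm x) ^ (n + m)" for x
  using mult_mono[OF C(2)[of x] D(2)[of x]] C(1) by (simp add: abs_mult power_add mult_ac)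
 then show ?case using C(1) D(1) by (intro exI[of _ "C * D"] exI[of _ "n + m"]) auto
qed

lemma polynomial_growth:
 fixes p :: "'a::euclidean_space => complex"
 assumes "polynomial_function p"
 shows "\<exists>C n. 0 \<le> C \<and> (\<forall>x. cmod (p x) \<le> C * (1 + norm x) ^ n)"
proof -
 have re: "real_polynomial_function (%x. Re (p x))" and im: "real_polynomial_function (%x. Im (p x))"
  using assms unfolding polynomial_function_complex_iff by auto
 obtain C n where C: "0 \<le> C" "\<And>x. \<bar>Re (p x)\<bar> \<le> C * (1 + norm x) ^ n" using real_polynomial_growth[OF re] by blast
 obtain D m where D: "0 \<le> D" "\<And>x. \<bar>Im (p x)\<bar> \<le> D * (1 + norm x) ^ m" using real_polynomial_growth[OF im] by blast
 have "cmod (p x) \<le> (C + D) * (1 + norm x) ^ (n + m)" for x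
 proof -
  have "C * (1 + norm x) ^ n \<le> C * (1 + norm x) ^ (n + m)" "D * (1 + norm x) ^ m \<le> D * (1 + norm x) ^ (n + m)"
   using C(1) D(1) by (auto intro!: mult_left_mono power_increasing)
  then show ?thesis using C(2)[of x] D(2)[of x] cmod_le[of "p x"] by (simp add: distrib_right)
 qed
 then show ?thesis using C(1) D(1) by (intro exI[of _ "C + D"] exI[of _ "n + m"]) auto
qed

lemma borel_measurable_polynomial: "polynomial_function (p :: real^'n => complex) ==> p \<in> borel_measurable borel"
 by (intro borel_measurable_continuous_onI continuous_on_polynomial)

text \<open>
 Lebesgue measure is invariant under translations; this is its infinitesimal form, obtained by
 integrating \<open>G(x + \<xi>) - G(x)\<close> along the segments in the direction \<open>\<xi>\<close>.
\<close>

lemma integral_dir_deriv_eq_0: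
 fixes G G' :: "real^'n => complex"
 assumes G: "integrable lborel G" and G': "integrable lborel G'" and cont: "continuous_on UNIV G'"
  and der: "\<And>x. has_dir_deriv G \<xi> (G' x) x"
 shows "(LINT x|lborel. G' x) = 0"
proof -
 have [measurable]: "G' \<in> borel_measurable borel" using G' by auto
 have L: "lborel = distr lborel borel (%x. v + x)" for v :: "real^'n" by (rule lborel_distr_plus[symmetric])
 have shift: "integrable lborel (%x. f (v + x))" "(LINT x|lborel. f (v + x)) = (LINT x|lborel. f x)"
  if "integrable lborel f" for f :: "real^'n => 'b::{banach, second_countable_topology}" and v
 proof -
  have [measurable]: "f \<in> borel_measurable borel" using that by auto
  show "integrable lborel (%x. f (v + x))" using that by (subst (asm) L[of v]) (simp add: integrable_distr_eq)
  show "(LINT x|lborel. f (v + x)) = (LINT x|lborel. f x)" by (subst (2) L[of v]) (simp add: integral_distr)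
 qed
 let ?F = "%s x. indicator {0..1} s *\<^sub>R G' (s *\<^sub>R \<xi> + x)"
 have "integrable (lborel \<Otimes>\<^sub>M lborel) (%(s, x). ?F s x)"
 proof (rule lborel_pair.Fubini_integrable)
  show "(%(s, x). ?F s x) \<in> borel_measurable (lborel \<Otimes>\<^sub>M lborel)" by measurable
  have "(%s. LINT x|lborel. norm (case (s, x) of (s, x) => ?F s x)) = (%s::real. indicator {0..1} s * (LINT x|lborel. norm (G' x)))"
   using shift(2)[OF integrable_norm[OF G']] by (auto simp: fun_eq_iff)
  then show "integrable lborel (%s. LINT x|lborel. norm (case (s, x) of (s, x) => ?F s x))" by (simp only:) simp
  show "AE s in lborel. integrable lborel (%x. case (s, x) of (s, x) => ?F s x)"
   using shift(1)[OF G'] by simp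
 qed
 from lborel_pair.Fubini_integral[OF this]
 have "(LINT x|lborel. LINT s|lborel. ?F s x) = (LINT s|lborel. LINT x|lborel. ?F s x)" by simp
 also have "\<dots> = (LINT s|lborel. indicator {0..1::real} s *\<^sub>R (LINT x|lborel. G' x))"
  using shift(2)[OF G'] by simp
 also have "\<dots> = (LINT x|lborel. G' x)" by simp
 also have "(LINT x|lborel. LINT s|lborel. ?F s x) = (LINT x|lborel. G (\<xi> + x) - G x)"
 proof (rule Bochner_Integration.integral_cong[OF refl])
  fix x
  have "((%t. G (t *\<^sub>R \<xi> + x)) has_vector_derivative G' (s *\<^sub>R \<xi> + x)) (at s within {0..1})" for s
  proof -
   have "((%t. G ((s *\<^sub>R \<xi> + x) + t *\<^sub>R \<xi>)) has_vector_derivative G' (s *\<^sub>R \<xi> + x)) (at (s - s))"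
    using der[of "s *\<^sub>R \<xi> + x"] by simp
   moreover have "((%t. t - s) has_vector_derivative 1) (at s)" by (auto intro!: derivative_eq_intros)
   ultimately have "((%t. G ((s *\<^sub>R \<xi> + x) + t *\<^sub>R \<xi>)) \<circ> (%t. t - s) has_vector_derivative G' (s *\<^sub>R \<xi> + x)) (at s)"
    using vector_diff_chain_at[of "%t. t - s" 1 s "%t. G ((s *\<^sub>R \<xi> + x) + t *\<^sub>R \<xi>)" "G' (s *\<^sub>R \<xi> + x)"] by simp
   then show ?thesis by (simp add: o_def algebra_simps has_vector_derivative_at_within)
  qed
  moreover have "continuous_on {0..1} (%s. G' (s *\<^sub>R \<xi> + x))"
   by (intro continuous_on_compose2[OF cont] continuous_intros) auto
  ultimately show "(LINT s|lborel. ?F s x) = G (\<xi> + x) - G x"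
   using integral_FTC_Icc[of 0 1 "%t. G (t *\<^sub>R \<xi> + x)" "%s. G' (s *\<^sub>R \<xi> + x)"] by simp
 qed
 also have "\<dots> = 0" using shift[OF G, of \<xi>] G by simp
 finally show ?thesis by simp
qed

lemma borel_measurable_root_reflection [measurable]: "root_reflection (\<alpha> :: real^'n) \<in> borel_measurable borel"
 by (intro borel_measurable_continuous_onI linear_continuous_on) (simp add: linear_linear root_reflection_linear)

lemma nn_integral_lborel_translate:
 fixes f :: "'a::euclidean_space => ennreal"
 assumes [measurable]: "f \<in> borel_measurable borel"
 shows "(\<integral>\<^sup>+x. f (x + c) \<partial>lborel) = (\<integral>\<^sup>+x. f x \<partial>lborel)"
 by (subst (2) lborel_distr_plus[of c, symmetric]) (simp add: nn_integral_distr add.commute)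

lemma nn_integral_lborel_uminus:
 fixes f :: "'a::euclidean_space => ennreal"
 assumes [measurable]: "f \<in> borel_measurable borel"
 shows "(\<integral>\<^sup>+x. f (- x) \<partial>lborel) = (\<integral>\<^sup>+x. f x \<partial>lborel)"
 by (subst (2) lborel_affine[of "-1" 0]) (simp_all add: nn_integral_density nn_integral_distr)

text \<open>
 The image of Lebesgue measure under a reflection is again translation invariant; the classical
 double integral against the unit ball, which the reflection preserves, identifies the two.
\<close>

lemma lborel_distr_root_reflection:
 fixes \<alpha> :: "real^'n" assumes \<alpha>: "\<alpha> \<noteq> 0"
 shows "distr lborel borel (root_reflection \<alpha>) = lborel"
proof (rule measure_eqI)
 fix A assume "A \<in> sets (distr lborel borel (root_reflection \<alpha>))"
 then have [measurable]: "A \<in> sets borel" by simp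
 let ?r = "root_reflection \<alpha>" and ?B = "cball (0 :: real^'n) 1"
 have diff: "?r (x - y) = ?r x - ?r y" for x y by (rule linear_diff[OF root_reflection_linear])
 have inv: "?r (?r x) = x" for x by (rule root_reflection_involution[OF \<alpha>])
 have B: "indicator ?B (?r x) = (indicator ?B x :: ennreal)" for x
  using norm_root_reflection[OF \<alpha>, of x] by (auto simp: indicator_def)
 have "emeasure lborel (?r -` A) * emeasure lborel ?B
   = (\<integral>\<^sup>+x. \<integral>\<^sup>+y. indicator A (?r x) * indicator ?B y \<partial>lborel \<partial>lborel)"
 proof -
  have "emeasure lborel (?r -` A) = (\<integral>\<^sup>+x. indicator (?r -` A) x \<partial>lborel)"
   using measurable_sets_borel[of ?r borel A] by (subst nn_integral_indicator) auto
  also have "(%x. indicator (?r -` A) x :: ennreal) = (%x. indicator A (?r x))"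
   by (auto simp: indicator_def)
  finally have "emeasure lborel (?r -` A) = (\<integral>\<^sup>+x. indicator A (?r x) \<partial>lborel)" .
  then show ?thesis by (simp add: nn_integral_cmult nn_integral_multc)
 qed
 also have "\<dots> = (\<integral>\<^sup>+x. \<integral>\<^sup>+y. indicator A (?r x) * indicator ?B (y + ?r x) \<partial>lborel \<partial>lborel)"
 proof (rule nn_integral_cong)
  fix x
  show "(\<integral>\<^sup>+y. indicator A (?r x) * indicator ?B y \<partial>lborel) = (\<integral>\<^sup>+y. indicator A (?r x) * indicator ?B (y + ?r x) \<partial>lborel)"
   by (rule nn_integral_lborel_translate[symmetric, where f = "%y. indicator A (?r x) * indicator ?B y"]) measurable
 qed
 also have "\<dots> = (\<integral>\<^sup>+y. \<integral>\<^sup>+x. indicator A (?r x) * indicator ?B (y + ?r x) \<partial>lborel \<partial>lborel)"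
  by (rule lborel_pair.Fubini') measurable
 also have "\<dots> = (\<integral>\<^sup>+y. \<integral>\<^sup>+x. indicator A (?r x - y) * indicator ?B x \<partial>lborel \<partial>lborel)"
 proof (rule nn_integral_cong)
  fix y
  have "(\<integral>\<^sup>+x. indicator A (?r x) * indicator ?B (y + ?r x) \<partial>lborel)
    = (\<integral>\<^sup>+x. indicator A (?r (x + - ?r y)) * indicator ?B (y + ?r (x + - ?r y)) \<partial>lborel)"
   by (rule nn_integral_lborel_translate[symmetric]) measurable
  also have "\<dots> = (\<integral>\<^sup>+x. indicator A (?r x - y) * indicator ?B (?r x) \<partial>lborel)"
   by (simp add: diff inv)
  finally show "(\<integral>\<^sup>+x. indicator A (?r x) * indicator ?B (y + ?r x) \<partial>lborel) = (\<integral>\<^sup>+x. indicator A (?r x - y) * indicator ?B x \<partial>lborel)"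
   unfolding B .
 qed
 also have "\<dots> = (\<integral>\<^sup>+x. \<integral>\<^sup>+y. indicator A (?r x - y) * indicator ?B x \<partial>lborel \<partial>lborel)"
  by (rule lborel_pair.Fubini') measurable
 also have "\<dots> = (\<integral>\<^sup>+x. emeasure lborel A * indicator ?B x \<partial>lborel)"
 proof (rule nn_integral_cong)
  fix x
  have "(\<integral>\<^sup>+y. indicator A (?r x - y) \<partial>lborel) = (\<integral>\<^sup>+y. indicator A (- y + ?r x) \<partial>lborel)" by simp
  also have "\<dots> = (\<integral>\<^sup>+y. indicator A (y + ?r x) \<partial>lborel)"
   by (rule nn_integral_lborel_uminus[where f = "%y. indicator A (y + ?r x)"]) measurable
  also have "\<dots> = emeasure lborel A"
   by (subst nn_integral_lborel_translate) auto
  finally show "(\<integral>\<^sup>+y. indicator A (?r x - y) * indicator ?B x \<partial>lborel) = emeasure lborel A * indicator ?B x"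
   by (simp add: nn_integral_multc)
 qed
 also have "\<dots> = emeasure lborel A * emeasure lborel ?B" by (simp add: nn_integral_cmult)
 finally have "emeasure lborel (?r -` A) * emeasure lborel ?B = emeasure lborel A * emeasure lborel ?B" .
 moreover have "emeasure lborel ?B \<noteq> 0" "emeasure lborel ?B \<noteq> \<infinity>"
  using emeasure_bounded_finite[OF bounded_cball[of "0 :: real^'n" 1]] content_cball_pos[of 1 "0 :: real^'n"]
  by (auto simp: measure_def)
 ultimately have "emeasure lborel (?r -` A) = emeasure lborel A"
  using mult_divide_eq_ennreal[of "emeasure lborel ?B"] by (metis infinity_ennreal_def)
 then show "emeasure (distr lborel borel ?r) A = emeasure lborel A"
  by (subst emeasure_distr) auto
qed simp

lemma integral_root_reflection:
 fixes f :: "real^'n => complex"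
 assumes "\<alpha> \<noteq> 0" and [measurable]: "f \<in> borel_measurable borel"
 shows "(LINT x|lborel. f (root_reflection \<alpha> x)) = (LINT x|lborel. f x)"
 by (subst (2) lborel_distr_root_reflection[OF assms(1), symmetric]) (simp add: integral_distr)

section \<open>Orthogonality of harmonics of different degrees\<close>

lemma square_powr_half: "(s\<^sup>2) powr (t / 2) = \<bar>s\<bar> powr t" for s t :: real
proof -
 have "s\<^sup>2 = \<bar>s\<bar> powr 2" by (simp add: powr_numeral)
 show ?thesis unfolding \<open>s\<^sup>2 = \<bar>s\<bar> powr 2\<close> powr_powr by simp
qed

context dunkl begin

definition weight :: "real^'n => real" where
 "weight x = (\<Prod>\<alpha>\<in>R. \<bar>\<alpha> \<bullet> x\<bar> powr k \<alpha>)"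

text \<open>
 A smooth and still invariant approximation: the weight itself is only Hoelder continuous at the
 hyperplanes when some \<open>k \<alpha>\<close> is small.
\<close>

definition smooth_weight :: "real => real^'n => real" where
 "smooth_weight \<epsilon> x = (\<Prod>\<alpha>\<in>R. ((\<alpha> \<bullet> x)\<^sup>2 + \<epsilon>) powr (k \<alpha> / 2))"

lemma borel_measurable_weight [measurable]: "weight \<in> borel_measurable borel"
 unfolding weight_def[abs_def] by measurable

lemma borel_measurable_smooth_weight [measurable]: "smooth_weight \<epsilon> \<in> borel_measurable borel"
 unfolding smooth_weight_def[abs_def] by measurable

lemma weight_nonneg: "0 \<le> weight x"
 unfolding weight_def by (intro prod_nonneg) auto

lemma weight_pos: "x \<in> regular ==> 0 < weight x"
 unfolding weight_def by (intro prod_pos) (auto simp: regular_def)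

lemma prod_R_reflection:
 fixes f :: "real => real => real"
 assumes "\<alpha> \<in> R"
 shows "(\<Prod>\<beta>\<in>R. f (\<beta> \<bullet> root_reflection \<alpha> x) (k \<beta>)) = (\<Prod>\<beta>\<in>R. f (\<beta> \<bullet> x) (k \<beta>))"
proof -
 have "(\<Prod>\<beta>\<in>R. f (\<beta> \<bullet> x) (k \<beta>)) = (\<Prod>\<beta>\<in>R. f (root_reflection \<alpha> \<beta> \<bullet> x) (k (root_reflection \<alpha> \<beta>)))"
  by (rule prod.reindex_bij_betw[symmetric, OF R_reflection_bij[OF assms]])
 also have "\<dots> = (\<Prod>\<beta>\<in>R. f (\<beta> \<bullet> root_reflection \<alpha> x) (k \<beta>))"
  using assms by (intro prod.cong) (auto simp: inner_root_reflection[OF R_nonzero] k_reflection)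
 finally show ?thesis by simp
qed

lemma weight_reflection: "\<alpha> \<in> R ==> weight (root_reflection \<alpha> x) = weight x"
 unfolding weight_def by (rule prod_R_reflection[where f = "%s t. \<bar>s\<bar> powr t"])

lemma smooth_weight_reflection: "\<alpha> \<in> R ==> smooth_weight \<epsilon> (root_reflection \<alpha> x) = smooth_weight \<epsilon> x"
 unfolding smooth_weight_def by (rule prod_R_reflection[where f = "%s t. (s\<^sup>2 + \<epsilon>) powr (t / 2)"])

lemma sum_R_k: "(\<Sum>\<alpha>\<in>R. k \<alpha>) = 2 * mult_sum P k"
 unfolding sum_R_P mult_sum_def using k_uminus[OF P_R] by (simp add: sum_distrib_left)

lemma prod_powr_const:
 fixes c :: real assumes "0 \<le> c" "R \<noteq> {} \<or> c \<noteq> 0"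
 shows "(\<Prod>\<alpha>\<in>R. c powr k \<alpha>) = c powr (2 * mult_sum P k)"
 unfolding sum_R_k[symmetric]
proof (cases "c = 0")
 case True
 then show "(\<Prod>\<alpha>\<in>R. c powr k \<alpha>) = c powr (\<Sum>\<alpha>\<in>R. k \<alpha>)" using assms by auto
next
 case False
 then show "(\<Prod>\<alpha>\<in>R. c powr k \<alpha>) = c powr (\<Sum>\<alpha>\<in>R. k \<alpha>)" using assms(1) by (simp add: powr_sum)
qed

lemma weight_scale: "0 < t ==> weight (t *\<^sub>R x) = t powr (2 * mult_sum P k) * weight x"
 using prod_powr_const[of t] unfolding weight_def
 by (simp add: abs_mult powr_mult prod.distrib)

lemma smooth_weight_nonneg: "0 \<le> smooth_weight \<epsilon> x"
 unfolding smooth_weight_def by (intro prod_nonneg) auto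

lemma smooth_weight_mono:
 assumes "0 \<le> \<epsilon>" "\<epsilon> \<le> 1" shows "smooth_weight \<epsilon> x \<le> smooth_weight 1 x"
 unfolding smooth_weight_def using assms k_nonneg by (intro prod_mono) (auto intro!: powr_mono2)

lemma weight_le_smooth: "weight x \<le> smooth_weight 1 x"
 unfolding smooth_weight_def weight_def
proof (intro prod_mono conjI)
 fix \<alpha> assume "\<alpha> \<in> R"
 have "\<bar>\<alpha> \<bullet> x\<bar> powr k \<alpha> = ((\<bar>\<alpha> \<bullet> x\<bar>)\<^sup>2) powr (k \<alpha> / 2)"
  by (simp add: square_powr_half)
 also have "\<dots> \<le> ((\<alpha> \<bullet> x)\<^sup>2 + 1) powr (k \<alpha> / 2)" using k_nonneg \<open>\<alpha> \<in> R\<close> by (intro powr_mono2) auto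
 finally show "\<bar>\<alpha> \<bullet> x\<bar> powr k \<alpha> \<le> ((\<alpha> \<bullet> x)\<^sup>2 + 1) powr (k \<alpha> / 2)" .
qed simp

lemma smooth_weight_growth: "\<exists>C n. 0 \<le> C \<and> (\<forall>x. smooth_weight 1 x \<le> C * (1 + norm x) ^ n)"
proof -
 define C where "C = (\<Prod>\<alpha>\<in>R. (1 + norm \<alpha>) powr k \<alpha>)"
 define n where "n = nat \<lceil>2 * mult_sum P k\<rceil>"
 have C: "0 \<le> C" unfolding C_def by (intro prod_nonneg) auto
 have "smooth_weight 1 x \<le> C * (1 + norm x) ^ n" for x
 proof -
  have "smooth_weight 1 x \<le> (\<Prod>\<alpha>\<in>R. ((1 + norm \<alpha>) * (1 + norm x)) powr k \<alpha>)"
   unfolding smooth_weight_def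
  proof (intro prod_mono conjI)
   fix \<alpha> assume \<alpha>: "\<alpha> \<in> R"
   have "\<bar>\<alpha> \<bullet> x\<bar> \<le> norm \<alpha> * norm x" by (rule Cauchy_Schwarz_ineq2)
   then have "(\<alpha> \<bullet> x)\<^sup>2 \<le> (norm \<alpha> * norm x)\<^sup>2" by (metis abs_ge_zero power2_abs power_mono)
   moreover have "(norm \<alpha> * norm x)\<^sup>2 + 1 \<le> ((1 + norm \<alpha>) * (1 + norm x))\<^sup>2"
   proof -
    have e: "(1 + norm \<alpha>) * (1 + norm x) = norm \<alpha> * norm x + (1 + (norm \<alpha> + norm x))" by (simp add: algebra_simps)
    have "1 \<le> (1 + (norm \<alpha> + norm x))\<^sup>2" by (simp add: power2_eq_square algebra_simps)
    moreover have "0 \<le> 2 * (norm \<alpha> * norm x) * (1 + (norm \<alpha> + norm x))" by simp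
    ultimately show ?thesis unfolding e power2_sum by linarith
   qed
   ultimately have "(\<alpha> \<bullet> x)\<^sup>2 + 1 \<le> ((1 + norm \<alpha>) * (1 + norm x))\<^sup>2" by linarith
   then have "((\<alpha> \<bullet> x)\<^sup>2 + 1) powr (k \<alpha> / 2) \<le> (((1 + norm \<alpha>) * (1 + norm x))\<^sup>2) powr (k \<alpha> / 2)"
    using k_nonneg \<alpha> by (intro powr_mono2) auto
   also have "\<dots> = ((1 + norm \<alpha>) * (1 + norm x)) powr k \<alpha>"
    unfolding square_powr_half by (simp add: abs_mult)
   finally show "((\<alpha> \<bullet> x)\<^sup>2 + 1) powr (k \<alpha> / 2) \<le> ((1 + norm \<alpha>) * (1 + norm x)) powr k \<alpha>" .
  qed simp
  also have "\<dots> = C * (1 + norm x) powr (2 * mult_sum P k)"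
   using prod_powr_const[of "1 + norm x"] norm_ge_zero[of x] by (simp add: C_def powr_mult prod.distrib)
  also have "(1 + norm x) powr (2 * mult_sum P k) \<le> (1 + norm x) powr real n"
   unfolding n_def by (intro powr_mono) (auto simp: real_nat_ceiling_ge)
  also have "(1 + norm x) powr real n = (1 + norm x) ^ n"
   by (rule powr_realpow) (simp add: add_pos_nonneg)
  finally show ?thesis using C by (simp add: mult_left_mono)
 qed
 then show ?thesis using C by blast
qed

lemma smooth_weight_tendsto:
 assumes "x \<in> regular" shows "(%j. smooth_weight (1 / real (Suc j)) x) \<longlonglongrightarrow> weight x"
proof -
 have "(%j. ((\<alpha> \<bullet> x)\<^sup>2 + 1 / real (Suc j)) powr (k \<alpha> / 2)) \<longlonglongrightarrow> \<bar>\<alpha> \<bullet> x\<bar> powr k \<alpha>" if "\<alpha> \<in> R" for \<alpha>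
 proof -
  have nz: "\<alpha> \<bullet> x \<noteq> 0" using assms that by (simp add: regular_def)
  have "(%j. 1 / real (Suc j)) \<longlonglongrightarrow> 0"
   using LIMSEQ_inverse_real_of_nat by (simp add: inverse_eq_divide)
  then have "(%j. ((\<alpha> \<bullet> x)\<^sup>2 + 1 / real (Suc j)) powr (k \<alpha> / 2)) \<longlonglongrightarrow> ((\<alpha> \<bullet> x)\<^sup>2 + 0) powr (k \<alpha> / 2)"
   using nz by (intro tendsto_intros) auto
  also have "((\<alpha> \<bullet> x)\<^sup>2 + 0) powr (k \<alpha> / 2) = \<bar>\<alpha> \<bullet> x\<bar> powr k \<alpha>" by (simp add: square_powr_half)
  finally show ?thesis .
 qed
 then show ?thesis unfolding smooth_weight_def weight_def by (intro tendsto_prod)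
qed

definition log_deriv :: "real => real^'n => real^'n => real" where
 "log_deriv \<epsilon> \<xi> x = (\<Sum>\<alpha>\<in>R. k \<alpha> * (\<alpha> \<bullet> \<xi>) * ((\<alpha> \<bullet> x) / ((\<alpha> \<bullet> x)\<^sup>2 + \<epsilon>)))"

lemma smooth_weight_deriv:
 assumes \<epsilon>: "0 < \<epsilon>"
 shows "((%t. smooth_weight \<epsilon> (x + t *\<^sub>R \<xi>)) has_real_derivative smooth_weight \<epsilon> x * log_deriv \<epsilon> \<xi> x) (at 0)"
proof -
 define f where "f \<alpha> t = ((\<alpha> \<bullet> (x + t *\<^sub>R \<xi>))\<^sup>2 + \<epsilon>) powr (k \<alpha> / 2)" for \<alpha> t
 have pos: "0 < (\<alpha> \<bullet> y)\<^sup>2 + \<epsilon>" for \<alpha> y using \<epsilon> by (simp add: add_nonneg_pos)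
 have fd: "(f \<alpha> has_real_derivative f \<alpha> 0 * (k \<alpha> * (\<alpha> \<bullet> \<xi>) * ((\<alpha> \<bullet> x) / ((\<alpha> \<bullet> x)\<^sup>2 + \<epsilon>)))) (at 0)" for \<alpha>
 proof -
  have "((%t. (\<alpha> \<bullet> (x + t *\<^sub>R \<xi>))\<^sup>2 + \<epsilon>) has_real_derivative 2 * (\<alpha> \<bullet> x) * (\<alpha> \<bullet> \<xi>)) (at 0)"
   unfolding inner_add_right inner_scaleR_right by (auto intro!: derivative_eq_intros)
  from DERIV_powr[OF this, of "%_. k \<alpha> / 2" 0]
  have "(f \<alpha> has_real_derivative f \<alpha> 0 * (0 * ln ((\<alpha> \<bullet> (x + 0 *\<^sub>R \<xi>))\<^sup>2 + \<epsilon>) + 2 * (\<alpha> \<bullet> x) * (\<alpha> \<bullet> \<xi>) * (k \<alpha> / 2) / ((\<alpha> \<bullet> (x + 0 *\<^sub>R \<xi>))\<^sup>2 + \<epsilon>))) (at 0)"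
   using pos[of \<alpha> x] unfolding f_def by simp
  then show ?thesis by (simp add: mult_ac)
 qed
 have "((%t. \<Prod>\<alpha>\<in>R. f \<alpha> t) has_real_derivative (\<Sum>\<alpha>\<in>R. f \<alpha> 0 * (k \<alpha> * (\<alpha> \<bullet> \<xi>) * ((\<alpha> \<bullet> x) / ((\<alpha> \<bullet> x)\<^sup>2 + \<epsilon>))) * (\<Prod>\<beta>\<in>R - {\<alpha>}. f \<beta> 0))) (at 0)"
  by (rule has_field_derivative_prod) (rule fd)
 moreover have "(\<Sum>\<alpha>\<in>R. f \<alpha> 0 * (k \<alpha> * (\<alpha> \<bullet> \<xi>) * ((\<alpha> \<bullet> x) / ((\<alpha> \<bullet> x)\<^sup>2 + \<epsilon>))) * (\<Prod>\<beta>\<in>R - {\<alpha>}. f \<beta> 0))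
   = (\<Sum>\<alpha>\<in>R. (\<Prod>\<beta>\<in>R. f \<beta> 0) * (k \<alpha> * (\<alpha> \<bullet> \<xi>) * ((\<alpha> \<bullet> x) / ((\<alpha> \<bullet> x)\<^sup>2 + \<epsilon>))))"
  by (intro sum.cong refl) (simp add: prod.remove[OF finite_R] mult_ac)
 moreover have "(\<Prod>\<beta>\<in>R. f \<beta> 0) = smooth_weight \<epsilon> x" by (simp add: f_def smooth_weight_def)
 ultimately show ?thesis
  by (simp add: f_def smooth_weight_def[symmetric] log_deriv_def sum_distrib_left)
qed

definition gauss :: "real^'n => real" where "gauss x = exp (- (x \<bullet> x) / 2)"

lemma gauss_deriv: "((%t. gauss (x + t *\<^sub>R \<xi>)) has_real_derivative - (x \<bullet> \<xi>) * gauss x) (at 0)"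
 unfolding gauss_def inner_add_left inner_add_right inner_scaleR_left inner_scaleR_right
 by (auto intro!: derivative_eq_intros simp: inner_commute field_simps)

lemma borel_measurable_gauss [measurable]: "gauss \<in> borel_measurable borel"
 unfolding gauss_def[abs_def] by measurable

lemma gauss_reflection: "\<alpha> \<in> R ==> gauss (root_reflection \<alpha> x) = gauss x"
 by (simp add: gauss_def root_reflection_inner_inner R_nonzero)

lemma poly_gauss_bound:
 assumes p: "polynomial_function p" and w: "\<And>x. 0 \<le> w x" "\<And>x. w x \<le> smooth_weight 1 x"
 shows "\<exists>C n. 0 \<le> C \<and> (\<forall>x. cmod (p x * of_real (gauss x * w x)) \<le> C * (1 + norm x) ^ n * exp (- (1 / 2 * (norm x)\<^sup>2)))"
proof -
 obtain C n where C: "0 \<le> C" "\<And>x. cmod (p x) \<le> C * (1 + norm x) ^ n" using polynomial_growth[OF p] by blast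
 obtain D m where D: "0 \<le> D" "\<And>x. smooth_weight 1 x \<le> D * (1 + norm x) ^ m" using smooth_weight_growth by blast
 have "cmod (p x * of_real (gauss x * w x)) \<le> (C * D) * (1 + norm x) ^ (n + m) * exp (- (1 / 2 * (norm x)\<^sup>2))" for x
 proof -
  have "cmod (p x * of_real (gauss x * w x)) = cmod (p x) * w x * gauss x"
   using w(1)[of x] by (simp add: norm_mult gauss_def abs_mult)
  also have "\<dots> \<le> (C * (1 + norm x) ^ n) * (D * (1 + norm x) ^ m) * gauss x"
   using C D w by (intro mult_right_mono mult_mono) (auto intro: order_trans[OF w(2) D(2)] simp: gauss_def)
  finally show ?thesis by (simp add: gauss_def power_add mult_ac power2_norm_eq_inner)
 qed
 then show ?thesis using C D by (intro exI[of _ "C * D"] exI[of _ "n + m"]) auto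
qed

lemma integrable_poly_gauss:
 fixes p :: "real^'n => complex"
 assumes p: "polynomial_function p" and [measurable]: "w \<in> borel_measurable borel"
  and w: "\<And>x. 0 \<le> w x" "\<And>x. w x \<le> smooth_weight 1 x"
 shows "integrable lborel (%x. p x * of_real (gauss x * w x))"
proof -
 have [measurable]: "p \<in> borel_measurable borel" using p by (rule borel_measurable_polynomial)
 obtain C n where "\<forall>x. cmod (p x * of_real (gauss x * w x)) \<le> C * (1 + norm x) ^ n * exp (- (1 / 2 * (norm x)\<^sup>2))"
  using poly_gauss_bound[OF p w] by blast
 then show ?thesis by (intro integrable_gaussian_bound[where \<delta> = "1 / 2" and C = C and n = n]) auto
qed

definition gint :: "(real^'n => complex) => complex" where
 "gint f = (LINT x|lborel. f x * of_real (gauss x * weight x))"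

lemma gint_integrable: "polynomial_function (p :: real^'n => complex) ==> integrable lborel (%x. p x * of_real (gauss x * weight x))"
 by (rule integrable_poly_gauss) (auto simp: weight_nonneg weight_le_smooth)

lemma gint_reflection:
 assumes "\<alpha> \<in> R" "polynomial_function p"
 shows "gint (%x. p (root_reflection \<alpha> x)) = gint p"
proof -
 have [measurable]: "p \<in> borel_measurable borel" using assms(2) by (rule borel_measurable_polynomial)
 have "gint (%x. p (root_reflection \<alpha> x)) = (LINT x|lborel. p (root_reflection \<alpha> x) * of_real (gauss (root_reflection \<alpha> x) * weight (root_reflection \<alpha> x)))"
  unfolding gint_def gauss_reflection[OF assms(1)] weight_reflection[OF assms(1)] ..
 also have "\<dots> = gint p"
  unfolding gint_def by (rule integral_root_reflection[OF R_nonzero[OF assms(1)]]) measurable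
 finally show ?thesis .
qed

lemma gint_cong_regular:
 assumes "\<And>x. x \<in> regular ==> f x = g x" "f \<in> borel_measurable borel" "g \<in> borel_measurable borel"
 shows "gint f = gint g"
 unfolding gint_def
proof (rule integral_cong_AE)
 show "AE x in lborel. f x * of_real (gauss x * weight x) = g x * of_real (gauss x * weight x)"
  using AE_regular by eventually_elim (simp add: assms(1))
qed (use assms(2,3) in measurable)

lemma gint_sum:
 assumes "\<And>i. i \<in> I ==> polynomial_function (p i)"
 shows "gint (%x. \<Sum>i\<in>I. p i x) = (\<Sum>i\<in>I. gint (p i))"
 unfolding gint_def sum_distrib_right
 by (rule Bochner_Integration.integral_sum) (rule gint_integrable[OF assms])

lemma gint_add: "polynomial_function p ==> polynomial_function q ==> gint (%x. p x + q x) = gint p + gint q"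
 unfolding gint_def distrib_right by (rule Bochner_Integration.integral_add) (rule gint_integrable, assumption)+

lemma gint_diff: "polynomial_function p ==> polynomial_function q ==> gint (%x. p x - q x) = gint p - gint q"
 unfolding gint_def left_diff_distrib by (rule Bochner_Integration.integral_diff) (rule gint_integrable, assumption)+

lemma gint_cmult: "gint (%x. c * p x) = c * gint p"
 unfolding gint_def mult.assoc by simp

text \<open>
 Integration by parts against the smooth weight; its logarithmic derivative
 \<open>\<langle>\<alpha>, x\<rangle> / (\<langle>\<alpha>, x\<rangle>\<^sup>2 + \<epsilon>)\<close> is odd under \<open>r\<^sub>\<alpha>\<close>, so only the odd part
 \<open>(Q(x) - Q(r\<^sub>\<alpha> x)) / 2\<close> of \<open>Q\<close> contributes, and that makes the limit \<open>\<epsilon> \<rightarrow> 0\<close> harmless.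
\<close>

lemma smooth_parts:
 assumes Q: "polynomial_function Q" and \<epsilon>: "0 < \<epsilon>" "\<epsilon> \<le> 1"
 shows "(LINT x|lborel. (dir_deriv \<xi> Q x - of_real (x \<bullet> \<xi>) * Q x) * of_real (gauss x * smooth_weight \<epsilon> x))
  + (\<Sum>\<alpha>\<in>R. of_real (k \<alpha> * (\<alpha> \<bullet> \<xi>) / 2) *
    (LINT x|lborel. root_quotient \<alpha> Q x * of_real (gauss x * (smooth_weight \<epsilon> x * ((\<alpha> \<bullet> x)\<^sup>2 / ((\<alpha> \<bullet> x)\<^sup>2 + \<epsilon>)))))) = 0"
proof -
 define H where "H = smooth_weight \<epsilon>"
 have [measurable]: "H \<in> borel_measurable borel" unfolding H_def by measurable
 have H: "0 \<le> H x" "H x \<le> smooth_weight 1 x" for x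
  unfolding H_def using smooth_weight_nonneg smooth_weight_mono \<epsilon> by auto
 have pos: "0 < (\<alpha> \<bullet> y)\<^sup>2 + \<epsilon>" for \<alpha> y using \<epsilon> by (simp add: add_nonneg_pos)
 have [measurable]: "Q \<in> borel_measurable borel" using Q by (rule borel_measurable_polynomial)
 define D where "D x = dir_deriv \<xi> Q x - of_real (x \<bullet> \<xi>) * Q x" for x
 have Dp: "polynomial_function D"
  unfolding D_def by (intro polynomial_function_diff polynomial_has_derivative(2) polynomial_intros Q)
 have [measurable]: "D \<in> borel_measurable borel" using Dp by (rule borel_measurable_polynomial)
 define kern where "kern \<alpha> x = (\<alpha> \<bullet> x) / ((\<alpha> \<bullet> x)\<^sup>2 + \<epsilon>)" for \<alpha> x :: "real^'n"
 have [measurable]: "kern \<alpha> \<in> borel_measurable borel" for \<alpha> unfolding kern_def[abs_def] by measurable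
 have kern_le: "\<bar>kern \<alpha> x\<bar> \<le> 1 / \<epsilon>" for \<alpha> x
 proof -
  have "\<epsilon> * \<bar>s\<bar> \<le> s\<^sup>2 + \<epsilon>" for s :: real
  proof (cases "\<bar>s\<bar> \<le> 1")
   case False
   then have "\<epsilon> * \<bar>s\<bar> \<le> \<bar>s\<bar> * \<bar>s\<bar>" using \<epsilon> by (intro mult_right_mono) auto
   then show ?thesis using \<epsilon> by (simp add: power2_eq_square)
  qed (use \<epsilon> in \<open>simp add: add_increasing mult_left_le\<close>)
  then show ?thesis unfolding kern_def abs_divide using \<epsilon> pos[of \<alpha> x] by (simp add: field_simps)
 qed
 define T where "T \<alpha> x = Q x * of_real (gauss x * (H x * kern \<alpha> x))" for \<alpha> x
 have Tint: "integrable lborel (T \<alpha>)" for \<alpha>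
 proof (rule integrable_dominated)
  show "integrable lborel (%x. of_real (1 / \<epsilon>) * (Q x * of_real (gauss x * H x)))"
   by (intro integrable_mult_right integrable_poly_gauss[OF Q _ H]) measurable
  have "(cmod (Q x) * \<bar>gauss x\<bar> * \<bar>H x\<bar>) * \<bar>kern \<alpha> x\<bar> \<le> (cmod (Q x) * \<bar>gauss x\<bar> * \<bar>H x\<bar>) * (1 / \<epsilon>)" for x
   using kern_le by (intro mult_left_mono) auto
  then show "AE x in lborel. norm (T \<alpha> x) \<le> norm (of_real (1 / \<epsilon>) * (Q x * of_real (gauss x * H x)))"
   using \<epsilon> by (intro AE_I2) (simp add: T_def norm_mult norm_divide abs_mult mult_ac)
 qed (simp add: T_def[abs_def])
 define G where "G x = Q x * of_real (gauss x * H x)" for x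
 define G' where "G' x = D x * of_real (gauss x * H x) + (\<Sum>\<alpha>\<in>R. mult_inner \<xi> \<alpha> * T \<alpha> x)" for x
 have E1: "(LINT x|lborel. G' x) = 0"
 proof -
  have der: "has_dir_deriv G \<xi> (G' x) x" for x
  proof -
   have "((%t. gauss (x + t *\<^sub>R \<xi>) * H (x + t *\<^sub>R \<xi>)) has_real_derivative
     (- (x \<bullet> \<xi>) * gauss x) * H (x + 0 *\<^sub>R \<xi>) + H x * log_deriv \<epsilon> \<xi> x * gauss (x + 0 *\<^sub>R \<xi>)) (at 0)"
    unfolding H_def by (intro DERIV_mult gauss_deriv smooth_weight_deriv \<epsilon>)
   then have "has_dir_deriv G \<xi> (Q (x + 0 *\<^sub>R \<xi>) * of_real ((- (x \<bullet> \<xi>) * gauss x) * H (x + 0 *\<^sub>R \<xi>) + H x * log_deriv \<epsilon> \<xi> x * gauss (x + 0 *\<^sub>R \<xi>))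
     + dir_deriv \<xi> Q x * of_real (gauss (x + 0 *\<^sub>R \<xi>) * H (x + 0 *\<^sub>R \<xi>))) x"
    unfolding G_def by (intro has_vector_derivative_mult polynomial_has_dir_deriv Q has_vector_derivative_of_real)
     (simp add: has_real_derivative_iff_has_vector_derivative)
   also have "Q (x + 0 *\<^sub>R \<xi>) * of_real ((- (x \<bullet> \<xi>) * gauss x) * H (x + 0 *\<^sub>R \<xi>) + H x * log_deriv \<epsilon> \<xi> x * gauss (x + 0 *\<^sub>R \<xi>))
     + dir_deriv \<xi> Q x * of_real (gauss (x + 0 *\<^sub>R \<xi>) * H (x + 0 *\<^sub>R \<xi>))
     = D x * of_real (gauss x * H x) + of_real (log_deriv \<epsilon> \<xi> x) * (Q x * of_real (gauss x * H x))"
    by (simp add: D_def algebra_simps)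
   also have "of_real (log_deriv \<epsilon> \<xi> x) * (Q x * of_real (gauss x * H x))
     = (\<Sum>\<alpha>\<in>R. mult_inner \<xi> \<alpha> * T \<alpha> x)"
    unfolding log_deriv_def T_def kern_def of_real_sum sum_distrib_right
    by (intro sum.cong refl) (simp only: of_real_mult mult_ac)
   finally show ?thesis unfolding G'_def .
  qed
  have nz: "(\<alpha> \<bullet> y)\<^sup>2 + \<epsilon> \<noteq> 0" for \<alpha> y using pos[of \<alpha> y] by linarith
  have Hc: "continuous_on UNIV H"
   unfolding H_def smooth_weight_def by (intro continuous_intros) (use nz in auto)
  have gc: "continuous_on UNIV gauss" unfolding gauss_def by (intro continuous_intros) auto
  have kc: "continuous_on UNIV (kern \<alpha>)" for \<alpha>
   unfolding kern_def by (intro continuous_intros) (use nz in auto)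
  show ?thesis
  proof (rule integral_dir_deriv_eq_0[OF _ _ _ der])
   show "integrable lborel G" unfolding G_def by (rule integrable_poly_gauss[OF Q _ H]) measurable
   show "integrable lborel G'"
    unfolding G'_def using Tint by (intro Bochner_Integration.integrable_add Bochner_Integration.integrable_sum integrable_mult_right integrable_poly_gauss[OF Dp _ H]) auto
   show "continuous_on UNIV G'"
    unfolding G'_def T_def by (intro continuous_intros continuous_on_polynomial Dp Q Hc gc kc)
  qed
 qed
 have E2: "(LINT x|lborel. G' x) = (LINT x|lborel. D x * of_real (gauss x * H x))
   + (\<Sum>\<alpha>\<in>R. mult_inner \<xi> \<alpha> * (LINT x|lborel. T \<alpha> x))"
  unfolding G'_def using Tint integrable_poly_gauss[OF Dp _ H]
  by (subst Bochner_Integration.integral_add) (auto simp: Bochner_Integration.integral_sum)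
 have half: "(LINT x|lborel. T \<alpha> x)
   = (LINT x|lborel. root_quotient \<alpha> Q x * of_real (gauss x * (H x * ((\<alpha> \<bullet> x)\<^sup>2 / ((\<alpha> \<bullet> x)\<^sup>2 + \<epsilon>))))) / 2" if \<alpha>: "\<alpha> \<in> R" for \<alpha>
 proof -
  define f where "f x = Q x * of_real (gauss x * (H x * kern \<alpha> x))" for x
  have [measurable]: "f \<in> borel_measurable borel" unfolding f_def by measurable
  have fint: "integrable lborel f" unfolding f_def using Tint[of \<alpha>] by (simp only: T_def[abs_def])
  have eq: "(LINT x|lborel. f (root_reflection \<alpha> x)) = (LINT x|lborel. f x)"
   by (rule integral_root_reflection[OF R_nonzero[OF \<alpha>]]) measurable
  have fr: "f (root_reflection \<alpha> x) = - (Q (root_reflection \<alpha> x) * of_real (gauss x * (H x * kern \<alpha> x)))" for x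
   unfolding f_def gauss_reflection[OF \<alpha>] kern_def inner_root_reflection_self[OF R_nonzero[OF \<alpha>]] H_def smooth_weight_reflection[OF \<alpha>]
   by simp
  have "integrable (distr lborel borel (root_reflection \<alpha>)) f"
   using fint by (simp add: lborel_distr_root_reflection[OF R_nonzero[OF \<alpha>]])
  then have frint: "integrable lborel (%x. f (root_reflection \<alpha> x))"
   by (subst (asm) integrable_distr_eq) auto
  have "2 * (LINT x|lborel. f x) = (LINT x|lborel. f x + f (root_reflection \<alpha> x))"
   using fint frint eq by simp
  also have "\<dots> = (LINT x|lborel. root_quotient \<alpha> Q x * of_real (gauss x * (H x * ((\<alpha> \<bullet> x)\<^sup>2 / ((\<alpha> \<bullet> x)\<^sup>2 + \<epsilon>)))))"
  proof (rule Bochner_Integration.integral_cong[OF refl])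
   fix x
   have "f x + f (root_reflection \<alpha> x) = (Q x - Q (root_reflection \<alpha> x)) * of_real (gauss x * (H x * kern \<alpha> x))"
    unfolding fr by (simp add: f_def left_diff_distrib)
   also have "\<dots> = root_quotient \<alpha> Q x * of_real (gauss x * (H x * ((\<alpha> \<bullet> x) * kern \<alpha> x)))"
    unfolding polynomial_root_quotient(2)[OF Q R_nonzero[OF \<alpha>]] by (simp add: mult_ac)
   finally show "f x + f (root_reflection \<alpha> x) = root_quotient \<alpha> Q x * of_real (gauss x * (H x * ((\<alpha> \<bullet> x)\<^sup>2 / ((\<alpha> \<bullet> x)\<^sup>2 + \<epsilon>))))"
    by (simp add: kern_def power2_eq_square)
  qed
  finally have "2 * (LINT x|lborel. f x) = (LINT x|lborel. root_quotient \<alpha> Q x * of_real (gauss x * (H x * ((\<alpha> \<bullet> x)\<^sup>2 / ((\<alpha> \<bullet> x)\<^sup>2 + \<epsilon>)))))" .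
  moreover have "y = z / 2" if "2 * y = z" for y z :: complex using that by auto
  ultimately show ?thesis unfolding f_def T_def by blast
 qed
 have "(\<Sum>\<alpha>\<in>R. mult_inner \<xi> \<alpha> * (LINT x|lborel. T \<alpha> x))
   = (\<Sum>\<alpha>\<in>R. of_real (k \<alpha> * (\<alpha> \<bullet> \<xi>) / 2) * (LINT x|lborel. root_quotient \<alpha> Q x * of_real (gauss x * (H x * ((\<alpha> \<bullet> x)\<^sup>2 / ((\<alpha> \<bullet> x)\<^sup>2 + \<epsilon>))))))"
  by (intro sum.cong refl) (simp only: half of_real_divide of_real_numeral times_divide_eq_left times_divide_eq_right)
 then show ?thesis using E1 E2 unfolding D_def H_def by (simp only:)
qed

end

context dunkl begin

lemma root_quotient_regular:
 "polynomial_function p ==> x \<in> regular ==> \<alpha> \<in> R ==> root_quotient \<alpha> p x = (p x - p (root_reflection \<alpha> x)) / of_real (\<alpha> \<bullet> x)"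
 by (auto simp: root_quotient_def regular_def)

text \<open>
 The derivative of the weight produces \<open>Q(x) / \<langle>\<alpha>, x\<rangle>\<close>, whose odd part under \<open>r\<^sub>\<alpha>\<close> integrates to zero;
 what remains is the difference quotient of the Dunkl operator. The argument is made for the
 smooth weights and passes to the limit \<open>\<epsilon> \<rightarrow> 0\<close> by dominated convergence.
\<close>

theorem gint_dunkl_op:
 assumes Q: "polynomial_function Q"
 shows "gint (dunkl_op P k \<xi> Q) = gint (%x. of_real (x \<bullet> \<xi>) * Q x)"
proof -
 define D where "D x = dir_deriv \<xi> Q x - of_real (x \<bullet> \<xi>) * Q x" for x
 have Dp: "polynomial_function D"
  unfolding D_def by (intro polynomial_function_diff polynomial_has_derivative(2) polynomial_intros Q)
 have Rp: "polynomial_function (root_quotient \<alpha> Q)" if "\<alpha> \<in> R" for \<alpha>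
  using polynomial_root_quotient(1)[OF Q R_nonzero[OF that]] .
 have [measurable]: "D \<in> borel_measurable borel" using Dp by (rule borel_measurable_polynomial)
 define \<epsilon> where "\<epsilon> j = 1 / real (Suc j)" for j
 have \<epsilon>: "0 < \<epsilon> j" "\<epsilon> j \<le> 1" for j unfolding \<epsilon>_def by auto
 have \<epsilon>0: "\<epsilon> \<longlonglongrightarrow> 0" unfolding \<epsilon>_def using LIMSEQ_inverse_real_of_nat by (simp add: inverse_eq_divide)
 have lim: "(%j. LINT x|lborel. p x * of_real (gauss x * (smooth_weight (\<epsilon> j) x * c j x))) \<longlonglongrightarrow> gint p"
  if p: "polynomial_function p" and [measurable]: "\<And>j. c j \<in> borel_measurable borel"
   and c: "\<And>j x. 0 \<le> c j x" "\<And>j x. c j x \<le> 1" "\<And>x. x \<in> regular ==> (%j. c j x) \<longlonglongrightarrow> 1" for p :: "real^'n => complex" and c :: "nat => real^'n => real"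
  unfolding gint_def
 proof (rule integral_dominated_convergence[where w = "%x. cmod (p x * of_real (gauss x * smooth_weight 1 x))"])
  have [measurable]: "p \<in> borel_measurable borel" using p by (rule borel_measurable_polynomial)
  show "(%x. p x * of_real (gauss x * weight x)) \<in> borel_measurable lborel" by measurable
  show "(%x. p x * of_real (gauss x * (smooth_weight (\<epsilon> j) x * c j x))) \<in> borel_measurable lborel" for j by measurable
  show "integrable lborel (%x. cmod (p x * of_real (gauss x * smooth_weight 1 x)))"
   by (intro integrable_norm integrable_poly_gauss p) (auto simp: smooth_weight_nonneg)
  show "AE x in lborel. (%j. p x * of_real (gauss x * (smooth_weight (\<epsilon> j) x * c j x))) \<longlonglongrightarrow> p x * of_real (gauss x * weight x)"
   using AE_regular
  proof eventually_elim
   case (elim x)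
   have "(%j. p x * of_real (gauss x * (smooth_weight (\<epsilon> j) x * c j x))) \<longlonglongrightarrow> p x * of_real (gauss x * (weight x * 1))"
    unfolding \<epsilon>_def by (intro tendsto_intros smooth_weight_tendsto c elim)
   then show ?case by simp
  qed
  show "AE x in lborel. norm (p x * of_real (gauss x * (smooth_weight (\<epsilon> j) x * c j x))) \<le> cmod (p x * of_real (gauss x * smooth_weight 1 x))" for j
  proof (rule AE_I2)
   fix x
   have "smooth_weight (\<epsilon> j) x * c j x \<le> smooth_weight 1 x * 1"
    using c smooth_weight_mono[OF less_imp_le[OF \<epsilon>(1)] \<epsilon>(2)] smooth_weight_nonneg by (intro mult_mono) auto
   then have "(cmod (p x) * gauss x) * (smooth_weight (\<epsilon> j) x * c j x) \<le> (cmod (p x) * gauss x) * smooth_weight 1 x"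
    by (intro mult_left_mono) (auto simp: gauss_def)
   then show "norm (p x * of_real (gauss x * (smooth_weight (\<epsilon> j) x * c j x))) \<le> cmod (p x * of_real (gauss x * smooth_weight 1 x))"
    using c(1)[of j x] smooth_weight_nonneg by (simp add: norm_mult abs_mult gauss_def)
  qed
 qed
 have "(%j. (LINT x|lborel. D x * of_real (gauss x * (smooth_weight (\<epsilon> j) x * 1)))
  + (\<Sum>\<alpha>\<in>R. of_real (k \<alpha> * (\<alpha> \<bullet> \<xi>) / 2) *
    (LINT x|lborel. root_quotient \<alpha> Q x * of_real (gauss x * (smooth_weight (\<epsilon> j) x * ((\<alpha> \<bullet> x)\<^sup>2 / ((\<alpha> \<bullet> x)\<^sup>2 + \<epsilon> j)))))))
  \<longlonglongrightarrow> gint D + (\<Sum>\<alpha>\<in>R. of_real (k \<alpha> * (\<alpha> \<bullet> \<xi>) / 2) * gint (root_quotient \<alpha> Q))"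
 proof (intro tendsto_add tendsto_sum tendsto_mult tendsto_const lim Dp Rp)
  fix \<alpha> x j assume \<alpha>: "\<alpha> \<in> R"
  have "0 < (\<alpha> \<bullet> x)\<^sup>2 + \<epsilon> j" using \<epsilon>(1)[of j] by (simp add: add_nonneg_pos)
  then show "(\<alpha> \<bullet> x)\<^sup>2 / ((\<alpha> \<bullet> x)\<^sup>2 + \<epsilon> j) \<le> 1" "0 \<le> (\<alpha> \<bullet> x)\<^sup>2 / ((\<alpha> \<bullet> x)\<^sup>2 + \<epsilon> j)" using \<epsilon>(1)[of j] by simp_all
 next
  fix \<alpha> x assume \<alpha>: "\<alpha> \<in> R" and x: "x \<in> regular"
  have nz: "(\<alpha> \<bullet> x)\<^sup>2 \<noteq> 0" using \<alpha> x by (simp add: regular_def)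
  have "(%j. (\<alpha> \<bullet> x)\<^sup>2 / ((\<alpha> \<bullet> x)\<^sup>2 + \<epsilon> j)) \<longlonglongrightarrow> (\<alpha> \<bullet> x)\<^sup>2 / ((\<alpha> \<bullet> x)\<^sup>2 + 0)"
   using nz by (intro tendsto_divide tendsto_add tendsto_const \<epsilon>0) auto
  then show "(%j. (\<alpha> \<bullet> x)\<^sup>2 / ((\<alpha> \<bullet> x)\<^sup>2 + \<epsilon> j)) \<longlonglongrightarrow> 1" using nz by simp
 qed auto
 moreover have "(LINT x|lborel. D x * of_real (gauss x * (smooth_weight (\<epsilon> j) x * 1)))
  + (\<Sum>\<alpha>\<in>R. of_real (k \<alpha> * (\<alpha> \<bullet> \<xi>) / 2) *
    (LINT x|lborel. root_quotient \<alpha> Q x * of_real (gauss x * (smooth_weight (\<epsilon> j) x * ((\<alpha> \<bullet> x)\<^sup>2 / ((\<alpha> \<bullet> x)\<^sup>2 + \<epsilon> j)))))) = 0" for j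
  using smooth_parts[OF Q \<epsilon>, of \<xi>] unfolding D_def by simp
 ultimately have 0: "gint D + (\<Sum>\<alpha>\<in>R. of_real (k \<alpha> * (\<alpha> \<bullet> \<xi>) / 2) * gint (root_quotient \<alpha> Q)) = 0"
  by (simp add: LIMSEQ_const_iff)
 have neg: "gint (root_quotient (- \<alpha>) Q) = - gint (root_quotient \<alpha> Q)" if "\<alpha> \<in> R" for \<alpha>
 proof -
  have r: "root_reflection (- \<alpha>) = root_reflection \<alpha>" by (simp add: root_reflection_def[abs_def])
  have "gint (root_quotient (- \<alpha>) Q) = gint (%x. (-1) * root_quotient \<alpha> Q x)"
  proof (rule gint_cong_regular)
   show "root_quotient (- \<alpha>) Q x = (-1) * root_quotient \<alpha> Q x" if "x \<in> regular" for x
    using \<open>\<alpha> \<in> R\<close> uminus_R[OF \<open>\<alpha> \<in> R\<close>] by (simp add: root_quotient_regular[OF Q that] r) (metis minus_diff_eq minus_divide_left)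
  qed (use Rp[OF that] Rp[OF uminus_R[OF that]] in \<open>auto intro!: borel_measurable_polynomial borel_measurable_uminus\<close>)
  then show ?thesis by (simp only: gint_cmult) simp
 qed
 have "(\<Sum>\<alpha>\<in>R. of_real (k \<alpha> * (\<alpha> \<bullet> \<xi>) / 2) * gint (root_quotient \<alpha> Q))
   = (\<Sum>\<alpha>\<in>P. mult_inner \<xi> \<alpha> * gint (root_quotient \<alpha> Q))"
  unfolding sum_R_P using k_uminus[OF P_R] neg[OF P_R] by (intro sum.cong) auto
 also have "\<dots> = gint (%x. \<Sum>\<alpha>\<in>P. mult_inner \<xi> \<alpha> * root_quotient \<alpha> Q x)"
  by (subst gint_sum) (auto simp: gint_cmult intro!: polynomial_function_complex_mult Rp P_R)
 finally have S: "gint D + gint (%x. \<Sum>\<alpha>\<in>P. mult_inner \<xi> \<alpha> * root_quotient \<alpha> Q x) = 0"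
  using 0 by simp
 have "gint (%x. dunkl_op P k \<xi> Q x - of_real (x \<bullet> \<xi>) * Q x)
   = gint (%x. D x + (\<Sum>\<alpha>\<in>P. mult_inner \<xi> \<alpha> * root_quotient \<alpha> Q x))"
  by (simp add: D_def dunkl_op_def algebra_simps)
 also have "\<dots> = 0"
 proof -
  have "polynomial_function (%x. \<Sum>\<alpha>\<in>P. mult_inner \<xi> \<alpha> * root_quotient \<alpha> Q x)"
   by (intro polynomial_intros Rp P_R finite_P)
  from gint_add[OF Dp this] S show ?thesis by (simp only:)
 qed
 finally show ?thesis
  by (subst (asm) gint_diff) (auto intro!: polynomial_dunkl_op Q polynomial_intros)
qed

text \<open>
 Dunkl operators satisfy the product rule up to terms that are odd under a reflection and hence
 vanish on integration.
\<close>

lemma gint_dunkl_op_product: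
 assumes p: "polynomial_function p" and q: "polynomial_function q"
 shows "gint (%x. dunkl_op P k \<xi> p x * q x) + gint (%x. p x * dunkl_op P k \<xi> q x) = gint (%x. of_real (x \<bullet> \<xi>) * p x * q x)"
proof -
 note polys = p q polynomial_dunkl_op polynomial_intros
 define B where "B \<alpha> x = of_real (\<alpha> \<bullet> x) * (root_quotient \<alpha> p x * root_quotient \<alpha> q x)" for \<alpha> x
 have Bp: "polynomial_function (B \<alpha>)" if "\<alpha> \<in> R" for \<alpha>
  unfolding B_def using polynomial_root_quotient(1)[OF p R_nonzero[OF that]] polynomial_root_quotient(1)[OF q R_nonzero[OF that]]
  by (intro polys)
 have Breg: "B \<alpha> x = (p x - p (root_reflection \<alpha> x)) * (q x - q (root_reflection \<alpha> x)) / of_real (\<alpha> \<bullet> x)" if "\<alpha> \<in> R" "x \<in> regular" for \<alpha> x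
  using that(2) that(1) by (simp add: B_def root_quotient_regular p q regular_def)
 have B0: "gint (B \<alpha>) = 0" if \<alpha>: "\<alpha> \<in> R" for \<alpha>
 proof -
  have "gint (%x. B \<alpha> (root_reflection \<alpha> x)) = gint (%x. (-1) * B \<alpha> x)"
  proof (rule gint_cong_regular)
   fix x assume x: "x \<in> regular"
   have swap: "(a' - a) * (b' - b) = (a - a') * (b - b')" for a a' b b' :: complex by (simp add: algebra_simps)
   show "B \<alpha> (root_reflection \<alpha> x) = (-1) * B \<alpha> x"
    unfolding Breg[OF \<alpha> x] Breg[OF \<alpha> regular_reflection[OF \<alpha> x]] root_reflection_involution[OF R_nonzero[OF \<alpha>]]
     inner_root_reflection_self[OF R_nonzero[OF \<alpha>]] swap[of "p (root_reflection \<alpha> x)"]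
    by simp
  qed (use borel_measurable_polynomial[OF Bp[OF \<alpha>]] in measurable)
  then have "gint (B \<alpha>) = - gint (B \<alpha>)"
   unfolding gint_cmult gint_reflection[OF \<alpha> Bp[OF \<alpha>]] by simp
  then show ?thesis by simp
 qed
 have "gint (%x. dunkl_op P k \<xi> p x * q x) + gint (%x. p x * dunkl_op P k \<xi> q x)
   = gint (%x. dunkl_op P k \<xi> p x * q x + p x * dunkl_op P k \<xi> q x)"
  by (subst gint_add) (auto intro!: polys)
 also have "\<dots> = gint (%x. dunkl_op P k \<xi> (%y. p y * q y) x + (\<Sum>\<alpha>\<in>P. mult_inner \<xi> \<alpha> * B \<alpha> x))"
 proof (rule gint_cong_regular)
  fix x assume x: "x \<in> regular"
  have "has_dir_deriv (%y. p y * q y) \<xi> (p (x + 0 *\<^sub>R \<xi>) * dir_deriv \<xi> q x + dir_deriv \<xi> p x * q (x + 0 *\<^sub>R \<xi>)) x"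
   by (intro has_vector_derivative_mult polynomial_has_dir_deriv p q)
  note D = dunkl_op_regular[OF x this]
  have A: "(\<Sum>\<alpha>\<in>P. mult_inner \<xi> \<alpha> * ((p x - p (root_reflection \<alpha> x)) / of_real (\<alpha> \<bullet> x))) * q x
    + p x * (\<Sum>\<alpha>\<in>P. mult_inner \<xi> \<alpha> * ((q x - q (root_reflection \<alpha> x)) / of_real (\<alpha> \<bullet> x)))
    = (\<Sum>\<alpha>\<in>P. mult_inner \<xi> \<alpha> * ((p x * q x - p (root_reflection \<alpha> x) * q (root_reflection \<alpha> x)) / of_real (\<alpha> \<bullet> x)))
    + (\<Sum>\<alpha>\<in>P. mult_inner \<xi> \<alpha> * B \<alpha> x)"
   unfolding sum_distrib_left sum_distrib_right sum.distrib[symmetric]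
  proof (intro sum.cong refl)
   fix \<alpha> assume \<alpha>: "\<alpha> \<in> P"
   have alg: "K * ((a - a') / d) * b + a * (K * ((b - b') / d)) = K * ((a * b - a' * b') / d) + K * ((a - a') * (b - b') / d)"
    if "d \<noteq> 0" for K a a' b b' d :: complex using that by (simp add: field_simps)
   show "mult_inner \<xi> \<alpha> * ((p x - p (root_reflection \<alpha> x)) / of_real (\<alpha> \<bullet> x)) * q x
     + p x * (mult_inner \<xi> \<alpha> * ((q x - q (root_reflection \<alpha> x)) / of_real (\<alpha> \<bullet> x)))
    = mult_inner \<xi> \<alpha> * ((p x * q x - p (root_reflection \<alpha> x) * q (root_reflection \<alpha> x)) / of_real (\<alpha> \<bullet> x))
     + mult_inner \<xi> \<alpha> * B \<alpha> x"
    unfolding Breg[OF P_R[OF \<alpha>] x] using regular_P[OF x \<alpha>] by (intro alg) simp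
  qed
  show "dunkl_op P k \<xi> p x * q x + p x * dunkl_op P k \<xi> q x
    = dunkl_op P k \<xi> (%y. p y * q y) x + (\<Sum>\<alpha>\<in>P. mult_inner \<xi> \<alpha> * B \<alpha> x)"
   unfolding D dunkl_op_polynomial_regular[OF p x] dunkl_op_polynomial_regular[OF q x]
   using A by (simp add: distrib_left distrib_right algebra_simps)
 next
  show "(%x. dunkl_op P k \<xi> p x * q x + p x * dunkl_op P k \<xi> q x) \<in> borel_measurable borel"
   by (intro borel_measurable_polynomial polynomial_function_add polys)
  show "(%x. dunkl_op P k \<xi> (%y. p y * q y) x + (\<Sum>\<alpha>\<in>P. mult_inner \<xi> \<alpha> * B \<alpha> x)) \<in> borel_measurable borel"
   by (intro borel_measurable_polynomial polynomial_intros polys Bp P_R finite_P) auto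
 qed
 also have "\<dots> = gint (dunkl_op P k \<xi> (%y. p y * q y)) + (\<Sum>\<alpha>\<in>P. mult_inner \<xi> \<alpha> * gint (B \<alpha>))"
 proof (subst gint_add)
  show "polynomial_function (%x. \<Sum>\<alpha>\<in>P. mult_inner \<xi> \<alpha> * B \<alpha> x)"
   by (intro polynomial_intros Bp P_R finite_P)
  have "gint (%x. \<Sum>\<alpha>\<in>P. mult_inner \<xi> \<alpha> * B \<alpha> x) = (\<Sum>\<alpha>\<in>P. mult_inner \<xi> \<alpha> * gint (B \<alpha>))"
   by (subst gint_sum) (auto simp: gint_cmult intro!: polynomial_function_complex_mult Bp P_R)
  then show "gint (dunkl_op P k \<xi> (%y. p y * q y)) + gint (%x. \<Sum>\<alpha>\<in>P. mult_inner \<xi> \<alpha> * B \<alpha> x)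
    = gint (dunkl_op P k \<xi> (%y. p y * q y)) + (\<Sum>\<alpha>\<in>P. mult_inner \<xi> \<alpha> * gint (B \<alpha>))" by simp
 qed (intro polys)
 also have "\<dots> = gint (%x. of_real (x \<bullet> \<xi>) * (p x * q x))"
  using B0[OF P_R] by (simp add: gint_dunkl_op polys)
 finally show ?thesis by (simp add: mult.assoc)
qed

text \<open>
 Integrating \<open>\<Sum>\<^sub>b T\<^sub>b p T\<^sub>b q\<close> by parts in both ways expresses it, for harmonic \<open>p\<close> and \<open>q\<close>, as the integral of
 \<open>\<Sum>\<^sub>b x\<^sub>b T\<^sub>b p\<close> times \<open>q\<close> and of \<open>p\<close> times \<open>\<Sum>\<^sub>b x\<^sub>b T\<^sub>b q\<close>. By Euler's identity these sums are \<open>m p\<close> and \<open>n q\<close> up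
 to reflection terms that are symmetric in \<open>p\<close> and \<open>q\<close>; hence \<open>m\<close> times the integral of \<open>p q\<close> is \<open>n\<close> times
 it.
\<close>

theorem harmonics_orthogonal_gauss:
 assumes p: "p \<in> dunkl_harmonics P k m" and q: "q \<in> dunkl_harmonics P k n" and "m \<noteq> n"
 shows "gint (%x. p x * q x) = 0"
proof -
 have pp: "polynomial_function p" and ph: "homogeneous m p" and p0: "\<And>x. dunkl_laplacian P k p x = 0"
  and qp: "polynomial_function q" and qh: "homogeneous n q" and q0: "\<And>x. dunkl_laplacian P k q x = 0"
  using p q by (auto simp: dunkl_harmonics_iff)
 let ?T = "dunkl_op P k"
 note polys = pp qp polynomial_dunkl_op polynomial_intros
 have I: "(\<Sum>b\<in>Basis. gint (%x. of_real (x \<bullet> b) * ?T b f x * g x)) = (\<Sum>b\<in>Basis. gint (%x. ?T b f x * ?T b g x))"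
  if f: "polynomial_function f" and g: "polynomial_function g" and f0: "\<And>x. dunkl_laplacian P k f x = 0" for f g
 proof -
  have "(\<Sum>b\<in>Basis. gint (%x. ?T b (?T b f) x * g x)) = gint (%x. dunkl_laplacian P k f x * g x)"
   unfolding dunkl_laplacian_def sum_distrib_right
   by (subst gint_sum) (auto intro!: f g polys)
  also have "\<dots> = 0" by (simp add: f0 gint_def)
  finally have 0: "(\<Sum>b\<in>Basis. gint (%x. ?T b (?T b f) x * g x)) = 0" .
  have "(\<Sum>b\<in>Basis. gint (%x. of_real (x \<bullet> b) * ?T b f x * g x))
    = (\<Sum>b\<in>Basis. gint (%x. ?T b (?T b f) x * g x) + gint (%x. ?T b f x * ?T b g x))"
   by (intro sum.cong refl gint_dunkl_op_product[symmetric] polynomial_dunkl_op f g)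
  then show ?thesis using 0 by (simp add: sum.distrib)
 qed
 define \<Delta> where "\<Delta> f x = (\<Sum>\<alpha>\<in>P. of_real (k \<alpha>) * (f x - f (root_reflection \<alpha> x)))" for f :: "real^'n => complex" and x
 have refl_poly: "polynomial_function (%x. f (root_reflection \<alpha> x))" if "polynomial_function f" for f :: "real^'n => complex" and \<alpha>
  using polynomial_function_compose[OF polynomial_root_reflection that] by (simp add: o_def)
 have \<Delta>p: "polynomial_function (\<Delta> f)" if "polynomial_function f" for f
  unfolding \<Delta>_def by (intro polynomial_intros refl_poly that finite_P)
 have J: "gint (%x. (of_nat d * f x + \<Delta> f x) * g x) = (\<Sum>b\<in>Basis. gint (%x. of_real (x \<bullet> b) * ?T b f x * g x))"
  if f: "polynomial_function f" "homogeneous d f" and g: "polynomial_function g" for f g d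
 proof -
  have "gint (%x. (of_nat d * f x + \<Delta> f x) * g x) = gint (%x. \<Sum>b\<in>Basis. of_real (x \<bullet> b) * ?T b f x * g x)"
  proof (rule gint_cong_regular)
   show "(of_nat d * f x + \<Delta> f x) * g x = (\<Sum>b\<in>Basis. of_real (x \<bullet> b) * ?T b f x * g x)" if "x \<in> regular" for x
    unfolding sum_distrib_right[symmetric] dunkl_degree_left[OF f that] \<Delta>_def ..
   show "(%x. (of_nat d * f x + \<Delta> f x) * g x) \<in> borel_measurable borel"
    by (intro borel_measurable_polynomial polynomial_intros f \<Delta>p g)
   show "(%x. \<Sum>b\<in>Basis. of_real (x \<bullet> b) * ?T b f x * g x) \<in> borel_measurable borel"
    by (intro borel_measurable_polynomial polynomial_function_sum f g polys) auto
  qed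
  also have "\<dots> = (\<Sum>b\<in>Basis. gint (%x. of_real (x \<bullet> b) * ?T b f x * g x))"
   by (rule gint_sum) (intro f g polys)
  finally show ?thesis .
 qed
 have sym: "gint (%x. \<Delta> p x * q x) = gint (%x. \<Delta> q x * p x)"
 proof -
  have ex: "gint (%x. \<Delta> f x * g x) = (\<Sum>\<alpha>\<in>P. of_real (k \<alpha>) * (gint (%x. f x * g x) - gint (%x. f (root_reflection \<alpha> x) * g x)))"
   if f: "polynomial_function f" and g: "polynomial_function g" for f g
  proof -
   have "gint (%x. \<Delta> f x * g x) = (\<Sum>\<alpha>\<in>P. gint (%x. of_real (k \<alpha>) * (f x * g x - f (root_reflection \<alpha> x) * g x)))"
    unfolding \<Delta>_def sum_distrib_right left_diff_distrib[symmetric] mult.assoc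
    by (rule gint_sum) (intro polynomial_intros refl_poly f g)
   also have "\<dots> = (\<Sum>\<alpha>\<in>P. of_real (k \<alpha>) * (gint (%x. f x * g x) - gint (%x. f (root_reflection \<alpha> x) * g x)))"
    unfolding gint_cmult by (intro sum.cong refl arg_cong2[where f = "(*)"] gint_diff polynomial_function_complex_mult refl_poly f g)
   finally show ?thesis .
  qed
  have "gint (%x. p (root_reflection \<alpha> x) * q x) = gint (%x. q (root_reflection \<alpha> x) * p x)" if "\<alpha> \<in> P" for \<alpha>
   using gint_reflection[OF P_R[OF that], of "%x. p (root_reflection \<alpha> x) * q x"]
   by (simp add: root_reflection_involution[OF P_nonzero[OF that]] polynomial_function_complex_mult refl_poly pp qp mult.commute)
  then show ?thesis unfolding ex[OF pp qp] ex[OF qp pp] by (simp add: mult.commute[of "p _"])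
 qed
 have "gint (%x. (of_nat m * p x + \<Delta> p x) * q x) = gint (%x. (of_nat n * q x + \<Delta> q x) * p x)"
  unfolding J[OF pp ph qp] J[OF qp qh pp] I[OF pp qp p0] I[OF qp pp q0] by (simp add: mult.commute)
 also have "gint (%x. (of_nat m * p x + \<Delta> p x) * q x) = of_nat m * gint (%x. p x * q x) + gint (%x. \<Delta> p x * q x)"
  unfolding distrib_right mult.assoc
  by (subst gint_add) (auto simp: gint_cmult intro!: polynomial_function_complex_mult \<Delta>p pp qp)
 also have "gint (%x. (of_nat n * q x + \<Delta> q x) * p x) = of_nat n * gint (%x. q x * p x) + gint (%x. \<Delta> q x * p x)"
  unfolding distrib_right mult.assoc
  by (subst gint_add) (auto simp: gint_cmult intro!: polynomial_function_complex_mult \<Delta>p pp qp)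
 finally have "of_nat m * gint (%x. p x * q x) = of_nat n * gint (%x. p x * q x)"
  unfolding sym by (simp add: mult.commute)
 then show ?thesis using \<open>m \<noteq> n\<close> by simp
qed

end

section \<open>Laguerre polynomials\<close>

definition laguerre_coeff :: "real => nat => nat => real" where
 "laguerre_coeff \<nu> l j = (-1) ^ j * pochhammer (\<nu> + real j + 1) (l - j) / (fact (l - j) * fact j)"

lemma gchoose_pochhammer: "j \<le> l ==> (\<nu> + real l) gchoose (l - j) = pochhammer (\<nu> + real j + 1) (l - j) / fact (l - j)"
 by (subst gbinomial_pochhammer') (simp add: of_nat_diff algebra_simps)

lemma laguerre_altdef: "laguerre l \<nu> t = (\<Sum>j\<le>l. laguerre_coeff \<nu> l j * t ^ j)"
 unfolding laguerre_def laguerre_coeff_def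
 by (intro sum.cong refl) (simp add: gchoose_pochhammer)

lemma laguerre_coeff_lead: "laguerre_coeff \<nu> l l \<noteq> 0"
 by (simp add: laguerre_coeff_def)

text \<open>The coefficient matrix of the Laguerre polynomials is triangular with non-zero diagonal.\<close>

lemma laguerre_triangular:
 fixes m :: "nat => complex"
 assumes "\<And>l. (\<Sum>j\<le>l. of_real (laguerre_coeff \<nu> l j * c ^ j) * m j) = 0" and c: "c \<noteq> 0"
 shows "m n = 0"
proof (induction n rule: less_induct)
 case (less n)
 have "0 = (\<Sum>j\<le>n. of_real (laguerre_coeff \<nu> n j * c ^ j) * m j)" using assms(1) by simp
 also have "\<dots> = of_real (laguerre_coeff \<nu> n n * c ^ n) * m n + (\<Sum>j<n. of_real (laguerre_coeff \<nu> n j * c ^ j) * m j)"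
  by (simp add: lessThan_Suc_atMost[symmetric])
 also have "(\<Sum>j<n. of_real (laguerre_coeff \<nu> n j * c ^ j) * m j) = 0"
  using less by (intro sum.neutral) auto
 finally show ?case using laguerre_coeff_lead[of \<nu> n] c by simp
qed

lemma laguerre_coeff_recursion:
 assumes "j < l"
 shows "(real j + 1) * (real j + 1 + \<nu>) * laguerre_coeff \<nu> l (Suc j) = (real j - real l) * laguerre_coeff \<nu> l j"
proof -
 obtain d where d: "l = Suc (j + d)" using assms less_iff_Suc_add by blast
 have p: "pochhammer (\<nu> + real j + 1) (Suc d) = (\<nu> + real j + 1) * pochhammer (\<nu> + real j + 2) d"
  by (simp add: pochhammer_rec algebra_simps)
 have e: "l - j = Suc d" "l - Suc j = d" "real j - real l = - real (Suc d)" using d by simp_all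
 have f: "\<nu> + real (Suc j) + 1 = \<nu> + real j + 2" by simp
 show ?thesis
  unfolding laguerre_coeff_def e f p fact_Suc of_nat_mult power_Suc
  by (simp add: divide_simps) (simp add: algebra_simps)
qed

text \<open>
 This writes a rising factorial in \<open>j\<close> through the falling factorials \<open>j choose s\<close>, which can be summed
 against exponential series and binomial sums.
\<close>

lemma pochhammer_Vandermonde:
 fixes \<nu> :: real
 shows "pochhammer (\<nu> + real j + 1) n = fact n * (\<Sum>s\<le>n. ((\<nu> + real n) gchoose (n - s)) * real (j choose s))"
proof -
 have "(\<Sum>s\<le>n. (real j gchoose s) * ((\<nu> + real n) gchoose (n - s))) = (real j + (\<nu> + real n)) gchoose n"
  using gbinomial_Vandermonde[of "real j" "\<nu> + real n" n] by (simp add: atMost_atLeast0)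
 moreover have "(real j + (\<nu> + real n)) gchoose n = pochhammer (\<nu> + real j + 1) n / fact n"
  by (subst gbinomial_pochhammer') (simp add: algebra_simps)
 ultimately show ?thesis by (simp add: binomial_gbinomial mult.commute field_simps)
qed

lemma binomial_product_sum:
 fixes y :: real assumes "s \<le> l"
 shows "(\<Sum>i\<le>l. y ^ i * real (l choose i) * real (i choose s)) = real (l choose s) * y ^ s * (1 + y) ^ (l - s)"
proof -
 have "(\<Sum>i\<le>l. y ^ i * real (l choose i) * real (i choose s)) = (\<Sum>i\<in>{s..l}. y ^ i * real (l choose i) * real (i choose s))"
  by (intro sum.mono_neutral_right) auto
 also have "\<dots> = (\<Sum>i\<in>{s..l}. real (l choose s) * y ^ s * (y ^ (i - s) * real ((l - s) choose (i - s))))"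
 proof (intro sum.cong refl)
  fix i assume i: "i \<in> {s..l}"
  then have "real (l choose i) * real (i choose s) = real (l choose s) * real ((l - s) choose (i - s))"
   using choose_mult[of s i l] by (simp flip: of_nat_mult)
  moreover have "y ^ i = y ^ s * y ^ (i - s)" using i by (simp flip: power_add)
  ultimately show "y ^ i * real (l choose i) * real (i choose s) = real (l choose s) * y ^ s * (y ^ (i - s) * real ((l - s) choose (i - s)))"
   by (simp add: mult_ac)
 qed
 also have "\<dots> = real (l choose s) * y ^ s * (\<Sum>i\<in>{s..l}. y ^ (i - s) * real ((l - s) choose (i - s)))"
  by (simp add: sum_distrib_left)
 also have "(\<Sum>i\<in>{s..l}. y ^ (i - s) * real ((l - s) choose (i - s))) = (\<Sum>i\<le>l - s. y ^ i * real ((l - s) choose i))"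
  using assms by (intro sum.reindex_bij_witness[of _ "%i. i + s" "%i. i - s"]) auto
 also have "\<dots> = (1 + y) ^ (l - s)"
  using binomial_ring[of y 1 "l - s"] by (simp add: add.commute mult.commute)
 finally show ?thesis .
qed

text \<open>
 The sum is an \<open>l\<close>-th finite difference of a polynomial of degree \<open>n < l\<close>. It is the integral of \<open>t\<^sup>n\<close>
 against a Laguerre polynomial and the Gamma density.
\<close>

lemma laguerre_moment_zero:
 assumes \<nu>: "-1 < \<nu>" and "n < l"
 shows "(\<Sum>i\<le>l. laguerre_coeff \<nu> l i * Gamma (\<nu> + real i + real n + 1)) = 0"
proof -
 have "laguerre_coeff \<nu> l i * Gamma (\<nu> + real i + real n + 1)
   = Gamma (\<nu> + real l + 1) / fact l * ((-1) ^ i * real (l choose i) * pochhammer (\<nu> + real i + 1) n)" if "i \<le> l" for i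
 proof -
  have pos: "\<nu> + real i + 1 \<notin> \<int>\<^sub>\<le>\<^sub>0" using \<nu> by (auto elim!: nonpos_Ints_cases)
  have G: "Gamma (\<nu> + real i + 1 + of_nat m) = pochhammer (\<nu> + real i + 1) m * Gamma (\<nu> + real i + 1)" for m
   using pochhammer_Gamma[OF pos, of m] Gamma_eq_zero_iff[of "\<nu> + real i + 1"] pos by (simp add: field_simps)
  have "laguerre_coeff \<nu> l i * Gamma (\<nu> + real i + real n + 1)
    = (-1) ^ i / (fact (l - i) * fact i) * (pochhammer (\<nu> + real i + 1) (l - i) * Gamma (\<nu> + real i + 1)) * pochhammer (\<nu> + real i + 1) n"
   using G[of n] by (simp add: laguerre_coeff_def add_ac mult_ac)
  also have "pochhammer (\<nu> + real i + 1) (l - i) * Gamma (\<nu> + real i + 1) = Gamma (\<nu> + real l + 1)"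
   using G[of "l - i"] that by (simp add: of_nat_diff algebra_simps)
  also have "(-1) ^ i / (fact (l - i) * fact i) = (-1) ^ i * real (l choose i) / fact l"
   using that by (simp add: binomial_fact mult.commute)
  finally show ?thesis by (simp add: mult_ac)
 qed
 then have "(\<Sum>i\<le>l. laguerre_coeff \<nu> l i * Gamma (\<nu> + real i + real n + 1))
   = (\<Sum>i\<le>l. Gamma (\<nu> + real l + 1) / fact l * ((-1) ^ i * real (l choose i) * pochhammer (\<nu> + real i + 1) n))"
  by (intro sum.cong) auto
 also have "\<dots> = Gamma (\<nu> + real l + 1) / fact l * (fact n * (\<Sum>s\<le>n. ((\<nu> + real n) gchoose (n - s)) * (\<Sum>i\<le>l. (-1) ^ i * real (l choose i) * real (i choose s))))"
 proof -
  have "(\<Sum>i\<le>l. (-1) ^ i * real (l choose i) * pochhammer (\<nu> + real i + 1) n)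
   = (\<Sum>i\<le>l. \<Sum>s\<le>n. fact n * (((\<nu> + real n) gchoose (n - s)) * ((-1) ^ i * real (l choose i) * real (i choose s))))"
   unfolding pochhammer_Vandermonde sum_distrib_left by (intro sum.cong refl) (simp only: mult_ac)
  also have "\<dots> = fact n * (\<Sum>s\<le>n. ((\<nu> + real n) gchoose (n - s)) * (\<Sum>i\<le>l. (-1) ^ i * real (l choose i) * real (i choose s)))"
   by (subst sum.swap) (simp only: sum_distrib_left)
  finally show ?thesis by (simp only: sum_distrib_left[symmetric])
 qed
 also have "(\<Sum>s\<le>n. ((\<nu> + real n) gchoose (n - s)) * (\<Sum>i\<le>l. (-1) ^ i * real (l choose i) * real (i choose s))) = 0"
 proof (intro sum.neutral ballI)
  fix s assume "s \<in> {..n}"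
  then have "s < l" using \<open>n < l\<close> by simp
  then show "((\<nu> + real n) gchoose (n - s)) * (\<Sum>i\<le>l. (-1) ^ i * real (l choose i) * real (i choose s)) = 0"
   using binomial_product_sum[of s l "-1"] by (simp add: power_0_left)
 qed
 finally show ?thesis by simp
qed

text \<open>The change of variable \<open>t \<mapsto> 2t\<close>, re-expanded in Laguerre polynomials, costs only a sign.\<close>

lemma laguerre_double:
 "(\<Sum>n\<le>l. laguerre_coeff \<nu> l n * 2 ^ n * fact n * laguerre n \<nu> t) = (-1) ^ l * laguerre l \<nu> (2 * t)"
proof -
 have co: "(\<Sum>n\<in>{j..l}. laguerre_coeff \<nu> l n * 2 ^ n * fact n * laguerre_coeff \<nu> n j) = (-1) ^ l * (laguerre_coeff \<nu> l j * 2 ^ j)" if j: "j \<le> l" for j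
 proof -
  have "laguerre_coeff \<nu> l n * 2 ^ n * fact n * laguerre_coeff \<nu> n j
    = (-1) ^ j * (laguerre_coeff \<nu> l j * 2 ^ j) * ((-2) ^ (n - j) * real ((l - j) choose (n - j)))" if n: "n \<in> {j..l}" for n
  proof -
   have p: "pochhammer (\<nu> + real j + 1) (l - j) = pochhammer (\<nu> + real j + 1) (n - j) * pochhammer (\<nu> + real n + 1) (l - n)"
    using pochhammer_product[of "n - j" "l - j" "\<nu> + real j + 1"] n diff_le_mono[of n l j] by (simp add: of_nat_diff algebra_simps)
   have b: "real ((l - j) choose (n - j)) = fact (l - j) / (fact (n - j) * fact (l - n))"
    using n by (subst binomial_fact) auto
   have s: "(-1) ^ n * 2 ^ n = ((2::real) ^ j * (-2) ^ (n - j)) * (-1) ^ j"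
   proof -
    have "(-1) ^ n * 2 ^ n = (-2::real) ^ n" by (simp flip: power_mult_distrib)
    also have "\<dots> = (-2) ^ j * (-2) ^ (n - j)" using n by (simp flip: power_add)
    also have "(-2::real) ^ j = (-1) ^ j * 2 ^ j" by (simp flip: power_mult_distrib)
    finally show ?thesis by simp
   qed
   have "laguerre_coeff \<nu> l n * 2 ^ n * fact n * laguerre_coeff \<nu> n j
     = ((-1) ^ n * 2 ^ n) * (-1) ^ j * (pochhammer (\<nu> + real j + 1) (n - j) * pochhammer (\<nu> + real n + 1) (l - n)) / (fact (l - n) * (fact (n - j) * fact j))"
    unfolding laguerre_coeff_def by (simp add: field_simps)
   also have "\<dots> = ((2::real) ^ j * (-2) ^ (n - j)) * ((-1) ^ j * (-1) ^ j) * pochhammer (\<nu> + real j + 1) (l - j) / (fact (l - n) * (fact (n - j) * fact j))"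
    unfolding s p by (simp add: mult_ac)
   also have "((-1) ^ j * (-1) ^ j :: real) = 1" by (simp flip: power_mult_distrib)
   finally have 1: "laguerre_coeff \<nu> l n * 2 ^ n * fact n * laguerre_coeff \<nu> n j
     = ((2::real) ^ j * (-2) ^ (n - j)) * pochhammer (\<nu> + real j + 1) (l - j) / (fact (l - n) * (fact (n - j) * fact j))" by simp
   have "(-1) ^ j * (laguerre_coeff \<nu> l j * 2 ^ j) * ((-2) ^ (n - j) * real ((l - j) choose (n - j)))
     = ((-1) ^ j * (-1) ^ j) * ((2::real) ^ j * (-2) ^ (n - j)) * pochhammer (\<nu> + real j + 1) (l - j) / (fact (l - n) * (fact (n - j) * fact j))"
    unfolding b laguerre_coeff_def by (simp add: field_simps)
   also have "((-1) ^ j * (-1) ^ j :: real) = 1" by (simp flip: power_mult_distrib)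
   finally show ?thesis using 1 by simp
  qed
  then have "(\<Sum>n\<in>{j..l}. laguerre_coeff \<nu> l n * 2 ^ n * fact n * laguerre_coeff \<nu> n j)
    = (-1) ^ j * (laguerre_coeff \<nu> l j * 2 ^ j) * (\<Sum>n\<in>{j..l}. (-2) ^ (n - j) * real ((l - j) choose (n - j)))"
   by (simp add: sum_distrib_left)
  also have "(\<Sum>n\<in>{j..l}. (-2) ^ (n - j) * real ((l - j) choose (n - j))) = (\<Sum>i\<le>l - j. (-2) ^ i * real ((l - j) choose i))"
   using j by (intro sum.reindex_bij_witness[of _ "%i. i + j" "%i. i - j"]) auto
  also have "\<dots> = (-1) ^ (l - j)"
   using binomial_ring[of "-2 :: real" 1 "l - j"] by (simp add: mult.commute)
  also have "(-1) ^ j * (laguerre_coeff \<nu> l j * 2 ^ j) * (-1) ^ (l - j) = ((-1) ^ j * (-1) ^ (l - j)) * (laguerre_coeff \<nu> l j * 2 ^ j)"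
   by (simp only: mult_ac)
  also have "(-1) ^ j * (-1) ^ (l - j) = (-1 :: real) ^ l" using j by (simp flip: power_add)
  finally show ?thesis .
 qed
 have "(\<Sum>n\<le>l. laguerre_coeff \<nu> l n * 2 ^ n * fact n * laguerre n \<nu> t)
   = (\<Sum>n\<in>{..l}. \<Sum>j\<in>{j \<in> {..l}. j \<le> n}. laguerre_coeff \<nu> l n * 2 ^ n * fact n * laguerre_coeff \<nu> n j * t ^ j)"
  unfolding laguerre_altdef[of _ \<nu> t] sum_distrib_left by (intro sum.cong) (auto simp: mult_ac)
 also have "\<dots> = (\<Sum>j\<in>{..l}. \<Sum>n\<in>{n \<in> {..l}. j \<le> n}. laguerre_coeff \<nu> l n * 2 ^ n * fact n * laguerre_coeff \<nu> n j * t ^ j)"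
  by (rule sum.swap_restrict) auto
 also have "\<dots> = (\<Sum>j\<in>{..l}. (-1) ^ l * (laguerre_coeff \<nu> l j * (2 * t) ^ j))"
 proof (intro sum.cong refl)
  fix j assume j: "j \<in> {..l}"
  have "{n \<in> {..l}. j \<le> n} = {j..l}" by auto
  then show "(\<Sum>n\<in>{n \<in> {..l}. j \<le> n}. laguerre_coeff \<nu> l n * 2 ^ n * fact n * laguerre_coeff \<nu> n j * t ^ j)
    = (-1) ^ l * (laguerre_coeff \<nu> l j * (2 * t) ^ j)"
   using co[of j] j by (simp add: sum_distrib_right[symmetric] power_mult_distrib)
 qed
 finally show ?thesis by (simp add: laguerre_altdef sum_distrib_left)
qed

text \<open>The radial profile of the eigenfunctions, in the variable \<open>t = \<parallel>x\<parallel>\<^sup>a / a\<close>.\<close>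

definition laguerre_exp :: "nat => real => real => real" where
 "laguerre_exp l \<nu> t = laguerre l \<nu> (2 * t) * exp (- t)"

lemma laguerre_exp_ODE:
 "\<exists>f' f''. (\<forall>t. (laguerre_exp l \<nu> has_real_derivative f' t) (at t)) \<and> (\<forall>t. (f' has_real_derivative f'' t) (at t)) \<and>
   (\<forall>t. t * f'' t + (\<nu> + 1) * f' t - t * laguerre_exp l \<nu> t = - (2 * real l + \<nu> + 1) * laguerre_exp l \<nu> t)"
proof -
 define q :: "real poly" where "q = (\<Sum>j\<le>l. monom (laguerre_coeff \<nu> l j) j)"
 have pq: "laguerre l \<nu> t = poly q t" for t
  by (simp add: q_def laguerre_altdef poly_sum poly_monom)
 have cq: "coeff q j = (if j \<le> l then laguerre_coeff \<nu> l j else 0)" for j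
  by (simp add: q_def coeff_sum if_distrib cong: if_cong)
 have ode: "pCons 0 (pderiv (pderiv q)) + smult (\<nu> + 1) (pderiv q) - pCons 0 (pderiv q) + smult (real l) q = 0"
 proof (rule poly_eqI)
  fix j
  have rec: "(real j + 1) * (real j + 1 + \<nu>) * coeff q (Suc j) = (real j - real l) * coeff q j"
   using laguerre_coeff_recursion[of j l \<nu>] by (cases "j < l"; cases "j = l") (auto simp: cq)
  show "coeff (pCons 0 (pderiv (pderiv q)) + smult (\<nu> + 1) (pderiv q) - pCons 0 (pderiv q) + smult (real l) q) j = coeff 0 j"
   using rec by (cases j) (simp_all add: coeff_pderiv coeff_pCons algebra_simps)
 qed
 have ode': "t * poly (pderiv (pderiv q)) t + (\<nu> + 1) * poly (pderiv q) t - t * poly (pderiv q) t + real l * poly q t = 0" for t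
  using arg_cong[OF ode, of "%p. poly p t"] by simp
 define f' where "f' t = (2 * poly (pderiv q) (2 * t) - poly q (2 * t)) * exp (- t)" for t
 define f'' where "f'' t = (4 * poly (pderiv (pderiv q)) (2 * t) - 4 * poly (pderiv q) (2 * t) + poly q (2 * t)) * exp (- t)" for t
 have pd: "((%t. poly r (2 * t)) has_real_derivative 2 * poly (pderiv r) (2 * t)) (at t)" for r t
 proof -
  have "((%t. 2 * t) has_real_derivative 2) (at t)" by (auto intro!: derivative_eq_intros)
  from DERIV_chain2[where f = "poly r" and g = "%t. 2 * t", OF poly_DERIV this]
  show ?thesis by (simp add: mult.commute)
 qed
 have "(laguerre_exp l \<nu> has_real_derivative f' t) (at t)" for t
  unfolding laguerre_exp_def[abs_def] pq f'_def
  by (rule derivative_eq_intros pd refl)+ (simp add: algebra_simps)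
 moreover have "(f' has_real_derivative f'' t) (at t)" for t
  unfolding f'_def[abs_def] f''_def
  by (rule derivative_eq_intros pd refl)+ (simp add: algebra_simps)
 moreover have "t * f'' t + (\<nu> + 1) * f' t - t * laguerre_exp l \<nu> t = - (2 * real l + \<nu> + 1) * laguerre_exp l \<nu> t" for t
 proof -
  have "t * f'' t + (\<nu> + 1) * f' t - t * laguerre_exp l \<nu> t + (2 * real l + \<nu> + 1) * laguerre_exp l \<nu> t
   = 2 * (2 * t * poly (pderiv (pderiv q)) (2 * t) + (\<nu> + 1) * poly (pderiv q) (2 * t) - 2 * t * poly (pderiv q) (2 * t) + real l * poly q (2 * t)) * exp (- t)"
   unfolding f'_def f''_def laguerre_exp_def pq by (simp add: algebra_simps)
  then have "t * f'' t + (\<nu> + 1) * f' t - t * laguerre_exp l \<nu> t + (2 * real l + \<nu> + 1) * laguerre_exp l \<nu> t = 0"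
   using ode'[of "2 * t"] by simp
  then show ?thesis by (simp add: algebra_simps)
 qed
 ultimately show ?thesis by blast
qed

section \<open>The Hankel transform of Laguerre functions\<close>

lemma has_bochner_integral_Gamma:
 fixes \<nu> c :: real
 assumes \<nu>: "-1 < \<nu>" and c: "0 < c"
 shows "has_bochner_integral lborel (%t. indicator {0<..} t * (t ^ n * exp (- (c * t)) * t powr \<nu>)) (Gamma (\<nu> + real n + 1) / c powr (\<nu> + real n + 1))"
proof (rule has_bochner_integral_nn_integral)
 have "(\<integral>\<^sup>+t. ennreal (indicator {0<..} t * (t ^ n * exp (- (c * t)) * t powr \<nu>)) \<partial>lborel)
   = (\<integral>\<^sup>+t. ennreal (exp (- (c * t)) * t powr (\<nu> + real n)) * indicator {0<..} t \<partial>lborel)"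
  by (intro nn_integral_cong) (auto simp: indicator_def powr_add powr_realpow mult_ac)
 also have "\<dots> = ennreal (Gamma (\<nu> + real n + 1) / c powr (\<nu> + real n + 1))"
  by (rule nn_integral_Gamma) (use \<nu> c in auto)
 finally show "(\<integral>\<^sup>+t. ennreal (indicator {0<..} t * (t ^ n * exp (- (c * t)) * t powr \<nu>)) \<partial>lborel) = ennreal (Gamma (\<nu> + real n + 1) / c powr (\<nu> + real n + 1))" .
 show "0 \<le> Gamma (\<nu> + real n + 1) / c powr (\<nu> + real n + 1)"
  using \<nu> by (intro divide_nonneg_nonneg less_imp_le[OF Gamma_real_pos]) auto
qed (auto simp: indicator_def)

text \<open>The Bessel function in the variable \<open>z = w\<^sup>2 / 4\<close>.\<close>

definition bessel_kernel :: "real => real => real" where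
 "bessel_kernel \<nu> z = (\<Sum>j. (- z) ^ j / (fact j * Gamma (\<nu> + real j + 1)))"

lemma Gamma_growth:
 assumes \<nu>: "-1 < \<nu>" and x: "0 < x"
 shows "\<exists>K>0. \<forall>j. x ^ j / Gamma (\<nu> + real j + 1) \<le> K"
proof -
 obtain N where N: "2 * x < real N" using reals_Archimedean2 by blast
 have pos: "0 < Gamma (\<nu> + real j + 1)" for j using \<nu> by (intro Gamma_real_pos) simp
 have "summable (%j. x ^ j / Gamma (\<nu> + real j + 1))"
 proof (rule summable_ratio_test[of "1 / 2" "Suc N"])
  fix n assume n: "Suc N \<le> n"
  have "\<nu> + real n + 1 \<notin> \<int>\<^sub>\<le>\<^sub>0" using \<nu> by (auto elim!: nonpos_Ints_cases)
  then have "Gamma (\<nu> + real (Suc n) + 1) = (\<nu> + real n + 1) * Gamma (\<nu> + real n + 1)"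
   using Gamma_plus1[of "\<nu> + real n + 1"] by (simp add: add_ac)
  moreover have "2 * x \<le> \<nu> + real n + 1" using n N \<nu> by linarith
  ultimately have e: "x ^ Suc n / Gamma (\<nu> + real (Suc n) + 1) = x / (\<nu> + real n + 1) * (x ^ n / Gamma (\<nu> + real n + 1))"
   and q: "x / (\<nu> + real n + 1) \<le> 1 / 2" using x by (simp_all add: field_simps)
  have y: "0 \<le> x ^ n / Gamma (\<nu> + real n + 1)" "0 \<le> x ^ Suc n / Gamma (\<nu> + real (Suc n) + 1)"
   using x by (intro divide_nonneg_nonneg less_imp_le[OF pos]; simp)+
  show "norm (x ^ Suc n / Gamma (\<nu> + real (Suc n) + 1)) \<le> 1 / 2 * norm (x ^ n / Gamma (\<nu> + real n + 1))"
   unfolding real_norm_def abs_of_nonneg[OF y(1)] abs_of_nonneg[OF y(2)]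
   unfolding e by (intro mult_right_mono q y)
 qed simp
 then have "Bseq (%j. x ^ j / Gamma (\<nu> + real j + 1))"
  by (intro convergent_imp_Bseq convergentI[OF summable_LIMSEQ_zero])
 then obtain K where "0 < K" "\<And>j. norm (x ^ j / Gamma (\<nu> + real j + 1)) \<le> K" by (auto simp: Bseq_def)
 then show ?thesis by (intro exI[of _ K]) (auto intro: order_trans[OF abs_ge_self])
qed

text \<open>The reciprocal Gamma factors decay faster than every geometric sequence.\<close>

lemma bessel_kernel_bound:
 assumes \<nu>: "-1 < \<nu>" and \<epsilon>: "0 < \<epsilon>"
 shows "\<exists>K>0. \<forall>z\<ge>0. summable (%j. \<bar>(- z) ^ j / (fact j * Gamma (\<nu> + real j + 1))\<bar>) \<and> \<bar>bessel_kernel \<nu> z\<bar> \<le> K * exp (\<epsilon> * z)"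
proof -
 obtain K where K: "K > 0" "\<And>j. (1 / \<epsilon>) ^ j / Gamma (\<nu> + real j + 1) \<le> K" using Gamma_growth[OF \<nu>, of "1 / \<epsilon>"] \<epsilon> by auto
 have pos: "0 < Gamma (\<nu> + real j + 1)" for j using \<nu> by (intro Gamma_real_pos) simp
 show ?thesis
 proof (intro exI[of _ K] conjI allI impI K)
  fix z :: real assume z: "0 \<le> z"
  have le: "\<bar>(- z) ^ j / (fact j * Gamma (\<nu> + real j + 1))\<bar> \<le> K * ((\<epsilon> * z) ^ j /\<^sub>R fact j)" for j
  proof -
   have "1 / Gamma (\<nu> + real j + 1) \<le> K * \<epsilon> ^ j" using K(2)[of j] \<epsilon> pos[of j] by (simp add: field_simps)
   then have "(z ^ j / fact j) * (1 / Gamma (\<nu> + real j + 1)) \<le> (z ^ j / fact j) * (K * \<epsilon> ^ j)"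
    using z by (intro mult_left_mono) auto
   then show ?thesis using z pos[of j] by (simp add: abs_mult power_abs power_mult_distrib divide_inverse mult_ac)
  qed
  have e: "(%j. K * ((\<epsilon> * z) ^ j /\<^sub>R fact j)) sums (K * exp (\<epsilon> * z))"
   by (intro sums_mult exp_converges)
  show s: "summable (%j. \<bar>(- z) ^ j / (fact j * Gamma (\<nu> + real j + 1))\<bar>)"
   by (rule summable_comparison_test'[OF sums_summable[OF e], of 0]) (use le in simp)
  have "\<bar>bessel_kernel \<nu> z\<bar> \<le> (\<Sum>j. \<bar>(- z) ^ j / (fact j * Gamma (\<nu> + real j + 1))\<bar>)"
   unfolding bessel_kernel_def by (rule summable_rabs[OF s])
  also have "\<dots> \<le> K * exp (\<epsilon> * z)"
   unfolding sums_unique[OF e] by (rule suminf_le[OF le s sums_summable[OF e]])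
  finally show "\<bar>bessel_kernel \<nu> z\<bar> \<le> K * exp (\<epsilon> * z)" .
 qed
qed

lemma borel_measurable_bessel_kernel [measurable]: "bessel_kernel \<nu> \<in> borel_measurable borel"
 unfolding bessel_kernel_def[abs_def] by measurable

lemma sums_pochhammer_exp:
 fixes x :: real
 shows "(%j. x ^ j / fact j * pochhammer (\<nu> + real j + 1) n) sums
  (fact n * exp x * (\<Sum>s\<le>n. ((\<nu> + real n) gchoose (n - s)) * x ^ s / fact s))"
proof -
 have s: "(%j. x ^ j / fact j * real (j choose s)) sums (x ^ s / fact s * exp x)" for s
 proof -
  have "(%j. x ^ (j + s) / fact (j + s) * real ((j + s) choose s)) sums (x ^ s / fact s * exp x)"
  proof -
   have "x ^ (j + s) / fact (j + s) * real ((j + s) choose s) = x ^ s / fact s * (x ^ j /\<^sub>R fact j)" for j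
    by (subst binomial_fact) (simp_all add: power_add field_simps)
   then show ?thesis using sums_mult[OF exp_converges[of x], of "x ^ s / fact s"] by simp
  qed
  moreover have "(\<Sum>i<s. x ^ i / fact i * real (i choose s)) = 0"
   by (intro sum.neutral) (simp add: binomial_eq_0)
  ultimately show ?thesis
   by (subst (asm) sums_iff_shift[of "%j. x ^ j / fact j * real (j choose s)" s]) (simp only: add_0_right)
 qed
 have "(%j. \<Sum>s\<le>n. fact n * ((\<nu> + real n) gchoose (n - s)) * (x ^ j / fact j * real (j choose s))) sums
   (\<Sum>s\<le>n. fact n * ((\<nu> + real n) gchoose (n - s)) * (x ^ s / fact s * exp x))"
  by (intro sums_sum sums_mult s)
 moreover have "(\<Sum>s\<le>n. fact n * ((\<nu> + real n) gchoose (n - s)) * (x ^ j / fact j * real (j choose s))) = x ^ j / fact j * pochhammer (\<nu> + real j + 1) n" for j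
  unfolding pochhammer_Vandermonde sum_distrib_left by (intro sum.cong refl) (simp add: field_simps)
 moreover have "(\<Sum>s\<le>n. fact n * ((\<nu> + real n) gchoose (n - s)) * (x ^ s / fact s * exp x)) = fact n * exp x * (\<Sum>s\<le>n. ((\<nu> + real n) gchoose (n - s)) * x ^ s / fact s)"
  unfolding sum_distrib_left by (intro sum.cong refl) (simp add: field_simps)
 ultimately show ?thesis by simp
qed

lemma Gamma_pochhammer:
 assumes "-1 < \<nu>"
 shows "Gamma (\<nu> + real (n + j) + 1) = pochhammer (\<nu> + real j + 1) n * Gamma (\<nu> + real j + 1)"
proof -
 have pos: "\<nu> + real j + 1 \<notin> \<int>\<^sub>\<le>\<^sub>0" using assms by (auto elim!: nonpos_Ints_cases)
 then show ?thesis
  using pochhammer_Gamma[OF pos, of n] Gamma_eq_zero_iff[of "\<nu> + real j + 1"] by (simp add: field_simps)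
qed

text \<open>
 Termwise integration of the Bessel series gives a series of rising factorials, whose sum is an
 exponential times a Laguerre polynomial (Kummer's transformation).
\<close>

lemma bessel_moment:
 assumes \<nu>: "-1 < \<nu>" and \<sigma>: "0 \<le> \<sigma>"
 shows "has_bochner_integral lborel (%t. indicator {0<..} t * (t ^ n * exp (- t) * bessel_kernel \<nu> (t * \<sigma>) * t powr \<nu>))
   (fact n * exp (- \<sigma>) * laguerre n \<nu> \<sigma>)"
proof -
 define f where "f j t = (- \<sigma>) ^ j / (fact j * Gamma (\<nu> + real j + 1)) * (indicator {0<..} t * (t ^ (n + j) * exp (- (1 * t)) * t powr \<nu>))" for j and t :: real
 have pos: "0 < Gamma (\<nu> + real j + 1)" for j using \<nu> by (intro Gamma_real_pos) simp
 have fI: "has_bochner_integral lborel (f j) ((- \<sigma>) ^ j / (fact j * Gamma (\<nu> + real j + 1)) * (Gamma (\<nu> + real (n + j) + 1) / 1 powr (\<nu> + real (n + j) + 1)))" for j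
  unfolding f_def by (intro has_bochner_integral_mult_right has_bochner_integral_Gamma) (use \<nu> in auto)
 have val: "(- \<sigma>) ^ j / (fact j * Gamma (\<nu> + real j + 1)) * (Gamma (\<nu> + real (n + j) + 1) / 1 powr (\<nu> + real (n + j) + 1))
   = (- \<sigma>) ^ j / fact j * pochhammer (\<nu> + real j + 1) n" for j
  unfolding Gamma_pochhammer[OF \<nu>, of n j] using pos[of j] by simp
 have normI: "(LINT t|lborel. norm (f j t)) = \<sigma> ^ j / fact j * pochhammer (\<nu> + real j + 1) n" for j
 proof -
  have "norm (f j t) = \<sigma> ^ j / (fact j * Gamma (\<nu> + real j + 1)) * (indicator {0<..} t * (t ^ (n + j) * exp (- (1 * t)) * t powr \<nu>))" for t
   using \<sigma> pos[of j] by (auto simp: f_def abs_mult power_abs indicator_def)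
  then have "has_bochner_integral lborel (%t. norm (f j t)) (\<sigma> ^ j / (fact j * Gamma (\<nu> + real j + 1)) * (Gamma (\<nu> + real (n + j) + 1) / 1 powr (\<nu> + real (n + j) + 1)))"
   by (simp only:) (intro has_bochner_integral_mult_right has_bochner_integral_Gamma; use \<nu> in simp)
  then show ?thesis
   unfolding Gamma_pochhammer[OF \<nu>, of n j] using pos[of j] by (simp add: has_bochner_integral_iff)
 qed
 have sm: "summable (%j. LINT t|lborel. norm (f j t))"
  unfolding normI using sums_pochhammer_exp by (rule sums_summable)
 have kern: "(%j. f j t) sums (indicator {0<..} t * (t ^ n * exp (- t) * bessel_kernel \<nu> (t * \<sigma>) * t powr \<nu>))"
  and kern_sm: "summable (%j. norm (f j t))" for t
 proof -
  show "(%j. f j t) sums (indicator {0<..} t * (t ^ n * exp (- t) * bessel_kernel \<nu> (t * \<sigma>) * t powr \<nu>))" "summable (%j. norm (f j t))"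
  proof (atomize(full), cases "0 < t")
   case False
   then show "(%j. f j t) sums (indicator {0<..} t * (t ^ n * exp (- t) * bessel_kernel \<nu> (t * \<sigma>) * t powr \<nu>)) \<and> summable (%j. norm (f j t))"
    by (simp add: f_def)
  next
   case True
   define c where "c = t ^ n * exp (- t) * t powr \<nu>"
   obtain K where "\<forall>z\<ge>0. summable (%j. \<bar>(- z) ^ j / (fact j * Gamma (\<nu> + real j + 1))\<bar>) \<and> \<bar>bessel_kernel \<nu> z\<bar> \<le> K * exp (1 * z)"
    using bessel_kernel_bound[OF \<nu>, of 1] by auto
   then have a: "summable (%j. \<bar>(- (t * \<sigma>)) ^ j / (fact j * Gamma (\<nu> + real j + 1))\<bar>)" using \<sigma> True by simp
   have fe: "f j t = c * ((- (t * \<sigma>)) ^ j / (fact j * Gamma (\<nu> + real j + 1)))" for j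
   proof -
    have e: "(- (t * \<sigma>)) ^ j = t ^ j * (- \<sigma>) ^ j" by (simp flip: power_mult_distrib)
    have ind: "indicator {0<..} t = (1 :: real)" using True by simp
    show ?thesis unfolding f_def c_def e ind power_add
     by (simp only: mult_1_left times_divide_eq_left times_divide_eq_right mult_ac)
   qed
   have "(%j. f j t) sums (c * bessel_kernel \<nu> (t * \<sigma>))"
    unfolding fe bessel_kernel_def by (rule sums_mult[OF summable_sums[OF summable_rabs_cancel[OF a]]])
   moreover have "summable (%j. norm (f j t))"
    unfolding fe real_norm_def abs_mult by (rule summable_mult[OF a])
   ultimately show "(%j. f j t) sums (indicator {0<..} t * (t ^ n * exp (- t) * bessel_kernel \<nu> (t * \<sigma>) * t powr \<nu>)) \<and> summable (%j. norm (f j t))"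
    using True by (simp add: c_def mult_ac)
  qed
 qed
 have ints: "integrable lborel (f j)" for j using fI[of j] by (simp add: has_bochner_integral_iff)
 have I: "integrable lborel (%t. \<Sum>j. f j t)"
  by (rule integrable_suminf[OF ints]) (use kern_sm sm in auto)
 have S: "(%j. LINT t|lborel. f j t) sums (LINT t|lborel. (\<Sum>j. f j t))"
  by (rule sums_integral[OF ints]) (use kern_sm sm in auto)
 have F: "(\<Sum>j. f j t) = indicator {0<..} t * (t ^ n * exp (- t) * bessel_kernel \<nu> (t * \<sigma>) * t powr \<nu>)" for t
  using kern by (rule sums_unique[symmetric])
 have V: "(LINT t|lborel. f j t) = (- \<sigma>) ^ j / fact j * pochhammer (\<nu> + real j + 1) n" for j
  using fI[of j] unfolding val by (simp add: has_bochner_integral_iff)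
 have L: "(%j. (- \<sigma>) ^ j / fact j * pochhammer (\<nu> + real j + 1) n) sums (fact n * exp (- \<sigma>) * laguerre n \<nu> \<sigma>)"
 proof -
  have "(\<Sum>s\<le>n. ((\<nu> + real n) gchoose (n - s)) * (- \<sigma>) ^ s / fact s) = laguerre n \<nu> \<sigma>"
   unfolding laguerre_def
  proof (intro sum.cong refl)
   fix s
   have "(- \<sigma>) ^ s = (-1) ^ s * \<sigma> ^ s" by (simp flip: power_mult_distrib)
   then show "((\<nu> + real n) gchoose (n - s)) * (- \<sigma>) ^ s / fact s = (-1) ^ s * ((\<nu> + real n) gchoose (n - s)) * \<sigma> ^ s / fact s"
    by simp
  qed
  then show ?thesis using sums_pochhammer_exp[of "- \<sigma>" \<nu> n] by simp
 qed
 from sums_unique2[OF S[unfolded V] L] I show ?thesis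
  unfolding has_bochner_integral_iff F by blast
qed

text \<open>
 The transform turns each power of \<open>t\<close> into a Laguerre polynomial, and \<open>laguerre_double\<close> collects these.
\<close>

theorem bessel_laguerre:
 assumes \<nu>: "-1 < \<nu>" and \<sigma>: "0 \<le> \<sigma>"
 shows "has_bochner_integral lborel (%t. indicator {0<..} t * (laguerre_exp l \<nu> t * bessel_kernel \<nu> (t * \<sigma>) * t powr \<nu>))
   ((-1) ^ l * laguerre_exp l \<nu> \<sigma>)"
proof -
 have "has_bochner_integral lborel (%t. \<Sum>n\<le>l. laguerre_coeff \<nu> l n * 2 ^ n * (indicator {0<..} t * (t ^ n * exp (- t) * bessel_kernel \<nu> (t * \<sigma>) * t powr \<nu>)))
   (\<Sum>n\<le>l. laguerre_coeff \<nu> l n * 2 ^ n * (fact n * exp (- \<sigma>) * laguerre n \<nu> \<sigma>))"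
  by (intro has_bochner_integral_sum has_bochner_integral_mult_right bessel_moment \<nu> \<sigma>)
 also have "(%t. \<Sum>n\<le>l. laguerre_coeff \<nu> l n * 2 ^ n * (indicator {0<..} t * (t ^ n * exp (- t) * bessel_kernel \<nu> (t * \<sigma>) * t powr \<nu>)))
   = (%t. indicator {0<..} t * (laguerre_exp l \<nu> t * bessel_kernel \<nu> (t * \<sigma>) * t powr \<nu>))"
  unfolding laguerre_exp_def laguerre_altdef sum_distrib_right sum_distrib_left
  by (intro ext sum.cong refl) (simp add: power_mult_distrib mult_ac)
 also have "(\<Sum>n\<le>l. laguerre_coeff \<nu> l n * 2 ^ n * (fact n * exp (- \<sigma>) * laguerre n \<nu> \<sigma>))
   = exp (- \<sigma>) * (\<Sum>n\<le>l. laguerre_coeff \<nu> l n * 2 ^ n * fact n * laguerre n \<nu> \<sigma>)"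
  unfolding sum_distrib_left by (intro sum.cong refl) (simp add: mult_ac)
 also have "\<dots> = (-1) ^ l * laguerre_exp l \<nu> \<sigma>"
  unfolding laguerre_double laguerre_exp_def by simp
 finally show ?thesis .
qed

lemma laguerre_exp_moments:
 assumes \<nu>: "-1 < \<nu>"
 shows "has_bochner_integral lborel (%t. indicator {0<..} t * (laguerre_exp l \<nu> t * (t ^ n * exp (- t)) * t powr \<nu>))
  ((\<Sum>i\<le>l. laguerre_coeff \<nu> l i * Gamma (\<nu> + real i + real n + 1)) / 2 powr (\<nu> + real n + 1))"
proof -
 have "has_bochner_integral lborel (%t. \<Sum>i\<le>l. laguerre_coeff \<nu> l i * 2 ^ i * (indicator {0<..} t * (t ^ (i + n) * exp (- (2 * t)) * t powr \<nu>)))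
   (\<Sum>i\<le>l. laguerre_coeff \<nu> l i * 2 ^ i * (Gamma (\<nu> + real (i + n) + 1) / 2 powr (\<nu> + real (i + n) + 1)))"
  by (intro has_bochner_integral_sum has_bochner_integral_mult_right has_bochner_integral_Gamma) (use \<nu> in auto)
 also have "(%t. \<Sum>i\<le>l. laguerre_coeff \<nu> l i * 2 ^ i * (indicator {0<..} t * (t ^ (i + n) * exp (- (2 * t)) * t powr \<nu>)))
   = (%t. indicator {0<..} t * (laguerre_exp l \<nu> t * (t ^ n * exp (- t)) * t powr \<nu>))"
  unfolding laguerre_exp_def laguerre_altdef sum_distrib_right sum_distrib_left
 proof (intro ext sum.cong refl)
  fix t :: real and i
  have "exp (- (2 * t)) = exp (- t) * exp (- t)" by (simp flip: exp_add)
  then show "laguerre_coeff \<nu> l i * 2 ^ i * (indicator {0<..} t * (t ^ (i + n) * exp (- (2 * t)) * t powr \<nu>))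
   = indicator {0<..} t * (laguerre_coeff \<nu> l i * (2 * t) ^ i * exp (- t) * (t ^ n * exp (- t)) * t powr \<nu>)"
   by (simp add: power_mult_distrib power_add mult_ac)
 qed
 also have "(\<Sum>i\<le>l. laguerre_coeff \<nu> l i * 2 ^ i * (Gamma (\<nu> + real (i + n) + 1) / 2 powr (\<nu> + real (i + n) + 1)))
   = (\<Sum>i\<le>l. laguerre_coeff \<nu> l i * Gamma (\<nu> + real i + real n + 1)) / 2 powr (\<nu> + real n + 1)"
  unfolding sum_divide_distrib
 proof (intro sum.cong refl)
  fix i
  have "2 powr (\<nu> + real (i + n) + 1) = 2 ^ i * 2 powr (\<nu> + real n + 1)"
   by (simp add: powr_realpow[symmetric] powr_add[symmetric] add_ac)
  then show "laguerre_coeff \<nu> l i * 2 ^ i * (Gamma (\<nu> + real (i + n) + 1) / 2 powr (\<nu> + real (i + n) + 1))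
   = laguerre_coeff \<nu> l i * Gamma (\<nu> + real i + real n + 1) / 2 powr (\<nu> + real n + 1)"
   by (simp add: add_ac)
 qed
 finally show ?thesis .
qed

lemma laguerre_exp_orthogonal:
 assumes \<nu>: "-1 < \<nu>" and "l \<noteq> l'"
 shows "(LINT t:{0<..}|lborel. complex_of_real (laguerre_exp l \<nu> t * laguerre_exp l' \<nu> t) * of_real (t powr \<nu>)) = 0"
proof -
 have zero: "has_bochner_integral lborel (%t. indicator {0<..} t * (laguerre_exp l \<nu> t * laguerre_exp m \<nu> t * t powr \<nu>)) 0" if "m < l" for l m
 proof -
  have "has_bochner_integral lborel (%t. \<Sum>n\<le>m. laguerre_coeff \<nu> m n * 2 ^ n * (indicator {0<..} t * (laguerre_exp l \<nu> t * (t ^ n * exp (- t)) * t powr \<nu>)))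
    (\<Sum>n\<le>m. laguerre_coeff \<nu> m n * 2 ^ n * ((\<Sum>i\<le>l. laguerre_coeff \<nu> l i * Gamma (\<nu> + real i + real n + 1)) / 2 powr (\<nu> + real n + 1)))"
   by (intro has_bochner_integral_sum has_bochner_integral_mult_right laguerre_exp_moments \<nu>)
  also have "(%t. \<Sum>n\<le>m. laguerre_coeff \<nu> m n * 2 ^ n * (indicator {0<..} t * (laguerre_exp l \<nu> t * (t ^ n * exp (- t)) * t powr \<nu>)))
    = (%t. indicator {0<..} t * (laguerre_exp l \<nu> t * laguerre_exp m \<nu> t * t powr \<nu>))"
   unfolding laguerre_exp_def[of m] laguerre_altdef[of m] sum_distrib_right sum_distrib_left
   by (intro ext sum.cong refl) (simp add: power_mult_distrib mult_ac)
  also have "(\<Sum>n\<le>m. laguerre_coeff \<nu> m n * 2 ^ n * ((\<Sum>i\<le>l. laguerre_coeff \<nu> l i * Gamma (\<nu> + real i + real n + 1)) / 2 powr (\<nu> + real n + 1))) = 0"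
   using that by (intro sum.neutral) (simp add: laguerre_moment_zero[OF \<nu>])
  finally show ?thesis .
 qed
 have "(LINT t|lborel. indicator {0<..} t * (laguerre_exp l \<nu> t * laguerre_exp l' \<nu> t * t powr \<nu>)) = 0"
 proof (cases "l' < l")
  case True
  then show ?thesis using zero[OF True] by (simp add: has_bochner_integral_iff)
 next
  case False
  then have "l < l'" using assms by simp
  from zero[OF this] show ?thesis by (simp add: has_bochner_integral_iff mult.commute[of "laguerre_exp l' \<nu> _"])
 qed
 then have "(LINT t|lborel. complex_of_real (indicator {0<..} t * (laguerre_exp l \<nu> t * laguerre_exp l' \<nu> t * t powr \<nu>))) = 0"
  by (simp only: integral_complex_of_real of_real_0)
 then show ?thesis by (simp add: set_lebesgue_integral_def scaleR_conv_of_real mult_ac)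
qed

section \<open>The Hankel transform on the weighted half-line\<close>

lemma laguerre_exp_bound: "\<exists>C>0. \<forall>t\<ge>0. \<bar>laguerre_exp l \<nu> t\<bar> \<le> C * exp (- (3 / 4 * t))"
proof -
 define C where "C = 1 + (\<Sum>n\<le>l. \<bar>laguerre_coeff \<nu> l n\<bar> * 2 ^ n * (fact n / (1 / 8) ^ n))"
 have C: "C > 0" unfolding C_def by (intro add_pos_nonneg sum_nonneg) auto
 have "\<bar>laguerre_exp l \<nu> t\<bar> \<le> C * exp (- (3 / 4 * t))" if t: "0 \<le> t" for t
 proof -
  have "\<bar>laguerre l \<nu> (2 * t)\<bar> \<le> (\<Sum>n\<le>l. \<bar>laguerre_coeff \<nu> l n\<bar> * 2 ^ n * t ^ n)"
   unfolding laguerre_altdef using t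
   by (intro order_trans[OF sum_abs] sum_mono) (simp add: abs_mult power_abs power_mult_distrib)
  also have "\<dots> \<le> (\<Sum>n\<le>l. \<bar>laguerre_coeff \<nu> l n\<bar> * 2 ^ n * (fact n / (1 / 8) ^ n * exp (1 / 4 * t)))"
  proof (intro sum_mono mult_left_mono)
   fix n
   have "t ^ n * 1 \<le> t ^ n * exp (1 / 8 * t)" using t by (intro mult_left_mono) auto
   also have "\<dots> \<le> fact n / (1 / 8) ^ n * exp (2 * (1 / 8) * t)" using power_exp_bound[of "1 / 8" t n] t by simp
   finally show "t ^ n \<le> fact n / (1 / 8) ^ n * exp (1 / 4 * t)" by simp
  qed auto
  also have "\<dots> = (C - 1) * exp (1 / 4 * t)" proof -
   have C1: "C - 1 = (\<Sum>n\<le>l. \<bar>laguerre_coeff \<nu> l n\<bar> * 2 ^ n * (fact n / (1 / 8) ^ n))" by (simp add: C_def)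
   show ?thesis unfolding C1 sum_distrib_right by (intro sum.cong refl) (simp only: mult.assoc)
  qed
  also have "\<dots> \<le> C * exp (1 / 4 * t)" by (intro mult_right_mono) auto
  finally have "\<bar>laguerre l \<nu> (2 * t)\<bar> * exp (- t) \<le> C * exp (1 / 4 * t) * exp (- t)" by (rule mult_right_mono) simp
  also have "\<dots> = C * exp (- (3 / 4 * t))" by (simp add: mult.assoc flip: exp_add)
  finally show ?thesis by (simp add: laguerre_exp_def abs_mult)
 qed
 then show ?thesis using C by blast
qed

lemma borel_measurable_laguerre_exp [measurable]: "laguerre_exp l \<nu> \<in> borel_measurable borel"
 unfolding laguerre_exp_def[abs_def] laguerre_altdef by measurable

lemma (in pair_sigma_finite) integrable_product_bound:
 fixes f :: "'a => 'b => complex" and u :: "'a => real" and v :: "'b => real"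
 assumes [measurable]: "case_prod f \<in> borel_measurable (M1 \<Otimes>\<^sub>M M2)"
  and u: "integrable M1 u" and v: "integrable M2 v"
  and bound: "\<And>x y. x \<in> space M1 ==> y \<in> space M2 ==> cmod (f x y) \<le> u x * v y"
 shows "integrable (M1 \<Otimes>\<^sub>M M2) (case_prod f)"
proof (rule integrable_dominated)
 have [measurable]: "u \<in> borel_measurable M1" "v \<in> borel_measurable M2" using u v by auto
 show "integrable (M1 \<Otimes>\<^sub>M M2) (%(x, y). u x * v y)"
 proof (rule Fubini_integrable)
  show "integrable M1 (%x. LINT y|M2. norm (case (x, y) of (x, y) => u x * v y))"
   using u by (simp add: abs_mult)
  show "AE x in M1. integrable M2 (%y. case (x, y) of (x, y) => u x * v y)"
   using v by simp
 qed measurable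
 show "AE z in M1 \<Otimes>\<^sub>M M2. norm (case_prod f z) \<le> norm (case z of (x, y) => u x * v y)"
  using bound by (auto simp: space_pair_measure intro!: AE_I2 order_trans[OF bound abs_ge_self])
qed measurable

text \<open>
 The functions \<open>e\<^bsup>-\<tau>\<^esup> L\<^sub>l(2\<tau>)\<close> span the products of \<open>e\<^bsup>-\<tau>\<^esup>\<close> and the powers of \<open>\<tau>\<close>, so that
 the problem of moments applies.
\<close>

lemma laguerre_exp_determine:
 fixes D :: "'a => complex" and \<tau> :: "'a => real"
 assumes [measurable]: "D \<in> borel_measurable M" "\<tau> \<in> borel_measurable M"
  and \<tau>: "\<And>x. 0 \<le> \<tau> x" and \<delta>: "0 < \<delta>"
  and int: "integrable M (%x. exp (- ((1 - \<delta>) * \<tau> x)) * cmod (D x))"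
  and zero: "\<And>l. (LINT x|M. D x * of_real (laguerre_exp l \<nu> (\<tau> x))) = 0"
  and g: "g \<in> borel_measurable borel" "\<And>t. cmod (g t) \<le> B"
 shows "(LINT x|M. g (\<tau> x) * (D x * of_real (exp (- \<tau> x)))) = 0"
proof -
 define G where "G r = D r * of_real (exp (- \<tau> r))" for r
 have [measurable]: "G \<in> borel_measurable M" unfolding G_def by measurable
 have normG: "exp (\<delta> * \<tau> r) * cmod (G r) = exp (- ((1 - \<delta>) * \<tau> r)) * cmod (D r)" for r
  unfolding G_def by (simp add: norm_mult mult.left_commute mult.commute[of _ "cmod (D r)"] algebra_simps flip: exp_add)
 have intG: "integrable M (%r. exp (\<delta> * \<tau> r) * cmod (G r))" unfolding normG by (rule int)
 have int_mom: "integrable M (%r. of_real (\<tau> r ^ n) * G r)" for n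
 proof (rule integrable_dominated)
  show "integrable M (%r. fact n / (\<delta> / 2) ^ n * (exp (\<delta> * \<tau> r) * cmod (G r)))" using intG by simp
  show "AE r in M. norm (of_real (\<tau> r ^ n) * G r) \<le> norm (fact n / (\<delta> / 2) ^ n * (exp (\<delta> * \<tau> r) * cmod (G r)))"
  proof (rule AE_I2)
   fix r
   have "\<tau> r ^ n * 1 \<le> \<tau> r ^ n * exp (\<delta> / 2 * \<tau> r)" using \<delta> \<tau>[of r] by (intro mult_left_mono) auto
   also have "\<dots> \<le> fact n / (\<delta> / 2) ^ n * exp (2 * (\<delta> / 2) * \<tau> r)" using \<delta> \<tau>[of r] by (intro power_exp_bound) auto
   finally have "\<tau> r ^ n * cmod (G r) \<le> fact n / (\<delta> / 2) ^ n * exp (\<delta> * \<tau> r) * cmod (G r)"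
    by (intro mult_right_mono) auto
   then show "norm (of_real (\<tau> r ^ n) * G r) \<le> norm (fact n / (\<delta> / 2) ^ n * (exp (\<delta> * \<tau> r) * cmod (G r)))"
    using \<delta> \<tau>[of r] by (simp add: norm_mult norm_power abs_mult mult.assoc)
  qed
 qed measurable
 have mom: "(LINT r|M. of_real (\<tau> r ^ n) * G r) = 0" for n
 proof (rule laguerre_triangular[where \<nu> = \<nu> and c = 2])
  fix l
  have "(\<Sum>j\<le>l. of_real (laguerre_coeff \<nu> l j * 2 ^ j) * (LINT r|M. of_real (\<tau> r ^ j) * G r))
    = (LINT r|M. (\<Sum>j\<le>l. of_real (laguerre_coeff \<nu> l j * 2 ^ j) * (of_real (\<tau> r ^ j) * G r)))"
   using int_mom by (subst Bochner_Integration.integral_sum) auto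
  also have "\<dots> = (LINT r|M. D r * of_real (laguerre_exp l \<nu> (\<tau> r)))"
   unfolding G_def laguerre_exp_def laguerre_altdef of_real_mult of_real_sum sum_distrib_right sum_distrib_left
   by (intro Bochner_Integration.integral_cong refl sum.cong) (simp add: power_mult_distrib mult_ac)
  finally show "(\<Sum>j\<le>l. of_real (laguerre_coeff \<nu> l j * 2 ^ j) * (LINT r|M. of_real (\<tau> r ^ j) * G r)) = 0"
   by (simp add: zero)
 qed simp
 have "(LINT r|M. g (\<tau> r) * G r) = 0"
  by (rule moments_determine[OF _ _ \<tau> \<delta> intG mom int_mom g]) auto
 then show ?thesis by (simp add: G_def)
qed

text \<open>
 The half-line with the measure \<open>r\<^bsup>a(\<nu>+1)-1\<^esup> dr\<close>, its Laguerre functions and its Hankel transform.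
\<close>

locale hankel =
 fixes a \<nu> :: real
 assumes a: "0 < a" and \<nu>: "-1 < \<nu>"
begin

abbreviation "\<mu> \<equiv> hankel_measure a \<nu>"

definition \<tau> :: "real => real" where "\<tau> r = r powr a / a"

lemma \<tau>_nonneg [simp]: "0 \<le> \<tau> r" using a by (simp add: \<tau>_def)

lemma \<tau>_measurable [measurable]: "\<tau> \<in> borel_measurable \<mu>"
 by (rule borel_measurable_hankel) (simp add: \<tau>_def[abs_def])

lemma integrable_exp: "0 < c ==> integrable \<mu> (%r. exp (- (c * \<tau> r)))"
 using nn_integral_exp_hankel[OF a \<nu>, of c]
 by (intro integrableI_bounded) (auto simp: \<tau>_def[symmetric])

lemma exp_L2: "0 < c ==> (%r. complex_of_real (exp (- (c * \<tau> r)))) \<in> L2_space \<mu>"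
 using integrable_exp[of "2 * c"]
 by (intro L2_spaceI) (auto simp: power2_eq_square mult.assoc simp flip: exp_add)

definition lag :: "nat => real => complex" where "lag l r = complex_of_real (laguerre_exp l \<nu> (\<tau> r))"

lemma lag_measurable [measurable]: "lag l \<in> borel_measurable \<mu>"
 unfolding lag_def by measurable

lemma lag_bound: "\<exists>C>0. \<forall>r. cmod (lag l r) \<le> C * exp (- (3 / 4 * \<tau> r))"
 using laguerre_exp_bound[of l \<nu>] by (auto simp: lag_def)

lemma cnj_lag [simp]: "cnj (lag l r) = lag l r" by (simp add: lag_def)

lemma lag_L2: "lag l \<in> L2_space \<mu>"
proof -
 obtain C where C: "C > 0" "\<And>r. cmod (lag l r) \<le> C * exp (- (3 / 4 * \<tau> r))" using lag_bound[of l] by blast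
 show ?thesis
 proof (rule L2_spaceI)
  show "integrable \<mu> (%r. (cmod (lag l r))\<^sup>2)"
  proof (rule integrable_dominated)
   show "integrable \<mu> (%r. (cmod (of_real C * complex_of_real (exp (- (3 / 4 * \<tau> r)))))\<^sup>2)"
    by (intro L2_integrable L2_scale exp_L2) simp
   show "AE r in \<mu>. norm ((cmod (lag l r))\<^sup>2) \<le> norm ((cmod (of_real C * complex_of_real (exp (- (3 / 4 * \<tau> r)))))\<^sup>2)"
    using C by (intro AE_I2) (auto simp: norm_mult intro!: power_mono)
  qed measurable
 qed measurable
qed

lemma L2_mult_exp_integrable:
 assumes f: "f \<in> L2_space \<mu>" and c: "0 < c"
 shows "integrable \<mu> (%r. exp (- (c * \<tau> r)) * cmod (f r))"
proof -
 have "integrable \<mu> (%r. cmod (complex_of_real (exp (- (c * \<tau> r))) * f r))"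
  by (intro integrable_norm L2_mult_integrable exp_L2 f c)
 then show ?thesis by (simp add: norm_mult)
qed

text \<open>
 The functions \<open>e\<^bsup>-\<tau>\<^esup> L\<^sub>l(2\<tau>)\<close> determine every function of less than exponential growth, not
 only the square integrable ones.
\<close>

lemma lag_determine:
 assumes [measurable]: "D \<in> borel_measurable \<mu>" and \<delta>: "0 < \<delta>" "\<delta> < 1"
  and int: "integrable \<mu> (%r. exp (- ((1 - \<delta>) * \<tau> r)) * cmod (D r))"
  and zero: "\<And>l. (LINT r|\<mu>. D r * lag l r) = 0"
 shows "AE r in \<mu>. D r = 0"
proof -
 define G where "G r = D r * of_real (exp (- \<tau> r))" for r
 define D' where "D' r = indicator {0<..} r *\<^sub>R D r" for r
 have [measurable]: "D' \<in> borel_measurable borel"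
  unfolding D'_def using assms(1) by (simp add: borel_measurable_hankel_iff)
 \<comment> \<open>The phase of \<open>D\<close>, as a function of \<open>\<tau>\<close>.\<close>
 define g where "g t = cnj (D' ((a * t) powr (1 / a))) / of_real (cmod (D' ((a * t) powr (1 / a))))" for t
 have [measurable]: "g \<in> borel_measurable borel" unfolding g_def by measurable
 have g: "cmod (g t) \<le> 1" for t unfolding g_def by (simp add: norm_divide)
 have "(LINT r|\<mu>. g (\<tau> r) * G r) = 0"
  unfolding G_def
  by (rule laguerre_exp_determine[where \<nu> = \<nu> and \<delta> = \<delta> and B = 1, OF _ _ _ \<delta>(1) int]) (use zero g in \<open>auto simp: lag_def\<close>)
 also have "(LINT r|\<mu>. g (\<tau> r) * G r) = (LINT r|\<mu>. of_real (cmod (G r)))"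
 proof (rule Bochner_Integration.integral_cong[OF refl])
  fix r assume "r \<in> space \<mu>"
  then have r: "0 < r" by simp
  have "(a * \<tau> r) powr (1 / a) = r" using a r by (simp add: \<tau>_def powr_powr)
  then have "g (\<tau> r) = cnj (D r) / of_real (cmod (D r))" using r by (simp add: g_def D'_def)
  moreover have "cnj z / of_real (cmod z) * (z * of_real e) = of_real (cmod z * e)" for z e
  proof (cases "z = 0")
   case False
   have "cnj z / of_real (cmod z) * (z * of_real e) = (cnj z * z) * of_real e / of_real (cmod z)" by simp
   also have "\<dots> = of_real ((cmod z)\<^sup>2 * e / cmod z)" unfolding cnj_mult_self(2) by simp
   also have "(cmod z)\<^sup>2 * e / cmod z = cmod z * e" using False by (simp add: power2_eq_square)
   finally show ?thesis .
  qed simp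
  ultimately show "g (\<tau> r) * G r = of_real (cmod (G r))"
   unfolding G_def by (simp add: norm_mult)
 qed
 finally have "(LINT r|\<mu>. cmod (G r)) = 0" by (simp only: integral_complex_of_real of_real_eq_0_iff)
 moreover have "integrable \<mu> (%r. cmod (G r))"
 proof (rule integrable_dominated[OF int])
  show "(%r. cmod (G r)) \<in> borel_measurable \<mu>" unfolding G_def by measurable
  have "exp (- \<tau> r) \<le> exp (- ((1 - \<delta>) * \<tau> r))" for r using \<delta> by (simp add: left_diff_distrib)
  then show "AE r in \<mu>. norm (cmod (G r)) \<le> norm (exp (- ((1 - \<delta>) * \<tau> r)) * cmod (D r))"
   by (intro AE_I2) (simp add: G_def norm_mult mult.commute[of "cmod (D _)"] mult_right_mono)
 qed
 ultimately have "AE r in \<mu>. cmod (G r) = 0" by (subst (asm) integral_nonneg_eq_0_iff_AE) auto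
 then show ?thesis by eventually_elim (simp add: G_def)
qed

lemma inner_lag: "L2_inner \<mu> f (lag l) = (LINT r|\<mu>. f r * lag l r)"
 by (simp add: L2_inner_def)

definition E :: "real => (real => complex) set" where
 "E t = {%r. b * lag l r | b l. real l = t \<or> b = 0}"

lemma E_cases: "v \<in> E t ==> (\<And>b l. v = (%r. b * lag l r) ==> real l = t \<or> b = 0 ==> thesis) ==> thesis"
 by (auto simp: E_def)

lemma lag_total: "L2_total \<mu> lag"
 unfolding L2_total_def
proof (intro conjI allI ballI impI lag_L2)
 fix f assume f: "f \<in> L2_space \<mu>" and "\<forall>l. L2_inner \<mu> f (lag l) = 0"
 then show "AE r in \<mu>. f r = 0"
  using L2_mult_exp_integrable[OF f, of "1 / 2"]
  by (intro lag_determine[where \<delta> = "1 / 2"]) (auto simp: inner_lag)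
qed

lemma lag_orthogonal: "l \<noteq> l' ==> L2_inner \<mu> (lag l) (lag l') = 0"
proof -
 assume "l \<noteq> l'"
 have "L2_inner \<mu> (lag l) (lag l') = (LINT r|\<mu>. complex_of_real (laguerre_exp l \<nu> (r powr a / a) * laguerre_exp l' \<nu> (r powr a / a)))"
  by (simp add: inner_lag lag_def \<tau>_def)
 also have "\<dots> = of_real (a powr \<nu>) * (LINT t:{0<..}|lborel. complex_of_real (laguerre_exp l \<nu> t * laguerre_exp l' \<nu> t) * of_real (t powr \<nu>))"
  by (rule integral_hankel_substitution[OF a \<nu>, where g = "%t. complex_of_real (laguerre_exp l \<nu> t * laguerre_exp l' \<nu> t)"]) measurable
 finally show ?thesis using laguerre_exp_orthogonal[OF \<nu> \<open>l \<noteq> l'\<close>] by simp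
qed

sublocale eigenspaces \<mu> E lag real
proof
 show "v \<in> L2_space \<mu>" if "v \<in> E t" for v t using that by (elim E_cases) (auto intro: L2_scale lag_L2)
 show "(%x. 0) \<in> E t" for t unfolding E_def by force
 show "(%x. v x + w x) \<in> E t" if "v \<in> E t" "w \<in> E t" for v w t
 proof -
  from that(1) obtain b l where v: "v = (%r. b * lag l r)" "real l = t \<or> b = 0" by (rule E_cases)
  from that(2) obtain b' l' where w: "w = (%r. b' * lag l' r)" "real l' = t \<or> b' = 0" by (rule E_cases)
  note * = v w
  show ?thesis
  proof (cases "b = 0")
   case True then show ?thesis using that * by simp
  next
   case False
   note b = this
   show ?thesis
   proof (cases "b' = 0")
    case True then show ?thesis using that * by simp
   next
    case False
    then have "l' = l" "real l = t" using * b by auto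
    then have "(%x. v x + w x) = (%r. (b + b') * lag l r)" using * by (simp add: distrib_right)
    then show ?thesis unfolding E_def using \<open>real l = t\<close> by blast
   qed
  qed
 qed
 show "(%x. c * v x) \<in> E t" if "v \<in> E t" for v t c
  using that
 proof (elim E_cases)
  fix b l assume "v = (%r. b * lag l r)" "real l = t \<or> b = 0"
  then show ?thesis unfolding E_def by (intro CollectI exI[of _ "c * b"] exI[of _ l]) (auto simp: mult.assoc)
 qed
 show "L2_inner \<mu> v w = 0" if "s \<noteq> t" "v \<in> E s" "w \<in> E t" for s t v w
 proof -
  from that(2) obtain b l where v: "v = (%r. b * lag l r)" "real l = s \<or> b = 0" by (rule E_cases)
  from that(3) obtain c j where w: "w = (%r. c * lag j r)" "real j = t \<or> c = 0" by (rule E_cases)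
  have "L2_inner \<mu> v w = b * (cnj c * L2_inner \<mu> (lag l) (lag j))"
   unfolding v(1) w(1) L2_inner_scale_left L2_inner_scale_right by (rule refl)
  also have "\<dots> = 0"
  proof (cases "l = j")
   case True then show ?thesis using v(2) w(2) that(1) by auto
  qed (simp add: lag_orthogonal)
  finally show ?thesis .
 qed
 show "lag j \<in> E (real j)" for j
  unfolding E_def by (intro CollectI exI[of _ 1] exI[of _ j]) auto
 show "L2_total \<mu> lag" by (rule lag_total)
qed

text \<open>
 The Laguerre function of number \<open>l\<close> is given the eigenvalue \<open>l\<close>, so that functions of the eigenvalue
 can multiply it by \<open>(-1)\<^sup>l\<close>.
\<close>

definition sign :: "real => real" where "sign t = (-1) ^ nat \<lfloor>t\<rfloor>"

lemma sign_nat [simp]: "sign (real l) = (-1) ^ l" by (simp add: sign_def)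

lemma abs_sign: "\<bar>sign t\<bar> = 1" by (simp add: sign_def power_abs)

text \<open>The unitary operator that the Hankel transform, suitably scaled, extends to.\<close>

definition flip :: "(real => complex) => (real => complex)" where
 "flip f = (SOME g. g \<in> L2_space \<mu> \<and> (\<forall>t. \<forall>v\<in>E t. L2_inner \<mu> g v = of_real (sign t) * L2_inner \<mu> f v))"

lemma flip:
 assumes "f \<in> L2_space \<mu>"
 shows flip_L2: "flip f \<in> L2_space \<mu>"
  and flip_E: "v \<in> E t ==> L2_inner \<mu> (flip f) v = of_real (sign t) * L2_inner \<mu> f v"
proof -
 have "\<exists>g. g \<in> L2_space \<mu> \<and> (\<forall>t. \<forall>v\<in>E t. L2_inner \<mu> g v = of_real (sign t) * L2_inner \<mu> f v)"
  using multiplier_exists[OF assms, of "%t. of_real (sign t)"] by (auto simp: abs_sign)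
 from someI_ex[OF this] show "flip f \<in> L2_space \<mu>" "v \<in> E t ==> L2_inner \<mu> (flip f) v = of_real (sign t) * L2_inner \<mu> f v"
  unfolding flip_def by blast+
qed

lemma flip_lag: "f \<in> L2_space \<mu> ==> L2_inner \<mu> (flip f) (lag l) = (-1) ^ l * L2_inner \<mu> f (lag l)"
 using flip_E[of f "lag l" "real l"] u_E by simp

lemma flip_symmetric: "f \<in> L2_space \<mu> ==> g \<in> L2_space \<mu> ==> L2_inner \<mu> (flip f) g = L2_inner \<mu> f (flip g)"
 by (rule multiplier_symmetric[where \<phi> = sign]) (auto intro: flip_L2 flip_E)

lemma flip_unique:
 assumes f: "f \<in> L2_space \<mu>" and g: "g \<in> L2_space \<mu>" and eq: "\<And>l. L2_inner \<mu> g (lag l) = (-1) ^ l * L2_inner \<mu> f (lag l)"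
 shows "AE r in \<mu>. g r = flip f r"
proof -
 have "AE r in \<mu>. g r - flip f r = 0"
  using u_total L2_diff[OF g flip_L2[OF f]]
  by (auto simp: L2_total_def L2_inner_diff_left g flip_L2 f lag_L2 flip_lag eq)
 then show ?thesis by simp
qed

subsection \<open>The kernel\<close>

definition ker :: "real => real => complex" where
 "ker r s = of_real (bessel_kernel \<nu> (\<tau> r * \<tau> s))"

lemma ker_sym: "ker r s = ker s r" by (simp add: ker_def mult.commute)

lemma bessel_tilde_eq:
 assumes "0 < r" "0 < s"
 shows "bessel_tilde \<nu> (2 / a * (r * s) powr (a / 2)) = bessel_kernel \<nu> (\<tau> r * \<tau> s)"
proof -
 define w where "w = 2 / a * (r * s) powr (a / 2)"
 have "((r * s) powr (a / 2))\<^sup>2 = r powr a * s powr a"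
 proof -
  have "(x powr (a / 2))\<^sup>2 = x powr a" if "0 < x" for x
   using that by (simp add: power2_eq_square flip: powr_add)
  then show ?thesis using assms by (simp add: powr_mult power_mult_distrib)
 qed
 then have "w\<^sup>2 = 4 * (\<tau> r * \<tau> s)"
  unfolding w_def \<tau>_def power_mult_distrib using a by (simp add: power2_eq_square)
 then have "(-1) ^ l * w ^ (2 * l) / (2 ^ (2 * l) * fact l * Gamma (\<nu> + real l + 1)) = (- (\<tau> r * \<tau> s)) ^ l / (fact l * Gamma (\<nu> + real l + 1))" for l
 proof -
  have "w ^ (2 * l) = 4 ^ l * (\<tau> r * \<tau> s) ^ l" by (simp add: power_mult \<open>w\<^sup>2 = _\<close> power_mult_distrib)
  moreover have "(2::real) ^ (2 * l) = 4 ^ l" by (simp add: power_mult)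
  moreover have "(- (\<tau> r * \<tau> s)) ^ l = (-1) ^ l * (\<tau> r * \<tau> s) ^ l" by (simp flip: power_mult_distrib)
  ultimately show ?thesis by (simp only: mult.left_commute[of "(-1) ^ l" "4 ^ l"] mult.assoc) simp
 qed
 then show ?thesis unfolding bessel_tilde_def bessel_kernel_def w_def[symmetric] by simp
qed

lemma hankel_integrand_eq:
 assumes "0 < r" "0 < s"
 shows "hankel_integrand a \<nu> \<psi> s r = \<psi> r * ker r s * of_real (r powr (a * (\<nu> + 1) - 1))"
 unfolding hankel_integrand_def bessel_tilde_eq[OF assms] ker_def by simp

lemma ker_measurable [measurable]:
 "f \<in> borel_measurable N ==> g \<in> borel_measurable N ==> (%z. ker (f z) (g z)) \<in> borel_measurable N"
proof -
 assume f: "f \<in> borel_measurable N" and g: "g \<in> borel_measurable N"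
 have \<tau>: "\<tau> \<in> borel_measurable borel" by (simp add: \<tau>_def[abs_def])
 have [measurable]: "(%z. \<tau> (f z)) \<in> borel_measurable N" "(%z. \<tau> (g z)) \<in> borel_measurable N"
  by (rule measurable_compose[OF f \<tau>], rule measurable_compose[OF g \<tau>])
 show ?thesis unfolding ker_def by measurable
qed

lemma id_measurable_hankel [measurable]: "(%r. r) \<in> borel_measurable \<mu>"
 by (rule borel_measurable_hankel) simp

lemma hankel_set_integrand:
 assumes "0 < s"
 shows "indicator {0<..} r *\<^sub>R hankel_integrand a \<nu> \<psi> s r = indicator {0<..} r *\<^sub>R ((\<psi> r * ker r s) * of_real (r powr (a * (\<nu> + 1) - 1)))"
 using hankel_integrand_eq[OF _ assms] by (auto simp: indicator_def)

lemma hankel_converges_iff: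
 assumes [measurable]: "\<psi> \<in> borel_measurable \<mu>"
 shows "hankel_converges a \<nu> \<psi> \<longleftrightarrow> (\<forall>s>0. integrable \<mu> (%r. \<psi> r * ker r s))"
proof -
 have "set_integrable lborel {0<..} (hankel_integrand a \<nu> \<psi> s) \<longleftrightarrow> integrable \<mu> (%r. \<psi> r * ker r s)" if "0 < s" for s
 proof -
  have "(%r. \<psi> r * ker r s) \<in> borel_measurable \<mu>" by measurable
  then show ?thesis by (subst integral_hankel(2)) (auto simp: set_integrable_def hankel_set_integrand[OF that])
 qed
 then show ?thesis by (auto simp: hankel_converges_def)
qed

lemma hankel_integral_eq:
 assumes [measurable]: "\<psi> \<in> borel_measurable \<mu>" and s: "0 < s"
 shows "hankel_integral a \<nu> \<psi> s = (LINT r|\<mu>. \<psi> r * ker r s)"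
proof -
 have "(%r. \<psi> r * ker r s) \<in> borel_measurable \<mu>" by measurable
 then show ?thesis
  by (subst integral_hankel(1)) (auto simp: hankel_integral_def set_lebesgue_integral_def hankel_set_integrand[OF s])
qed

lemma ker_bound: "0 < \<epsilon> ==> \<exists>K>0. \<forall>r s. cmod (ker r s) \<le> K * exp (\<epsilon> * (\<tau> r * \<tau> s))"
 using bessel_kernel_bound[OF \<nu>, of \<epsilon>] by (auto simp: ker_def)

lemma lag_ker_integrable: "integrable \<mu> (%r. lag l r * ker r s)"
proof -
 obtain C where C: "C > 0" "\<And>r. cmod (lag l r) \<le> C * exp (- (3 / 4 * \<tau> r))" using lag_bound[of l] by blast
 have "0 < 1 / (4 * (\<tau> s + 1))" by (simp add: add_nonneg_pos)
 from ker_bound[OF this] obtain K where K: "K > 0" "\<And>r. cmod (ker r s) \<le> K * exp (1 / (4 * (\<tau> s + 1)) * (\<tau> r * \<tau> s))" by blast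
 show ?thesis
 proof (rule integrable_dominated)
  show "integrable \<mu> (%r. C * K * exp (- (1 / 2 * \<tau> r)))" by (intro integrable_mult_right integrable_exp) simp
  show "AE r in \<mu>. norm (lag l r * ker r s) \<le> norm (C * K * exp (- (1 / 2 * \<tau> r)))"
  proof (rule AE_I2)
   fix r
   have "1 / (4 * (\<tau> s + 1)) * (\<tau> r * \<tau> s) \<le> 1 / (4 * (\<tau> s + 1)) * (\<tau> r * (\<tau> s + 1))"
    using \<tau>_nonneg[of s] by (intro mult_left_mono) auto
   also have "\<dots> = 1 / 4 * \<tau> r" 
   proof -
    have "u \<noteq> 0 ==> 1 / (4 * u) * (t * u) = 1 / 4 * t" for u t :: real by simp
    moreover have "\<tau> s + 1 \<noteq> 0" using \<tau>_nonneg[of s] by linarith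
    ultimately show ?thesis by metis
   qed
   finally have "1 / (4 * (\<tau> s + 1)) * (\<tau> r * \<tau> s) \<le> 1 / 4 * \<tau> r" .
   then have "cmod (ker r s) \<le> K * exp (1 / 4 * \<tau> r)" using K by (meson exp_le_cancel_iff less_imp_le mult_left_mono order_trans)
   then have "cmod (lag l r) * cmod (ker r s) \<le> (C * exp (- (3 / 4 * \<tau> r))) * (K * exp (1 / 4 * \<tau> r))"
    using C by (intro mult_mono) auto
   also have "\<dots> = C * K * (exp (- (3 / 4 * \<tau> r)) * exp (1 / 4 * \<tau> r))" by simp
   also have "\<dots> = C * K * exp (- (1 / 2 * \<tau> r))" by (simp flip: exp_add)
   finally show "norm (lag l r * ker r s) \<le> norm (C * K * exp (- (1 / 2 * \<tau> r)))" using C K by (simp add: norm_mult)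
  qed
 qed measurable
qed

lemma lag_ker_integral: "(LINT r|\<mu>. lag l r * ker r s) = of_real (a powr \<nu>) * (-1) ^ l * lag l s"
proof -
 have "(LINT r|\<mu>. lag l r * ker r s) = (LINT r|\<mu>. complex_of_real (laguerre_exp l \<nu> (r powr a / a) * bessel_kernel \<nu> ((r powr a / a) * \<tau> s)))"
  by (simp add: lag_def ker_def \<tau>_def)
 also have "\<dots> = of_real (a powr \<nu>) * (LINT t:{0<..}|lborel. complex_of_real (laguerre_exp l \<nu> t * bessel_kernel \<nu> (t * \<tau> s)) * of_real (t powr \<nu>))"
  by (rule integral_hankel_substitution[OF a \<nu>, where g = "%t. complex_of_real (laguerre_exp l \<nu> t * bessel_kernel \<nu> (t * \<tau> s))"]) measurable
 also have "(LINT t:{0<..}|lborel. complex_of_real (laguerre_exp l \<nu> t * bessel_kernel \<nu> (t * \<tau> s)) * of_real (t powr \<nu>))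
   = (LINT t|lborel. complex_of_real (indicator {0<..} t * (laguerre_exp l \<nu> t * bessel_kernel \<nu> (t * \<tau> s) * t powr \<nu>)))"
  by (simp add: set_lebesgue_integral_def scaleR_conv_of_real mult_ac)
 also have "\<dots> = of_real ((-1) ^ l * laguerre_exp l \<nu> (\<tau> s))"
  using bessel_laguerre[OF \<nu>, of "\<tau> s" l] by (simp only: integral_complex_of_real has_bochner_integral_iff \<tau>_nonneg)
 finally show ?thesis by (simp add: lag_def)
qed

end

context hankel begin

lemma sigma_finite_hankel: "sigma_finite_measure \<mu>"
proof -
 interpret sigma_finite_measure "restrict_space lborel {0<..} :: real measure"
  by (rule sigma_finite_measure_restrict_space) (auto intro: sigma_finite_lborel)
 have "(%r. ennreal (r powr (a * (\<nu> + 1) - 1))) \<in> borel_measurable (restrict_space lborel {0<..})"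
 proof (rule measurable_restrict_space1)
  show "(%r. ennreal (r powr (a * (\<nu> + 1) - 1))) \<in> borel_measurable lborel"
   by (intro measurable_compose[OF _ measurable_ennreal] powr_real_measurable) auto
 qed
 then show ?thesis unfolding hankel_measure_def by (simp add: sigma_finite_iff_density_finite)
qed

sublocale \<mu>: sigma_finite_measure \<mu> by (rule sigma_finite_hankel)
sublocale \<mu>\<mu>: pair_sigma_finite \<mu> \<mu> ..

definition "transform \<psi> s = (LINT r|\<mu>. \<psi> r * ker r s)"

lemma transform_measurable [measurable]:
 assumes [measurable]: "\<psi> \<in> borel_measurable \<mu>" shows "transform \<psi> \<in> borel_measurable \<mu>"
 unfolding transform_def by measurable

text \<open>
 On the support of \<open>\<eta>\<close> the growth rate of the kernel can be made small compared with the decay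
 \<open>e\<^bsup>-3\<tau>/4\<^esup>\<close> of the Laguerre functions, uniformly in \<open>r\<close>.
\<close>

lemma bounded_support_product_bound:
 assumes supp: "\<And>r. T < \<tau> r ==> \<eta> r = 0" and T: "0 \<le> T"
 shows "\<exists>B>0. \<forall>r s. cmod (\<eta> r * ker r s) \<le> B * (exp (- \<tau> r) * cmod (\<eta> r)) * exp (1 / 4 * \<tau> s)"
proof -
 have "0 < 1 / (4 * (T + 1))" using T by simp
 from ker_bound[OF this] obtain K where K: "K > 0" "\<And>r s. cmod (ker r s) \<le> K * exp (1 / (4 * (T + 1)) * (\<tau> r * \<tau> s))" by blast
 have "cmod (\<eta> r * ker r s) \<le> (exp T * K) * (exp (- \<tau> r) * cmod (\<eta> r)) * exp (1 / 4 * \<tau> s)" for r s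
 proof (cases "\<tau> r > T")
  case False
  then have "1 \<le> exp T * exp (- \<tau> r)" by (simp flip: exp_add)
  then have 1: "1 * cmod (\<eta> r) \<le> (exp T * exp (- \<tau> r)) * cmod (\<eta> r)" by (rule mult_right_mono) simp
  have "1 / (4 * (T + 1)) * (\<tau> r * \<tau> s) \<le> 1 / (4 * (T + 1)) * ((T + 1) * \<tau> s)"
   using False T by (intro mult_left_mono mult_right_mono) auto
  also have "\<dots> = 1 / 4 * \<tau> s" using T by (auto simp: divide_simps)
  finally have "cmod (ker r s) \<le> K * exp (1 / 4 * \<tau> s)" using K by (meson exp_le_cancel_iff less_imp_le mult_left_mono order_trans)
  then have "cmod (\<eta> r) * cmod (ker r s) \<le> (exp T * exp (- \<tau> r) * cmod (\<eta> r)) * (K * exp (1 / 4 * \<tau> s))"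
   using 1 K by (intro mult_mono) auto
  then show ?thesis by (simp add: norm_mult mult_ac)
 qed (simp add: supp)
 then show ?thesis using K by (intro exI[of _ "exp T * K"]) auto
qed

text \<open>
 For bounded support the double integrals against Laguerre functions converge absolutely, so
 Fubini's theorem moves the transform onto the Laguerre functions. The difference of the two
 sides grows too slowly to be orthogonal to all of them without vanishing.
\<close>

lemma transform_bounded_support:
 assumes \<eta>2: "\<eta> \<in> L2_space \<mu>" and supp: "\<And>r. T < \<tau> r ==> \<eta> r = 0" and T: "0 \<le> T"
 shows "AE s in \<mu>. transform \<eta> s = of_real (a powr \<nu>) * flip \<eta> s"
proof -
 have [measurable]: "\<eta> \<in> borel_measurable \<mu>" using \<eta>2 by (rule L2_measurable)
 have [measurable]: "flip \<eta> \<in> borel_measurable \<mu>" using flip_L2[OF \<eta>2] by (rule L2_measurable)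
 define w where "w r = exp (- \<tau> r) * cmod (\<eta> r)" for r
 have w0: "0 \<le> w r" for r by (simp add: w_def)
 obtain B where B: "B > 0" "\<And>r s. cmod (\<eta> r * ker r s) \<le> B * w r * exp (1 / 4 * \<tau> s)"
  using bounded_support_product_bound[of T \<eta>, OF supp T] unfolding w_def by blast
 have e1: "integrable \<mu> (%r. w r)" using L2_mult_exp_integrable[OF \<eta>2, of 1] unfolding w_def by simp
 define B' where "B' = B * (LINT r|\<mu>. w r)"
 have tb: "cmod (transform \<eta> s) \<le> B' * exp (1 / 4 * \<tau> s)" for s
 proof -
  have i: "integrable \<mu> (%r. \<eta> r * ker r s)"
   by (rule integrable_dominated[OF integrable_mult_right[OF integrable_mult_left[OF e1, of "exp (1 / 4 * \<tau> s)"], of B]])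
    (use B in \<open>auto intro!: AE_I2 order_trans[OF B(2)] simp: mult.assoc\<close>)
  have "cmod (transform \<eta> s) \<le> (LINT r|\<mu>. cmod (\<eta> r * ker r s))"
   unfolding transform_def by (rule integral_norm_bound)
  also have "\<dots> \<le> (LINT r|\<mu>. B * w r * exp (1 / 4 * \<tau> s))"
   using i e1 B by (intro integral_mono) auto
  also have "\<dots> = B' * exp (1 / 4 * \<tau> s)" unfolding B'_def by simp
  finally show ?thesis .
 qed
 define D where "D s = transform \<eta> s - of_real (a powr \<nu>) * flip \<eta> s" for s
 have [measurable]: "D \<in> borel_measurable \<mu>" unfolding D_def by measurable
 have tl: "integrable \<mu> (%s. transform \<eta> s * lag l s)" for l
 proof -
  obtain C where C: "C > 0" "\<And>r. cmod (lag l r) \<le> C * exp (- (3 / 4 * \<tau> r))" using lag_bound[of l] by blast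
  show ?thesis
  proof (rule integrable_dominated)
   show "integrable \<mu> (%s. B' * C * exp (- (1 / 2 * \<tau> s)))" by (intro integrable_mult_right integrable_exp) simp
   show "AE s in \<mu>. norm (transform \<eta> s * lag l s) \<le> norm (B' * C * exp (- (1 / 2 * \<tau> s)))"
   proof (rule AE_I2)
    fix s
    have "0 \<le> B' * exp (1 / 4 * \<tau> s)" using tb[of s] norm_ge_zero order_trans by blast
    then have "cmod (transform \<eta> s) * cmod (lag l s) \<le> (B' * exp (1 / 4 * \<tau> s)) * (C * exp (- (3 / 4 * \<tau> s)))"
     using tb C by (intro mult_mono) auto
    also have "\<dots> = B' * C * (exp (1 / 4 * \<tau> s) * exp (- (3 / 4 * \<tau> s)))" by simp
    also have "\<dots> = B' * C * exp (- (1 / 2 * \<tau> s))" by (simp flip: exp_add)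
    finally show "norm (transform \<eta> s * lag l s) \<le> norm (B' * C * exp (- (1 / 2 * \<tau> s)))"
     unfolding norm_mult[of "transform \<eta> s"] by (rule order_trans) simp
   qed
  qed measurable
 qed
 have D0: "(LINT s|\<mu>. D s * lag l s) = 0" for l
 proof -
  obtain C where C: "C > 0" "\<And>r. cmod (lag l r) \<le> C * exp (- (3 / 4 * \<tau> r))" using lag_bound[of l] by blast
  have "integrable (\<mu> \<Otimes>\<^sub>M \<mu>) (%(r, s). \<eta> r * ker r s * lag l s)"
  proof (rule \<mu>\<mu>.integrable_product_bound)
   show "integrable \<mu> (%r. B * w r)" using e1 by simp
   show "integrable \<mu> (%s. C * exp (- (1 / 2 * \<tau> s)))" by (intro integrable_mult_right integrable_exp) simp
   fix r s
   have "cmod (\<eta> r * ker r s) * cmod (lag l s) \<le> (B * w r * exp (1 / 4 * \<tau> s)) * (C * exp (- (3 / 4 * \<tau> s)))"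
    using B C w0 by (intro mult_mono) auto
   also have "\<dots> = (B * w r) * (C * (exp (1 / 4 * \<tau> s) * exp (- (3 / 4 * \<tau> s))))" by simp
   also have "exp (1 / 4 * \<tau> s) * exp (- (3 / 4 * \<tau> s)) = exp (- (1 / 2 * \<tau> s))" by (simp flip: exp_add)
   finally show "cmod (\<eta> r * ker r s * lag l s) \<le> (B * w r) * (C * exp (- (1 / 2 * \<tau> s)))"
    by (simp only: norm_mult)
  qed measurable
  from \<mu>\<mu>.Fubini_integral[OF this]
  have "(LINT s|\<mu>. transform \<eta> s * lag l s) = (LINT r|\<mu>. LINT s|\<mu>. \<eta> r * ker r s * lag l s)"
   unfolding transform_def by simp
  also have "\<dots> = (LINT r|\<mu>. \<eta> r * (LINT s|\<mu>. lag l s * ker s r))"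
   by (simp add: ker_sym[of _ "_"] mult.assoc mult.commute[of "lag l _"])
  also have "\<dots> = of_real (a powr \<nu>) * (-1) ^ l * (LINT r|\<mu>. \<eta> r * lag l r)"
  proof -
   have "\<eta> r * (of_real (a powr \<nu>) * (-1) ^ l * lag l r) = of_real (a powr \<nu>) * (-1) ^ l * (\<eta> r * lag l r)" for r
    by (simp only: mult_ac)
   then show ?thesis unfolding lag_ker_integral by (simp only: integral_mult_right_zero)
  qed
  finally have 1: "(LINT s|\<mu>. transform \<eta> s * lag l s) = of_real (a powr \<nu>) * (-1) ^ l * (LINT r|\<mu>. \<eta> r * lag l r)" .
  have fl: "integrable \<mu> (%s. flip \<eta> s * lag l s)"
   by (intro L2_mult_integrable flip_L2 \<eta>2 lag_L2)
  have "(LINT s|\<mu>. D s * lag l s) = (LINT s|\<mu>. transform \<eta> s * lag l s - of_real (a powr \<nu>) * (flip \<eta> s * lag l s))"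
   unfolding D_def by (simp add: left_diff_distrib mult.assoc)
  also have "\<dots> = (LINT s|\<mu>. transform \<eta> s * lag l s) - of_real (a powr \<nu>) * (LINT s|\<mu>. flip \<eta> s * lag l s)"
   using tl fl by simp
  also have "(LINT s|\<mu>. flip \<eta> s * lag l s) = (-1) ^ l * (LINT r|\<mu>. \<eta> r * lag l r)"
   using flip_lag[OF \<eta>2, of l] by (simp add: inner_lag)
  finally show ?thesis unfolding 1 by simp
 qed
 have "integrable \<mu> (%s. exp (- ((1 - 1 / 2) * \<tau> s)) * cmod (D s))"
 proof (rule integrable_dominated)
  show "integrable \<mu> (%s. B' * exp (- (1 / 4 * \<tau> s)) + a powr \<nu> * (exp (- (1 / 2 * \<tau> s)) * cmod (flip \<eta> s)))"
   by (intro Bochner_Integration.integrable_add integrable_mult_right integrable_exp L2_mult_exp_integrable flip_L2 \<eta>2) auto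
  show "AE s in \<mu>. norm (exp (- ((1 - 1 / 2) * \<tau> s)) * cmod (D s)) \<le> norm (B' * exp (- (1 / 4 * \<tau> s)) + a powr \<nu> * (exp (- (1 / 2 * \<tau> s)) * cmod (flip \<eta> s)))"
  proof (rule AE_I2)
   fix s
   have "cmod (D s) \<le> B' * exp (1 / 4 * \<tau> s) + a powr \<nu> * cmod (flip \<eta> s)"
    unfolding D_def using tb[of s] by (intro order_trans[OF norm_triangle_ineq4] add_mono) (auto simp: norm_mult)
   then have "exp (- (1 / 2 * \<tau> s)) * cmod (D s) \<le> exp (- (1 / 2 * \<tau> s)) * (B' * exp (1 / 4 * \<tau> s) + a powr \<nu> * cmod (flip \<eta> s))"
    by (intro mult_left_mono) auto
   also have "\<dots> = B' * (exp (- (1 / 2 * \<tau> s)) * exp (1 / 4 * \<tau> s)) + a powr \<nu> * (exp (- (1 / 2 * \<tau> s)) * cmod (flip \<eta> s))"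
    by (simp add: algebra_simps)
   also have "exp (- (1 / 2 * \<tau> s)) * exp (1 / 4 * \<tau> s) = exp (- (1 / 4 * \<tau> s))" by (simp flip: exp_add)
   finally show "norm (exp (- ((1 - 1 / 2) * \<tau> s)) * cmod (D s)) \<le> norm (B' * exp (- (1 / 4 * \<tau> s)) + a powr \<nu> * (exp (- (1 / 2 * \<tau> s)) * cmod (flip \<eta> s)))"
    using abs_ge_self[of "B' * exp (- (1 / 4 * \<tau> s)) + a powr \<nu> * (exp (- (1 / 2 * \<tau> s)) * cmod (flip \<eta> s))"] by simp
  qed
 qed measurable
 then have "AE s in \<mu>. D s = 0" by (intro lag_determine[where \<delta> = "1 / 2"] D0) auto
 then show ?thesis by (simp add: D_def)
qed

lemma flip_isometry:
 assumes h: "h \<in> L2_space \<mu>" shows "L2_sq \<mu> (flip h) = L2_sq \<mu> h"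
proof -
 have "(-1) ^ l * ((-1) ^ l * z) = z" for l and z :: complex by (cases "even l") simp_all
 then have "AE r in \<mu>. h r = flip (flip h) r" by (intro flip_unique flip_L2 h) (simp add: flip_lag[OF h])
 then have "L2_inner \<mu> h (flip (flip h)) = L2_inner \<mu> h h"
  by (intro L2_inner_cong_AE L2_measurable[OF h] L2_measurable[OF flip_L2[OF flip_L2[OF h]]]) (auto elim: eventually_mono)
 then have "L2_inner \<mu> (flip h) (flip h) = L2_inner \<mu> h h" by (simp add: flip_symmetric h flip_L2)
 then show ?thesis by (simp add: L2_inner_self)
qed

text \<open>
 For a general square integrable \<open>\<psi>\<close> whose integral converges pointwise, nothing is known about
 the size of the integral. The truncations of \<open>\<psi>\<close> have transforms that converge pointwise, by
 dominated convergence, and in the mean, by isometry; Fatou's lemma identifies the two limits.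
\<close>

theorem transform_eq_flip:
 assumes \<psi>: "\<psi> \<in> L2_space \<mu>" and conv: "\<And>s. 0 < s ==> integrable \<mu> (%r. \<psi> r * ker r s)"
 shows "AE s in \<mu>. transform \<psi> s = of_real (a powr \<nu>) * flip \<psi> s"
proof -
 have [measurable]: "\<psi> \<in> borel_measurable \<mu>" using \<psi> by (rule L2_measurable)
 have f\<psi>: "flip \<psi> \<in> L2_space \<mu>" by (rule flip_L2[OF \<psi>])
 then have [measurable]: "flip \<psi> \<in> borel_measurable \<mu>" by (rule L2_measurable)
 define i where "i n r = (if \<tau> r \<le> real n then 1 else 0 :: complex)" for n r
 have [measurable]: "i n \<in> borel_measurable \<mu>" for n unfolding i_def by measurable
 have i1: "cmod (i n r) \<le> 1" "cmod (1 - i n r) \<le> 1" for n r by (auto simp: i_def)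
 have ilim: "\<forall>\<^sub>F n in sequentially. i n r = 1" for r
  using eventually_ge_at_top[of "nat \<lceil>\<tau> r\<rceil>"] by eventually_elim (simp add: i_def nat_le_iff ceiling_le_iff)
 define h where "h n r = (1 - i n r) * \<psi> r" for n r
 have h2: "h n \<in> L2_space \<mu>" and \<psi>2: "(%r. i n r * \<psi> r) \<in> L2_space \<mu>" for n
  unfolding h_def by (rule L2_bounded_mult[OF \<psi> _ i1(2)] L2_bounded_mult[OF \<psi> _ i1(1)]; measurable)+
 define D where "D n s = transform (%r. i n r * \<psi> r) s - of_real (a powr \<nu>) * flip \<psi> s" for n s
 have D_eq: "AE s in \<mu>. D n s = - of_real (a powr \<nu>) * flip (h n) s" for n
 proof -
  have t: "AE s in \<mu>. transform (%r. i n r * \<psi> r) s = of_real (a powr \<nu>) * flip (%r. i n r * \<psi> r) s"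
   by (rule transform_bounded_support[OF \<psi>2, of "real n"]) (auto simp: i_def)
  have "AE s in \<mu>. flip \<psi> s - flip (%r. i n r * \<psi> r) s = flip (h n) s"
  proof (rule flip_unique[OF h2 L2_diff[OF f\<psi> flip_L2[OF \<psi>2]]])
   have "h n = (%r. \<psi> r - i n r * \<psi> r)" by (simp add: h_def[abs_def] left_diff_distrib)
   then show "L2_inner \<mu> (%s. flip \<psi> s - flip (%r. i n r * \<psi> r) s) (lag l) = (-1) ^ l * L2_inner \<mu> (h n) (lag l)" for l
    by (simp add: L2_inner_diff_left f\<psi> flip_L2 \<psi> \<psi>2 lag_L2 flip_lag right_diff_distrib)
  qed
  with t show ?thesis
  proof eventually_elim
   case (elim s)
   show ?case unfolding D_def elim(1) elim(2)[symmetric] by (simp add: right_diff_distrib)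
  qed
 qed
 have D_lim: "(%n. D n s) \<longlonglongrightarrow> transform \<psi> s - of_real (a powr \<nu>) * flip \<psi> s" if s: "s \<in> space \<mu>" for s
 proof -
  have "(%n. transform (%r. i n r * \<psi> r) s) \<longlonglongrightarrow> transform \<psi> s"
   unfolding transform_def
  proof (rule integral_dominated_convergence[where w = "%r. cmod (\<psi> r * ker r s)"])
   show "AE r in \<mu>. (%n. i n r * \<psi> r * ker r s) \<longlonglongrightarrow> \<psi> r * ker r s"
    using ilim by (intro AE_I2 tendsto_eventually) (auto elim!: eventually_mono)
   show "AE r in \<mu>. norm (i n r * \<psi> r * ker r s) \<le> cmod (\<psi> r * ker r s)" for n
    by (intro AE_I2) (simp add: i_def)
   show "integrable \<mu> (%r. cmod (\<psi> r * ker r s))" using conv[of s] s by simp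
  qed measurable
  then show ?thesis unfolding D_def by (intro tendsto_diff tendsto_const)
 qed
 have "(%n. L2_sq \<mu> (h n)) \<longlonglongrightarrow> (LINT r|\<mu>. (0::real))"
  unfolding L2_sq_def
 proof (rule integral_dominated_convergence[where w = "%r. (cmod (\<psi> r))\<^sup>2"])
  show "AE r in \<mu>. (%n. (cmod (h n r))\<^sup>2) \<longlonglongrightarrow> 0"
   using ilim by (intro AE_I2 tendsto_eventually) (auto elim!: eventually_mono simp: h_def)
  show "AE r in \<mu>. norm ((cmod (h n r))\<^sup>2) \<le> (cmod (\<psi> r))\<^sup>2" for n by (intro AE_I2) (simp add: h_def i_def)
 qed (use L2_integrable[OF \<psi>] L2_measurable[OF h2] in auto)
 then have "(%n. (a powr \<nu>)\<^sup>2 * L2_sq \<mu> (h n)) \<longlonglongrightarrow> (a powr \<nu>)\<^sup>2 * 0" by (intro tendsto_intros) simp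
 from tendsto_ennrealI[OF this]
 have lim0: "liminf (%n. ennreal ((a powr \<nu>)\<^sup>2 * L2_sq \<mu> (h n))) = 0" by (simp add: lim_imp_Liminf)
 have Dm [measurable]: "D n \<in> borel_measurable \<mu>" for n unfolding D_def by measurable
 have D_sq: "(\<integral>\<^sup>+s. ennreal ((cmod (D n s))\<^sup>2) \<partial>\<mu>) = ennreal ((a powr \<nu>)\<^sup>2 * L2_sq \<mu> (h n))" for n
 proof -
  have "(\<integral>\<^sup>+s. ennreal ((cmod (D n s))\<^sup>2) \<partial>\<mu>) = (\<integral>\<^sup>+s. ennreal ((a powr \<nu>)\<^sup>2 * (cmod (flip (h n) s))\<^sup>2) \<partial>\<mu>)"
   using D_eq[of n] by (intro nn_integral_cong_AE) (auto elim!: eventually_mono simp: norm_mult power_mult_distrib)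
  also have "\<dots> = ennreal (LINT s|\<mu>. (a powr \<nu>)\<^sup>2 * (cmod (flip (h n) s))\<^sup>2)"
   using L2_integrable[OF flip_L2[OF h2]] by (intro nn_integral_eq_integral) auto
  finally show ?thesis using flip_isometry[OF h2, of n] by (simp add: L2_sq_def)
 qed
 have "(\<integral>\<^sup>+s. ennreal ((cmod (transform \<psi> s - of_real (a powr \<nu>) * flip \<psi> s))\<^sup>2) \<partial>\<mu>)
   = (\<integral>\<^sup>+s. liminf (%n. ennreal ((cmod (D n s))\<^sup>2)) \<partial>\<mu>)"
  by (intro nn_integral_cong lim_imp_Liminf[symmetric] tendsto_ennrealI tendsto_power tendsto_norm D_lim) simp_all
 also have "\<dots> \<le> liminf (%n. \<integral>\<^sup>+s. ennreal ((cmod (D n s))\<^sup>2) \<partial>\<mu>)" by (rule nn_integral_liminf) measurable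
 also have "\<dots> = 0" unfolding D_sq by (rule lim0)
 finally have "(\<integral>\<^sup>+s. ennreal ((cmod (transform \<psi> s - of_real (a powr \<nu>) * flip \<psi> s))\<^sup>2) \<partial>\<mu>) = 0" by simp
 then show ?thesis by (subst (asm) nn_integral_0_iff_AE) auto
qed

lemma hankel_integral_eq_flip:
 assumes \<psi>: "\<psi> \<in> L2_space \<mu>" and conv: "hankel_converges a \<nu> \<psi>"
 shows "AE s in \<mu>. hankel_integral a \<nu> \<psi> s = of_real (a powr \<nu>) * flip \<psi> s"
proof -
 have m: "\<psi> \<in> borel_measurable \<mu>" using \<psi> by (rule L2_measurable)
 have "AE s in \<mu>. transform \<psi> s = of_real (a powr \<nu>) * flip \<psi> s"
  using conv unfolding hankel_converges_iff[OF m] by (intro transform_eq_flip \<psi>) auto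
 moreover have "AE s in \<mu>. hankel_integral a \<nu> \<psi> s = transform \<psi> s"
  by (intro AE_I2) (simp add: hankel_integral_eq[OF m] transform_def)
 ultimately show ?thesis by eventually_elim simp
qed

text \<open>
 These combinations are dense and supply the approximating sequence required by the second clause
 in the definition of the Hankel transform.
\<close>

lemma lag_combination_hankel:
 defines "\<Psi> c n \<equiv> %r. \<Sum>j<n. c j * lag j r"
 shows "hankel_converges a \<nu> (\<Psi> c n)"
  and "0 < s ==> hankel_integral a \<nu> (\<Psi> c n) s = of_real (a powr \<nu>) * (\<Sum>j<n. (-1) ^ j * c j * lag j s)"
proof -
 have m [measurable]: "\<Psi> c n \<in> borel_measurable \<mu>" unfolding \<Psi>_def by measurable
 have i: "integrable \<mu> (%r. c j * (lag j r * ker r s))" for j s using lag_ker_integrable by simp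
 show "hankel_converges a \<nu> (\<Psi> c n)"
  unfolding hankel_converges_iff[OF m] unfolding \<Psi>_def sum_distrib_right mult.assoc using i by auto
 assume s: "0 < s"
 show "hankel_integral a \<nu> (\<Psi> c n) s = of_real (a powr \<nu>) * (\<Sum>j<n. (-1) ^ j * c j * lag j s)"
  unfolding hankel_integral_eq[OF m s] unfolding \<Psi>_def sum_distrib_right mult.assoc
  by (subst Bochner_Integration.integral_sum)
   (use i in \<open>auto simp: lag_ker_integral sum_distrib_left mult.assoc mult.left_commute intro!: sum.cong\<close>)
qed

text \<open>
 Whichever clause of its definition applies, the Hankel transform of a square integrable function
 is the same multiple of the unitary operator.
\<close>

theorem hankel_transform_eq_flip:
 assumes \<psi>: "\<psi> \<in> L2_space \<mu>"
 shows "AE s in \<mu>. hankel_transform a \<nu> \<psi> s = of_real (a powr \<nu>) * flip \<psi> s"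
proof (cases "hankel_converges a \<nu> \<psi>")
 case True
 then show ?thesis using hankel_integral_eq_flip[OF \<psi> True] by (simp add: hankel_transform_def)
next
 case False
 define ext where "ext g \<longleftrightarrow> (\<exists>\<Psi>. (\<forall>n. hankel_converges a \<nu> (\<Psi> n)) \<and> L2_tendsto \<mu> \<Psi> \<psi> \<and>
    L2_tendsto \<mu> (%n. hankel_integral a \<nu> (\<Psi> n)) g)" for g
 have f\<psi>: "flip \<psi> \<in> L2_space \<mu>" by (rule flip_L2[OF \<psi>])
 have "ext (%s. of_real (a powr \<nu>) * flip \<psi> s)"
 proof -
  note ex = orthonormal_expansion[OF gram_schmidt_orthonormal gram_schmidt_total]
  have "\<exists>b. gram_schmidt j = (%r. b * lag j r)" for j
   using gram_schmidt_E[of j] by (auto elim!: E_cases) (metis mult_zero_left)+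
  then obtain b where b: "\<And>j. gram_schmidt j = (%r. b j * lag j r)" by metis
  define c where "c j = L2_inner \<mu> \<psi> (gram_schmidt j) * b j" for j
  have e1: "L2_tendsto \<mu> (%n r. \<Sum>j<n. c j * lag j r) \<psi>"
   using ex[OF \<psi>] unfolding c_def by (simp add: b mult.assoc)
  have c2: "L2_inner \<mu> (flip \<psi>) (gram_schmidt j) * b j = (-1) ^ j * c j" for j
   using flip_E[OF \<psi>, of "gram_schmidt j" "real j"] gram_schmidt_E[of j] unfolding c_def by simp
  have e2: "L2_tendsto \<mu> (%n r. \<Sum>j<n. (-1) ^ j * c j * lag j r) (flip \<psi>)"
   using ex[OF f\<psi>] unfolding c2[symmetric] by (simp add: b mult.assoc)
  have "L2_tendsto \<mu> (%n. hankel_integral a \<nu> (%r. \<Sum>j<n. c j * lag j r)) (%s. of_real (a powr \<nu>) * flip \<psi> s)"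
  proof -
   have eqn: "hankel_integral a \<nu> (%r. \<Sum>j<n. c j * lag j r) s = of_real (a powr \<nu>) * (\<Sum>j<n. (-1) ^ j * c j * lag j s)" if "s \<in> space \<mu>" for n s
    using lag_combination_hankel(2)[of s c n] that by simp
   have mem: "hankel_integral a \<nu> (%r. \<Sum>j<n. c j * lag j r) \<in> L2_space \<mu>" for n
   proof (rule L2_cong_AE)
    show "(%s. of_real (a powr \<nu>) * (\<Sum>j<n. (-1) ^ j * c j * lag j s)) \<in> L2_space \<mu>"
     by (intro L2_scale L2_sum lag_L2)
    show "AE s in \<mu>. of_real (a powr \<nu>) * (\<Sum>j<n. (-1) ^ j * c j * lag j s) = hankel_integral a \<nu> (%r. \<Sum>j<n. c j * lag j r) s"
     using eqn by (intro AE_I2) simp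
    have "(%s. of_real (a powr \<nu>) * (\<Sum>j<n. (-1) ^ j * c j * lag j s)) \<in> borel_measurable \<mu>" by measurable
    then show "hankel_integral a \<nu> (%r. \<Sum>j<n. c j * lag j r) \<in> borel_measurable \<mu>"
     by (subst measurable_cong[OF eqn])
   qed
   have "L2_sq \<mu> (%s. hankel_integral a \<nu> (%r. \<Sum>j<n. c j * lag j r) s - of_real (a powr \<nu>) * flip \<psi> s)
     = (a powr \<nu>)\<^sup>2 * L2_sq \<mu> (%s. (\<Sum>j<n. (-1) ^ j * c j * lag j s) - flip \<psi> s)" for n
   proof -
    have "L2_sq \<mu> (%s. hankel_integral a \<nu> (%r. \<Sum>j<n. c j * lag j r) s - of_real (a powr \<nu>) * flip \<psi> s)
      = (LINT s|\<mu>. (a powr \<nu>)\<^sup>2 * (cmod ((\<Sum>j<n. (-1) ^ j * c j * lag j s) - flip \<psi> s))\<^sup>2)"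
     unfolding L2_sq_def
    proof (rule Bochner_Integration.integral_cong[OF refl])
     fix s assume "s \<in> space \<mu>"
     then show "(cmod (hankel_integral a \<nu> (%r. \<Sum>j<n. c j * lag j r) s - of_real (a powr \<nu>) * flip \<psi> s))\<^sup>2
       = (a powr \<nu>)\<^sup>2 * (cmod ((\<Sum>j<n. (-1) ^ j * c j * lag j s) - flip \<psi> s))\<^sup>2"
      unfolding eqn[OF \<open>s \<in> space \<mu>\<close>] right_diff_distrib[symmetric] by (simp add: norm_mult power_mult_distrib)
    qed
    then show ?thesis by (simp add: L2_sq_def)
   qed
   moreover have "(%n. (a powr \<nu>)\<^sup>2 * L2_sq \<mu> (%s. (\<Sum>j<n. (-1) ^ j * c j * lag j s) - flip \<psi> s)) \<longlonglongrightarrow> 0"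
    using e2 unfolding L2_tendsto_iff by (intro tendsto_mult_right_zero) auto
   ultimately show ?thesis
    unfolding L2_tendsto_iff using mem L2_scale[OF f\<psi>] by auto
  qed
  then show ?thesis
   unfolding ext_def using e1 lag_combination_hankel(1)
   by (intro exI[of _ "%n r. \<Sum>j<n. c j * lag j r"]) blast
 qed
 then have "ext (SOME g. ext g)" by (rule someI[of ext])
 then have "ext (hankel_transform a \<nu> \<psi>)" using False by (simp add: hankel_transform_def ext_def)
 then obtain \<Psi> where \<Psi>: "\<And>n. hankel_converges a \<nu> (\<Psi> n)" "L2_tendsto \<mu> \<Psi> \<psi>"
   "L2_tendsto \<mu> (%n. hankel_integral a \<nu> (\<Psi> n)) (hankel_transform a \<nu> \<psi>)"
  by (auto simp: ext_def)
 have \<Psi>2: "\<Psi> n \<in> L2_space \<mu>" for n using \<Psi>(2) by (simp add: L2_tendsto_def)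
 have H2: "hankel_transform a \<nu> \<psi> \<in> L2_space \<mu>" using \<Psi>(3) by (simp add: L2_tendsto_def)
 have I2: "hankel_integral a \<nu> (\<Psi> n) \<in> L2_space \<mu>" for n using \<Psi>(3) by (simp add: L2_tendsto_def)
 define h where "h s = of_real (1 / a powr \<nu>) * hankel_transform a \<nu> \<psi> s" for s
 have "L2_inner \<mu> h (lag l) = (-1) ^ l * L2_inner \<mu> \<psi> (lag l)" for l
 proof -
  have "L2_inner \<mu> (hankel_integral a \<nu> (\<Psi> n)) (lag l) = of_real (a powr \<nu>) * ((-1) ^ l * L2_inner \<mu> (\<Psi> n) (lag l))" for n
  proof -
   have "L2_inner \<mu> (hankel_integral a \<nu> (\<Psi> n)) (lag l) = L2_inner \<mu> (%s. of_real (a powr \<nu>) * flip (\<Psi> n) s) (lag l)"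
    by (rule L2_inner_cong_AE)
     (use hankel_integral_eq_flip[OF \<Psi>2 \<Psi>(1)] L2_measurable[OF I2] L2_measurable[OF L2_scale[OF flip_L2[OF \<Psi>2]]] in auto)
   then show ?thesis by (simp add: L2_inner_scale_left flip_lag \<Psi>2)
  qed
  then have "(%n. of_real (a powr \<nu>) * ((-1) ^ l * L2_inner \<mu> (\<Psi> n) (lag l))) \<longlonglongrightarrow> L2_inner \<mu> (hankel_transform a \<nu> \<psi>) (lag l)"
   using L2_tendsto_inner[OF \<Psi>(3) lag_L2[of l]] by simp
  moreover have "(%n. of_real (a powr \<nu>) * ((-1) ^ l * L2_inner \<mu> (\<Psi> n) (lag l))) \<longlonglongrightarrow> of_real (a powr \<nu>) * ((-1) ^ l * L2_inner \<mu> \<psi> (lag l))"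
   by (intro tendsto_intros L2_tendsto_inner[OF \<Psi>(2) lag_L2])
  ultimately have "L2_inner \<mu> (hankel_transform a \<nu> \<psi>) (lag l) = of_real (a powr \<nu>) * ((-1) ^ l * L2_inner \<mu> \<psi> (lag l))"
   by (rule LIMSEQ_unique)
  then show ?thesis unfolding h_def L2_inner_scale_left using a by simp
 qed
 then have "AE s in \<mu>. h s = flip \<psi> s"
  unfolding h_def by (intro flip_unique \<psi> L2_scale H2) auto
 then show ?thesis by eventually_elim (use a in \<open>simp add: h_def field_simps\<close>)
qed

end

section \<open>Square integrable functions with respect to the Dunkl weight\<close>

subsection \<open>Polynomials determine integrable functions of compact support\<close>

lemma polynomials_determine:
 fixes F :: "'a::euclidean_space => complex"
 assumes F: "integrable lborel F" and K: "compact K" "\<And>x. x \<notin> K ==> F x = 0"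
  and zero: "\<And>q. real_polynomial_function q ==> (LINT x|lborel. of_real (q x) * F x) = 0"
 shows "AE x in lborel. F x = 0"
proof (rule sigma_finite_measure.density_zero[OF sigma_finite_lborel F])
 fix A :: "'a set" assume [measurable]: "A \<in> sets lborel"
 have "(LINT x|lborel. of_real (indicator A x) * F x) = 0"
  by (rule polynomials_determine_image[where y = "%x. x" and g = "%x. of_real (indicator A x)" and B = 1, OF F _ K(1) _ zero])
   (use K(2) in \<open>auto simp: indicator_def\<close>)
 then show "(LINT x:A|lborel. F x) = 0" by (simp add: set_lebesgue_integral_def scaleR_conv_of_real)
qed

subsection \<open>Integration of a homogeneous polynomial times a radial function\<close>

lemma AE_hankel_iff: "(AE r in hankel_measure a \<nu>. Q r) \<longleftrightarrow> (AE r in lborel. 0 < r \<longrightarrow> Q r)"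
proof -
 have m: "(%r. ennreal (r powr (a * (\<nu> + 1) - 1))) \<in> borel_measurable (restrict_space lborel {0<..})"
  by (intro measurable_restrict_space1 measurable_compose[OF _ measurable_ennreal] powr_real_measurable) auto
 show ?thesis unfolding hankel_measure_def AE_density[OF m] by (subst AE_restrict_space_iff) auto
qed

locale ka_dunkl = dunkl R P k for R P :: "(real^'n) set" and k +
 fixes a :: real
 assumes a: "0 < a" and index: "a + 2 * mult_sum P k + real CARD('n) - 2 > 0"
begin

abbreviation "M \<equiv> dunkl_measure R k a"
abbreviation "lam m \<equiv> lambda_kam P k a m"
abbreviation "\<mu> m \<equiv> hankel_measure a (lam m)"
abbreviation "\<tau> \<equiv> hankel.\<tau> a"

lemma lam_exponent: "a * (lam m + 1) - 1 = 2 * real m + 2 * mult_sum P k + real CARD('n) + a - 3"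
 using a by (simp add: lambda_kam_def field_simps)

lemma lam_gt: "-1 < lam m"
 using a index mult_sum_nonneg by (simp add: lambda_kam_def field_simps)

lemma hankel_lam: "hankel a (lam m)"
 using a lam_gt by unfold_locales

lemma dunkl_weight_eq: "dunkl_weight R k a x = norm x powr (a - 2) * weight x"
 by (simp add: dunkl_weight_def weight_def)

lemma borel_measurable_dunkl_weight [measurable]: "dunkl_weight R k a \<in> borel_measurable borel"
 unfolding dunkl_weight_eq[abs_def] by measurable

lemma dunkl_weight_nonneg: "0 \<le> dunkl_weight R k a x"
 by (simp add: dunkl_weight_eq weight_nonneg)

lemma sets_M [simp, measurable_cong]: "sets M = sets borel" by (simp add: dunkl_measure_def)

lemma space_M [simp]: "space M = UNIV" by (simp add: dunkl_measure_def)

lemma measurable_M [simp]: "borel_measurable M = borel_measurable borel" by (rule measurable_cong_sets) auto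

lemma AE_M_iff: "(AE x in M. Q x) \<longleftrightarrow> (AE x in lborel. Q x)"
proof -
 have pos: "0 < ennreal (dunkl_weight R k a x)" if "x \<in> regular" for x
  using weight_pos[OF that] that by (simp add: dunkl_weight_eq regular_def)
 have "(AE x in lborel. 0 < ennreal (dunkl_weight R k a x) \<longrightarrow> Q x) \<longleftrightarrow> (AE x in lborel. Q x)"
 proof
  assume "AE x in lborel. 0 < ennreal (dunkl_weight R k a x) \<longrightarrow> Q x"
  then show "AE x in lborel. Q x" using AE_regular by eventually_elim (use pos in auto)
 qed (auto elim: eventually_mono)
 then show ?thesis unfolding dunkl_measure_def by (subst AE_density) auto
qed

lemma AE_M_regular: "AE x in M. x \<in> regular" using AE_regular by (simp add: AE_M_iff)

lemma AE_M_nonzero: "AE x in M. x \<noteq> 0" using AE_M_regular by eventually_elim (simp add: regular_def)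

lemma homogeneous_polynomial_weight:
 assumes V: "polynomial_function V" "homogeneous d V"
 shows "(%x. V x * of_real (weight x)) \<in> borel_measurable borel"
  and "0 < t ==> V (t *\<^sub>R x) * of_real (weight (t *\<^sub>R x)) = of_real (t powr (real d + 2 * mult_sum P k)) * (V x * of_real (weight x))"
  and "\<exists>B. \<forall>x. norm x \<le> 1 \<longrightarrow> cmod (V x * of_real (weight x)) \<le> B"
proof -
 have [measurable]: "V \<in> borel_measurable borel" using V(1) by (rule borel_measurable_polynomial)
 show "(%x. V x * of_real (weight x)) \<in> borel_measurable borel" by measurable
 show "V (t *\<^sub>R x) * of_real (weight (t *\<^sub>R x)) = of_real (t powr (real d + 2 * mult_sum P k)) * (V x * of_real (weight x))" if "0 < t"
  using V(2) that by (simp add: weight_scale powr_add powr_realpow homogeneous_def)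
 obtain C n where C: "0 \<le> C" "\<And>x. cmod (V x) \<le> C * (1 + norm x) ^ n" using polynomial_growth[OF V(1)] by blast
 obtain D j where D: "0 \<le> D" "\<And>x. smooth_weight 1 x \<le> D * (1 + norm x) ^ j" using smooth_weight_growth by blast
 have "cmod (V x * of_real (weight x)) \<le> (C * 2 ^ n) * (D * 2 ^ j)" if x: "norm x \<le> 1" for x
 proof -
  have "(1 + norm x) ^ i \<le> 2 ^ i" for i using x by (intro power_mono) auto
  then have "cmod (V x) \<le> C * 2 ^ n" "weight x \<le> D * 2 ^ j"
   using C D weight_le_smooth[of x] by (meson mult_left_mono order_trans)+
  then show ?thesis using C(1) weight_nonneg[of x] by (auto simp: norm_mult intro!: mult_mono)
 qed
 then show "\<exists>B. \<forall>x. norm x \<le> 1 \<longrightarrow> cmod (V x * of_real (weight x)) \<le> B" by blast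
qed

text \<open>
 Up to normalisation, the integral of \<open>V\<close> over the unit sphere with the weight \<open>\<Prod>\<^sub>\<alpha> \<bar>\<langle>\<alpha>, x\<rangle>\<bar>\<^bsup>k\<^sub>\<alpha>\<^esup>\<close>, expressed by
 the unit ball; \<open>d\<close> is the degree of homogeneity of \<open>V\<close>.
\<close>

definition sphere_integral :: "nat => (real^'n => complex) => complex" where
 "sphere_integral d V = of_real (real d + 2 * mult_sum P k + real CARD('n)) * (LINT x:cball 0 1|lborel. V x * of_real (weight x))"

lemma integral_M_polar:
 assumes V: "polynomial_function V" "homogeneous d V" and [measurable]: "g \<in> borel_measurable borel"
  and int: "integrable M (%x. g (norm x) * V x)"
 shows "(LINT x|M. g (norm x) * V x)
  = sphere_integral d V * (LINT r:{0<..}|lborel. g r * of_real (r powr (real d + 2 * mult_sum P k + real CARD('n) + a - 3)))"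
proof -
 define g' where "g' r = g r * of_real (r powr (a - 2))" for r
 have [measurable]: "g' \<in> borel_measurable borel" unfolding g'_def[abs_def] by measurable
 have [measurable]: "V \<in> borel_measurable borel" using V(1) by (rule borel_measurable_polynomial)
 have eq: "dunkl_weight R k a x *\<^sub>R (g (norm x) * V x) = g' (norm x) * (V x * of_real (weight x))" for x
  by (simp add: g'_def dunkl_weight_eq scaleR_conv_of_real)
 have int': "integrable lborel (%x. g' (norm x) * (V x * of_real (weight x)))"
  using int unfolding dunkl_measure_def by (subst (asm) integrable_density) (auto simp: eq dunkl_weight_nonneg)
 obtain B where B: "\<And>x. norm x \<le> 1 ==> cmod (V x * of_real (weight x)) \<le> B"
  using homogeneous_polynomial_weight(3)[OF V] by blast
 have "(LINT x|M. g (norm x) * V x) = (LINT x|lborel. g' (norm x) * (V x * of_real (weight x)))"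
  unfolding dunkl_measure_def by (subst integral_density) (auto simp: eq dunkl_weight_nonneg)
 also have "\<dots> = of_real (real d + 2 * mult_sum P k + real DIM(real^'n)) * (LINT x:cball 0 1|lborel. V x * of_real (weight x)) *
   (LINT r:{0<..}|lborel. g' r * of_real (r powr (real d + 2 * mult_sum P k + real DIM(real^'n) - 1)))"
  by (rule integral_polar[OF homogeneous_polynomial_weight(1)[OF V] _ homogeneous_polynomial_weight(2)[OF V] B _ int'])
   (use mult_sum_nonneg in auto)
 also have "(LINT r:{0<..}|lborel. g' r * of_real (r powr (real d + 2 * mult_sum P k + real DIM(real^'n) - 1)))
   = (LINT r:{0<..}|lborel. g r * of_real (r powr (real d + 2 * mult_sum P k + real CARD('n) + a - 3)))"
 proof (rule set_lebesgue_integral_cong)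
  show "\<forall>r. r \<in> {0<..} \<longrightarrow> g' r * of_real (r powr (real d + 2 * mult_sum P k + real DIM(real^'n) - 1))
    = g r * of_real (r powr (real d + 2 * mult_sum P k + real CARD('n) + a - 3))"
   by (auto simp: g'_def mult.assoc simp flip: of_real_mult powr_add) (simp add: algebra_simps)
 qed simp
 finally show ?thesis by (simp add: sphere_integral_def)
qed

lemma nn_integral_M_polar:
 assumes p: "polynomial_function p" "homogeneous m p" and [measurable]: "g \<in> borel_measurable borel"
 shows "(\<integral>\<^sup>+x. g (norm x) * ennreal ((cmod (p x))\<^sup>2) \<partial>M)
  = ennreal ((2 * real m + 2 * mult_sum P k + real CARD('n)) * (LINT x:cball 0 1|lborel. (cmod (p x))\<^sup>2 * weight x)) * (\<integral>\<^sup>+r. g r \<partial>\<mu> m)"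
proof -
 let ?V = "%x. (cmod (p x))\<^sup>2 * weight x" and ?e = "2 * real m + 2 * mult_sum P k"
 have [measurable]: "p \<in> borel_measurable borel" using p(1) by (rule borel_measurable_polynomial)
 have V: "polynomial_function (%x. p x * cnj (p x))" "homogeneous (2 * m) (%x. p x * cnj (p x))"
  using p by (auto intro!: polynomial_intros simp: homogeneous_def power_add mult_2)
 have VV: "p x * cnj (p x) * of_real (weight x) = of_real (?V x)" for x by (simp add: cnj_mult_self(1) del: of_real_power)
 obtain B where B: "\<And>x. norm x \<le> 1 ==> ?V x \<le> B"
  using homogeneous_polynomial_weight(3)[OF V] unfolding VV norm_of_real by (meson abs_le_D1)
 have hom: "?V (t *\<^sub>R x) = t powr ?e * ?V x" if "0 < t" for t x
  using homogeneous_polynomial_weight(2)[OF V that, of x] unfolding VV of_real_mult[symmetric] of_real_eq_iff by simp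
 have "(\<integral>\<^sup>+x. g (norm x) * ennreal ((cmod (p x))\<^sup>2) \<partial>M) = (\<integral>\<^sup>+x. g (norm x) * ennreal (norm x powr (a - 2)) * ennreal (?V x) \<partial>lborel)"
  unfolding dunkl_measure_def
  by (subst nn_integral_density) (auto simp: dunkl_weight_eq ennreal_mult' weight_nonneg mult_ac intro!: nn_integral_cong)
 also have "\<dots> = ennreal ((?e + real DIM(real^'n)) * (LINT x:cball 0 1|lborel. ?V x)) *
   (\<integral>\<^sup>+r. g r * ennreal (r powr (a - 2)) * ennreal (r powr (?e + real DIM(real^'n) - 1)) * indicator {0<..} r \<partial>lborel)"
  by (rule nn_integral_polar[where g = "%r. g r * ennreal (r powr (a - 2))", OF _ _ _ hom B])
   (use mult_sum_nonneg weight_nonneg in auto)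
 also have "(\<integral>\<^sup>+r. g r * ennreal (r powr (a - 2)) * ennreal (r powr (?e + real DIM(real^'n) - 1)) * indicator {0<..} r \<partial>lborel) = (\<integral>\<^sup>+r. g r \<partial>\<mu> m)"
 proof -
  have "ennreal (r powr (a - 2)) * ennreal (r powr (?e + real DIM(real^'n) - 1)) = ennreal (r powr (a * (lam m + 1) - 1))" for r
   unfolding lam_exponent by (simp add: algebra_simps flip: ennreal_mult' powr_add)
  then show ?thesis by (subst nn_integral_hankel) (auto simp: mult.assoc intro!: nn_integral_cong)
 qed
 finally show ?thesis by simp
qed

end

context ka_dunkl begin

subsection \<open>Products of a harmonic polynomial and a radial function\<close>

lemma harmonicsD:
 assumes "p \<in> dunkl_harmonics P k m"
 shows "polynomial_function p" "homogeneous m p" "p \<in> borel_measurable borel" "continuous_on UNIV p"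
 using assms by (auto simp: dunkl_harmonics_iff intro: borel_measurable_polynomial continuous_on_polynomial)

definition sphere_norm :: "nat => (real^'n => complex) => real" where
 "sphere_norm m p = (2 * real m + 2 * mult_sum P k + real CARD('n)) * (LINT x:cball 0 1|lborel. (cmod (p x))\<^sup>2 * weight x)"

lemma sphere_norm_eq_0:
 assumes p: "p \<in> dunkl_harmonics P k m" and "ennreal (sphere_norm m p) = 0"
 shows "p x = 0"
proof -
 note [measurable] = harmonicsD(3)[OF p]
 have "(\<integral>\<^sup>+x. ennreal ((cmod (p x))\<^sup>2) \<partial>M) = 0"
  using nn_integral_M_polar[OF harmonicsD(1,2)[OF p], of "%_. 1"] assms(2) by (simp add: sphere_norm_def)
 then have "AE x in M. p x = 0" by (subst (asm) nn_integral_0_iff_AE) auto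
 then have "AE x in lborel. p x = 0" by (simp add: AE_M_iff)
 moreover have o: "open {x. p x \<noteq> 0}" using harmonicsD(4)[OF p] by (simp add: open_Collect_neq)
 ultimately have "{x. p x \<noteq> 0} \<in> null_sets lborel" by (subst AE_iff_null_sets) (auto intro: borel_open)
 then have "negligible {x. p x \<noteq> 0}" by (simp add: negligible_iff_null_sets null_sets_completionI)
 then show ?thesis using open_not_negligible[OF o] by blast
qed

lemma harmonic_radial_measurable:
 assumes p: "p \<in> dunkl_harmonics P k m" and g: "g \<in> borel_measurable (\<mu> j)"
 shows "(%x. p x * g (norm x)) \<in> borel_measurable M"
proof -
 define g' where "g' r = indicator {0<..} r *\<^sub>R g r" for r
 have [measurable]: "g' \<in> borel_measurable borel" using g by (simp add: g'_def[abs_def] borel_measurable_hankel_iff)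
 note [measurable] = harmonicsD(3)[OF p]
 have "(%x. p x * g (norm x)) = (%x. p x * (if norm x = 0 then g 0 else g' (norm x)))" by (auto simp: g'_def)
 also have "\<dots> \<in> borel_measurable M" unfolding measurable_M by measurable
 finally show ?thesis .
qed

text \<open>
 Polar coordinates with \<open>V = 1\<close>.
\<close>

lemma AE_radial:
 assumes "AE r in \<mu> m. Q r" shows "AE x in M. Q (norm x)"
proof -
 have "AE r in lborel. 0 < r \<longrightarrow> Q r" using assms by (simp add: AE_hankel_iff)
 then obtain N where N: "{r. \<not> (0 < r \<longrightarrow> Q r)} \<subseteq> N" "N \<in> null_sets lborel" by (auto simp: eventually_ae_filter)
 have [measurable]: "N \<in> sets borel" using N(2) by auto
 have one: "polynomial_function (%x::real^'n. 1 :: complex)" "homogeneous 0 (%x::real^'n. 1 :: complex)"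
  by (auto simp: homogeneous_def)
 have "AE r in lborel. r \<notin> N" using N(2) by (rule AE_not_in)
 then have "(\<integral>\<^sup>+r. indicator N r \<partial>\<mu> 0) = 0"
  by (subst nn_integral_hankel) (auto simp: nn_integral_0_iff_AE elim!: eventually_mono)
 then have "(\<integral>\<^sup>+x. indicator N (norm x) \<partial>M) = 0"
  using nn_integral_M_polar[OF one, of "indicator N"] by simp
 then have "AE x in M. norm x \<notin> N"
  by (subst (asm) nn_integral_0_iff_AE) (auto elim!: eventually_mono simp: indicator_def)
 then show ?thesis using AE_M_nonzero
 proof eventually_elim
  case (elim x)
  then have "0 < norm x" by simp
  then show ?case using N(1) elim(1) by blast
 qed
qed

text \<open>
 The exponent of the half-line measure of index \<open>\<lambda>\<^sub>m\<close> is exactly what \<open>\<bar>p\<bar>\<^sup>2\<close>, the weight and the volume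
 element contribute in polar coordinates.
\<close>

lemma harmonic_radial_L2_iff:
 assumes p: "p \<in> dunkl_harmonics P k m" and g: "g \<in> borel_measurable (\<mu> m)"
 shows "(%x. p x * g (norm x)) \<in> L2_space M \<longleftrightarrow> g \<in> L2_space (\<mu> m) \<or> (\<forall>x. p x = 0)"
proof -
 define g' where "g' r = indicator {0<..} r *\<^sub>R g r" for r
 have [measurable]: "g' \<in> borel_measurable borel" using g by (simp add: g'_def[abs_def] borel_measurable_hankel_iff)
 note m = harmonic_radial_measurable[OF p g]
 have "(\<integral>\<^sup>+x. ennreal ((cmod (p x * g (norm x)))\<^sup>2) \<partial>M) = (\<integral>\<^sup>+x. ennreal ((cmod (g' (norm x)))\<^sup>2) * ennreal ((cmod (p x))\<^sup>2) \<partial>M)"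
 proof (rule nn_integral_cong_AE)
  show "AE x in M. ennreal ((cmod (p x * g (norm x)))\<^sup>2) = ennreal ((cmod (g' (norm x)))\<^sup>2) * ennreal ((cmod (p x))\<^sup>2)"
   using AE_M_nonzero by eventually_elim (simp add: g'_def norm_mult power_mult_distrib mult.commute flip: ennreal_mult')
 qed
 also have "\<dots> = ennreal (sphere_norm m p) * (\<integral>\<^sup>+r. ennreal ((cmod (g' r))\<^sup>2) \<partial>\<mu> m)"
  unfolding sphere_norm_def by (rule nn_integral_M_polar[OF harmonicsD(1,2)[OF p]]) measurable
 also have "(\<integral>\<^sup>+r. ennreal ((cmod (g' r))\<^sup>2) \<partial>\<mu> m) = (\<integral>\<^sup>+r. ennreal ((cmod (g r))\<^sup>2) \<partial>\<mu> m)"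
  by (intro nn_integral_cong) (simp add: g'_def)
 finally have eq: "(\<integral>\<^sup>+x. ennreal ((cmod (p x * g (norm x)))\<^sup>2) \<partial>M) = ennreal (sphere_norm m p) * (\<integral>\<^sup>+r. ennreal ((cmod (g r))\<^sup>2) \<partial>\<mu> m)" .
 have 1: "f \<in> L2_space N \<longleftrightarrow> (\<integral>\<^sup>+x. ennreal ((cmod (f x))\<^sup>2) \<partial>N) < \<infinity>" if "f \<in> borel_measurable N" for f and N :: "'z measure"
 proof -
  have "(%x. (cmod (f x))\<^sup>2) \<in> borel_measurable N" using that by measurable
  then show ?thesis using that by (simp add: L2_space_def integrable_iff_bounded)
 qed
 have z: "(\<forall>x. p x = 0) ==> sphere_norm m p = 0" by (simp add: sphere_norm_def set_lebesgue_integral_def)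
 show ?thesis
 proof (cases "ennreal (sphere_norm m p) = 0")
  case True
  then have "\<forall>x. p x = 0" using sphere_norm_eq_0[OF p] by blast
  then show ?thesis by (simp add: L2_zero)
 next
  case False
  then have "\<not> (\<forall>x. p x = 0)" using z by (metis ennreal_0)
  then show ?thesis
   unfolding 1[OF m] 1[OF g] eq using False by (auto simp: ennreal_mult_less_top)
 qed
qed

lemma harmonic_radial_inner:
 assumes p: "p \<in> dunkl_harmonics P k m" and q: "q \<in> dunkl_harmonics P k n"
  and g: "g \<in> L2_space (\<mu> m)" and h: "h \<in> L2_space (\<mu> n)"
 shows "L2_inner M (%x. p x * g (norm x)) (%x. q x * h (norm x))
  = sphere_integral (m + n) (%x. p x * cnj (q x)) * (LINT r:{0<..}|lborel. g r * cnj (h r) * of_real (r powr (real m + real n + 2 * mult_sum P k + real CARD('n) + a - 3)))"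
proof -
 define G where "G r = indicator {0<..} r *\<^sub>R (g r * cnj (h r))" for r
 have gm: "(%r. indicator {0<..} r *\<^sub>R g r) \<in> borel_measurable borel" "(%r. indicator {0<..} r *\<^sub>R h r) \<in> borel_measurable borel"
  using L2_measurable[OF g] L2_measurable[OF h] by (simp_all only: borel_measurable_hankel_iff)
 have "G = (%r. (indicator {0<..} r *\<^sub>R g r) * cnj (indicator {0<..} r *\<^sub>R h r))" by (auto simp: G_def indicator_def)
 then have [measurable]: "G \<in> borel_measurable borel"
  by (simp only:) (intro borel_measurable_times borel_measurable_cnj gm)
 have V: "polynomial_function (%x. p x * cnj (q x))" "homogeneous (m + n) (%x. p x * cnj (q x))"
  using harmonicsD(1,2)[OF p] harmonicsD(1,2)[OF q]
  by (auto intro!: polynomial_intros simp: homogeneous_def power_add)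
 have [measurable]: "(%x. p x * cnj (q x)) \<in> borel_measurable borel" using V(1) by (rule borel_measurable_polynomial)
 have L: "(%x. p x * g (norm x)) \<in> L2_space M" "(%x. q x * h (norm x)) \<in> L2_space M"
  using g h by (auto simp: harmonic_radial_L2_iff[OF p] harmonic_radial_L2_iff[OF q] L2_measurable)
 have ae: "AE x in M. p x * g (norm x) * cnj (q x * h (norm x)) = G (norm x) * (p x * cnj (q x))"
  using AE_M_nonzero by eventually_elim (simp add: G_def)
 have Gm: "(%x. G (norm x) * (p x * cnj (q x))) \<in> borel_measurable M" unfolding measurable_M by measurable
 have "integrable M (%x. G (norm x) * (p x * cnj (q x)))"
  by (rule integrable_cong_AE_imp[OF L2_inner_integrable[OF L] Gm]) (rule ae)
 from integral_M_polar[OF V _ this]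
 have "(LINT x|M. G (norm x) * (p x * cnj (q x))) = sphere_integral (m + n) (%x. p x * cnj (q x)) *
   (LINT r:{0<..}|lborel. G r * of_real (r powr (real m + real n + 2 * mult_sum P k + real CARD('n) + a - 3)))" by simp
 also have "(LINT r:{0<..}|lborel. G r * of_real (r powr (real m + real n + 2 * mult_sum P k + real CARD('n) + a - 3)))
   = (LINT r:{0<..}|lborel. g r * cnj (h r) * of_real (r powr (real m + real n + 2 * mult_sum P k + real CARD('n) + a - 3)))"
  by (rule set_lebesgue_integral_cong) (auto simp: G_def)
 also have "(LINT x|M. G (norm x) * (p x * cnj (q x))) = L2_inner M (%x. p x * g (norm x)) (%x. q x * h (norm x))"
  unfolding L2_inner_def
  by (rule integral_cong_AE[OF borel_measurable_integrable[OF L2_inner_integrable[OF L]] Gm ae, symmetric])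
 finally show ?thesis .
qed

lemma harmonic_radial_inner_same:
 assumes p: "p \<in> dunkl_harmonics P k m" "q \<in> dunkl_harmonics P k m"
  and g: "g \<in> L2_space (\<mu> m)" and h: "h \<in> L2_space (\<mu> m)"
 shows "L2_inner M (%x. p x * g (norm x)) (%x. q x * h (norm x)) = sphere_integral (m + m) (%x. p x * cnj (q x)) * L2_inner (\<mu> m) g h"
proof -
 have "L2_inner (\<mu> m) g h = (LINT r:{0<..}|lborel. g r * cnj (h r) * of_real (r powr (a * (lam m + 1) - 1)))"
  unfolding L2_inner_def
  by (rule integral_hankel(1)) (use L2_inner_integrable[OF g h] in auto)
 then show ?thesis unfolding harmonic_radial_inner[OF p g h] lam_exponent by simp
qed

text \<open>
 The sphere integral of a homogeneous polynomial is its Gaussian integral divided by a positive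
 Gamma factor, so the orthogonality known for the Gaussian weight carries over to the sphere.
\<close>

lemma sphere_integral_harmonics:
 assumes p: "p \<in> dunkl_harmonics P k m" and q: "q \<in> dunkl_harmonics P k n" and "m \<noteq> n"
 shows "sphere_integral (m + n) (%x. p x * cnj (q x)) = 0"
proof -
 define V where "V x = p x * cnj (q x)" for x
 define e where "e = real (m + n) + 2 * mult_sum P k"
 define \<nu> where "\<nu> = (e + real CARD('n)) / 2 - 1"
 have e: "0 \<le> e" using mult_sum_nonneg by (simp add: e_def)
 then have \<nu>: "-1 < \<nu>" by (simp add: \<nu>_def add_nonneg_pos)
 have V: "polynomial_function V" "homogeneous (m + n) V"
  using harmonicsD(1,2)[OF p] harmonicsD(1,2)[OF q] unfolding V_def[abs_def]
  by (auto intro!: polynomial_intros simp: homogeneous_def power_add)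
 obtain B where B: "\<And>x. norm x \<le> 1 ==> cmod (V x * of_real (weight x)) \<le> B"
  using homogeneous_polynomial_weight(3)[OF V] by blast
 let ?g = "%r. complex_of_real (exp (- r\<^sup>2 / 2))"
 have eq: "V x * of_real (gauss x * weight x) = ?g (norm x) * (V x * of_real (weight x))" for x
  by (simp add: gauss_def power2_norm_eq_inner)
 have int: "integrable lborel (%x. ?g (norm x) * (V x * of_real (weight x)))"
  using gint_integrable[OF V(1)] unfolding eq .
 have "0 = gint V"
  using harmonics_orthogonal_gauss[OF p harmonics_cnj[OF q] \<open>m \<noteq> n\<close>] by (simp add: V_def[abs_def])
 also have "\<dots> = (LINT x|lborel. ?g (norm x) * (V x * of_real (weight x)))" unfolding gint_def eq ..
 also have "\<dots> = of_real (e + real DIM(real^'n)) * (LINT x:cball 0 1|lborel. V x * of_real (weight x)) *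
   (LINT r:{0<..}|lborel. ?g r * of_real (r powr (e + real DIM(real^'n) - 1)))"
  unfolding e_def
  by (rule integral_polar[OF homogeneous_polynomial_weight(1)[OF V] _ homogeneous_polynomial_weight(2)[OF V] B _ int])
   (use e in \<open>auto simp: e_def\<close>)
 also have "(LINT r:{0<..}|lborel. ?g r * of_real (r powr (e + real DIM(real^'n) - 1))) = of_real (2 powr \<nu> * Gamma (\<nu> + 1))"
 proof -
  have \<nu>2: "2 * (\<nu> + 1) - 1 = e + real CARD('n) - 1" by (simp add: \<nu>_def)
  have "(LINT r:{0<..}|lborel. ?g r * of_real (r powr (e + real DIM(real^'n) - 1)))
    = (LINT r:{0<..}|lborel. complex_of_real (exp (- (r powr 2 / 2))) * of_real (r powr (2 * (\<nu> + 1) - 1)))"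
   unfolding \<nu>2 by (rule set_lebesgue_integral_cong) auto
  also have "\<dots> = (LINT r|hankel_measure 2 \<nu>. complex_of_real (exp (- (r powr 2 / 2))))"
   by (rule integral_hankel(1)[symmetric]) (intro borel_measurable_hankel, measurable)
  also have "\<dots> = of_real (2 powr \<nu>) * (LINT t:{0<..}|lborel. complex_of_real (exp (- t)) * of_real (t powr \<nu>))"
   by (rule integral_hankel_substitution[OF _ \<nu>, where g = "%t. complex_of_real (exp (- t))"]) auto
  also have "(LINT t:{0<..}|lborel. complex_of_real (exp (- t)) * of_real (t powr \<nu>)) = of_real (Gamma (\<nu> + 1))"
   using has_bochner_integral_integral_eq[OF has_bochner_integral_Gamma[OF \<nu>, of 1 0]]
   by (simp add: set_lebesgue_integral_def scaleR_conv_of_real flip: of_real_mult)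
  finally show ?thesis by simp
 qed
 finally have "of_real (e + real CARD('n)) * (LINT x:cball 0 1|lborel. V x * of_real (weight x)) * of_real (2 powr \<nu> * Gamma (\<nu> + 1)) = 0" by simp
 moreover have "0 < Gamma (\<nu> + 1)" using \<nu> by (intro Gamma_real_pos) simp
 ultimately show ?thesis by (simp add: sphere_integral_def e_def V_def[abs_def])
qed

lemma harmonic_radial_orthogonal:
 assumes "p \<in> dunkl_harmonics P k m" "q \<in> dunkl_harmonics P k n" "g \<in> L2_space (\<mu> m)" "h \<in> L2_space (\<mu> n)" "m \<noteq> n"
 shows "L2_inner M (%x. p x * g (norm x)) (%x. q x * h (norm x)) = 0"
 unfolding harmonic_radial_inner[OF assms(1-4)] sphere_integral_harmonics[OF assms(1,2,5)] by simp

subsection \<open>Eigenfunctions\<close>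

abbreviation "lag m \<equiv> hankel.lag a (lam m)"
abbreviation "basis_fun l m p \<equiv> laguerre_basis_fun P k a l m p"

definition eigenvalue :: "nat => nat => real" where
 "eigenvalue l m = - a * (2 * real l + lam m + 1)"

lemma basis_fun_eq: "basis_fun l m p = (%x. p x * lag m l (norm x))"
 by (rule ext) (simp add: laguerre_basis_fun_def hankel.lag_def[OF hankel_lam] hankel.\<tau>_def[OF hankel_lam] laguerre_exp_def)

lemma basis_fun_L2: "p \<in> dunkl_harmonics P k m ==> basis_fun l m p \<in> L2_space M"
 unfolding basis_fun_eq
 using hankel.lag_L2[OF hankel_lam] by (subst harmonic_radial_L2_iff) (auto dest: L2_measurable)

text \<open>
 Different degrees are separated by the sphere integral, equal degrees by the Laguerre functions.
\<close>

lemma basis_fun_orthogonal: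
 assumes p: "p \<in> dunkl_harmonics P k m" and q: "q \<in> dunkl_harmonics P k n" and ne: "l \<noteq> j \<or> m \<noteq> n"
 shows "L2_inner M (basis_fun l m p) (basis_fun j n q) = 0"
proof (cases "m = n")
 case True
 then show ?thesis
  using p q ne unfolding basis_fun_eq
  by (simp add: harmonic_radial_inner_same hankel.lag_L2[OF hankel_lam] hankel.lag_orthogonal[OF hankel_lam])
next
 case False
 then show ?thesis
  unfolding basis_fun_eq by (intro harmonic_radial_orthogonal[OF p q]) (auto simp: hankel.lag_L2[OF hankel_lam])
qed

text \<open>
 Only directional derivatives at regular points enter the Dunkl Laplacian there; their existence
 makes it additive.
\<close>

definition twice_differentiable :: "(real^'n => complex) => bool" where
 "twice_differentiable v \<longleftrightarrow> (\<forall>x\<in>regular. \<forall>\<xi>. (\<exists>d. has_dir_deriv v \<xi> d x) \<and> (\<exists>d. has_dir_deriv (dunkl_op P k \<xi> v) \<xi> d x))"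

lemma has_dir_deriv_cong_regular:
 assumes x: "x \<in> regular" and eq: "\<And>y. y \<in> regular ==> f y = g y" and f: "has_dir_deriv f \<xi> d x"
 shows "has_dir_deriv g \<xi> d x"
proof (rule has_vector_derivative_transform_within_open[OF f])
 have "open ((%t. x + t *\<^sub>R \<xi>) -` regular)" using open_regular by (intro open_vimage continuous_intros)
 then show "open {t. x + t *\<^sub>R \<xi> \<in> regular}" by (simp add: vimage_def)
qed (use x eq in auto)

lemma twice_differentiable_add:
 assumes u: "twice_differentiable u" and v: "twice_differentiable v"
 shows "twice_differentiable (%x. u x + v x)"
  and "x \<in> regular ==> dunkl_laplacian P k (%x. u x + v x) x = dunkl_laplacian P k u x + dunkl_laplacian P k v x"
proof -
 define F where "F b = (if b then v else u)" for b :: bool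
 have T: "twice_differentiable (F b)" for b using u v by (simp add: F_def)
 have S: "(%x. u x + v x) = (%x. \<Sum>b\<in>UNIV. 1 * F b x)" by (simp add: UNIV_bool F_def)
 have op: "dunkl_op P k \<xi> (%x. u x + v x) y = (\<Sum>b\<in>UNIV. 1 * dunkl_op P k \<xi> (F b) y)" if "y \<in> regular" for y \<xi>
  unfolding S by (rule dunkl_op_sum[OF that]) (use T that in \<open>auto simp: twice_differentiable_def\<close>)
 have op2: "dunkl_op P k \<xi> (dunkl_op P k \<xi> (%x. u x + v x)) x = (\<Sum>b\<in>UNIV. 1 * dunkl_op P k \<xi> (dunkl_op P k \<xi> (F b)) x)"
  if x: "x \<in> regular" for x \<xi>
 proof -
  have "dunkl_op P k \<xi> (dunkl_op P k \<xi> (%x. u x + v x)) x = dunkl_op P k \<xi> (%y. \<Sum>b\<in>UNIV. 1 * dunkl_op P k \<xi> (F b) y) x"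
   by (rule dunkl_op_cong[OF x op])
  also have "\<dots> = (\<Sum>b\<in>UNIV. 1 * dunkl_op P k \<xi> (dunkl_op P k \<xi> (F b)) x)"
   by (rule dunkl_op_sum[OF x]) (use T x in \<open>auto simp: twice_differentiable_def\<close>)
  finally show ?thesis .
 qed
 show "dunkl_laplacian P k (%x. u x + v x) x = dunkl_laplacian P k u x + dunkl_laplacian P k v x" if "x \<in> regular"
  unfolding dunkl_laplacian_def op2[OF that] by (simp add: UNIV_bool F_def sum.distrib)
 show "twice_differentiable (%x. u x + v x)"
  unfolding twice_differentiable_def
 proof (intro ballI allI conjI)
  fix x \<xi> assume x: "x \<in> regular"
  have d: "\<exists>d. has_dir_deriv (F b) \<xi> d x" "\<exists>d. has_dir_deriv (dunkl_op P k \<xi> (F b)) \<xi> d x" for b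
   using T x by (auto simp: twice_differentiable_def)
  from d(1)[of True] d(1)[of False] show "\<exists>d. has_dir_deriv (%x. u x + v x) \<xi> d x"
   by (auto simp: F_def intro: has_vector_derivative_add)
  from d(2) obtain d' where d': "\<And>b. has_dir_deriv (dunkl_op P k \<xi> (F b)) \<xi> (d' b) x" by metis
  define H where "H y = (\<Sum>b\<in>UNIV. 1 * dunkl_op P k \<xi> (F b) y)" for y
  have "has_dir_deriv H \<xi> (\<Sum>b\<in>UNIV. 1 * d' b) x"
   unfolding H_def by (intro has_vector_derivative_sum has_vector_derivative_mult_right d')
  from has_dir_deriv_cong_regular[where f = H and g = "dunkl_op P k \<xi> (%x. u x + v x)", OF x _ this]
  have "has_dir_deriv (dunkl_op P k \<xi> (%x. u x + v x)) \<xi> (\<Sum>b\<in>UNIV. 1 * d' b) x" by (simp only: H_def op)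
  then show "\<exists>d. has_dir_deriv (dunkl_op P k \<xi> (%x. u x + v x)) \<xi> d x" by blast
 qed
qed

definition ka_laplacian :: "(real^'n => complex) => real^'n => complex" where
 "ka_laplacian v x = of_real (norm x powr (2 - a)) * dunkl_laplacian P k v x - of_real (norm x powr a) * v x"

text \<open>
 In the variable \<open>\<tau> = \<parallel>x\<parallel>\<^sup>a / a\<close> the eigenvalue equation becomes the differential equation of
 \<open>e\<^bsup>-\<tau>\<^esup> L\<^sub>l(2\<tau>)\<close>.
\<close>

lemma basis_fun_eigen:
 assumes p: "p \<in> dunkl_harmonics P k m"
 shows "twice_differentiable (basis_fun l m p)"
  and "x \<in> regular ==> ka_laplacian (basis_fun l m p) x = of_real (eigenvalue l m) * basis_fun l m p x"
proof -
 note pp = harmonicsD(1,2)[OF p]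
 obtain f' f'' where f': "\<And>t. (laguerre_exp l (lam m) has_real_derivative f' t) (at t)"
  and f'': "\<And>t. (f' has_real_derivative f'' t) (at t)"
  and ode: "\<And>t. t * f'' t + (lam m + 1) * f' t - t * laguerre_exp l (lam m) t = - (2 * real l + lam m + 1) * laguerre_exp l (lam m) t"
  using laguerre_exp_ODE[of l "lam m"] by blast
 define w where "w s = s powr (a / 2) / a" for s
 define w1 where "w1 s = s powr (a / 2 - 1) / 2" for s :: real
 define w2 where "w2 s = (a / 2 - 1) / 2 * s powr (a / 2 - 2)" for s
 have dw: "(w has_real_derivative w1 s) (at s)" "(w1 has_real_derivative w2 s) (at s)" if "0 < s" for s
 proof -
  show "(w has_real_derivative w1 s) (at s)"
   unfolding w_def[abs_def] w1_def using that a by (auto intro!: derivative_eq_intros)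
  have "a / 2 - 1 - 1 = a / 2 - 2" by simp
  then show "(w1 has_real_derivative w2 s) (at s)"
   unfolding w1_def[abs_def] w2_def using that a by (auto intro!: derivative_eq_intros simp: mult.commute)
 qed
 define \<Phi> where "\<Phi> s = laguerre_exp l (lam m) (w s)" for s
 define \<Phi>1 where "\<Phi>1 s = f' (w s) * w1 s" for s
 define \<Phi>2 where "\<Phi>2 s = f'' (w s) * w1 s * w1 s + f' (w s) * w2 s" for s
 have D1: "\<forall>s>0. (\<Phi> has_real_derivative \<Phi>1 s) (at s)"
  unfolding \<Phi>_def[abs_def] \<Phi>1_def using DERIV_chain2[OF f' dw(1)] by blast
 have D2: "\<forall>s>0. (\<Phi>1 has_real_derivative \<Phi>2 s) (at s)"
 proof (intro allI impI)
  fix s :: real assume "0 < s"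
  from DERIV_mult[OF DERIV_chain2[OF f'' dw(1)[OF this]] dw(2)[OF this]]
  show "(\<Phi>1 has_real_derivative \<Phi>2 s) (at s)" unfolding \<Phi>1_def[abs_def] \<Phi>2_def by (simp add: mult_ac add.commute)
 qed
 have np: "norm y powr t = (y \<bullet> y) powr (t / 2)" for y :: "real^'n" and t
  by (cases "y = 0") (simp_all add: norm_eq_sqrt_inner powr_half_sqrt[symmetric] powr_powr)
 have b: "basis_fun l m p = (%y. p y * of_real (\<Phi> (y \<bullet> y)))"
  unfolding basis_fun_eq hankel.lag_def[OF hankel_lam] hankel.\<tau>_def[OF hankel_lam] \<Phi>_def w_def np ..
 show "twice_differentiable (basis_fun l m p)"
  unfolding twice_differentiable_def b
 proof (intro ballI allI conjI)
  fix x \<xi> assume x: "x \<in> regular"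
  then have x0: "x \<noteq> 0" by (simp add: regular_def)
  show "\<exists>d. has_dir_deriv (%y. p y * of_real (\<Phi> (y \<bullet> y))) \<xi> d x"
   using has_dir_deriv_radial[OF pp(1) x0 D1] by blast
  have q: "polynomial_function (dunkl_op P k \<xi> p)" "polynomial_function (%y. of_real (2 * (y \<bullet> \<xi>)) * p y)"
   using pp by (auto intro!: polynomial_dunkl_op polynomial_intros simp del: of_real_mult)
  have "has_dir_deriv (%y. dunkl_op P k \<xi> p y * of_real (\<Phi> (y \<bullet> y)) + of_real (2 * (y \<bullet> \<xi>)) * p y * of_real (\<Phi>1 (y \<bullet> y))) \<xi>
    ((dir_deriv \<xi> (dunkl_op P k \<xi> p) x * of_real (\<Phi> (x \<bullet> x)) + of_real (2 * (x \<bullet> \<xi>)) * dunkl_op P k \<xi> p x * of_real (\<Phi>1 (x \<bullet> x))) +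
    (dir_deriv \<xi> (%y. of_real (2 * (y \<bullet> \<xi>)) * p y) x * of_real (\<Phi>1 (x \<bullet> x)) + of_real (2 * (x \<bullet> \<xi>)) * (of_real (2 * (x \<bullet> \<xi>)) * p x) * of_real (\<Phi>2 (x \<bullet> x)))) x"
   by (intro has_vector_derivative_add has_dir_deriv_radial[OF q(1) x0 D1] has_dir_deriv_radial[OF q(2) x0 D2])
  from has_dir_deriv_cong_regular[OF x dunkl_op_radial[OF pp(1) _ D1, symmetric] this]
  show "\<exists>d. has_dir_deriv (dunkl_op P k \<xi> (%y. p y * of_real (\<Phi> (y \<bullet> y)))) \<xi> d x"
   by blast
 qed
 show "ka_laplacian (basis_fun l m p) x = of_real (eigenvalue l m) * basis_fun l m p x" if x: "x \<in> regular"
 proof -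
  define s where "s = x \<bullet> x"
  have s: "0 < s" using x by (simp add: s_def regular_def)
  define D where "D = 2 * real m + real CARD('n) + 2 * mult_sum P k"
  have D: "D + a - 2 = a * (lam m + 1)" using a by (simp add: D_def lambda_kam_def field_simps)
  have c1: "s powr (1 - a / 2) * s powr (a / 2 - 1) = 1" using s by (simp flip: powr_add)
  have c2: "s * s powr (a / 2 - 2) = s powr (a / 2 - 1)" using s powr_add[of s 1 "a / 2 - 2"] by simp
  have c3: "s * s powr (a / 2 - 1) = s powr (a / 2)" using s powr_add[of s 1 "a / 2 - 1"] by simp
  let ?A = "s powr (1 - a / 2)" and ?B = "s powr (a / 2 - 1)" and ?f1 = "f' (w s)" and ?f2 = "f'' (w s)"
  have alg: "A * (2 * D * (f1 * (B / 2)) + 4 * s * (f2 * (B / 2) * (B / 2) + f1 * ((a / 2 - 1) / 2 * C)))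
    = D * f1 * (A * B) + f2 * (A * B) * (s * B) + (a - 2) * f1 * (A * (s * C))" for A B C f1 f2 :: real
   by (simp add: field_simps)
  have "?A * (2 * D * \<Phi>1 s + 4 * s * \<Phi>2 s)
    = D * ?f1 * (?A * ?B) + ?f2 * (?A * ?B) * (s * ?B) + (a - 2) * ?f1 * (?A * (s * s powr (a / 2 - 2)))"
   unfolding \<Phi>1_def \<Phi>2_def w1_def w2_def by (rule alg)
  also have "\<dots> = (D + a - 2) * ?f1 + ?f2 * s powr (a / 2)" unfolding c2 c3 c1 by (simp add: algebra_simps)
  also have "\<dots> = a * (w s * ?f2 + (lam m + 1) * ?f1)" unfolding D using a by (simp add: w_def algebra_simps)
  finally have e1: "?A * (2 * D * \<Phi>1 s + 4 * s * \<Phi>2 s) = a * (w s * ?f2 + (lam m + 1) * ?f1)" .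
  have "?A * (2 * D * \<Phi>1 s + 4 * s * \<Phi>2 s) - s powr (a / 2) * \<Phi> s = a * (w s * ?f2 + (lam m + 1) * ?f1 - w s * \<Phi> s)"
   unfolding e1 using a by (simp add: w_def algebra_simps)
  also have "\<dots> = eigenvalue l m * \<Phi> s" unfolding \<Phi>_def ode eigenvalue_def by (simp add: algebra_simps)
  finally have e2: "?A * (2 * D * \<Phi>1 s + 4 * s * \<Phi>2 s) - s powr (a / 2) * \<Phi> s = eigenvalue l m * \<Phi> s" .
  have lap: "dunkl_laplacian P k (basis_fun l m p) x = p x * of_real (2 * D * \<Phi>1 s + 4 * s * \<Phi>2 s)"
   unfolding b dunkl_laplacian_radial[OF pp x D1 D2] using p by (simp add: dunkl_harmonics_def s_def D_def)
  have h: "(2 - a) / 2 = 1 - a / 2" by simp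
  have e3: "ka_laplacian (basis_fun l m p) x = p x * of_real (?A * (2 * D * \<Phi>1 s + 4 * s * \<Phi>2 s) - s powr (a / 2) * \<Phi> s)"
   unfolding ka_laplacian_def lap unfolding np s_def[symmetric] h b by (simp add: algebra_simps)
  show ?thesis unfolding e3 e2 unfolding b s_def by simp
 qed
qed

end

context ka_dunkl begin

subsection \<open>Finite combinations of eigenfunctions\<close>

text \<open>
 Finite combinations are encoded by lists; the coefficients are absorbed into the harmonic
 polynomials.
\<close>

definition comb :: "(nat \<times> nat \<times> (real^'n => complex)) list => real^'n => complex" where
 "comb xs x = (\<Sum>(l, m, p)\<leftarrow>xs. basis_fun l m p x)"

definition eigen_comb :: "(nat \<times> nat \<times> (real^'n => complex)) list => real^'n => complex" where
 "eigen_comb xs x = (\<Sum>(l, m, p)\<leftarrow>xs. of_real (eigenvalue l m) * basis_fun l m p x)"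

definition harmonic_list :: "(nat \<times> nat \<times> (real^'n => complex)) list => bool" where
 "harmonic_list xs \<longleftrightarrow> (\<forall>(l, m, p)\<in>set xs. p \<in> dunkl_harmonics P k m)"

definition eigen_list :: "real => (nat \<times> nat \<times> (real^'n => complex)) list => bool" where
 "eigen_list t xs \<longleftrightarrow> harmonic_list xs \<and> (\<forall>(l, m, p)\<in>set xs. eigenvalue l m = t)"

definition eigen :: "real => (real^'n => complex) set" where
 "eigen t = {comb xs | xs. eigen_list t xs}"

lemma comb_simps:
 "comb [] = (%x. 0)" "comb ((l, m, p) # xs) = (%x. basis_fun l m p x + comb xs x)"
 "comb (xs @ ys) = (%x. comb xs x + comb ys x)"
 "eigen_comb [] = (%x. 0)" "eigen_comb ((l, m, p) # xs) = (%x. of_real (eigenvalue l m) * basis_fun l m p x + eigen_comb xs x)"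
 "eigen_comb (xs @ ys) = (%x. eigen_comb xs x + eigen_comb ys x)"
 by (auto simp: comb_def eigen_comb_def)

lemma harmonic_list_simps [simp]:
 "harmonic_list []" "harmonic_list ((l, m, p) # xs) \<longleftrightarrow> p \<in> dunkl_harmonics P k m \<and> harmonic_list xs"
 "harmonic_list (xs @ ys) \<longleftrightarrow> harmonic_list xs \<and> harmonic_list ys"
 by (simp_all add: harmonic_list_def ball_Un)

lemma eigen_list_simps [simp]:
 "eigen_list t []" "eigen_list t ((l, m, p) # xs) \<longleftrightarrow> p \<in> dunkl_harmonics P k m \<and> eigenvalue l m = t \<and> eigen_list t xs"
 "eigen_list t (xs @ ys) \<longleftrightarrow> eigen_list t xs \<and> eigen_list t ys"
 by (auto simp add: eigen_list_def ball_Un)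

lemma comb_L2: "harmonic_list xs ==> comb xs \<in> L2_space M \<and> eigen_comb xs \<in> L2_space M"
 by (induction xs) (auto simp: comb_simps intro!: L2_add L2_scale L2_zero basis_fun_L2)

lemma basis_fun_zero: "basis_fun l m (%x. 0) = (%x. 0)"
 by (simp add: basis_fun_eq)

lemma comb_eigen:
 "harmonic_list xs ==> twice_differentiable (comb xs) \<and> (\<forall>x\<in>regular. ka_laplacian (comb xs) x = eigen_comb xs x)"
proof (induction xs)
 case Nil
 then show ?case
  using basis_fun_eigen(1)[OF harmonics_zero, of 0 0] basis_fun_eigen(2)[OF harmonics_zero, of _ 0 0]
  by (simp add: comb_simps basis_fun_zero)
next
 case (Cons y xs)
 obtain l m p where y: "y = (l, m, p)" by (cases y) auto
 then have p: "p \<in> dunkl_harmonics P k m" and xs: "harmonic_list xs" using Cons.prems by auto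
 note IH = Cons.IH[OF xs] and b = basis_fun_eigen(1)[OF p, of l] basis_fun_eigen(2)[OF p, of _ l]
 have "ka_laplacian (%x. basis_fun l m p x + comb xs x) x = ka_laplacian (basis_fun l m p) x + ka_laplacian (comb xs) x" if "x \<in> regular" for x
  using twice_differentiable_add(2)[OF b(1) conjunct1[OF IH] that] by (simp add: ka_laplacian_def algebra_simps)
 then show ?case
  using twice_differentiable_add(1)[OF b(1) conjunct1[OF IH]] b(2) IH by (simp add: y comb_simps)
qed

lemma eigen_comb_eq: "eigen_list t xs ==> eigen_comb xs = (%x. of_real t * comb xs x)"
 by (induction xs) (auto simp: comb_simps distrib_left)

text \<open>
 Different eigenvalues force different indices \<open>(l, m)\<close>; the converse may fail, so an eigenspace can
 contain several degrees.
\<close>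

lemma basis_fun_inner_eigen:
 assumes p: "p \<in> dunkl_harmonics P k m" and v: "v \<in> eigen t" and ne: "eigenvalue l m \<noteq> t"
 shows "L2_inner M (basis_fun l m p) v = 0"
proof -
 obtain ys where ys: "v = comb ys" "eigen_list t ys" using v by (auto simp: eigen_def)
 have "L2_inner M (basis_fun l m p) (comb ys) = 0"
  using ys(2)
 proof (induction ys)
  case Nil then show ?case by (simp add: comb_simps L2_inner_def)
 next
  case (Cons y ys)
  obtain j n q where y: "y = (j, n, q)" by (cases y) auto
  then have q: "q \<in> dunkl_harmonics P k n" "eigenvalue j n = t" "eigen_list t ys" using Cons.prems by auto
  have "L2_inner M (basis_fun l m p) (basis_fun j n q) = 0"
   using ne q(2) by (intro basis_fun_orthogonal p q) auto
  moreover have "comb ys \<in> L2_space M" using q(3) comb_L2 by (auto simp: eigen_list_def)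
  ultimately show ?case
   by (simp add: y comb_simps L2_inner_add_right basis_fun_L2 p q Cons.IH)
 qed
 then show ?thesis by (simp add: ys)
qed

lemma eigen_L2: "v \<in> eigen t ==> v \<in> L2_space M"
 using comb_L2 by (auto simp: eigen_def eigen_list_def)

lemma eigen_comb_inner:
 assumes "harmonic_list xs" and v: "v \<in> eigen t"
 shows "L2_inner M (eigen_comb xs) v = of_real t * L2_inner M (comb xs) v"
 using assms(1)
proof (induction xs)
 case Nil then show ?case by (simp add: comb_simps L2_inner_def)
next
 case (Cons y xs)
 obtain l m p where y: "y = (l, m, p)" by (cases y) auto
 then have p: "p \<in> dunkl_harmonics P k m" and xs: "harmonic_list xs" using Cons.prems by auto
 have "of_real (eigenvalue l m) * L2_inner M (basis_fun l m p) v = of_real t * L2_inner M (basis_fun l m p) v"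
  using basis_fun_inner_eigen[OF p v] by (cases "eigenvalue l m = t") auto
 then show ?case
  using comb_L2[OF xs] Cons.IH[OF xs]
  by (simp add: y comb_simps L2_inner_add_left L2_inner_scale_left L2_scale basis_fun_L2 p eigen_L2[OF v] distrib_left)
qed

lemma eigen_orthogonal:
 assumes "s \<noteq> t" "v \<in> eigen s" "w \<in> eigen t" shows "L2_inner M v w = 0"
proof -
 obtain xs where xs: "v = comb xs" "eigen_list s xs" using assms(2) by (auto simp: eigen_def)
 have "L2_inner M (eigen_comb xs) w = of_real t * L2_inner M v w"
  using eigen_comb_inner[OF _ assms(3)] xs by (auto simp: eigen_list_def)
 then have "of_real s * L2_inner M v w = of_real t * L2_inner M v w"
  by (simp add: eigen_comb_eq[OF xs(2)] xs(1) L2_inner_scale_left)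
 then show ?thesis using assms(1) by simp
qed

lemma eigen_scale: "v \<in> eigen t ==> (%x. c * v x) \<in> eigen t"
proof -
 assume "v \<in> eigen t"
 then obtain xs where xs: "v = comb xs" "eigen_list t xs" by (auto simp: eigen_def)
 from xs(2) have "eigen_list t (map (%(l, m, p). (l, m, %x. c * p x)) xs) \<and> comb (map (%(l, m, p). (l, m, %x. c * p x)) xs) = (%x. c * comb xs x)"
  by (induction xs) (auto simp: comb_simps basis_fun_eq distrib_left mult.assoc harmonics_scale)
 then show ?thesis unfolding eigen_def xs(1) by (metis (mono_tags, lifting) mem_Collect_eq)
qed

lemma basis_fun_in_eigen: "p \<in> dunkl_harmonics P k m ==> basis_fun l m p \<in> eigen (eigenvalue l m)"
 unfolding eigen_def by (intro CollectI exI[of _ "[(l, m, p)]"]) (simp add: comb_simps)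

lemma laguerre_span_eq: "laguerre_span P k a = {comb xs | xs. harmonic_list xs}"
proof (intro set_eqI iffI)
 fix v assume "v \<in> laguerre_span P k a"
 then obtain S c where v: "v = (%x. \<Sum>u\<in>S. c u * u x)" and S: "finite S"
   "S \<subseteq> {basis_fun l m p | l m p. p \<in> dunkl_harmonics P k m}" by (auto simp: laguerre_span_def)
 have "\<forall>u\<in>S. \<exists>l m p. u = basis_fun l m p \<and> p \<in> dunkl_harmonics P k m" using S(2) by blast
 then obtain l m p where lmp: "\<And>u. u \<in> S ==> u = basis_fun (l u) (m u) (p u) \<and> p u \<in> dunkl_harmonics P k (m u)" by metis
 obtain us where us: "set us = S" "distinct us" using finite_distinct_list[OF S(1)] by blast
 let ?xs = "map (%u. (l u, m u, %x. c u * p u x)) us"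
 have "harmonic_list ?xs" using lmp us(1) by (auto simp: harmonic_list_def harmonics_scale)
 moreover have "v = comb ?xs"
 proof
  fix x
  have "basis_fun (l u) (m u) (%x. c u * p u x) x = c u * u x" if "u \<in> S" for u
   using lmp[OF that] by (metis (no_types, lifting) basis_fun_eq mult.assoc)
  then show "v x = comb ?xs x"
   unfolding v comb_def using us by (simp add: o_def sum_list_distinct_conv_sum_set)
 qed
 ultimately show "v \<in> {comb xs | xs. harmonic_list xs}" by blast
next
 fix v assume "v \<in> {comb xs | xs. harmonic_list xs}"
 then obtain xs where v: "v = comb xs" and xs: "harmonic_list xs" by blast
 from xs have "\<exists>S c. comb xs = (%x. \<Sum>u\<in>S. c u * u x) \<and> finite S \<and> S \<subseteq> {basis_fun l m p | l m p. p \<in> dunkl_harmonics P k m}"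
 proof (induction xs)
  case Nil
  show ?case by (intro exI[of _ "{}"]) (simp add: comb_simps)
 next
  case (Cons y xs)
  obtain l m p where y: "y = (l, m, p)" by (cases y) auto
  then have p: "p \<in> dunkl_harmonics P k m" and "harmonic_list xs" using Cons.prems by auto
  then obtain S c where S: "comb xs = (%x. \<Sum>u\<in>S. c u * u x)" "finite S" "S \<subseteq> {basis_fun l m p | l m p. p \<in> dunkl_harmonics P k m}"
   using Cons.IH by blast
  let ?b = "basis_fun l m p"
  define c' where "c' u = (if u \<in> S then c u else 0) + (if u = ?b then 1 else 0)" for u
  have "(\<Sum>u\<in>insert ?b S. c' u * u x) = ?b x + comb xs x" for x
  proof -
   have "(\<Sum>u\<in>insert ?b S. c' u * u x) = (\<Sum>u\<in>insert ?b S. (if u \<in> S then c u else 0) * u x) + (\<Sum>u\<in>insert ?b S. if u = ?b then u x else 0)"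
    unfolding c'_def distrib_right sum.distrib by (intro arg_cong2[where f = "(+)"] sum.cong) auto
   also have "(\<Sum>u\<in>insert ?b S. if u = ?b then u x else 0) = ?b x" using S(2) by (subst sum.delta) auto
   also have "(\<Sum>u\<in>insert ?b S. (if u \<in> S then c u else 0) * u x) = (\<Sum>u\<in>S. c u * u x)"
    using S(2) by (intro sum.mono_neutral_cong_right) auto
   finally show ?thesis by (simp add: S(1))
  qed
  then show ?case using S(2,3) p
   by (intro exI[of _ "insert ?b S"] exI[of _ c']) (auto simp: y comb_simps)
 qed
 then show "v \<in> laguerre_span P k a" unfolding laguerre_span_def v by auto
qed

subsection \<open>The eigenfunctions are total\<close>

lemma one_harmonic: "(%x. 1) \<in> dunkl_harmonics P k 0"
proof -
 have "dunkl_op P k \<xi> (%x. c) = (%x. 0)" for \<xi> and c :: complex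
  by (rule ext) (auto simp: dunkl_op_def root_quotient_def dir_deriv_eqI[OF has_vector_derivative_const] intro!: sum.neutral)
 then show ?thesis by (simp add: dunkl_harmonics_def dunkl_laplacian_def)
qed

lemma ball_polynomial_L2:
 assumes q: "polynomial_function q" and \<rho>: "0 < \<rho>"
 shows "(%x. indicator (cball 0 \<rho>) x *\<^sub>R q x) \<in> L2_space M"
proof -
 have [measurable]: "q \<in> borel_measurable borel" using q by (rule borel_measurable_polynomial)
 have "bounded (q ` cball 0 \<rho>)" by (intro compact_imp_bounded compact_continuous_image continuous_on_polynomial q) auto
 then obtain B where B: "\<And>x. x \<in> cball 0 \<rho> ==> cmod (q x) \<le> B" unfolding bounded_iff by blast
 have e: "(%x. 1 * of_real (exp (- (1 * \<tau> (norm x))))) \<in> L2_space M"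
  using hankel.exp_L2[OF hankel_lam, of 1 0]
  by (subst harmonic_radial_L2_iff[OF one_harmonic, where g = "%r. of_real (exp (- (1 * \<tau> r)))"]) (auto dest: L2_measurable)
 define g where "g x = indicator (cball 0 \<rho>) x *\<^sub>R (of_real (exp (\<tau> (norm x))) * q x)" for x
 have t: "\<tau> r = r powr a / a" for r by (rule hankel.\<tau>_def[OF hankel_lam])
 have "cmod (g x) \<le> exp (\<tau> \<rho>) * \<bar>B\<bar>" for x
 proof (cases "x \<in> cball 0 \<rho>")
  case True
  then have "\<tau> (norm x) \<le> \<tau> \<rho>" using a by (auto simp: t intro!: divide_right_mono powr_mono2)
  then show ?thesis using B[OF True] True by (auto simp: g_def norm_mult intro!: mult_mono)
 qed (simp add: g_def)
 moreover have "g \<in> borel_measurable M" unfolding g_def[abs_def] t measurable_M by measurable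
 ultimately have "(%x. g x * (1 * of_real (exp (- (1 * \<tau> (norm x)))))) \<in> L2_space M"
  by (intro L2_bounded_mult[OF e, where B = "exp (\<tau> \<rho>) * \<bar>B\<bar>"]) auto
 also have "(%x. g x * (1 * of_real (exp (- (1 * \<tau> (norm x)))))) = (%x. indicator (cball 0 \<rho>) x *\<^sub>R q x)"
 proof
  fix x :: "real^'n"
  have "complex_of_real (exp (\<tau> (norm x))) * of_real (exp (- \<tau> (norm x))) = 1" by (simp flip: of_real_mult exp_add)
  then show "g x * (1 * of_real (exp (- (1 * \<tau> (norm x))))) = indicator (cball 0 \<rho>) x *\<^sub>R q x"
   by (simp add: g_def mult.assoc mult.left_commute)
 qed
 finally show ?thesis .
qed

text \<open>
 Orthogonality to all Laguerre functions times \<open>p\<close> makes every moment in \<open>\<tau>\<close> of \<open>f(x) p(x)\<^sup>* e\<^bsup>-\<tau>\<^esup>\<close> vanish, hence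
 its integral against every bounded function of \<open>\<tau>\<close>, in particular against radial functions cut off
 at a sphere.
\<close>

lemma orthogonal_ball_harmonic:
 assumes f: "f \<in> L2_space M" and p: "p \<in> dunkl_harmonics P k m" and \<rho>: "0 < \<rho>"
  and zero: "\<And>l. L2_inner M f (basis_fun l m p) = 0"
 shows "L2_inner M f (%x. indicator (cball 0 \<rho>) x *\<^sub>R (of_real ((x \<bullet> x) ^ j) * p x)) = 0"
proof -
 note [measurable] = L2_measurable[OF f] harmonicsD(3)[OF p]
 have t: "\<tau> r = r powr a / a" for r by (rule hankel.\<tau>_def[OF hankel_lam])
 define D where "D x = f x * cnj (p x)" for x
 define T where "T = \<tau> \<rho>"
 \<comment> \<open>A bounded function of \<open>\<tau>\<close> that cuts off outside the ball and cancels the factor \<open>e\<^bsup>-\<tau>\<^esup>\<close>.\<close>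
 define g where "g s = indicator {0..T} s *\<^sub>R complex_of_real (exp s * ((a * s) powr (2 / a)) ^ j)" for s
 have "(LINT x|M. g (\<tau> (norm x)) * (D x * of_real (exp (- \<tau> (norm x))))) = 0"
 proof (rule laguerre_exp_determine[where \<nu> = "lam m" and \<delta> = "1 / 2" and B = "exp T * ((a * T) powr (2 / a)) ^ j"])
  show "D \<in> borel_measurable M" unfolding D_def[abs_def] by measurable
  show "(%x. \<tau> (norm x)) \<in> borel_measurable M" unfolding t measurable_M by measurable
  show "0 \<le> \<tau> (norm x)" for x :: "real^'n" by (rule hankel.\<tau>_nonneg[OF hankel_lam])
  have "(%x. p x * of_real (exp (- (1 / 2 * \<tau> (norm x))))) \<in> L2_space M"
   using hankel.exp_L2[OF hankel_lam, of "1 / 2" m]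
   by (subst harmonic_radial_L2_iff[OF p, where g = "%r. of_real (exp (- (1 / 2 * \<tau> r)))"]) (auto dest: L2_measurable)
  from integrable_norm[OF L2_inner_integrable[OF f this]]
  show "integrable M (%x. exp (- ((1 - 1 / 2) * \<tau> (norm x))) * cmod (D x))" by (simp add: D_def norm_mult mult_ac)
  show "(LINT x|M. D x * of_real (laguerre_exp l (lam m) (\<tau> (norm x)))) = 0" for l
   using zero[of l] by (simp add: L2_inner_def basis_fun_eq D_def hankel.lag_def[OF hankel_lam] mult.assoc)
  show "g \<in> borel_measurable borel" unfolding g_def[abs_def] by measurable
  show "cmod (g s) \<le> exp T * ((a * T) powr (2 / a)) ^ j" for s
   using a by (auto simp: g_def indicator_def norm_mult norm_power intro!: mult_mono power_mono powr_mono2)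
 qed simp
 also have "(LINT x|M. g (\<tau> (norm x)) * (D x * of_real (exp (- \<tau> (norm x)))))
   = L2_inner M f (%x. indicator (cball 0 \<rho>) x *\<^sub>R (of_real ((x \<bullet> x) ^ j) * p x))"
  unfolding L2_inner_def
 proof (rule Bochner_Integration.integral_cong[OF refl])
  fix x :: "real^'n"
  have sq: "(a * \<tau> (norm x)) powr (2 / a) = x \<bullet> x"
   using a by (cases "x = 0") (simp_all add: t powr_powr power2_norm_eq_inner)
  have le: "\<tau> (norm x) \<le> T \<longleftrightarrow> x \<in> cball 0 \<rho>"
  proof -
   have "norm x powr a \<le> \<rho> powr a \<longleftrightarrow> norm x \<le> \<rho>"
    using a \<rho> powr_mono2[of a "norm x" \<rho>] powr_less_mono2[of a \<rho> "norm x"] by (metis less_eq_real_def norm_ge_zero not_le)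
   then show ?thesis using a by (simp add: T_def t divide_le_cancel)
  qed
  have ex: "complex_of_real (exp s) * of_real (exp (- s)) = 1" for s by (simp flip: of_real_mult exp_add)
  have "g (\<tau> (norm x)) = indicator (cball 0 \<rho>) x *\<^sub>R (of_real (exp (\<tau> (norm x))) * of_real ((x \<bullet> x) ^ j))"
   unfolding g_def sq using hankel.\<tau>_nonneg[OF hankel_lam, of "norm x"] le by (simp add: indicator_def)
  then have "g (\<tau> (norm x)) * (D x * of_real (exp (- \<tau> (norm x))))
    = indicator (cball 0 \<rho>) x *\<^sub>R ((of_real (exp (\<tau> (norm x))) * of_real (exp (- \<tau> (norm x)))) * (of_real ((x \<bullet> x) ^ j) * D x))"
   by (simp add: mult_ac)
  then show "g (\<tau> (norm x)) * (D x * of_real (exp (- \<tau> (norm x)))) = f x * cnj (indicator (cball 0 \<rho>) x *\<^sub>R (of_real ((x \<bullet> x) ^ j) * p x))"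
   unfolding ex by (simp add: D_def mult_ac)
 qed
 finally show ?thesis .
qed

lemma ball_polynomials_total:
 assumes f: "f \<in> L2_space M"
  and zero: "\<And>\<rho> bs. 0 < \<rho> ==> bs \<in> lists Basis ==> L2_inner M f (%x. indicator (cball 0 \<rho>) x *\<^sub>R of_real (monomial bs x)) = 0"
 shows "AE x in M. f x = 0"
proof -
 note [measurable] = L2_measurable[OF f]
 have fm [measurable]: "f \<in> borel_measurable borel" using L2_measurable[OF f] by simp
 have q0: "L2_inner M f (%x. indicator (cball 0 \<rho>) x *\<^sub>R of_real (q x)) = 0" if \<rho>: "0 < \<rho>" and q: "real_polynomial_function q" for q \<rho>
 proof -
  have "real_polynomial_function q \<and> L2_inner M f (%x. indicator (cball 0 \<rho>) x *\<^sub>R of_real (q x)) = 0"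
   using real_polynomial_in_monomial_span[OF q]
  proof induction
   case (monomial bs) then show ?case using zero[OF \<rho>] by (simp add: real_polynomial_monomial)
  next
   case (add q r)
   have "L2_inner M f (%x. indicator (cball 0 \<rho>) x *\<^sub>R of_real (q x) + indicator (cball 0 \<rho>) x *\<^sub>R of_real (r x)) = 0"
    using add by (subst L2_inner_add_right) (auto intro!: f ball_polynomial_L2 polynomial_function_of_real \<rho>)
   then show ?case using add by (simp add: real_polynomial_add scaleR_add_right)
  next
   case (scale q c)
   have "L2_inner M f (%x. of_real c * (indicator (cball 0 \<rho>) x *\<^sub>R of_real (q x))) = 0"
    using scale unfolding L2_inner_scale_right by simp
   then show ?case using scale by (simp add: polynomial_intros)
  qed
  then show ?thesis by blast
 qed
 have ball: "AE x in M. norm x \<le> \<rho> \<longrightarrow> f x = 0" if \<rho>: "0 < \<rho>" for \<rho>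
 proof -
  define F where "F x = dunkl_weight R k a x *\<^sub>R (indicator (cball 0 \<rho>) x *\<^sub>R f x)" for x
  have one: "polynomial_function (%x::real^'n. 1 :: complex)" by simp
  have "integrable M (%x. indicator (cball 0 \<rho>) x *\<^sub>R f x)"
   using L2_inner_integrable[OF f ball_polynomial_L2[OF one \<rho>]] by (simp add: scaleR_conv_of_real mult.commute)
  then have int: "integrable lborel F"
   unfolding dunkl_measure_def F_def[abs_def] by (subst (asm) integrable_density) (auto simp: dunkl_weight_nonneg)
  have "AE x in lborel. F x = 0"
  proof (rule polynomials_determine[OF int compact_cball])
   show "F x = 0" if "x \<notin> cball 0 \<rho>" for x using that by (simp add: F_def)
   fix q :: "real^'n => real" assume q: "real_polynomial_function q"
   have [measurable]: "q \<in> borel_measurable borel"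
    using q by (intro borel_measurable_continuous_onI) (simp add: continuous_on_polymonial_function real_polynomial_function_eq)
   have "0 = (LINT x|M. f x * cnj (indicator (cball 0 \<rho>) x *\<^sub>R of_real (q x)))"
    using q0[OF \<rho> q] by (simp add: L2_inner_def)
   also have "\<dots> = (LINT x|lborel. dunkl_weight R k a x *\<^sub>R (f x * cnj (indicator (cball 0 \<rho>) x *\<^sub>R of_real (q x))))"
    unfolding dunkl_measure_def by (subst integral_density) (auto simp: dunkl_weight_nonneg)
   also have "\<dots> = (LINT x|lborel. of_real (q x) * F x)"
    by (intro Bochner_Integration.integral_cong refl) (simp add: F_def scaleR_conv_of_real mult_ac)
   finally show "(LINT x|lborel. of_real (q x) * F x) = 0" by simp
  qed
  then have "AE x in M. F x = 0" by (simp add: AE_M_iff)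
  then show ?thesis using AE_M_regular
  proof eventually_elim
   case (elim x)
   have "0 < dunkl_weight R k a x" using weight_pos[OF elim(2)] elim(2) by (simp add: dunkl_weight_eq regular_def)
   then show ?case using elim(1) by (auto simp: F_def)
  qed
 qed
 have "AE x in M. \<forall>n. norm x \<le> real (Suc n) \<longrightarrow> f x = 0"
  unfolding AE_all_countable by (intro allI ball) simp
 then show ?thesis
 proof eventually_elim
  case (elim x)
  obtain n where "norm x \<le> real n" using real_arch_simple by blast
  then have "norm x \<le> real (Suc n)" by simp
  then show ?case using elim by blast
 qed
qed

text \<open>
 Countably many harmonics suffice: those in the decompositions of the monomials.
\<close>

lemma eigenfunctions_total: "\<exists>u c. (\<forall>n. u n \<in> eigen (c n)) \<and> L2_total M u"
proof -
 define B where "B = from_nat_into (lists (Basis :: (real^'n) set))"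
 have ne: "lists (Basis :: (real^'n) set) \<noteq> {}" and cnt: "countable (lists (Basis :: (real^'n) set))"
  using countable_lists[OF countable_finite[OF finite_Basis]] by auto
 have "\<exists>h d. (\<forall>j. h j \<in> dunkl_harmonics P k (d j)) \<and>
   (\<forall>x. of_real (monomial (B i) x) = (\<Sum>j\<le>length (B i). of_real ((x \<bullet> x) ^ j) * h j x))" for i
  using harmonic_decomposition[OF polynomial_function_of_real[OF real_polynomial_monomial[of "B i"]], of "length (B i)"]
  by (simp add: homogeneous_def monomial_scale) metis
 then obtain h d where h: "\<And>i j. h i j \<in> dunkl_harmonics P k (d i j)"
  and dec: "\<And>i x. of_real (monomial (B i) x) = (\<Sum>j\<le>length (B i). of_real ((x \<bullet> x) ^ j) * h i j x)" by metis
 define u where "u n = (case from_nat n of (l, i, j) => basis_fun l (d i j) (h i j))" for n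
 define c where "c n = (case from_nat n of (l, i, j) => eigenvalue l (d i j))" for n
 have ue: "u n \<in> eigen (c n)" for n
  using basis_fun_in_eigen[OF h] by (simp add: u_def c_def split: prod.split)
 have "AE x in M. f x = 0" if f: "f \<in> L2_space M" and zero: "\<forall>n. L2_inner M f (u n) = 0" for f
 proof (rule ball_polynomials_total[OF f])
  fix \<rho> :: real and bs :: "(real^'n) list" assume \<rho>: "0 < \<rho>" and bs: "bs \<in> lists Basis"
  obtain i where i: "bs = B i" unfolding B_def using from_nat_into_surj[OF cnt bs] by blast
  have z: "L2_inner M f (%x. indicator (cball 0 \<rho>) x *\<^sub>R (of_real ((x \<bullet> x) ^ j) * h i j x)) = 0" for j
  proof (rule orthogonal_ball_harmonic[OF f h \<rho>])
   show "L2_inner M f (basis_fun l (d i j) (h i j)) = 0" for l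
    using zero[rule_format, of "to_nat (l, i, j)"] by (simp add: u_def)
  qed
  have "L2_inner M f (%x. \<Sum>j\<le>length (B i). indicator (cball 0 \<rho>) x *\<^sub>R (of_real ((x \<bullet> x) ^ j) * h i j x)) = 0"
   by (subst L2_inner_sum_right)
    (auto simp: z f intro!: ball_polynomial_L2 \<rho> polynomial_intros harmonicsD(1)[OF h] polynomial_intros simp del: of_real_power)
  then show "L2_inner M f (%x. indicator (cball 0 \<rho>) x *\<^sub>R of_real (monomial bs x)) = 0"
   unfolding i dec scaleR_sum_right .
 qed
 then have "L2_total M u" using ue eigen_L2 unfolding L2_total_def by blast
 then show ?thesis using ue by blast
qed

end

section \<open>The transform on products of harmonic polynomials and radial functions\<close>

context ka_dunkl begin

lemma diagonal_laguerre_operator: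
 assumes u: "\<And>n. u n \<in> eigen (c n)" "L2_total M u"
 shows "diagonal_operator M eigen u c (laguerre_operator R P k a)"
proof
 show "v \<in> L2_space M" if "v \<in> eigen t" for v t using that by (rule eigen_L2)
 show "(%x. 0) \<in> eigen t" for t
  unfolding eigen_def by (intro CollectI exI[of _ "[]"]) (simp add: comb_simps)
 show "(%x. v x + w x) \<in> eigen t" if vw: "v \<in> eigen t" "w \<in> eigen t" for v w t
 proof -
  obtain xs ys where xs: "v = comb xs" "eigen_list t xs" and ys: "w = comb ys" "eigen_list t ys"
   using vw by (auto simp: eigen_def)
  show ?thesis unfolding eigen_def using xs ys by (intro CollectI exI[of _ "xs @ ys"]) (simp add: comb_simps)
 qed
 show "(%x. b * v x) \<in> eigen t" if "v \<in> eigen t" for v t b using that by (rule eigen_scale)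
 show "L2_inner M v w = 0" if "s \<noteq> t" "v \<in> eigen s" "w \<in> eigen t" for s t v w using that by (rule eigen_orthogonal)
 show "u j \<in> eigen (c j)" for j by (rule u)
 show "L2_total M u" by (rule u)
 show "f \<in> L2_space M \<and> g \<in> L2_space M" if "(f, g) \<in> laguerre_operator R P k a" for f g
  using that by (simp add: laguerre_operator_def)
 show "L2_inner M g v = of_real t * L2_inner M f v" if fg: "(f, g) \<in> laguerre_operator R P k a" and v: "v \<in> eigen t" for f g v t
 proof -
  obtain w where L2: "f \<in> L2_space M" "g \<in> L2_space M" and w: "w \<in> laguerre_span P k a" "AE x in M. f x = w x" "AE x in M. g x = ka_laplacian w x"
   using fg by (auto simp: laguerre_operator_def ka_laplacian_def)
  obtain xs where xs: "w = comb xs" "harmonic_list xs" using w(1) by (auto simp: laguerre_span_eq)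
  have "AE x in M. g x = eigen_comb xs x"
   using w(3) AE_M_regular by eventually_elim (use comb_eigen[OF xs(2)] xs(1) in auto)
  then have "L2_inner M g v = L2_inner M (eigen_comb xs) v"
   by (rule L2_inner_cong_AE) (use L2 comb_L2[OF xs(2)] eigen_L2[OF v] in \<open>auto dest: L2_measurable\<close>)
  also have "\<dots> = of_real t * L2_inner M (comb xs) v" by (rule eigen_comb_inner[OF xs(2) v])
  also have "L2_inner M (comb xs) v = L2_inner M f v"
   by (rule L2_inner_cong_AE) (use w(2) xs(1) L2 comb_L2[OF xs(2)] eigen_L2[OF v] in \<open>auto dest: L2_measurable elim: eventually_mono\<close>)
  finally show ?thesis .
 qed
 show "(%x. \<Sum>j<n. v j x, %x. \<Sum>j<n. of_real (c j) * v j x) \<in> laguerre_operator R P k a" if v: "\<And>j. v j \<in> eigen (c j)" for n v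
 proof -
  have "\<forall>j. \<exists>xs. v j = comb xs \<and> eigen_list (c j) xs" using v by (auto simp: eigen_def)
  then obtain xs where xs: "\<And>j. v j = comb (xs j)" "\<And>j. eigen_list (c j) (xs j)" by metis
  define ys where "ys n = concat (map xs [0..<n])" for n
  have "harmonic_list (ys n) \<and> comb (ys n) = (%x. \<Sum>j<n. v j x) \<and> eigen_comb (ys n) = (%x. \<Sum>j<n. of_real (c j) * v j x)" for n
  proof (induction n)
   case 0 then show ?case by (simp add: ys_def comb_simps)
  next
   case (Suc n)
   have "ys (Suc n) = ys n @ xs n" by (simp add: ys_def)
   moreover have "harmonic_list (xs n)" using xs(2) by (simp add: eigen_list_def)
   ultimately show ?case using Suc by (simp add: comb_simps xs(1) eigen_comb_eq[OF xs(2)])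
  qed
  then have ys: "harmonic_list (ys n)" "comb (ys n) = (%x. \<Sum>j<n. v j x)" "eigen_comb (ys n) = (%x. \<Sum>j<n. of_real (c j) * v j x)" by auto
  have "AE x in M. eigen_comb (ys n) x = ka_laplacian (comb (ys n)) x"
   using AE_M_regular by eventually_elim (use comb_eigen[OF ys(1)] in simp)
  then show ?thesis
   unfolding ys(2,3)[symmetric] laguerre_operator_def
   using comb_L2[OF ys(1)] ys(1) by (auto simp: laguerre_span_eq ka_laplacian_def)
 qed
qed

text \<open>
 The prefactor of the transform cancels the part of the spectrum that does not depend on \<open>l\<close> and \<open>m\<close>.
\<close>

lemma fourier_phase:
 "exp (\<i> * of_real (pi / 2 * ((2 * mult_sum P k + real CARD('n) + a - 2) / a))) * exp (of_real (pi / (2 * a)) * \<i> * of_real (eigenvalue l m))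
  = exp (- \<i> * of_real (pi / a * real m)) * (-1) ^ l"
proof -
 have "pi / 2 * ((2 * mult_sum P k + real CARD('n) + a - 2) / a) + pi / (2 * a) * eigenvalue l m = - (pi / a * real m) - real l * pi"
  using a by (simp add: eigenvalue_def lambda_kam_def field_simps)
 then have "\<i> * complex_of_real (pi / 2 * ((2 * mult_sum P k + real CARD('n) + a - 2) / a)) + \<i> * of_real (pi / (2 * a) * eigenvalue l m)
   = \<i> * of_real (- (pi / a * real m) - real l * pi)"
  unfolding distrib_left[symmetric] of_real_add[symmetric] by (rule arg_cong)
 also have "\<dots> = - \<i> * of_real (pi / a * real m) + - (of_nat l * (\<i> * of_real pi))" by (simp add: algebra_simps)
 finally have "exp (\<i> * of_real (pi / 2 * ((2 * mult_sum P k + real CARD('n) + a - 2) / a))) * exp (of_real (pi / (2 * a)) * \<i> * of_real (eigenvalue l m))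
   = exp (- \<i> * of_real (pi / a * real m)) * exp (- (of_nat l * (\<i> * of_real pi)))"
  unfolding exp_add[symmetric] by (simp add: mult_ac)
 also have "exp (- (of_nat l * (\<i> * of_real pi))) = (-1 :: complex) ^ l"
  unfolding exp_minus exp_of_nat_mult by (cases "even l") (simp_all add: exp_pi_i')
 finally show ?thesis .
qed

lemma ka_fourier_basis:
 assumes f: "f \<in> L2_space M"
 shows "ka_fourier R P k a f \<in> L2_space M"
  and "p \<in> dunkl_harmonics P k m ==>
   L2_inner M (ka_fourier R P k a f) (basis_fun l m p) = exp (- \<i> * of_real (pi / a * real m)) * (-1) ^ l * L2_inner M f (basis_fun l m p)"
proof -
 obtain u c where u: "\<And>n. u n \<in> eigen (c n)" "L2_total M u" using eigenfunctions_total by blast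
 interpret D: diagonal_operator M eigen u c "laguerre_operator R P k a" by (rule diagonal_laguerre_operator[OF u])
 let ?\<phi> = "%t. exp (of_real (pi / (2 * a)) * \<i> * of_real t) :: complex"
 have \<phi>: "?\<phi> \<in> borel_measurable borel" "\<And>t. cmod (?\<phi> t) \<le> 1"
  by (auto intro!: borel_measurable_continuous_onI continuous_intros)
 note FC = D.functional_calculus_eigen[OF f \<phi>]
 have eq: "ka_fourier R P k a f = (%x. exp (\<i> * of_real (pi / 2 * ((2 * mult_sum P k + real CARD('n) + a - 2) / a))) *
   functional_calculus M (op_closure M (laguerre_operator R P k a)) ?\<phi> f x)"
  by (rule ext) (simp only: ka_fourier_def)
 show "ka_fourier R P k a f \<in> L2_space M" unfolding eq by (intro L2_scale FC(1))
 assume "p \<in> dunkl_harmonics P k m"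
 note b = basis_fun_in_eigen[OF this]
 show "L2_inner M (ka_fourier R P k a f) (basis_fun l m p) = exp (- \<i> * of_real (pi / a * real m)) * (-1) ^ l * L2_inner M f (basis_fun l m p)"
  unfolding eq L2_inner_scale_left FC(2)[OF b] fourier_phase[symmetric] by (simp only: mult.assoc)
qed

lemma AE_eq_basis:
 assumes f: "f \<in> L2_space M" and g: "g \<in> L2_space M"
  and eq: "\<And>l m p. p \<in> dunkl_harmonics P k m ==> L2_inner M f (basis_fun l m p) = L2_inner M g (basis_fun l m p)"
 shows "AE x in M. f x = g x"
proof -
 obtain u c where u: "\<And>n. u n \<in> eigen (c n)" "L2_total M u" using eigenfunctions_total by blast
 note d = L2_diff[OF f g]
 have "L2_inner M (%x. f x - g x) (comb xs) = 0" if "harmonic_list xs" for xs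
  using that
 proof (induction xs)
  case Nil then show ?case by (simp add: comb_simps L2_inner_def)
 next
  case (Cons y xs)
  obtain l m p where y: "y = (l, m, p)" by (cases y) auto
  then have p: "p \<in> dunkl_harmonics P k m" "harmonic_list xs" using Cons.prems by auto
  then have "L2_inner M (%x. f x - g x) (basis_fun l m p) = 0"
   by (subst L2_inner_diff_left) (auto simp: f g basis_fun_L2 eq)
  then show ?case using comb_L2[OF p(2)] Cons.IH[OF p(2)]
   by (simp add: y comb_simps L2_inner_add_right d basis_fun_L2[OF p(1)])
 qed
 then have "L2_inner M (%x. f x - g x) (u n) = 0" for n
  using u(1)[of n] by (auto simp: eigen_def eigen_list_def)
 then have "AE x in M. f x - g x = 0" using u(2) d by (auto simp: L2_total_def)
 then show ?thesis by simp
qed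

text \<open>
 A function \<open>p(x) \<psi>(\<parallel>x\<parallel>)\<close> is orthogonal to all eigenfunctions except those of the same shape, on
 which the transform acts as multiplication by \<open>(-1)\<^sup>l\<close> times a constant phase; so does the Hankel
 transform of \<open>\<psi>\<close>.
\<close>

theorem ka_fourier_harmonic_radial:
 assumes f: "f \<in> L2_space M" and p: "p \<in> dunkl_harmonics P k m" and f_eq: "\<forall>x. f x = p x * \<psi> (norm x)"
 shows "AE \<xi> in M. ka_fourier R P k a f \<xi>
  = of_real (a powr (- lam m)) * exp (- \<i> * of_real (pi / a * real m)) * p \<xi> * hankel_transform a (lam m) \<psi> (norm \<xi>)"
proof (cases "\<forall>x. p x = 0")
 case True
 then have "f = (%x. 0)" using f_eq by auto
 then have "AE \<xi> in M. ka_fourier R P k a f \<xi> = 0"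
  using ka_fourier_basis[OF f] L2_zero[of M] by (intro AE_eq_basis) (auto simp: L2_inner_def)
 then show ?thesis using True by simp
next
 case False
 interpret H: hankel a "lam m" by (rule hankel_lam)
 note ph = harmonicsD[OF p]
 have fp: "f = (%x. p x * \<psi> (norm x))" using f_eq by blast
 have \<psi>m: "\<psi> \<in> borel_measurable (\<mu> m)"
 proof -
  obtain \<omega> where \<omega>: "\<omega> \<in> regular" "p \<omega> \<noteq> 0"
   using eq_on_regular_imp_eq[OF ph(4), of "%x. 0"] False by auto
  then have n: "0 < norm \<omega>" by (simp add: regular_def)
  have [measurable]: "f \<in> borel_measurable borel" using L2_measurable[OF f] by simp
  have "indicator {0<..} r *\<^sub>R \<psi> r = indicator {0<..} r *\<^sub>R (f ((r / norm \<omega>) *\<^sub>R \<omega>) / (of_real ((r / norm \<omega>) ^ m) * p \<omega>))" for r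
   using \<omega>(2) n ph(2) by (cases "0 < r") (auto simp: f_eq homogeneous_def)
  then show ?thesis unfolding borel_measurable_hankel_iff by (simp only:) measurable
 qed
 have \<psi>: "\<psi> \<in> L2_space (\<mu> m)" using f False unfolding fp harmonic_radial_L2_iff[OF p \<psi>m] by blast
 have fl: "H.flip \<psi> \<in> L2_space (\<mu> m)" by (rule H.flip_L2[OF \<psi>])
 define \<kappa> where "\<kappa> = exp (- \<i> * complex_of_real (pi / a * real m))"
 have G: "(%x. \<kappa> * (p x * H.flip \<psi> (norm x))) \<in> L2_space M"
  using fl by (intro L2_scale) (simp add: harmonic_radial_L2_iff[OF p L2_measurable[OF fl]])
 have "AE \<xi> in M. ka_fourier R P k a f \<xi> = \<kappa> * (p \<xi> * H.flip \<psi> (norm \<xi>))"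
 proof (rule AE_eq_basis[OF ka_fourier_basis(1)[OF f] G])
  fix l n q assume q: "q \<in> dunkl_harmonics P k n"
  have lag: "lag n l \<in> L2_space (\<mu> n)" by (rule hankel.lag_L2[OF hankel_lam])
  have "\<kappa> * L2_inner M (%x. p x * H.flip \<psi> (norm x)) (basis_fun l n q) = exp (- \<i> * of_real (pi / a * real n)) * (-1) ^ l * L2_inner M f (basis_fun l n q)"
  proof (cases "n = m")
   case True
   have "L2_inner (\<mu> m) (H.flip \<psi>) (lag m l) = (-1) ^ l * L2_inner (\<mu> m) \<psi> (lag m l)" by (rule H.flip_lag[OF \<psi>])
   then show ?thesis
    using q lag unfolding True fp basis_fun_eq by (simp add: harmonic_radial_inner_same[OF p] fl \<psi> \<kappa>_def)
  next
   case False
   then show ?thesis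
    unfolding fp basis_fun_eq
    using harmonic_radial_orthogonal[OF p q fl lag] harmonic_radial_orthogonal[OF p q \<psi> lag] by simp
  qed
  then show "L2_inner M (ka_fourier R P k a f) (basis_fun l n q) = L2_inner M (%x. \<kappa> * (p x * H.flip \<psi> (norm x))) (basis_fun l n q)"
   unfolding ka_fourier_basis(2)[OF f q] L2_inner_scale_left by simp
 qed
 moreover have "AE \<xi> in M. hankel_transform a (lam m) \<psi> (norm \<xi>) = of_real (a powr lam m) * H.flip \<psi> (norm \<xi>)"
  by (rule AE_radial[OF H.hankel_transform_eq_flip[OF \<psi>]])
 ultimately show ?thesis
 proof eventually_elim
  case (elim \<xi>)
  have arr: "x * u * v * (y * w) = u * (v * w)" if "x * y = 1" for x y u v w :: complex
  proof -
   have "x * u * v * (y * w) = (x * y) * (u * (v * w))" by (simp only: mult_ac)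
   then show ?thesis by (simp only: that mult_1)
  qed
  have one: "complex_of_real (a powr (- lam m)) * of_real (a powr lam m) = 1" using a by (simp flip: of_real_mult powr_add)
  have eq: "of_real (a powr (- lam m)) * \<kappa> * p \<xi> * hankel_transform a (lam m) \<psi> (norm \<xi>) = \<kappa> * (p \<xi> * H.flip \<psi> (norm \<xi>))"
   unfolding elim(2) by (rule arr[OF one])
  show ?case unfolding elim(1) \<kappa>_def[symmetric] eq ..
 qed
qed

end

theorem theorem5p21:
  fixes R P :: "(real^'n) set" and k :: "real^'n \<Rightarrow> real" and a :: real
  assumes "reduced_root_system R"
    and "positive_subsystem R P"
    and "multiplicity_function R k"
    and "\<forall>\<alpha>\<in>R. k \<alpha> \<ge> 0"
    and "a > 0"
    and "a + 2 * mult_sum P k + real CARD('n) - 2 > 0"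
  shows "(\<forall>(f :: real^'n \<Rightarrow> complex) (m :: nat) p (\<psi> :: real \<Rightarrow> complex).
            integrable (dunkl_measure R k a) f \<longrightarrow>
            f \<in> L2_space (dunkl_measure R k a) \<longrightarrow>
            p \<in> dunkl_harmonics P k m \<longrightarrow>
            (\<forall>x. f x = p x * \<psi> (norm x)) \<longrightarrow>
            (AE \<xi> in dunkl_measure R k a.
               ka_fourier R P k a f \<xi> =
                 of_real (a powr (- ((2 * real m + 2 * mult_sum P k + real CARD('n) - 2) / a)))
                 * exp (- \<i> * of_real (pi / a * real m)) * p \<xi>
                 * hankel_transform a ((2 * real m + 2 * mult_sum P k + real CARD('n) - 2) / a)
                     \<psi> (norm \<xi>)))
       \<and> (\<forall>f :: real^'n \<Rightarrow> complex.
            integrable (dunkl_measure R k a) f \<longrightarrow>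
            f \<in> L2_space (dunkl_measure R k a) \<longrightarrow>
            (\<exists>\<psi>. \<forall>x. f x = \<psi> (norm x)) \<longrightarrow>
            (\<exists>\<phi>. AE \<xi> in dunkl_measure R k a. ka_fourier R P k a f \<xi> = \<phi> (norm \<xi>)))"
proof -
 interpret ka_dunkl R P k a
  using assms by unfold_locales auto
 have main: "AE \<xi> in M. ka_fourier R P k a f \<xi>
   = of_real (a powr (- lam m)) * exp (- \<i> * of_real (pi / a * real m)) * p \<xi> * hankel_transform a (lam m) \<psi> (norm \<xi>)"
  if "f \<in> L2_space M" "p \<in> dunkl_harmonics P k m" "\<forall>x. f x = p x * \<psi> (norm x)" for f m p \<psi>
  using ka_fourier_harmonic_radial that by blast
 show ?thesis
 proof (intro conjI allI impI)
  fix f :: "real^'n \<Rightarrow> complex" and m p and \<psi> :: "real \<Rightarrow> complex"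
  assume "f \<in> L2_space M" "p \<in> dunkl_harmonics P k m" "\<forall>x. f x = p x * \<psi> (norm x)"
  from main[OF this] show "AE \<xi> in M. ka_fourier R P k a f \<xi> =
    of_real (a powr (- ((2 * real m + 2 * mult_sum P k + real CARD('n) - 2) / a)))
    * exp (- \<i> * of_real (pi / a * real m)) * p \<xi>
    * hankel_transform a ((2 * real m + 2 * mult_sum P k + real CARD('n) - 2) / a) \<psi> (norm \<xi>)"
   unfolding lambda_kam_def .
 next
  fix f :: "real^'n \<Rightarrow> complex"
  assume f: "f \<in> L2_space M" and "\<exists>\<psi>. \<forall>x. f x = \<psi> (norm x)"
  then obtain \<psi> where "\<forall>x. f x = 1 * \<psi> (norm x)" by auto
  from main[OF f one_harmonic this]
  show "\<exists>\<phi>. AE \<xi> in M. ka_fourier R P k a f \<xi> = \<phi> (norm \<xi>)"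
   by (intro exI[of _ "\<lambda>r. of_real (a powr (- lam 0)) * exp (- \<i> * of_real (pi / a * real 0)) * 1 * hankel_transform a (lam 0) \<psi> r"])
 qed
qed

end
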